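(* Let $n\ge 1$ and let $G$ be either the product $G_m^{\otimes n}$ of $n$ copies of a cyclic group $G_m$ of fixed finite order $m$, or one of the irreducible non-exceptional reflection groups $G(m,p,n)$, acting on the quantum affine space $O_q(\mathsf{k}^{2n})$ in the way described in the context. Then the invariant subring $O_q(\mathsf{k}^{2n})^G$ is a Galois order over a polynomial subalgebra $\Gamma$ of $O_q(\mathsf{k}^{2n})^G$. Moreover, $O_q(\mathsf{k}^{2n})^G$ is free as a left $\Gamma$-module and free as a right $\Gamma$-module.
   Context: $\mathsf{k}$ is an algebraically closed field of characteristic $0$; all rings are $\mathsf{k}$-algebras; $q\in\mathsf{k}$ is nonzero and not a root of unity. Quantum affine space: the quantum plane is $\mathsf{k}_q[x,y]=\mathsf{k}\langle x,y\mid yx=qxy\rangle$, and $O_q(\mathsf{k}^{2n})=\mathsf{k}_q[x_1,y_1]\otimes_{\mathsf{k}}\cdots\otimes_{\mathsf{k}}\mathsf{k}_q[x_n,y_n]$. Groups and actions: $G_m\subset\mathsf{k}^*$ is the cyclic group of $m$-th roots of unity, and $G_m^{\otimes n}$ is the direct product of $n$ copies of it. An element $g=(g_1,\dots,g_n)\in G_m^{\otimes n}$ acts on $O_q(\mathsf{k}^{2n})$ by algebra automorphisms with $g(x_i)=g_ix_i$, $g(y_i)=y_i$. For $m\ge1$, $n\ge1$ and $p>0$ with $p\mid m$, let $A(m,p,n)$ be the subgroup of $G_m^{\otimes n}$ of elements $(h_1,\dots,h_n)$ with $(h_1h_2\cdots h_n)^{m/p}=1$, and $G(m,p,n)=A(m,p,n)\rtimes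 S_n$, with $S_n$ permuting the entries. An element $h=(g,\pi)\in G(m,p,n)$ acts by $h(x_i)=g_ix_{\pi(i)}$, $h(y_i)=y_{\pi(i)}$. Galois orders: Let $\Gamma$ be a commutative domain with field of fractions $K$, $L$ a finite Galois extension of $K$ with Galois group $H=\mathrm{Gal}(L/K)$, and $\mathfrak{M}\subset\mathrm{Aut}_{\mathsf{k}}L$ a monoid such that any $m,m'\in\mathfrak{M}$ with the same restriction to $K$ are equal, and on which $H$ acts by conjugation. $L*\mathfrak{M}$ is the skew monoid ring ($m\ell=m(\ell)m$), with $H$ acting on it by $h(\ell m)=h(\ell)\,(hmh^{-1})$. A finitely generated $\Gamma$-ring $U$ with $\Gamma\subset U\subset(L*\mathfrak{M})^H$ is a Galois ring over $\Gamma$ if $KU=UK=(L*\mathfrak{M})^H$. It is a right (left) Galois order over $\Gamma$ if moreover for every finite-dimensional right (left) $K$-subspace $W\subset(L*\mathfrak{M})^H$, the intersection $W\cap U$ is a finitely generated right (left) $\Gamma$-module; it is a Galois order if it is both a left and a right Galois order. An algebra containing $\Gamma$ is called a Galois order over $\Gamma$ if it is isomorphic, over $\Gamma$, to such a $U$ for some choice of $L$ and $\mathfrak{M}$. *)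

theory Defs
  imports
    "HOL-Library.Poly_Mapping"
    "HOL-Computational_Algebra.Polynomial"
    "HOL-Computational_Algebra.Fraction_Field"
    "HOL-Algebra.Embedded_Algebras"
    "HOL-Algebra.Product_Groups"
    "HOL-Algebra.Algebra"
begin

text \<open>
  The ground field is a type \<open>'k\<close>. A \<open>'k\<close>-algebra, commutative or not, with elements in \<open>'a\<close>
  is a record of type \<open>('k, 'a) module\<close>: a ring together with a scalar multiplication.
\<close>

definition monoid_algebra :: "('m, 'e) monoid_scheme \<Rightarrow> ('k::field, 'm \<Rightarrow> 'k) module" where
  "monoid_algebra M =
    \<lparr>carrier = {f. finite {a. f a \<noteq> 0} \<and> {a. f a \<noteq> 0} \<subseteq> carrier M},
     monoid.mult = (\<lambda>f g m. \<Sum>(a, b) \<in> {(a, b). f a \<noteq> 0 \<and> g b \<noteq> 0 \<and> a \<otimes>\<^bsub>M\<^esub> b = m}. f a * g b),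
     one = (\<lambda>m. if m = \<one>\<^bsub>M\<^esub> then 1 else 0),
     ring.zero = (\<lambda>m. 0),
     ring.add = (\<lambda>f g m. f m + g m),
     module.smult = (\<lambda>c f m. c * f m)\<rparr>"

definition monom_elem :: "'m \<Rightarrow> ('m \<Rightarrow> 'k::field)" where
  "monom_elem a = (\<lambda>m. if m = a then 1 else 0)"

definition quotient_algebra :: "('k, 'a) module \<Rightarrow> 'a set \<Rightarrow> ('k, 'a set) module" where
  "quotient_algebra A I =
    ring.extend (A Quot I) (module.fields (\<lambda>c S. \<Union>a\<in>S. I +>\<^bsub>A\<^esub> (c \<odot>\<^bsub>A\<^esub> a)))"

definition algebra_automorphisms :: "('k, 'a) module \<Rightarrow> ('a \<Rightarrow> 'a) set" where
  "algebra_automorphisms A =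
    {\<phi> \<in> ring_hom A A \<inter> Bij (carrier A). \<forall>c. \<forall>a\<in>carrier A. \<phi> (c \<odot>\<^bsub>A\<^esub> a) = c \<odot>\<^bsub>A\<^esub> \<phi> a}"

definition subalgebra :: "'a set \<Rightarrow> ('k, 'a) module \<Rightarrow> bool" where
  "subalgebra B A \<longleftrightarrow> subring B A \<and> (\<forall>c. \<forall>b\<in>B. c \<odot>\<^bsub>A\<^esub> b \<in> B)"

definition polynomial_algebra :: "nat \<Rightarrow> ('k::field, (nat \<Rightarrow> nat) \<Rightarrow> 'k) module" where
  "polynomial_algebra r =
    monoid_algebra (product_group {..<r} (\<lambda>_. \<lparr>carrier = UNIV, monoid.mult = (+), one = 0\<rparr>))"

definition polynomial_subalgebra :: "'a set \<Rightarrow> ('k::field, 'a) module \<Rightarrow> bool" where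
  "polynomial_subalgebra \<Gamma> A \<longleftrightarrow> subalgebra \<Gamma> A \<and>
    (\<exists>r. \<exists>\<psi> \<in> ring_iso (polynomial_algebra r) (A\<lparr>carrier := \<Gamma>\<rparr>).
      \<forall>c. \<forall>f\<in>carrier (polynomial_algebra r).
        \<psi> (c \<odot>\<^bsub>polynomial_algebra r\<^esub> f) = c \<odot>\<^bsub>A\<^esub> \<psi> f)"

text \<open>
  The tensor product over \<open>'k\<close> of a family of algebras is the free vector space on the tuples
  of elements modulo the relations of multilinearity. With tuples multiplied componentwise, the
  free vector space is a monoid algebra, and the subspace spanned by the relations is the
  two-sided ideal they generate.
\<close>

definition tensor_relations :: "'i set \<Rightarrow> ('i \<Rightarrow> ('k::field, 'a) module) \<Rightarrow> (('i \<Rightarrow> 'a) \<Rightarrow> 'k) set" where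
  "tensor_relations I A =
    {(\<lambda>t. monom_elem (u(i := a \<oplus>\<^bsub>A i\<^esub> b)) t - monom_elem (u(i := a)) t - monom_elem (u(i := b)) t)
      | u i a b. u \<in> (\<Pi>\<^sub>E j\<in>I. carrier (A j)) \<and> i \<in> I \<and> a \<in> carrier (A i) \<and> b \<in> carrier (A i)} \<union>
    {(\<lambda>t. monom_elem (u(i := c \<odot>\<^bsub>A i\<^esub> a)) t - c * monom_elem (u(i := a)) t)
      | u i a c. u \<in> (\<Pi>\<^sub>E j\<in>I. carrier (A j)) \<and> i \<in> I \<and> a \<in> carrier (A i)}"

definition tensor_algebra_product ::
  "'i set \<Rightarrow> ('i \<Rightarrow> ('k::field, 'a) module) \<Rightarrow> ('k, (('i \<Rightarrow> 'a) \<Rightarrow> 'k) set) module" where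
  "tensor_algebra_product I A =
    (let F = monoid_algebra (product_group I A)
     in quotient_algebra F (Idl\<^bsub>F\<^esub> (tensor_relations I A)))"

definition pure_tensor ::
  "'i set \<Rightarrow> ('i \<Rightarrow> ('k::field, 'a) module) \<Rightarrow> ('i \<Rightarrow> 'a) \<Rightarrow> (('i \<Rightarrow> 'a) \<Rightarrow> 'k) set" where
  "pure_tensor I A u =
    (let F = monoid_algebra (product_group I A)
     in Idl\<^bsub>F\<^esub> (tensor_relations I A) +>\<^bsub>F\<^esub> monom_elem u)"

datatype plane_gen = GenX | GenY

definition free_plane :: "('k::field, plane_gen list \<Rightarrow> 'k) module" where
  "free_plane = monoid_algebra \<lparr>carrier = UNIV, monoid.mult = (@), one = []\<rparr>"

definition plane_ideal :: "'k::field \<Rightarrow> (plane_gen list \<Rightarrow> 'k) set" where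
  "plane_ideal q = Idl\<^bsub>free_plane\<^esub> {\<lambda>w. monom_elem [GenY, GenX] w - q * monom_elem [GenX, GenY] w}"

definition quantum_plane :: "'k::field \<Rightarrow> ('k, (plane_gen list \<Rightarrow> 'k) set) module" where
  "quantum_plane q = quotient_algebra free_plane (plane_ideal q)"

definition plane_var :: "'k::field \<Rightarrow> plane_gen \<Rightarrow> (plane_gen list \<Rightarrow> 'k) set" where
  "plane_var q z = plane_ideal q +>\<^bsub>free_plane\<^esub> monom_elem [z]"

type_synonym 'k quantum_space_elem = "((nat \<Rightarrow> (plane_gen list \<Rightarrow> 'k) set) \<Rightarrow> 'k) set"

text \<open>The variables \<open>x\<^sub>1, \<dots>, x\<^sub>n\<close> and \<open>y\<^sub>1, \<dots>, y\<^sub>n\<close> are indexed by \<open>0, \<dots>, n - 1\<close>.\<close>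

definition quantum_space :: "nat \<Rightarrow> 'k::field \<Rightarrow> ('k, 'k quantum_space_elem) module" where
  "quantum_space n q = tensor_algebra_product {..<n} (\<lambda>_. quantum_plane q)"

definition quantum_var :: "nat \<Rightarrow> 'k::field \<Rightarrow> plane_gen \<Rightarrow> nat \<Rightarrow> 'k quantum_space_elem" where
  "quantum_var n q z i = pure_tensor {..<n} (\<lambda>_. quantum_plane q)
    (\<lambda>j\<in>{..<n}. if j = i then plane_var q z else \<one>\<^bsub>quantum_plane q\<^esub>)"

text \<open>
  Group elements are pairs \<open>(g, \<pi>)\<close> of a tuple of roots of unity and a permutation of the indices;
  elements of the product group carry the identity permutation. Only the action of the elements
  enters the ring of invariants.
\<close>

definition cyclic_power :: "nat \<Rightarrow> nat \<Rightarrow> (nat \<Rightarrow> 'k::field) set" where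
  "cyclic_power m n = (\<Pi>\<^sub>E i\<in>{..<n}. {z. z ^ m = 1})"

definition cyclic_power_group :: "nat \<Rightarrow> nat \<Rightarrow> ((nat \<Rightarrow> 'k::field) \<times> (nat \<Rightarrow> nat)) set" where
  "cyclic_power_group m n = cyclic_power m n \<times> {id}"

definition reflection_group ::
  "nat \<Rightarrow> nat \<Rightarrow> nat \<Rightarrow> ((nat \<Rightarrow> 'k::field) \<times> (nat \<Rightarrow> nat)) set" where
  "reflection_group m p n =
    {h \<in> cyclic_power m n. (\<Prod>i<n. h i) ^ (m div p) = 1} \<times> {\<pi>. \<pi> permutes {..<n}}"

text \<open>
  The defining relations are respected and the variables generate the algebra, so for the
  group elements above the automorphism below exists and is unique.
\<close>

definition group_action ::
  "nat \<Rightarrow> 'k::field \<Rightarrow> (nat \<Rightarrow> 'k) \<times> (nat \<Rightarrow> nat) \<Rightarrow> 'k quantum_space_elem \<Rightarrow> 'k quantum_space_elem" where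
  "group_action n q = (\<lambda>(g, \<pi>). THE \<phi>. \<phi> \<in> algebra_automorphisms (quantum_space n q) \<and>
    (\<forall>i<n. \<phi> (quantum_var n q GenX i) = g i \<odot>\<^bsub>quantum_space n q\<^esub> quantum_var n q GenX (\<pi> i) \<and>
           \<phi> (quantum_var n q GenY i) = quantum_var n q GenY (\<pi> i)))"

definition invariant_algebra ::
  "nat \<Rightarrow> 'k::field \<Rightarrow> ((nat \<Rightarrow> 'k) \<times> (nat \<Rightarrow> nat)) set \<Rightarrow> ('k, 'k quantum_space_elem) module" where
  "invariant_algebra n q G = (quantum_space n q)
    \<lparr>carrier := {a \<in> carrier (quantum_space n q). \<forall>h\<in>G. group_action n q h a = a}\<rparr>"

text \<open>
  The module notions below are for left modules over a subring; the right-handed ones are obtained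
  in the opposite ring.
\<close>

definition opposite_ring :: "('a, 'e) ring_scheme \<Rightarrow> ('a, 'e) ring_scheme" where
  "opposite_ring R = R\<lparr>monoid.mult := (\<lambda>a b. b \<otimes>\<^bsub>R\<^esub> a)\<rparr>"

definition left_span :: "('a, 'e) ring_scheme \<Rightarrow> 'a set \<Rightarrow> 'a set \<Rightarrow> 'a set" where
  "left_span R S B =
    {\<Oplus>\<^bsub>R\<^esub>b\<in>F. c b \<otimes>\<^bsub>R\<^esub> b | F c. finite F \<and> F \<subseteq> B \<and> c \<in> F \<rightarrow> S}"

definition left_finitely_generated :: "('a, 'e) ring_scheme \<Rightarrow> 'a set \<Rightarrow> 'a set \<Rightarrow> bool" where
  "left_finitely_generated R S N \<longleftrightarrow> (\<exists>F. finite F \<and> F \<subseteq> N \<and> left_span R S F = N)"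

definition left_free :: "('a, 'e) ring_scheme \<Rightarrow> 'a set \<Rightarrow> 'a set \<Rightarrow> bool" where
  "left_free R S N \<longleftrightarrow> (\<exists>B\<subseteq>N. left_span R S B = N \<and>
    (\<forall>F c. finite F \<and> F \<subseteq> B \<and> c \<in> F \<rightarrow> S \<and> (\<Oplus>\<^bsub>R\<^esub>b\<in>F. c b \<otimes>\<^bsub>R\<^esub> b) = \<zero>\<^bsub>R\<^esub>
      \<longrightarrow> (\<forall>b\<in>F. c b = \<zero>\<^bsub>R\<^esub>)))"

definition field_automorphisms :: "'l ring \<Rightarrow> 'l set \<Rightarrow> ('l \<Rightarrow> 'l) set" where
  "field_automorphisms L F = {\<sigma> \<in> ring_hom L L \<inter> Bij (carrier L). \<forall>a\<in>F. \<sigma> a = a}"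

text \<open>A finite extension is Galois if the fixed field of its automorphism group is the base field.\<close>

definition finite_galois :: "'l ring \<Rightarrow> 'l set \<Rightarrow> bool" where
  "finite_galois L K \<longleftrightarrow> field L \<and> subfield K L \<and> ring.finite_dimension L K (carrier L) \<and>
    {a \<in> carrier L. \<forall>\<sigma>\<in>field_automorphisms L K. \<sigma> a = a} = K"

definition fraction_subfield :: "'l ring \<Rightarrow> 'l set \<Rightarrow> 'l set" where
  "fraction_subfield L \<Gamma> = {a \<otimes>\<^bsub>L\<^esub> inv\<^bsub>L\<^esub> b | a b. a \<in> \<Gamma> \<and> b \<in> \<Gamma> - {\<zero>\<^bsub>L\<^esub>}}"

abbreviation galois_group :: "'l ring \<Rightarrow> 'l set \<Rightarrow> ('l \<Rightarrow> 'l) set" where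
  "galois_group L \<Gamma> \<equiv> field_automorphisms L (fraction_subfield L \<Gamma>)"

text \<open>
  An element \<open>f\<close> of the skew monoid ring stands for the finite sum of the \<open>f m \<cdot> m\<close>, and the
  product is determined by \<open>m \<cdot> l = m(l) \<cdot> m\<close>.
\<close>

definition skew_monoid_ring :: "'l ring \<Rightarrow> ('l \<Rightarrow> 'l) set \<Rightarrow> (('l \<Rightarrow> 'l) \<Rightarrow> 'l) ring" where
  "skew_monoid_ring L M =
    \<lparr>carrier = {f \<in> M \<rightarrow>\<^sub>E carrier L. finite {m \<in> M. f m \<noteq> \<zero>\<^bsub>L\<^esub>}},
     monoid.mult = (\<lambda>f g. \<lambda>m\<in>M.
       finsum L (\<lambda>(a, b). f a \<otimes>\<^bsub>L\<^esub> a (g b))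
         {(a, b) \<in> M \<times> M. f a \<noteq> \<zero>\<^bsub>L\<^esub> \<and> g b \<noteq> \<zero>\<^bsub>L\<^esub> \<and> a \<otimes>\<^bsub>BijGroup (carrier L)\<^esub> b = m}),
     one = (\<lambda>m\<in>M. if m = \<one>\<^bsub>BijGroup (carrier L)\<^esub> then \<one>\<^bsub>L\<^esub> else \<zero>\<^bsub>L\<^esub>),
     ring.zero = (\<lambda>m\<in>M. \<zero>\<^bsub>L\<^esub>),
     ring.add = (\<lambda>f g. \<lambda>m\<in>M. f m \<oplus>\<^bsub>L\<^esub> g m)\<rparr>"

definition skew_embed :: "'l ring \<Rightarrow> ('l \<Rightarrow> 'l) set \<Rightarrow> 'l \<Rightarrow> (('l \<Rightarrow> 'l) \<Rightarrow> 'l)" where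
  "skew_embed L M l = (\<lambda>m\<in>M. if m = \<one>\<^bsub>BijGroup (carrier L)\<^esub> then l else \<zero>\<^bsub>L\<^esub>)"

definition conjugate :: "'l ring \<Rightarrow> ('l \<Rightarrow> 'l) \<Rightarrow> ('l \<Rightarrow> 'l) \<Rightarrow> ('l \<Rightarrow> 'l)" where
  "conjugate L h m =
    h \<otimes>\<^bsub>BijGroup (carrier L)\<^esub> m \<otimes>\<^bsub>BijGroup (carrier L)\<^esub> inv\<^bsub>BijGroup (carrier L)\<^esub> h"

text \<open>
  Since \<open>h(l \<cdot> m) = h(l) \<cdot> h m h\<^sup>-\<^sup>1\<close>, the coefficient of \<open>h f\<close> at \<open>m\<close> is the image under \<open>h\<close> of the
  coefficient of \<open>f\<close> at \<open>h\<^sup>-\<^sup>1 m h\<close>.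
\<close>

definition skew_act :: "'l ring \<Rightarrow> ('l \<Rightarrow> 'l) set \<Rightarrow> ('l \<Rightarrow> 'l) \<Rightarrow> (('l \<Rightarrow> 'l) \<Rightarrow> 'l) \<Rightarrow> (('l \<Rightarrow> 'l) \<Rightarrow> 'l)" where
  "skew_act L M h f = (\<lambda>m\<in>M. h (f (conjugate L (inv\<^bsub>BijGroup (carrier L)\<^esub> h) m)))"

definition skew_invariants :: "'l ring \<Rightarrow> 'l set \<Rightarrow> ('l \<Rightarrow> 'l) set \<Rightarrow> (('l \<Rightarrow> 'l) \<Rightarrow> 'l) set" where
  "skew_invariants L \<Gamma> M =
    {f \<in> carrier (skew_monoid_ring L M). \<forall>h\<in>galois_group L \<Gamma>. skew_act L M h f = f}"

text \<open>In the following, \<open>k\<close> is the copy of the ground field inside \<open>\<Gamma>\<close>.\<close>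

definition galois_setting :: "'l ring \<Rightarrow> 'l set \<Rightarrow> 'l set \<Rightarrow> ('l \<Rightarrow> 'l) set \<Rightarrow> bool" where
  "galois_setting L k \<Gamma> M \<longleftrightarrow>
    field L \<and> subdomain \<Gamma> L \<and> subfield k L \<and> k \<subseteq> \<Gamma> \<and>
    finite_galois L (fraction_subfield L \<Gamma>) \<and>
    M \<subseteq> field_automorphisms L k \<and> submonoid M (BijGroup (carrier L)) \<and>
    (\<forall>m\<in>M. \<forall>m'\<in>M. (\<forall>a\<in>fraction_subfield L \<Gamma>. m a = m' a) \<longrightarrow> m = m') \<and>
    (\<forall>h\<in>galois_group L \<Gamma>. \<forall>m\<in>M. conjugate L h m \<in> M)"

definition galois_ring :: "'l ring \<Rightarrow> 'l set \<Rightarrow> ('l \<Rightarrow> 'l) set \<Rightarrow> (('l \<Rightarrow> 'l) \<Rightarrow> 'l) set \<Rightarrow> bool" where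
  "galois_ring L \<Gamma> M U \<longleftrightarrow>
    (let R = skew_monoid_ring L M; K = skew_embed L M ` fraction_subfield L \<Gamma> in
      subring U R \<and> skew_embed L M ` \<Gamma> \<subseteq> U \<and> U \<subseteq> skew_invariants L \<Gamma> M \<and>
      (\<exists>F. finite F \<and> F \<subseteq> U \<and> generate_ring R (skew_embed L M ` \<Gamma> \<union> F) = U) \<and>
      left_span R K U = skew_invariants L \<Gamma> M \<and>
      left_span (opposite_ring R) K U = skew_invariants L \<Gamma> M)"

definition galois_order :: "'l ring \<Rightarrow> 'l set \<Rightarrow> ('l \<Rightarrow> 'l) set \<Rightarrow> (('l \<Rightarrow> 'l) \<Rightarrow> 'l) set \<Rightarrow> bool" where
  "galois_order L \<Gamma> M U \<longleftrightarrow> galois_ring L \<Gamma> M U \<and>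
    (let K = skew_embed L M ` fraction_subfield L \<Gamma> in
      \<forall>R \<in> {skew_monoid_ring L M, opposite_ring (skew_monoid_ring L M)}.
        \<forall>W \<subseteq> skew_invariants L \<Gamma> M. ring.finite_dimension R K W
          \<longrightarrow> left_finitely_generated R (skew_embed L M ` \<Gamma>) (W \<inter> U))"

definition galois_order_over :: "'l itself \<Rightarrow> 'a set \<Rightarrow> ('k, 'a) module \<Rightarrow> bool" where
  "galois_order_over _ \<Gamma> A \<longleftrightarrow> subalgebra \<Gamma> A \<and>
    (\<exists>(L :: 'l ring) M \<iota> \<phi>.
      \<iota> \<in> ring_hom (A\<lparr>carrier := \<Gamma>\<rparr>) L \<and> inj_on \<iota> \<Gamma> \<and>
      galois_setting L (range (\<lambda>c. \<iota> (c \<odot>\<^bsub>A\<^esub> \<one>\<^bsub>A\<^esub>))) (\<iota> ` \<Gamma>) M \<and>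
      \<phi> \<in> ring_hom A (skew_monoid_ring L M) \<and> inj_on \<phi> (carrier A) \<and>
      (\<forall>a\<in>\<Gamma>. \<phi> a = skew_embed L M (\<iota> a)) \<and>
      galois_order L (\<iota> ` \<Gamma>) M (\<phi> ` carrier A))"

text \<open>
  The field \<open>L\<close> has to live on a fixed type. The one below is as large as \<open>'k\<close> when \<open>'k\<close> is
  infinite; every finite extension of the fraction field of a polynomial algebra \<open>\<Gamma>\<close> is then
  isomorphic to a field whose carrier is a subset of it, so that no choice of \<open>L\<close> is lost.
\<close>

type_synonym 'k rational_functions = "((nat \<Rightarrow>\<^sub>0 nat) \<Rightarrow>\<^sub>0 'k) fract"

end

theory Submission imports Defs begin

text \<open>
  Let \<open>P = k[y\<^sub>1, \<dots>, y\<^sub>n]\<close>. Quantum affine space is the crossed product of \<open>P\<close> with the monoid of monomials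
  \<open>x\<^sup>a\<close>, where \<open>x\<^sup>a\<close> acts on \<open>P\<close> by the dilation \<open>y\<^sub>i \<mapsto> q\<^bsup>-a_i\<^esup> y\<^sub>i\<close>. Its elements are finite sums \<open>\<Sum>\<^sub>a p\<^sub>a x\<^sup>a\<close>
  with \<open>p\<^sub>a\<close> in \<open>P\<close> (\<open>\<Psi>_bij\<close>). Both kinds of groups are products \<open>T \<times> W\<close> of a set \<open>T\<close> of tuples of roots of
  unity and a group \<open>W\<close> of permutations, trivial or symmetric, so that an element is invariant iff only
  exponents \<open>a\<close> in the submonoid \<open>MM\<close> of those with \<open>x\<^sup>a\<close> fixed by \<open>T\<close> occur and the coefficients satisfy
  \<open>p\<^bsub>\<pi>a\<^esub> = \<pi>(p\<^sub>a)\<close> for \<open>\<pi>\<close> in \<open>W\<close> (\<open>invariant_iff_UU\<close>).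

  The subalgebra of the theorem is \<open>\<Gamma> = P\<^sup>W\<close>. It is a polynomial algebra, and \<open>P\<close> is free of finite rank
  over it; for the symmetric group the generators are the elementary symmetric polynomials and a basis
  is given by Artin's monomials (\<open>\<Gamma>_structure\<close>). Let \<open>L = Frac P\<close> and \<open>K = Frac \<Gamma> = L\<^sup>W\<close>, a Galois extension
  with group \<open>W\<close>. The dilations of \<open>L\<close> by the exponents in \<open>MM\<close> form a monoid. They are already distinct on
  \<open>y\<^sub>1 + \<dots> + y\<^sub>n\<close> because \<open>q\<close> is not a root of unity, so the skew monoid ring is the crossed product of \<open>L\<close>
  with \<open>MM\<close>, and the algebra of invariants consists of those elements of its invariant ring whose
  coefficients are polynomials (\<open>EI_integral\<close>).

  From this description the conditions on a Galois order follow. Clearing denominators in \<open>\<Gamma>\<close> shows that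
  the invariants of the skew monoid ring are spanned over \<open>K\<close> by integral ones (\<open>span_fractions\<close>). A finite
  dimensional subspace involves finitely many exponents only, so its integral elements form a submodule
  of a finitely generated \<open>P\<close>-module, which is finitely generated over \<open>\<Gamma>\<close> by Hilbert's basis theorem
  (\<open>finitely_generated_intersections\<close>). The ring is finitely generated because the invariants of \<open>T\<close> are
  a finite bimodule over \<open>\<Gamma>\<close> and the image of \<open>\<Gamma>\<close> under \<open>y\<^sub>i \<mapsto> x\<^sub>i\<^sup>m\<close>, and averaging over \<open>W\<close> is linear for
  both (\<open>UU_generated\<close>). Writing coefficients on the right of the monomials instead of the left turns left
  modules into right ones, so each one-sided statement is proved once.

  For freeness, the invariants of \<open>T\<close> are free over \<open>P\<close>, hence over \<open>\<Gamma>\<close>, and the invariants of \<open>T \<times> W\<close> are a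
  graded direct summand by the Reynolds operator. A graded version of Nakayama's lemma then shows that
  homogeneous representatives of a basis modulo the augmentation ideal of \<open>\<Gamma>\<close> form a basis
  (\<open>invariants_free\<close>).
\<close>

section \<open>Algebras over a field\<close>

locale kalgebra = ring A for A :: "('k::field, 'a) module" (structure) +
  assumes smult_closed [simp, intro]: "a \<in> carrier A \<Longrightarrow> c \<odot> a \<in> carrier A"
    and smult_l_distr: "a \<in> carrier A \<Longrightarrow> (c + d) \<odot> a = c \<odot> a \<oplus> d \<odot> a"
    and smult_r_distr: "a \<in> carrier A \<Longrightarrow> b \<in> carrier A \<Longrightarrow> c \<odot> (a \<oplus> b) = c \<odot> a \<oplus> c \<odot> b"
    and smult_assoc: "a \<in> carrier A \<Longrightarrow> (c * d) \<odot> a = c \<odot> (d \<odot> a)"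
    and smult_one [simp]: "a \<in> carrier A \<Longrightarrow> 1 \<odot> a = a"
    and smult_mult_l: "a \<in> carrier A \<Longrightarrow> b \<in> carrier A \<Longrightarrow> (c \<odot> a) \<otimes> b = c \<odot> (a \<otimes> b)"
    and smult_mult_r: "a \<in> carrier A \<Longrightarrow> b \<in> carrier A \<Longrightarrow> a \<otimes> (c \<odot> b) = c \<odot> (a \<otimes> b)"
begin

lemma smult_zero_l [simp]: "a \<in> carrier A \<Longrightarrow> 0 \<odot> a = \<zero>"
  using smult_l_distr[of a 0 0] smult_closed[of a 0]
  by (metis add.l_cancel_one add_0 zero_closed)

lemma smult_zero_r [simp]: "c \<odot> \<zero> = \<zero>"
  using smult_r_distr[of \<zero> \<zero> c] smult_closed[of \<zero> c] by (metis add.l_cancel_one l_zero zero_closed)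

lemma smult_minus_one: "a \<in> carrier A \<Longrightarrow> (- 1) \<odot> a = \<ominus> a"
  using smult_l_distr[of a "-1" 1] by (simp add: minus_equality)

lemma smult_finsum:
  "f \<in> S \<rightarrow> carrier A \<Longrightarrow> c \<odot> (\<Oplus>x\<in>S. f x) = (\<Oplus>x\<in>S. c \<odot> f x)"
proof (induction S rule: infinite_finite_induct)
  case (insert x S)
  then have "f \<in> S \<rightarrow> carrier A" "f x \<in> carrier A" by auto
  with insert show ?case
    by (subst finsum_insert; (subst finsum_insert)?) (auto simp: smult_r_distr Pi_iff)
qed auto

end

text \<open>Elements of a monoid algebra are finitely supported functions, so \<open>linear_extension A u\<close> is the
linear map that sends the basis element \<open>x\<close> to \<open>u x\<close>.\<close>

definition linear_extension :: "('k::field, 'a) module \<Rightarrow> ('x \<Rightarrow> 'a) \<Rightarrow> ('x \<Rightarrow> 'k) \<Rightarrow> 'a" where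
  "linear_extension A u f = (\<Oplus>\<^bsub>A\<^esub>x\<in>{x. f x \<noteq> 0}. f x \<odot>\<^bsub>A\<^esub> u x)"

definition alg_hom :: "('k, 'a) module \<Rightarrow> ('k, 'b) module \<Rightarrow> ('a \<Rightarrow> 'b) set" where
  "alg_hom A B = {\<phi> \<in> ring_hom A B. \<forall>c. \<forall>a\<in>carrier A. \<phi> (c \<odot>\<^bsub>A\<^esub> a) = c \<odot>\<^bsub>B\<^esub> \<phi> a}"

context kalgebra begin

lemma linear_extension_superset:
  assumes "finite S" "{x. f x \<noteq> 0} \<subseteq> S" "u \<in> S \<rightarrow> carrier A"
  shows "linear_extension A u f = (\<Oplus>x\<in>S. f x \<odot> u x)"
  unfolding linear_extension_def
  by (rule add.finprod_mono_neutral_cong_left) (use assms in \<open>auto simp: Pi_iff\<close>)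

lemma linear_extension_closed:
  "(\<And>x. f x \<noteq> 0 \<Longrightarrow> u x \<in> carrier A) \<Longrightarrow> linear_extension A u f \<in> carrier A"
  unfolding linear_extension_def by (rule finsum_closed) auto

lemma linear_extension_add:
  assumes "finite {x. f x \<noteq> 0}" "finite {x. g x \<noteq> 0}"
    and "\<And>x. f x \<noteq> 0 \<or> g x \<noteq> 0 \<Longrightarrow> u x \<in> carrier A"
  shows "linear_extension A u (\<lambda>x. f x + g x) = linear_extension A u f \<oplus> linear_extension A u g"
proof -
  define S where "S = {x. f x \<noteq> 0} \<union> {x. g x \<noteq> 0}"
  have S: "finite S" "u \<in> S \<rightarrow> carrier A" using assms by (auto simp: S_def)
  have "(\<Oplus>x\<in>S. (f x + g x) \<odot> u x) = (\<Oplus>x\<in>S. f x \<odot> u x \<oplus> g x \<odot> u x)"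
    by (rule finsum_cong') (use S in \<open>auto simp: smult_l_distr Pi_iff\<close>)
  also have "\<dots> = (\<Oplus>x\<in>S. f x \<odot> u x) \<oplus> (\<Oplus>x\<in>S. g x \<odot> u x)"
    by (rule finsum_addf) (use S in auto)
  finally show ?thesis
    by (subst (1 2 3) linear_extension_superset[OF S(1) _ S(2)]) (auto simp: S_def)
qed

lemma linear_extension_smult:
  assumes "finite {x. f x \<noteq> 0}" and "\<And>x. f x \<noteq> 0 \<Longrightarrow> u x \<in> carrier A"
  shows "linear_extension A u (\<lambda>x. c * f x) = c \<odot> linear_extension A u f"
proof -
  define S where "S = {x. f x \<noteq> 0}"
  have S: "finite S" "u \<in> S \<rightarrow> carrier A" using assms by (auto simp: S_def)
  have "(\<Oplus>x\<in>S. (c * f x) \<odot> u x) = (\<Oplus>x\<in>S. c \<odot> (f x \<odot> u x))"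
    by (rule finsum_cong') (use S in \<open>auto simp: smult_assoc Pi_iff\<close>)
  also have "\<dots> = c \<odot> (\<Oplus>x\<in>S. f x \<odot> u x)"
    by (rule smult_finsum[symmetric]) (use S in auto)
  finally show ?thesis
    by (subst (1 2) linear_extension_superset[OF S(1) _ S(2)]) (auto simp: S_def)
qed

lemma linear_extension_monom [simp]:
  "u a \<in> carrier A \<Longrightarrow> linear_extension A u (monom_elem a) = u a"
  by (subst linear_extension_superset[where S = "{a}"]) (auto simp: monom_elem_def split: if_splits)

lemma linear_extension_zero [simp]: "linear_extension A u (\<lambda>x. 0) = \<zero>"
  by (simp add: linear_extension_def)

end

lemma alg_homD:
  assumes "\<phi> \<in> alg_hom A B"
  shows "a \<in> carrier A \<Longrightarrow> \<phi> a \<in> carrier B"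
    and "a \<in> carrier A \<Longrightarrow> b \<in> carrier A \<Longrightarrow> \<phi> (a \<oplus>\<^bsub>A\<^esub> b) = \<phi> a \<oplus>\<^bsub>B\<^esub> \<phi> b"
    and "a \<in> carrier A \<Longrightarrow> b \<in> carrier A \<Longrightarrow> \<phi> (a \<otimes>\<^bsub>A\<^esub> b) = \<phi> a \<otimes>\<^bsub>B\<^esub> \<phi> b"
    and "\<phi> \<one>\<^bsub>A\<^esub> = \<one>\<^bsub>B\<^esub>"
    and "a \<in> carrier A \<Longrightarrow> \<phi> (c \<odot>\<^bsub>A\<^esub> a) = c \<odot>\<^bsub>B\<^esub> \<phi> a"
  using assms by (auto simp: alg_hom_def ring_hom_add ring_hom_mult ring_hom_one ring_hom_closed)

lemma alg_hom_zero:
  assumes "\<phi> \<in> alg_hom A B" "kalgebra A" "kalgebra B"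
  shows "\<phi> \<zero>\<^bsub>A\<^esub> = \<zero>\<^bsub>B\<^esub>"
proof -
  interpret A: kalgebra A by fact
  interpret B: kalgebra B by fact
  show ?thesis
    by (metis A.smult_zero_l A.zero_closed B.smult_zero_l alg_homD(1,5) assms(1))
qed

section \<open>Monoid algebras\<close>

locale monoid_alg = M: monoid M for M :: "('m, 'e) monoid_scheme" +
  fixes F :: "('k::field, 'm \<Rightarrow> 'k) module"
  defines F_def: "F \<equiv> monoid_algebra M"
begin

lemma carrier_iff: "f \<in> carrier F \<longleftrightarrow> finite {a. f a \<noteq> 0} \<and> {a. f a \<noteq> 0} \<subseteq> carrier M"
  and add_eq: "f \<oplus>\<^bsub>F\<^esub> g = (\<lambda>m. f m + g m)"
  and zero_eq: "\<zero>\<^bsub>F\<^esub> = (\<lambda>m. 0)"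
  and one_eq: "\<one>\<^bsub>F\<^esub> = monom_elem \<one>\<^bsub>M\<^esub>"
  and smult_eq: "c \<odot>\<^bsub>F\<^esub> f = (\<lambda>m. c * f m)"
  by (auto simp: F_def monoid_algebra_def monom_elem_def)

text \<open>The product of the monoid algebra is a sum over a set of pairs that depends on both factors. Summing
over a fixed rectangle instead makes bilinearity a matter of distributing sums.\<close>

lemma mult_eq:
  assumes "finite S" "finite T" "{a. f a \<noteq> 0} \<subseteq> S" "{a. g a \<noteq> 0} \<subseteq> T"
  shows "(f \<otimes>\<^bsub>F\<^esub> g) x = (\<Sum>a\<in>S. \<Sum>b\<in>T. if a \<otimes>\<^bsub>M\<^esub> b = x then f a * g b else 0)"
proof -
  have "(f \<otimes>\<^bsub>F\<^esub> g) x = (\<Sum>(a, b) \<in> {(a, b). f a \<noteq> 0 \<and> g b \<noteq> 0 \<and> a \<otimes>\<^bsub>M\<^esub> b = x}. f a * g b)"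
    by (simp add: F_def monoid_algebra_def)
  also have "\<dots> = (\<Sum>(a, b) \<in> S \<times> T. if a \<otimes>\<^bsub>M\<^esub> b = x then f a * g b else 0)"
    by (rule sum.mono_neutral_cong_left) (use assms in \<open>auto split: if_splits\<close>)
  finally show ?thesis by (simp add: sum.cartesian_product)
qed

lemma monom_closed [simp]: "a \<in> carrier M \<Longrightarrow> monom_elem a \<in> carrier F"
  by (auto simp: carrier_iff monom_elem_def)

lemma monom_mult: "monom_elem a \<otimes>\<^bsub>F\<^esub> monom_elem b = monom_elem (a \<otimes>\<^bsub>M\<^esub> b)"
proof
  fix x show "(monom_elem a \<otimes>\<^bsub>F\<^esub> monom_elem b) x = monom_elem (a \<otimes>\<^bsub>M\<^esub> b) x"
    by (subst mult_eq[where S = "{a}" and T = "{b}"]) (auto simp: monom_elem_def)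
qed

lemma conv_add_closed: "f \<in> carrier F \<Longrightarrow> g \<in> carrier F \<Longrightarrow> f \<oplus>\<^bsub>F\<^esub> g \<in> carrier F"
  unfolding carrier_iff add_eq
  by (auto intro: finite_subset[of _ "{a. f a \<noteq> 0} \<union> {a. g a \<noteq> 0}"] simp: subset_iff; metis add_0)

lemma conv_smult_closed: "f \<in> carrier F \<Longrightarrow> c \<odot>\<^bsub>F\<^esub> f \<in> carrier F"
  unfolding carrier_iff smult_eq by (auto intro: finite_subset[of _ "{a. f a \<noteq> 0}"])

lemma mult_supp:
  assumes "f \<in> carrier F" "g \<in> carrier F"
  shows "{x. (f \<otimes>\<^bsub>F\<^esub> g) x \<noteq> 0} \<subseteq> (\<lambda>(a,b). a \<otimes>\<^bsub>M\<^esub> b) ` ({a. f a \<noteq> 0} \<times> {b. g b \<noteq> 0})"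
proof
  fix x assume "x \<in> {x. (f \<otimes>\<^bsub>F\<^esub> g) x \<noteq> 0}"
  then have "(f \<otimes>\<^bsub>F\<^esub> g) x \<noteq> 0" by simp
  also have "(f \<otimes>\<^bsub>F\<^esub> g) x = (\<Sum>a\<in>{a. f a \<noteq> 0}. \<Sum>b\<in>{b. g b \<noteq> 0}. if a \<otimes>\<^bsub>M\<^esub> b = x then f a * g b else 0)"
    by (rule mult_eq) (use assms in \<open>simp_all add: carrier_iff\<close>)
  finally obtain a where a: "f a \<noteq> 0" "(\<Sum>b\<in>{b. g b \<noteq> 0}. if a \<otimes>\<^bsub>M\<^esub> b = x then f a * g b else 0) \<noteq> 0"
    by (auto elim: sum.not_neutral_contains_not_neutral)
  then obtain b where "g b \<noteq> 0" "a \<otimes>\<^bsub>M\<^esub> b = x"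
    by (auto elim!: sum.not_neutral_contains_not_neutral split: if_splits)
  with a(1) have "f a \<noteq> 0" "g b \<noteq> 0" "a \<otimes>\<^bsub>M\<^esub> b = x" by simp_all
  then show "x \<in> (\<lambda>(a,b). a \<otimes>\<^bsub>M\<^esub> b) ` ({a. f a \<noteq> 0} \<times> {b. g b \<noteq> 0})" by auto
qed

lemma conv_mult_closed:
  assumes "f \<in> carrier F" "g \<in> carrier F"
  shows "f \<otimes>\<^bsub>F\<^esub> g \<in> carrier F"
proof -
  have "finite ((\<lambda>(a,b). a \<otimes>\<^bsub>M\<^esub> b) ` ({a. f a \<noteq> 0} \<times> {b. g b \<noteq> 0}))"
    using assms by (auto simp: carrier_iff)
  moreover have "(\<lambda>(a,b). a \<otimes>\<^bsub>M\<^esub> b) ` ({a. f a \<noteq> 0} \<times> {b. g b \<noteq> 0}) \<subseteq> carrier M"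
    using assms by (auto simp: carrier_iff)
  ultimately show ?thesis using mult_supp[OF assms]
    unfolding carrier_iff by (meson finite_subset order_trans)
qed

lemma mult_add_l:
  assumes "f \<in> carrier F" "g \<in> carrier F" "h \<in> carrier F"
  shows "(f \<oplus>\<^bsub>F\<^esub> g) \<otimes>\<^bsub>F\<^esub> h = f \<otimes>\<^bsub>F\<^esub> h \<oplus>\<^bsub>F\<^esub> g \<otimes>\<^bsub>F\<^esub> h"
proof
  fix x
  define S T where "S = {a. f a \<noteq> 0} \<union> {a. g a \<noteq> 0}" "T = {a. h a \<noteq> 0}"
  have fin: "finite S" "finite T" using assms by (auto simp: S_T_def carrier_iff)
  show "((f \<oplus>\<^bsub>F\<^esub> g) \<otimes>\<^bsub>F\<^esub> h) x = (f \<otimes>\<^bsub>F\<^esub> h \<oplus>\<^bsub>F\<^esub> g \<otimes>\<^bsub>F\<^esub> h) x"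
    unfolding add_eq
    by (subst (1 2 3) mult_eq[OF fin])
       (auto simp: S_T_def distrib_right sum.distrib[symmetric] intro!: sum.cong)
qed

lemma mult_add_r:
  assumes "f \<in> carrier F" "g \<in> carrier F" "h \<in> carrier F"
  shows "h \<otimes>\<^bsub>F\<^esub> (f \<oplus>\<^bsub>F\<^esub> g) = h \<otimes>\<^bsub>F\<^esub> f \<oplus>\<^bsub>F\<^esub> h \<otimes>\<^bsub>F\<^esub> g"
proof
  fix x
  define S T where "S = {a. f a \<noteq> 0} \<union> {a. g a \<noteq> 0}" "T = {a. h a \<noteq> 0}"
  have fin: "finite S" "finite T" using assms by (auto simp: S_T_def carrier_iff)
  show "(h \<otimes>\<^bsub>F\<^esub> (f \<oplus>\<^bsub>F\<^esub> g)) x = (h \<otimes>\<^bsub>F\<^esub> f \<oplus>\<^bsub>F\<^esub> h \<otimes>\<^bsub>F\<^esub> g) x"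
    unfolding add_eq
    by (subst (1 2 3) mult_eq[OF fin(2,1)])
       (auto simp: S_T_def distrib_left sum.distrib[symmetric] intro!: sum.cong)
qed

lemma mult_smult:
  assumes "f \<in> carrier F" "h \<in> carrier F"
  shows "(c \<odot>\<^bsub>F\<^esub> f) \<otimes>\<^bsub>F\<^esub> h = c \<odot>\<^bsub>F\<^esub> (f \<otimes>\<^bsub>F\<^esub> h)" "f \<otimes>\<^bsub>F\<^esub> (c \<odot>\<^bsub>F\<^esub> h) = c \<odot>\<^bsub>F\<^esub> (f \<otimes>\<^bsub>F\<^esub> h)"
proof -
  define S T where "S = {a. f a \<noteq> 0}" "T = {a. h a \<noteq> 0}"
  have fin: "finite S" "finite T" using assms by (auto simp: S_T_def carrier_iff)
  show "(c \<odot>\<^bsub>F\<^esub> f) \<otimes>\<^bsub>F\<^esub> h = c \<odot>\<^bsub>F\<^esub> (f \<otimes>\<^bsub>F\<^esub> h)"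
    unfolding smult_eq
    by (rule ext, subst (1 2) mult_eq[OF fin])
       (auto simp: S_T_def sum_distrib_left mult.assoc intro!: sum.cong)
  show "f \<otimes>\<^bsub>F\<^esub> (c \<odot>\<^bsub>F\<^esub> h) = c \<odot>\<^bsub>F\<^esub> (f \<otimes>\<^bsub>F\<^esub> h)"
    unfolding smult_eq
    by (rule ext, subst (1 2) mult_eq[OF fin])
       (auto simp: S_T_def sum_distrib_left mult.left_commute intro!: sum.cong)
qed

lemma mult_zero: "\<zero>\<^bsub>F\<^esub> \<otimes>\<^bsub>F\<^esub> f = \<zero>\<^bsub>F\<^esub>" "f \<otimes>\<^bsub>F\<^esub> \<zero>\<^bsub>F\<^esub> = \<zero>\<^bsub>F\<^esub>"
  unfolding zero_eq by (auto simp: F_def monoid_algebra_def)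

lemma conv_zero_closed: "\<zero>\<^bsub>F\<^esub> \<in> carrier F" by (auto simp: carrier_iff zero_eq)

text \<open>Once bilinearity is known, this induction reduces associativity, the unit laws and the homomorphism
property to basis elements.\<close>

lemma induct [consumes 1, case_names zero add]:
  assumes "f \<in> carrier F" and zero: "P \<zero>\<^bsub>F\<^esub>"
    and add: "\<And>c a g. a \<in> carrier M \<Longrightarrow> g \<in> carrier F \<Longrightarrow> P g \<Longrightarrow> P (c \<odot>\<^bsub>F\<^esub> monom_elem a \<oplus>\<^bsub>F\<^esub> g)"
  shows "P f"
proof -
  have "finite S \<Longrightarrow> S \<subseteq> carrier M \<Longrightarrow> {a. f a \<noteq> 0} \<subseteq> S \<Longrightarrow> P f" for S f
  proof (induction S arbitrary: f rule: finite_induct)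
    case empty
    then have "f = (\<lambda>m. 0)" by auto
    with zero show ?case by (simp add: zero_eq)
  next
    case (insert a S)
    define g where "g = f(a := 0)"
    have "P g" by (rule insert.IH) (use insert in \<open>auto simp: g_def\<close>)
    moreover have "g \<in> carrier F" using insert
      by (auto simp: carrier_iff g_def intro: finite_subset[of _ "S"])
    moreover have "f = f a \<odot>\<^bsub>F\<^esub> monom_elem a \<oplus>\<^bsub>F\<^esub> g"
      by (auto simp: add_eq smult_eq g_def monom_elem_def)
    ultimately show ?case using add[of a g "f a"] insert.prems by simp
  qed
  with assms(1) show ?thesis unfolding carrier_iff by blast
qed

lemma mult_assoc:
  assumes "f \<in> carrier F" "g \<in> carrier F" "h \<in> carrier F"
  shows "(f \<otimes>\<^bsub>F\<^esub> g) \<otimes>\<^bsub>F\<^esub> h = f \<otimes>\<^bsub>F\<^esub> (g \<otimes>\<^bsub>F\<^esub> h)"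
  using assms(1)
proof (induction f rule: induct)
  case (add c a f')
  note f' = add
  have "(monom_elem a \<otimes>\<^bsub>F\<^esub> g) \<otimes>\<^bsub>F\<^esub> h = monom_elem a \<otimes>\<^bsub>F\<^esub> (g \<otimes>\<^bsub>F\<^esub> h)"
    using assms(2)
  proof (induction g rule: induct)
    case (add d b g')
    note g' = add
    have "(monom_elem a \<otimes>\<^bsub>F\<^esub> monom_elem b) \<otimes>\<^bsub>F\<^esub> h = monom_elem a \<otimes>\<^bsub>F\<^esub> (monom_elem b \<otimes>\<^bsub>F\<^esub> h)"
      using assms(3)
    proof (induction h rule: induct)
      case (add e c h')
      with f'(1) g'(1) show ?case
        by (simp add: mult_add_r mult_smult conv_mult_closed conv_smult_closed monom_mult M.m_assoc)
    qed (simp add: mult_zero)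
    with g' f'(1) assms(3) show ?case
      by (simp add: mult_add_r mult_add_l mult_smult conv_mult_closed conv_smult_closed)
  qed (simp add: mult_zero)
  with add assms(2,3) show ?case
    by (simp add: mult_add_l mult_smult conv_mult_closed conv_smult_closed)
qed (simp add: mult_zero)

lemma mult_one: "f \<in> carrier F \<Longrightarrow> \<one>\<^bsub>F\<^esub> \<otimes>\<^bsub>F\<^esub> f = f" "f \<in> carrier F \<Longrightarrow> f \<otimes>\<^bsub>F\<^esub> \<one>\<^bsub>F\<^esub> = f"
proof -
  show "f \<in> carrier F \<Longrightarrow> \<one>\<^bsub>F\<^esub> \<otimes>\<^bsub>F\<^esub> f = f"
    by (induction f rule: induct)
      (simp_all add: mult_zero one_eq mult_add_r mult_smult conv_smult_closed monom_mult)
  show "f \<in> carrier F \<Longrightarrow> f \<otimes>\<^bsub>F\<^esub> \<one>\<^bsub>F\<^esub> = f"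
    by (induction f rule: induct)
      (simp_all add: mult_zero one_eq mult_add_l mult_smult conv_smult_closed monom_mult)
qed

sublocale kalgebra F
proof -
  have neg: "\<exists>g\<in>carrier F. g \<oplus>\<^bsub>F\<^esub> f = \<zero>\<^bsub>F\<^esub>" if "f \<in> carrier F" for f
    by (rule bexI[of _ "(- 1) \<odot>\<^bsub>F\<^esub> f"]) (use that conv_smult_closed[of f "- 1"] in \<open>auto simp: add_eq smult_eq zero_eq\<close>)
  have "abelian_group F"
    by (rule abelian_groupI)
       (auto simp: neg conv_add_closed conv_zero_closed, auto simp: add_eq zero_eq algebra_simps)
  moreover have "Group.monoid F"
    by (rule monoidI) (auto simp: conv_mult_closed mult_assoc mult_one, simp add: one_eq)
  ultimately have "ring F"
    by (rule ringI) (auto simp: mult_add_l mult_add_r)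
  then interpret ring F .
  show "kalgebra F"
    by unfold_locales (auto simp: conv_smult_closed mult_smult, auto simp: add_eq smult_eq algebra_simps)
qed

text \<open>
  The universal property of the monoid algebra. It is used three times: for the free algebra on two
  letters, for the algebra on tuples that presents a tensor product, and for polynomial algebras.
\<close>

lemma linear_extension_hom:
  assumes "kalgebra B" and u: "u \<in> hom M B" "u \<one>\<^bsub>M\<^esub> = \<one>\<^bsub>B\<^esub>"
  shows "linear_extension B u \<in> alg_hom F B"
proof -
  interpret B: kalgebra B by fact
  let ?L = "linear_extension B u"
  have uc: "a \<in> carrier M \<Longrightarrow> u a \<in> carrier B" for a using u by (auto simp: hom_def)
  have um: "a \<in> carrier M \<Longrightarrow> b \<in> carrier M \<Longrightarrow> u (a \<otimes>\<^bsub>M\<^esub> b) = u a \<otimes>\<^bsub>B\<^esub> u b" for a b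
    using u by (auto simp: hom_def)
  have cl: "f \<in> carrier F \<Longrightarrow> ?L f \<in> carrier B" for f
    by (rule B.linear_extension_closed) (auto simp: carrier_iff uc)
  have ad: "f \<in> carrier F \<Longrightarrow> g \<in> carrier F \<Longrightarrow> ?L (f \<oplus>\<^bsub>F\<^esub> g) = ?L f \<oplus>\<^bsub>B\<^esub> ?L g" for f g
    unfolding add_eq by (rule B.linear_extension_add) (auto simp: carrier_iff uc)
  have sm: "f \<in> carrier F \<Longrightarrow> ?L (c \<odot>\<^bsub>F\<^esub> f) = c \<odot>\<^bsub>B\<^esub> ?L f" for f c
    unfolding smult_eq by (rule B.linear_extension_smult) (auto simp: carrier_iff uc)
  have ze: "?L \<zero>\<^bsub>F\<^esub> = \<zero>\<^bsub>B\<^esub>" by (simp add: zero_eq)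
  have mo: "a \<in> carrier M \<Longrightarrow> ?L (monom_elem a) = u a" for a by (simp add: uc)
  have mult1: "?L (monom_elem a \<otimes>\<^bsub>F\<^esub> g) = u a \<otimes>\<^bsub>B\<^esub> ?L g" if "a \<in> carrier M" "g \<in> carrier F" for a g
    using that(2)
    by (induction g rule: induct)
       (use that(1) in \<open>simp_all add: mult_zero ze uc mult_add_r mult_smult ad sm cl monom_mult mo um
         B.r_distr B.smult_mult_r\<close>)
  have mult: "?L (f \<otimes>\<^bsub>F\<^esub> g) = ?L f \<otimes>\<^bsub>B\<^esub> ?L g" if "f \<in> carrier F" "g \<in> carrier F" for f g
    using that(1)
    by (induction f rule: induct)
       (use that(2) in \<open>simp_all add: mult_zero ze uc mult_add_l mult_smult ad sm cl mult1 mo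
         B.l_distr B.smult_mult_l\<close>)
  show ?thesis unfolding alg_hom_def
    by (auto intro!: ring_hom_memI simp: cl ad sm mult one_eq mo u(2))
qed

end

section \<open>Quotient algebras\<close>

lemma ring_cong:
  assumes "ring R" "carrier S = carrier R" "monoid.mult S = monoid.mult R" "one S = one R"
    "ring.zero S = ring.zero R" "ring.add S = ring.add R"
  shows "ring S"
proof -
  interpret R: ring R by fact
  have "abelian_group S"
    by (rule abelian_groupI)
      (use R.add.l_inv_ex in \<open>auto simp: assms(2-) R.add.m_assoc R.add.m_comm R.add.m_lcomm\<close>)
  moreover have "Group.monoid S"
    by (rule monoidI) (auto simp: assms(2-) R.m_assoc)
  ultimately show ?thesis
    by (rule ringI) (auto simp: assms(2-) R.l_distr R.r_distr)
qed

text \<open>The scalar multiplication of \<open>quotient_algebra\<close> is a union over the representatives of a coset. It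
is the coset of a single scalar multiple because an ideal of an algebra is a subspace: \<open>c \<odot> i\<close> is the
product of \<open>c \<odot> \<one>\<close> and \<open>i\<close>.\<close>

lemma kalgebra_quotient:
  assumes "kalgebra A" "ideal I A"
  shows "kalgebra (quotient_algebra A I)"
    and "(\<lambda>a. I +>\<^bsub>A\<^esub> a) \<in> alg_hom A (quotient_algebra A I)"
    and "carrier (quotient_algebra A I) = (\<lambda>a. I +>\<^bsub>A\<^esub> a) ` carrier A"
proof -
  interpret A: kalgebra A by fact
  interpret I: ideal I A by fact
  let ?Q = "quotient_algebra A I"
  have R: "ring (A Quot I)" by (rule I.quotient_is_ring)
  have eqs: "carrier ?Q = carrier (A Quot I)" "monoid.mult ?Q = monoid.mult (A Quot I)"
    "one ?Q = one (A Quot I)" "ring.zero ?Q = ring.zero (A Quot I)" "ring.add ?Q = ring.add (A Quot I)"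
    by (simp_all add: quotient_algebra_def ring.defs)
  interpret Q: ring ?Q by (rule ring_cong[OF R eqs])
  show car: "carrier ?Q = (\<lambda>a. I +>\<^bsub>A\<^esub> a) ` carrier A"
    by (auto simp: eqs FactRing_def A_RCOSETS_def' )
  have rh: "(\<lambda>a. I +>\<^bsub>A\<^esub> a) \<in> ring_hom A ?Q"
    using I.rcos_ring_hom unfolding ring_hom_def eqs by auto
  have sm: "c \<odot>\<^bsub>?Q\<^esub> (I +>\<^bsub>A\<^esub> a) = I +>\<^bsub>A\<^esub> (c \<odot>\<^bsub>A\<^esub> a)" if a: "a \<in> carrier A" for a c
  proof -
    have "I +>\<^bsub>A\<^esub> (c \<odot>\<^bsub>A\<^esub> b) = I +>\<^bsub>A\<^esub> (c \<odot>\<^bsub>A\<^esub> a)" if "b \<in> I +>\<^bsub>A\<^esub> a" for b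
    proof -
      from that obtain i where i: "i \<in> I" "b = i \<oplus>\<^bsub>A\<^esub> a" by (auto simp: a_r_coset_def r_coset_def)
      have ic: "i \<in> carrier A" using i I.a_Hcarr by auto
      have "c \<odot>\<^bsub>A\<^esub> i = (c \<odot>\<^bsub>A\<^esub> \<one>\<^bsub>A\<^esub>) \<otimes>\<^bsub>A\<^esub> i" using ic by (simp add: A.smult_mult_l)
      also have "\<dots> \<in> I" using i(1) by (simp add: I.I_l_closed)
      finally have "c \<odot>\<^bsub>A\<^esub> b \<in> I +>\<^bsub>A\<^esub> (c \<odot>\<^bsub>A\<^esub> a)"
        using i ic a by (auto simp: a_r_coset_def r_coset_def A.smult_r_distr)
      then show ?thesis
        using A.a_repr_independence[OF _ _ I.a_subgroup, of "c \<odot>\<^bsub>A\<^esub> b" "c \<odot>\<^bsub>A\<^esub> a"] a by simp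
    qed
    moreover have "a \<in> I +>\<^bsub>A\<^esub> a" using I.a_rcos_self a by blast
    ultimately have "(\<Union>b\<in>I +>\<^bsub>A\<^esub> a. I +>\<^bsub>A\<^esub> (c \<odot>\<^bsub>A\<^esub> b)) = I +>\<^bsub>A\<^esub> (c \<odot>\<^bsub>A\<^esub> a)" by blast
    then show ?thesis by (simp add: quotient_algebra_def ring.defs module.defs)
  qed
  from rh sm show "(\<lambda>a. I +>\<^bsub>A\<^esub> a) \<in> alg_hom A ?Q" by (auto simp: alg_hom_def)
  note hm = ring_hom_add[OF rh, symmetric] ring_hom_mult[OF rh, symmetric]
  show "kalgebra ?Q"
  proof unfold_locales
  qed (unfold car, auto simp: sm hm A.smult_l_distr A.smult_r_distr A.smult_assoc A.smult_mult_l A.smult_mult_r)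
qed

lemma quotient_induced:
  assumes A: "kalgebra A" "ideal I A" and B: "kalgebra B" and \<psi>: "\<psi> \<in> alg_hom A B"
    and ker: "\<And>i. i \<in> I \<Longrightarrow> \<psi> i = \<zero>\<^bsub>B\<^esub>"
  obtains \<psi>' where "\<psi>' \<in> alg_hom (quotient_algebra A I) B" "\<And>a. a \<in> carrier A \<Longrightarrow> \<psi>' (I +>\<^bsub>A\<^esub> a) = \<psi> a"
proof -
  interpret A: kalgebra A by fact
  interpret I: ideal I A by fact
  interpret B: kalgebra B by fact
  note D = alg_homD[OF \<psi>]
  define \<psi>' where "\<psi>' S = \<psi> (SOME a. a \<in> S)" for S
  have eq: "\<psi>' (I +>\<^bsub>A\<^esub> a) = \<psi> a" if a: "a \<in> carrier A" for a
  proof -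
    have "a \<in> I +>\<^bsub>A\<^esub> a" using I.a_rcos_self a by blast
    then have "(SOME b. b \<in> I +>\<^bsub>A\<^esub> a) \<in> I +>\<^bsub>A\<^esub> a" by (rule someI)
    then obtain i where i: "i \<in> I" "(SOME b. b \<in> I +>\<^bsub>A\<^esub> a) = i \<oplus>\<^bsub>A\<^esub> a" by (auto simp: a_r_coset_def r_coset_def)
    have ic: "i \<in> carrier A" using i I.a_Hcarr by auto
    show ?thesis using i a ic by (simp add: \<psi>'_def D ker)
  qed
  note Q = kalgebra_quotient[OF A]
  note q = alg_homD(2-)[OF Q(2), symmetric]
  have "\<psi>' \<in> alg_hom (quotient_algebra A I) B"
    by (auto simp: alg_hom_def Q(3) q eq D intro!: ring_hom_memI)
  with eq that show ?thesis by blast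
qed

lemma alg_hom_kernel_ideal:
  assumes "kalgebra A" "kalgebra B" "\<psi> \<in> alg_hom A B"
  shows "ideal {a \<in> carrier A. \<psi> a = \<zero>\<^bsub>B\<^esub>} A"
proof -
  interpret A: kalgebra A by fact
  interpret B: kalgebra B by fact
  have "\<psi> \<in> ring_hom A B" using assms(3) by (simp add: alg_hom_def)
  then interpret h: ring_hom_ring A B \<psi> by (rule ring_hom_ringI2[OF A.ring_axioms B.ring_axioms])
  show ?thesis using h.kernel_is_ideal unfolding a_kernel_def' .
qed

lemma genideal_quotient_induced:
  assumes A: "kalgebra A" "S \<subseteq> carrier A" and B: "kalgebra B" and \<psi>: "\<psi> \<in> alg_hom A B"
    and ker: "\<And>i. i \<in> S \<Longrightarrow> \<psi> i = \<zero>\<^bsub>B\<^esub>"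
  obtains \<psi>' where "\<psi>' \<in> alg_hom (quotient_algebra A (Idl\<^bsub>A\<^esub> S)) B"
    "\<And>a. a \<in> carrier A \<Longrightarrow> \<psi>' (Idl\<^bsub>A\<^esub> S +>\<^bsub>A\<^esub> a) = \<psi> a"
proof -
  interpret A: kalgebra A by fact
  have sub: "Idl\<^bsub>A\<^esub> S \<subseteq> {a \<in> carrier A. \<psi> a = \<zero>\<^bsub>B\<^esub>}"
    using A(2) ker by (intro A.genideal_minimal[OF alg_hom_kernel_ideal[OF A(1) B \<psi>]]) blast
  have ker': "\<psi> i = \<zero>\<^bsub>B\<^esub>" if "i \<in> Idl\<^bsub>A\<^esub> S" for i using subsetD[OF sub that] by simp
  show ?thesis
    by (rule quotient_induced[OF A(1) A.genideal_ideal[OF A(2)] B \<psi> ker']) (auto intro: that)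
qed

section \<open>Spanning sets\<close>

text \<open>Spanning is phrased through subspaces, without linear combinations: a linear property of all elements
is then proved by checking it on a spanning set, which is how two homomorphisms are compared below.\<close>

definition is_subspace :: "('k, 'a) module \<Rightarrow> 'a set \<Rightarrow> bool" where
  "is_subspace A Z \<longleftrightarrow> Z \<subseteq> carrier A \<and> \<zero>\<^bsub>A\<^esub> \<in> Z \<and> (\<forall>a\<in>Z. \<forall>b\<in>Z. a \<oplus>\<^bsub>A\<^esub> b \<in> Z) \<and>
    (\<forall>c. \<forall>a\<in>Z. c \<odot>\<^bsub>A\<^esub> a \<in> Z)"

definition spans :: "('k, 'a) module \<Rightarrow> 'a set \<Rightarrow> bool" where
  "spans A S \<longleftrightarrow> S \<subseteq> carrier A \<and> (\<forall>Z. is_subspace A Z \<and> S \<subseteq> Z \<longrightarrow> carrier A \<subseteq> Z)"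

lemma spansD: "spans A S \<Longrightarrow> is_subspace A Z \<Longrightarrow> S \<subseteq> Z \<Longrightarrow> a \<in> carrier A \<Longrightarrow> a \<in> Z"
  by (auto simp: spans_def)

lemma subspace_preimage:
  assumes "kalgebra A" "kalgebra B" "\<phi> \<in> alg_hom A B" "is_subspace B Z"
  shows "is_subspace A {a \<in> carrier A. \<phi> a \<in> Z}"
proof -
  interpret A: kalgebra A by fact
  show ?thesis
    using assms(4) alg_hom_zero[OF assms(3,1,2)] unfolding is_subspace_def
    by (auto simp: alg_homD[OF assms(3)])
qed

lemma spans_image:
  assumes "kalgebra A" "kalgebra B" "\<phi> \<in> alg_hom A B" "carrier B = \<phi> ` carrier A" "spans A S"
  shows "spans B (\<phi> ` S)"
  unfolding spans_def
proof (intro conjI allI impI)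
  have S: "S \<subseteq> carrier A" using assms(5) by (auto simp: spans_def)
  show "\<phi> ` S \<subseteq> carrier B" using S assms(4) by auto
  fix Z assume Z: "is_subspace B Z \<and> \<phi> ` S \<subseteq> Z"
  have "carrier A \<subseteq> {a \<in> carrier A. \<phi> a \<in> Z}"
    using spansD[OF assms(5) subspace_preimage[OF assms(1-3), of Z]] Z S by blast
  then show "carrier B \<subseteq> Z" using assms(4) by auto
qed

lemma spans_trans:
  assumes "spans A S" "S' \<subseteq> carrier A" "\<And>s Z. s \<in> S \<Longrightarrow> is_subspace A Z \<Longrightarrow> S' \<subseteq> Z \<Longrightarrow> s \<in> Z"
  shows "spans A S'"
  using assms unfolding spans_def by (meson subsetI)

lemma (in monoid_alg) spans_monoms: "spans F (monom_elem ` carrier M)"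
  unfolding spans_def
proof (intro conjI allI impI subsetI)
  show "x \<in> carrier F" if "x \<in> monom_elem ` carrier M" for x using that by auto
next
  fix Z f assume Z: "is_subspace F Z \<and> monom_elem ` carrier M \<subseteq> Z" and "f \<in> carrier F"
  from this(2) show "f \<in> Z"
    by (induction f rule: induct) (use Z in \<open>auto simp: is_subspace_def\<close>)
qed

section \<open>The quantum plane\<close>

definition word_monoid :: "plane_gen list monoid" where
  "word_monoid = \<lparr>carrier = UNIV, monoid.mult = (@), one = []\<rparr>"

interpretation fp: monoid_alg word_monoid "free_plane :: ('k::field, plane_gen list \<Rightarrow> 'k) module"
  rewrites "carrier word_monoid = UNIV" and "monoid.mult word_monoid = (@)" and "one word_monoid = []"
proof -
  show "monoid_alg word_monoid"
    by unfold_locales (auto simp: word_monoid_def)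
  show "(free_plane :: ('k::field, plane_gen list \<Rightarrow> 'k) module) \<equiv> monoid_algebra word_monoid"
    by (simp add: free_plane_def word_monoid_def)
qed (auto simp: word_monoid_def)

lemma quantum_plane_kalgebra: "kalgebra (quantum_plane q)"
  and quantum_plane_coset_hom:
    "(\<lambda>a. plane_ideal q +>\<^bsub>free_plane\<^esub> a) \<in> alg_hom free_plane (quantum_plane q)"
  and quantum_plane_carrier:
    "carrier (quantum_plane q) = (\<lambda>a. plane_ideal q +>\<^bsub>free_plane\<^esub> a) ` carrier free_plane"
  and plane_relation: "plane_var q GenY \<otimes>\<^bsub>quantum_plane q\<^esub> plane_var q GenX =
    q \<odot>\<^bsub>quantum_plane q\<^esub> (plane_var q GenX \<otimes>\<^bsub>quantum_plane q\<^esub> plane_var q GenY)"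
proof -
  let ?r = "\<lambda>w. monom_elem [GenY, GenX] w - q * monom_elem [GenX, GenY] w"
  let ?F = "free_plane :: ('a, plane_gen list \<Rightarrow> 'a) module" and ?Q = "quantum_plane q" and ?I = "plane_ideal q"
  have r: "?r = monom_elem [GenY, GenX] \<oplus>\<^bsub>?F\<^esub> (- q) \<odot>\<^bsub>?F\<^esub> monom_elem [GenX, GenY]"
    by (auto simp: fp.add_eq fp.smult_eq)
  have rc: "?r \<in> carrier ?F" unfolding r by auto
  have I: "ideal ?I ?F" unfolding plane_ideal_def by (rule fp.genideal_ideal) (use rc in auto)
  have k: "kalgebra ?F" by (rule fp.kalgebra_axioms)
  note Q = kalgebra_quotient[OF k I, folded quantum_plane_def]
  show "kalgebra ?Q" "(\<lambda>a. ?I +>\<^bsub>?F\<^esub> a) \<in> alg_hom ?F ?Q" "carrier ?Q = (\<lambda>a. ?I +>\<^bsub>?F\<^esub> a) ` carrier ?F"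
    using Q by auto
  interpret Q: kalgebra ?Q by fact
  interpret I: ideal ?I ?F by fact
  note D = alg_homD[OF Q(2)]
  have rI: "?r \<in> ?I" unfolding plane_ideal_def by (rule fp.genideal_self') (rule rc)
  have "?I +>\<^bsub>?F\<^esub> ?r = ?I"
    by (rule fp.a_coset_join2) (use rc rI I.a_subgroup in auto)
  also have "?I = \<zero>\<^bsub>?Q\<^esub>" by (simp add: quantum_plane_def quotient_algebra_def ring.defs FactRing_def)
  finally have z: "?I +>\<^bsub>?F\<^esub> ?r = \<zero>\<^bsub>?Q\<^esub>" .
  have "monom_elem [GenY, GenX] = ?r \<oplus>\<^bsub>?F\<^esub> q \<odot>\<^bsub>?F\<^esub> monom_elem [GenX, GenY]"
    by (auto simp: fp.add_eq fp.smult_eq)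
  then have "?I +>\<^bsub>?F\<^esub> monom_elem [GenY, GenX] = ?I +>\<^bsub>?F\<^esub> (?r \<oplus>\<^bsub>?F\<^esub> q \<odot>\<^bsub>?F\<^esub> monom_elem [GenX, GenY])"
    by (rule arg_cong)
  also have "\<dots> = q \<odot>\<^bsub>?Q\<^esub> (?I +>\<^bsub>?F\<^esub> monom_elem [GenX, GenY])"
    using rc by (simp add: D z del: diff_conv_add_uminus)
  finally have "?I +>\<^bsub>?F\<^esub> (monom_elem [GenY] \<otimes>\<^bsub>?F\<^esub> monom_elem [GenX]) =
    q \<odot>\<^bsub>?Q\<^esub> (?I +>\<^bsub>?F\<^esub> (monom_elem [GenX] \<otimes>\<^bsub>?F\<^esub> monom_elem [GenY]))"
    by (simp add: fp.monom_mult)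
  then show "plane_var q GenY \<otimes>\<^bsub>?Q\<^esub> plane_var q GenX = q \<odot>\<^bsub>?Q\<^esub> (plane_var q GenX \<otimes>\<^bsub>?Q\<^esub> plane_var q GenY)"
    by (simp add: D plane_var_def)
qed

lemma plane_var_closed [simp]: "plane_var q z \<in> carrier (quantum_plane q)"
  by (auto simp: plane_var_def quantum_plane_carrier)

lemma quantum_plane_hom:
  fixes q :: "'k::field" and B :: "('k, 'b) module"
  assumes "kalgebra B" "x \<in> carrier B" "y \<in> carrier B" "y \<otimes>\<^bsub>B\<^esub> x = q \<odot>\<^bsub>B\<^esub> (x \<otimes>\<^bsub>B\<^esub> y)"
  obtains \<psi> where "\<psi> \<in> alg_hom (quantum_plane q) B" "\<psi> (plane_var q GenX) = x" "\<psi> (plane_var q GenY) = y"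
proof -
  interpret B: kalgebra B by fact
  let ?F = "free_plane :: ('k, plane_gen list \<Rightarrow> 'k) module"
  define l where "l z = (case z of GenX \<Rightarrow> x | GenY \<Rightarrow> y)" for z
  define u where "u w = foldr (\<lambda>z a. l z \<otimes>\<^bsub>B\<^esub> a) w \<one>\<^bsub>B\<^esub>" for w
  have l: "l z \<in> carrier B" for z using assms by (cases z) (auto simp: l_def)
  have u: "u w \<in> carrier B" for w by (induction w) (auto simp: u_def l)
  have um: "u (v @ w) = u v \<otimes>\<^bsub>B\<^esub> u w" for v w
    by (induction v) (use u l in \<open>auto simp: u_def B.m_assoc\<close>)
  have hom: "linear_extension B u \<in> alg_hom ?F B"
  proof (rule fp.linear_extension_hom[OF assms(1)])
    show "u \<in> hom word_monoid B" by (rule homI) (simp_all add: u um word_monoid_def)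
    show "u [] = \<one>\<^bsub>B\<^esub>" by (simp add: u_def)
  qed
  note D = alg_homD[OF hom]
  let ?r = "\<lambda>w. monom_elem [GenY, GenX] w - q * monom_elem [GenX, GenY] w"
  have r: "?r = monom_elem [GenY, GenX] \<oplus>\<^bsub>?F\<^esub> (- q) \<odot>\<^bsub>?F\<^esub> monom_elem [GenX, GenY]"
    by (auto simp: fp.add_eq fp.smult_eq)
  have "linear_extension B u ?r = u [GenY, GenX] \<oplus>\<^bsub>B\<^esub> (- q) \<odot>\<^bsub>B\<^esub> u [GenX, GenY]"
    unfolding r by (simp add: D u)
  also have "\<dots> = (q + - q) \<odot>\<^bsub>B\<^esub> (x \<otimes>\<^bsub>B\<^esub> y)"
    using assms by (subst B.smult_l_distr) (auto simp: u_def l_def)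
  finally have r0: "linear_extension B u ?r = \<zero>\<^bsub>B\<^esub>" using assms by simp
  obtain \<psi> where \<psi>: "\<psi> \<in> alg_hom (quantum_plane q) B"
    "\<And>a. a \<in> carrier ?F \<Longrightarrow> \<psi> (plane_ideal q +>\<^bsub>?F\<^esub> a) = linear_extension B u a"
    using genideal_quotient_induced[OF fp.kalgebra_axioms _ assms(1) hom, of "{?r}"] r0
    unfolding plane_ideal_def quantum_plane_def r by auto
  show ?thesis
    by (rule that[OF \<psi>(1)]) (use u assms in \<open>simp_all add: plane_var_def \<psi>(2), simp_all add: u_def l_def\<close>)
qed

text \<open>This moves \<open>x\<close> to the right past the \<open>y\<close>s and so brings a word in the generators of the quantum plane
into normal form.\<close>

lemma (in kalgebra) pow_skew_commute:
  assumes "x \<in> carrier A" "y \<in> carrier A" "x \<otimes> y = r \<odot> (y \<otimes> x)"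
  shows "x \<otimes> y [^] (b::nat) = r ^ b \<odot> (y [^] b \<otimes> x)"
proof (induction b)
  case (Suc b)
  have "x \<otimes> y [^] Suc b = (x \<otimes> y [^] b) \<otimes> y" using assms by (simp add: m_assoc)
  also have "\<dots> = r ^ b \<odot> (y [^] b \<otimes> (x \<otimes> y))" using assms by (simp add: Suc smult_mult_l m_assoc)
  also have "\<dots> = r ^ Suc b \<odot> (y [^] Suc b \<otimes> x)"
    using assms by (simp add: smult_mult_r smult_assoc[symmetric] m_assoc mult.commute)
  finally show ?case .
qed (use assms in simp)

definition plane_monom :: "'k::field \<Rightarrow> nat \<Rightarrow> nat \<Rightarrow> (plane_gen list \<Rightarrow> 'k) set" where
  "plane_monom q b a = plane_var q GenY [^]\<^bsub>quantum_plane q\<^esub> b \<otimes>\<^bsub>quantum_plane q\<^esub> plane_var q GenX [^]\<^bsub>quantum_plane q\<^esub> a"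

text \<open>Only spanning is needed at this point: the independence of the monomials \<open>y\<^sup>b x\<^sup>a\<close> comes out later from
their images in the standard model. Prepending a letter to a monomial in normal form gives a multiple
of such a monomial again, by the commutation rule.\<close>

lemma spans_quantum_plane:
  fixes q :: "'k::field"
  assumes "q \<noteq> 0"
  shows "spans (quantum_plane q) (range (\<lambda>(b, a). plane_monom q b a))"
proof -
  let ?F = "free_plane :: ('k, plane_gen list \<Rightarrow> 'k) module" and ?Q = "quantum_plane q" and ?I = "plane_ideal q"
  interpret Q: kalgebra ?Q by (rule quantum_plane_kalgebra)
  note D = alg_homD[OF quantum_plane_coset_hom]
  let ?X = "plane_var q GenX" and ?Y = "plane_var q GenY"
  have xy: "?X \<otimes>\<^bsub>?Q\<^esub> ?Y = inverse q \<odot>\<^bsub>?Q\<^esub> (?Y \<otimes>\<^bsub>?Q\<^esub> ?X)"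
    by (simp add: plane_relation Q.smult_assoc[symmetric] assms)
  have mc: "plane_monom q b a \<in> carrier ?Q" for a b by (simp add: plane_monom_def)
  have pc: "z \<otimes>\<^bsub>?Q\<^esub> z [^]\<^bsub>?Q\<^esub> k = z [^]\<^bsub>?Q\<^esub> k \<otimes>\<^bsub>?Q\<^esub> z" if "z \<in> carrier ?Q" for z and k :: nat
    using Q.nat_pow_comm[OF that, of 1 k] that by simp
  have word: "\<exists>c b a. ?I +>\<^bsub>?F\<^esub> monom_elem w = c \<odot>\<^bsub>?Q\<^esub> plane_monom q b a" for w
  proof (induction w)
    case Nil
    have "?I +>\<^bsub>?F\<^esub> monom_elem [] = \<one>\<^bsub>?Q\<^esub>" by (simp add: D(4)[symmetric] fp.one_eq)
    then show ?case
      by (intro exI[of _ 1] exI[of _ 0] exI[of _ "0::nat"]) (simp add: plane_monom_def)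
  next
    case (Cons z w)
    then obtain c b a where w: "?I +>\<^bsub>?F\<^esub> monom_elem w = c \<odot>\<^bsub>?Q\<^esub> plane_monom q b a" by blast
    have "?I +>\<^bsub>?F\<^esub> monom_elem (z # w) = plane_var q z \<otimes>\<^bsub>?Q\<^esub> (?I +>\<^bsub>?F\<^esub> monom_elem w)"
      by (simp add: plane_var_def D(3)[symmetric] fp.monom_mult)
    also have "\<dots> = c \<odot>\<^bsub>?Q\<^esub> (plane_var q z \<otimes>\<^bsub>?Q\<^esub> plane_monom q b a)"
      by (simp add: w Q.smult_mult_r mc)
    also have "plane_var q z \<otimes>\<^bsub>?Q\<^esub> plane_monom q b a =
        (case z of GenX \<Rightarrow> inverse q ^ b \<odot>\<^bsub>?Q\<^esub> plane_monom q b (Suc a) | GenY \<Rightarrow> plane_monom q (Suc b) a)"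
    proof (cases z)
      case GenX
      have "?X \<otimes>\<^bsub>?Q\<^esub> plane_monom q b a = (?X \<otimes>\<^bsub>?Q\<^esub> ?Y [^]\<^bsub>?Q\<^esub> b) \<otimes>\<^bsub>?Q\<^esub> ?X [^]\<^bsub>?Q\<^esub> a"
        by (simp add: plane_monom_def Q.m_assoc)
      also have "\<dots> = inverse q ^ b \<odot>\<^bsub>?Q\<^esub> plane_monom q b (Suc a)"
        by (simp add: Q.pow_skew_commute[OF _ _ xy] plane_monom_def Q.smult_mult_l Q.m_assoc pc)
      finally show ?thesis by (simp add: GenX)
    next
      case GenY
      then show ?thesis
        by (simp add: plane_monom_def Q.m_assoc[symmetric] pc)
    qed
    finally have eq: "?I +>\<^bsub>?F\<^esub> monom_elem (z # w) = c \<odot>\<^bsub>?Q\<^esub>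
        (case z of GenX \<Rightarrow> inverse q ^ b \<odot>\<^bsub>?Q\<^esub> plane_monom q b (Suc a) | GenY \<Rightarrow> plane_monom q (Suc b) a)" .
    show ?case
      by (cases z) (use eq mc in \<open>auto simp: Q.smult_assoc[symmetric]\<close>)
  qed
  have "spans ?Q ((\<lambda>a. ?I +>\<^bsub>?F\<^esub> a) ` range monom_elem)"
    by (rule spans_image[OF fp.kalgebra_axioms quantum_plane_kalgebra quantum_plane_coset_hom
        quantum_plane_carrier fp.spans_monoms])
  then show ?thesis
  proof (rule spans_trans)
    fix s Z assume "s \<in> (\<lambda>a. ?I +>\<^bsub>?F\<^esub> a) ` range monom_elem"
      and Z: "is_subspace ?Q Z" "range (\<lambda>(b, a). plane_monom q b a) \<subseteq> Z"
    then obtain c b a where "s = c \<odot>\<^bsub>?Q\<^esub> plane_monom q b a" using word by blast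
    with Z show "s \<in> Z" by (auto simp: is_subspace_def image_subset_iff)
  qed (auto simp: mc)
qed

section \<open>Tensor products of algebras\<close>

text \<open>The target of a homomorphism out of a tensor product need not be commutative, so the product of the
images of the factors has to be taken in a fixed order.\<close>

primrec ordered_prod :: "('a, 'e) monoid_scheme \<Rightarrow> (nat \<Rightarrow> 'a) \<Rightarrow> nat \<Rightarrow> 'a" where
  "ordered_prod B f 0 = \<one>\<^bsub>B\<^esub>"
| "ordered_prod B f (Suc n) = ordered_prod B f n \<otimes>\<^bsub>B\<^esub> f n"

lemma ordered_prod_cong: "(\<And>i. i < n \<Longrightarrow> f i = g i) \<Longrightarrow> ordered_prod B f n = ordered_prod B g n"
  by (induction n) auto

context monoid begin

lemma ordered_prod_closed [simp]: "(\<And>i. i < n \<Longrightarrow> f i \<in> carrier G) \<Longrightarrow> ordered_prod G f n \<in> carrier G"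
  by (induction n) auto

lemma ordered_prod_commute:
  assumes "\<And>i. i < n \<Longrightarrow> f i \<in> carrier G" "a \<in> carrier G" "\<And>i. i < n \<Longrightarrow> a \<otimes> f i = f i \<otimes> a"
  shows "a \<otimes> ordered_prod G f n = ordered_prod G f n \<otimes> a"
  using assms
proof (induction n)
  case (Suc n)
  have "a \<otimes> (ordered_prod G f n \<otimes> f n) = (a \<otimes> ordered_prod G f n) \<otimes> f n"
    using Suc.prems by (simp add: m_assoc)
  also have "\<dots> = ordered_prod G f n \<otimes> (a \<otimes> f n)" using Suc by (simp add: m_assoc)
  also have "\<dots> = ordered_prod G f n \<otimes> f n \<otimes> a" using Suc.prems by (simp add: m_assoc)
  finally show ?case by simp
qed simp

text \<open>Moving \<open>f n\<close> past the first \<open>n\<close> factors \<open>g i\<close> only uses that the images of different tensor factors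
commute.\<close>

lemma ordered_prod_mult:
  assumes "\<And>i. i < n \<Longrightarrow> f i \<in> carrier G" "\<And>i. i < n \<Longrightarrow> g i \<in> carrier G"
    and "\<And>i j. i < n \<Longrightarrow> j < n \<Longrightarrow> i \<noteq> j \<Longrightarrow> f i \<otimes> g j = g j \<otimes> f i"
  shows "ordered_prod G (\<lambda>i. f i \<otimes> g i) n = ordered_prod G f n \<otimes> ordered_prod G g n"
  using assms
proof (induction n)
  case (Suc n)
  let ?f = "ordered_prod G f n" and ?g = "ordered_prod G g n"
  have fg: "?f \<in> carrier G" "?g \<in> carrier G" "f n \<in> carrier G" "g n \<in> carrier G" using Suc.prems by auto
  have "f n \<otimes> ?g = ?g \<otimes> f n" by (rule ordered_prod_commute) (use Suc.prems in auto)
  then have "?f \<otimes> ?g \<otimes> (f n \<otimes> g n) = ?f \<otimes> f n \<otimes> (?g \<otimes> g n)"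
    using fg by (metis m_assoc m_closed)
  then show ?case using Suc by simp
qed simp

end

context kalgebra begin

lemma ordered_prod_upd_add:
  assumes "\<And>i. i < n \<Longrightarrow> f i \<in> carrier A" "a \<in> carrier A" "b \<in> carrier A" "i < n"
  shows "ordered_prod A (f(i := a \<oplus> b)) n = ordered_prod A (f(i := a)) n \<oplus> ordered_prod A (f(i := b)) n"
  using assms
proof (induction n)
  case (Suc n)
  show ?case
  proof (cases "i = n")
    case True
    have e: "ordered_prod A (f(n := c)) (Suc n) = ordered_prod A f n \<otimes> c" for c
      by (simp, rule arg_cong2[where f = "(\<otimes>)"], rule ordered_prod_cong) auto
    show ?thesis unfolding True e using Suc.prems by (simp add: r_distr)
  next
    case False
    with Suc.prems have i: "i < n" by simp
    have "\<And>c. c \<in> carrier A \<Longrightarrow> ordered_prod A (f(i := c)) n \<in> carrier A"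
      using Suc.prems by (intro ordered_prod_closed) auto
    with Suc i show ?thesis by (simp add: l_distr)
  qed
qed simp

lemma ordered_prod_upd_smult:
  assumes "\<And>i. i < n \<Longrightarrow> f i \<in> carrier A" "a \<in> carrier A" "i < n"
  shows "ordered_prod A (f(i := c \<odot> a)) n = c \<odot> ordered_prod A (f(i := a)) n"
  using assms
proof (induction n)
  case (Suc n)
  show ?case
  proof (cases "i = n")
    case True
    have e: "ordered_prod A (f(n := c)) (Suc n) = ordered_prod A f n \<otimes> c" for c
      by (simp, rule arg_cong2[where f = "(\<otimes>)"], rule ordered_prod_cong) auto
    show ?thesis unfolding True e using Suc.prems by (simp add: smult_mult_r)
  next
    case False
    with Suc.prems have i: "i < n" by simp
    have "ordered_prod A (f(i := a)) n \<in> carrier A"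
      using Suc.prems by (intro ordered_prod_closed) auto
    with Suc i show ?thesis by (simp add: smult_mult_l)
  qed
qed simp

end

lemma monoid_product_group:
  assumes "\<And>i. i \<in> I \<Longrightarrow> Group.monoid (G i)"
  shows "Group.monoid (product_group I G)"
proof (rule monoidI)
  fix x y z assume *: "x \<in> carrier (product_group I G)" "y \<in> carrier (product_group I G)" "z \<in> carrier (product_group I G)"
  then show "x \<otimes>\<^bsub>product_group I G\<^esub> y \<otimes>\<^bsub>product_group I G\<^esub> z = x \<otimes>\<^bsub>product_group I G\<^esub> (y \<otimes>\<^bsub>product_group I G\<^esub> z)"
    using assms by (auto simp: fun_eq_iff PiE_iff intro!: monoid.m_assoc)
qed (use assms in \<open>auto simp: PiE_iff monoid.m_closed monoid.one_closed monoid.l_one monoid.r_one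
       extensional_def fun_eq_iff\<close>)

locale tensor_product =
  fixes n :: nat and A :: "nat \<Rightarrow> ('k::field, 'a) module"
  assumes factor: "\<And>i. i < n \<Longrightarrow> kalgebra (A i)"
begin

abbreviation tuples where "tuples \<equiv> product_group {..<n} A"
abbreviation FA :: "('k, (nat \<Rightarrow> 'a) \<Rightarrow> 'k) module" where "FA \<equiv> monoid_algebra tuples"
abbreviation J where "J \<equiv> Idl\<^bsub>FA\<^esub> (tensor_relations {..<n} A)"
abbreviation TA where "TA \<equiv> tensor_algebra_product {..<n} A"
abbreviation pure where "pure \<equiv> pure_tensor {..<n} A"

sublocale free: monoid_alg tuples FA
  rewrites "carrier tuples = (\<Pi>\<^sub>E i\<in>{..<n}. carrier (A i))"
    and "monoid.mult tuples = (\<lambda>x y. \<lambda>i\<in>{..<n}. x i \<otimes>\<^bsub>A i\<^esub> y i)" and "one tuples = (\<lambda>i\<in>{..<n}. \<one>\<^bsub>A i\<^esub>)"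
proof -
  have "Group.monoid tuples"
    by (rule monoid_product_group) (auto dest!: factor simp: kalgebra_def ring_def)
  then show "monoid_alg tuples" by (simp add: monoid_alg_def)
qed auto

lemma update_tuple:
  "u \<in> (\<Pi>\<^sub>E j\<in>{..<n}. carrier (A j)) \<Longrightarrow> i < n \<Longrightarrow> a \<in> carrier (A i) \<Longrightarrow> u(i := a) \<in> (\<Pi>\<^sub>E j\<in>{..<n}. carrier (A j))"
  by (auto simp: PiE_iff extensional_def)

text \<open>The relations are given as pointwise differences of functions. Here they are written with the
operations of the algebra on tuples, so that homomorphisms can be applied to them.\<close>

lemma relation_cases:
  assumes "r \<in> tensor_relations {..<n} A"
  obtains (add) u i a b where "u \<in> (\<Pi>\<^sub>E j\<in>{..<n}. carrier (A j))" "i < n" "a \<in> carrier (A i)" "b \<in> carrier (A i)"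
      "r = monom_elem (u(i := a \<oplus>\<^bsub>A i\<^esub> b)) \<oplus>\<^bsub>FA\<^esub> ((- 1) \<odot>\<^bsub>FA\<^esub> monom_elem (u(i := a)) \<oplus>\<^bsub>FA\<^esub> (- 1) \<odot>\<^bsub>FA\<^esub> monom_elem (u(i := b)))"
      "monom_elem (u(i := a \<oplus>\<^bsub>A i\<^esub> b)) = r \<oplus>\<^bsub>FA\<^esub> (monom_elem (u(i := a)) \<oplus>\<^bsub>FA\<^esub> monom_elem (u(i := b)))"
  | (smult) u i a c where "u \<in> (\<Pi>\<^sub>E j\<in>{..<n}. carrier (A j))" "i < n" "a \<in> carrier (A i)"
      "r = monom_elem (u(i := c \<odot>\<^bsub>A i\<^esub> a)) \<oplus>\<^bsub>FA\<^esub> (- c) \<odot>\<^bsub>FA\<^esub> monom_elem (u(i := a))"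
      "monom_elem (u(i := c \<odot>\<^bsub>A i\<^esub> a)) = r \<oplus>\<^bsub>FA\<^esub> c \<odot>\<^bsub>FA\<^esub> monom_elem (u(i := a))"
proof -
  consider u i a b where "r = (\<lambda>t. monom_elem (u(i := a \<oplus>\<^bsub>A i\<^esub> b)) t - monom_elem (u(i := a)) t - monom_elem (u(i := b)) t)"
      "u \<in> (\<Pi>\<^sub>E j\<in>{..<n}. carrier (A j))" "i < n" "a \<in> carrier (A i)" "b \<in> carrier (A i)"
    | u i a c where "r = (\<lambda>t. monom_elem (u(i := c \<odot>\<^bsub>A i\<^esub> a)) t - c * monom_elem (u(i := a)) t)"
      "u \<in> (\<Pi>\<^sub>E j\<in>{..<n}. carrier (A j))" "i < n" "a \<in> carrier (A i)"
    using assms unfolding tensor_relations_def by blast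
  then show thesis
  proof cases
    case 1
    show thesis
      by (rule add[OF 1(2-5)]) (simp_all add: 1(1) free.add_eq free.smult_eq fun_eq_iff)
  next
    case 2
    show thesis
      by (rule smult[OF 2(2-4), of c]) (simp_all add: 2(1) free.add_eq free.smult_eq fun_eq_iff)
  qed
qed

lemma relations_closed: "tensor_relations {..<n} A \<subseteq> carrier FA"
proof
  fix r assume "r \<in> tensor_relations {..<n} A"
  then show "r \<in> carrier FA"
  proof (cases rule: relation_cases)
    case (add u i a b)
    interpret Ai: kalgebra "A i" by (rule factor[OF add(2)])
    have "u(i := a) \<in> (\<Pi>\<^sub>E j\<in>{..<n}. carrier (A j))" "u(i := b) \<in> (\<Pi>\<^sub>E j\<in>{..<n}. carrier (A j))"
      "u(i := a \<oplus>\<^bsub>A i\<^esub> b) \<in> (\<Pi>\<^sub>E j\<in>{..<n}. carrier (A j))"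
      by (intro update_tuple add Ai.add.m_closed)+
    then show ?thesis unfolding add(5) by (intro free.add.m_closed free.smult_closed free.monom_closed)
  next
    case (smult u i a c)
    interpret Ai: kalgebra "A i" by (rule factor[OF smult(2)])
    have "u(i := a) \<in> (\<Pi>\<^sub>E j\<in>{..<n}. carrier (A j))"
      "u(i := c \<odot>\<^bsub>A i\<^esub> a) \<in> (\<Pi>\<^sub>E j\<in>{..<n}. carrier (A j))"
      by (intro update_tuple smult Ai.smult_closed)+
    then show ?thesis unfolding smult(4) by (intro free.add.m_closed free.smult_closed free.monom_closed)
  qed
qed

lemma ideal_J: "ideal J FA" by (rule free.genideal_ideal[OF relations_closed])

lemma TA_eq: "TA = quotient_algebra FA J"
  by (simp add: tensor_algebra_product_def Let_def)

lemma pure_eq: "pure u = J +>\<^bsub>FA\<^esub> monom_elem u"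
  by (simp add: pure_tensor_def Let_def)

lemma kalgebra_TA: "kalgebra TA"
  and coset_hom: "(\<lambda>a. J +>\<^bsub>FA\<^esub> a) \<in> alg_hom FA TA"
  and carrier_TA: "carrier TA = (\<lambda>a. J +>\<^bsub>FA\<^esub> a) ` carrier FA"
  using kalgebra_quotient[OF free.kalgebra_axioms ideal_J] by (simp_all add: TA_eq)

lemma pure_closed: "u \<in> (\<Pi>\<^sub>E j\<in>{..<n}. carrier (A j)) \<Longrightarrow> pure u \<in> carrier TA"
  by (auto simp: pure_eq carrier_TA)

lemma relation_zero: "r \<in> tensor_relations {..<n} A \<Longrightarrow> J +>\<^bsub>FA\<^esub> r = \<zero>\<^bsub>TA\<^esub>"
proof -
  assume r: "r \<in> tensor_relations {..<n} A"
  interpret I: ideal J FA by (rule ideal_J)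
  have rJ: "r \<in> J" using free.genideal_self[OF relations_closed] r by auto
  then have "J +>\<^bsub>FA\<^esub> r = J"
    using relations_closed r I.a_subgroup by (intro free.a_coset_join2) auto
  then show ?thesis by (simp add: TA_eq quotient_algebra_def ring.defs FactRing_def)
qed

lemma pure_add:
  assumes "u \<in> (\<Pi>\<^sub>E j\<in>{..<n}. carrier (A j))" "i < n" "a \<in> carrier (A i)" "b \<in> carrier (A i)"
  shows "pure (u(i := a \<oplus>\<^bsub>A i\<^esub> b)) = pure (u(i := a)) \<oplus>\<^bsub>TA\<^esub> pure (u(i := b))"
proof -
  interpret Ai: kalgebra "A i" by (rule factor[OF assms(2)])
  interpret T: kalgebra TA by (rule kalgebra_TA)
  let ?r = "\<lambda>t. monom_elem (u(i := a \<oplus>\<^bsub>A i\<^esub> b)) t - monom_elem (u(i := a)) t - monom_elem (u(i := b)) t"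
  have r: "?r \<in> tensor_relations {..<n} A" unfolding tensor_relations_def using assms by blast
  have e: "monom_elem (u(i := a \<oplus>\<^bsub>A i\<^esub> b)) = ?r \<oplus>\<^bsub>FA\<^esub> (monom_elem (u(i := a)) \<oplus>\<^bsub>FA\<^esub> monom_elem (u(i := b)))"
    by (auto simp: free.add_eq)
  have c: "?r \<in> carrier FA" using r relations_closed by auto
  have cs: "monom_elem (u(i := a)) \<in> carrier FA" "monom_elem (u(i := b)) \<in> carrier FA"
    by (intro free.monom_closed update_tuple assms)+
  have cl: "pure (u(i := a)) \<in> carrier TA" "pure (u(i := b)) \<in> carrier TA"
    by (intro pure_closed update_tuple assms)+
  have "pure (u(i := a \<oplus>\<^bsub>A i\<^esub> b)) = J +>\<^bsub>FA\<^esub> (?r \<oplus>\<^bsub>FA\<^esub> (monom_elem (u(i := a)) \<oplus>\<^bsub>FA\<^esub> monom_elem (u(i := b))))"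
    unfolding pure_eq by (rule arg_cong[OF e])
  also have "\<dots> = \<zero>\<^bsub>TA\<^esub> \<oplus>\<^bsub>TA\<^esub> (pure (u(i := a)) \<oplus>\<^bsub>TA\<^esub> pure (u(i := b)))"
    unfolding pure_eq relation_zero[OF r, symmetric]
    by (subst alg_homD(2)[OF coset_hom c free.add.m_closed[OF cs]], subst alg_homD(2)[OF coset_hom cs]) (rule refl)
  finally show ?thesis using cl by simp
qed

lemma pure_smult:
  assumes "u \<in> (\<Pi>\<^sub>E j\<in>{..<n}. carrier (A j))" "i < n" "a \<in> carrier (A i)"
  shows "pure (u(i := c \<odot>\<^bsub>A i\<^esub> a)) = c \<odot>\<^bsub>TA\<^esub> pure (u(i := a))"
proof -
  interpret Ai: kalgebra "A i" by (rule factor[OF assms(2)])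
  interpret T: kalgebra TA by (rule kalgebra_TA)
  let ?r = "\<lambda>t. monom_elem (u(i := c \<odot>\<^bsub>A i\<^esub> a)) t - c * monom_elem (u(i := a)) t"
  have r: "?r \<in> tensor_relations {..<n} A" unfolding tensor_relations_def using assms by blast
  have e: "monom_elem (u(i := c \<odot>\<^bsub>A i\<^esub> a)) = ?r \<oplus>\<^bsub>FA\<^esub> c \<odot>\<^bsub>FA\<^esub> monom_elem (u(i := a))"
    by (auto simp: free.add_eq free.smult_eq)
  have c: "?r \<in> carrier FA" using r relations_closed by auto
  have cs: "monom_elem (u(i := a)) \<in> carrier FA"
    by (intro free.monom_closed update_tuple assms)+
  have cl: "pure (u(i := a)) \<in> carrier TA"
    by (intro pure_closed update_tuple assms)+
  have "pure (u(i := c \<odot>\<^bsub>A i\<^esub> a)) = J +>\<^bsub>FA\<^esub> (?r \<oplus>\<^bsub>FA\<^esub> c \<odot>\<^bsub>FA\<^esub> monom_elem (u(i := a)))"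
    unfolding pure_eq by (rule arg_cong[OF e])
  also have "\<dots> = \<zero>\<^bsub>TA\<^esub> \<oplus>\<^bsub>TA\<^esub> c \<odot>\<^bsub>TA\<^esub> pure (u(i := a))"
    unfolding pure_eq relation_zero[OF r, symmetric]
    by (subst alg_homD(2)[OF coset_hom c free.smult_closed[OF cs]], subst alg_homD(5)[OF coset_hom cs]) (rule refl)
  finally show ?thesis using cl by simp
qed

text \<open>The universal property of the tensor product of algebras. On the free vector space on tuples the map
\<open>u \<mapsto> \<Prod>\<^sub>i \<psi>\<^sub>i(u\<^sub>i)\<close> is multiplicative because the images commute, and it kills the relations because
each \<open>\<psi>\<^sub>i\<close> is linear.\<close>

lemma universal:
  assumes B: "kalgebra B" and \<psi>: "\<And>i. i < n \<Longrightarrow> \<psi> i \<in> alg_hom (A i) B"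
    and comm: "\<And>i j a b. i < n \<Longrightarrow> j < n \<Longrightarrow> i \<noteq> j \<Longrightarrow> a \<in> carrier (A i) \<Longrightarrow> b \<in> carrier (A j) \<Longrightarrow>
      \<psi> i a \<otimes>\<^bsub>B\<^esub> \<psi> j b = \<psi> j b \<otimes>\<^bsub>B\<^esub> \<psi> i a"
  obtains \<Psi> where "\<Psi> \<in> alg_hom TA B"
    "\<And>u. u \<in> (\<Pi>\<^sub>E j\<in>{..<n}. carrier (A j)) \<Longrightarrow> \<Psi> (pure u) = ordered_prod B (\<lambda>i. \<psi> i (u i)) n"
proof -
  interpret B: kalgebra B by fact
  define w where "w u = ordered_prod B (\<lambda>i. \<psi> i (u i)) n" for u
  have \<psi>c: "u \<in> (\<Pi>\<^sub>E j\<in>{..<n}. carrier (A j)) \<Longrightarrow> i < n \<Longrightarrow> \<psi> i (u i) \<in> carrier B" for u i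
    using alg_homD(1)[OF \<psi>] by auto
  have wc: "u \<in> (\<Pi>\<^sub>E j\<in>{..<n}. carrier (A j)) \<Longrightarrow> w u \<in> carrier B" for u
    unfolding w_def by (intro B.ordered_prod_closed \<psi>c)
  have upd: "w (u(i := a)) = ordered_prod B ((\<lambda>j. \<psi> j (u j))(i := \<psi> i a)) n" for u i a
    unfolding w_def by (rule ordered_prod_cong) auto
  have hom: "linear_extension B w \<in> alg_hom FA B"
  proof (rule free.linear_extension_hom[OF B])
    show "w \<in> hom tuples B"
    proof (rule homI)
      fix u v assume uv: "u \<in> carrier tuples" "v \<in> carrier tuples"
      have "w (u \<otimes>\<^bsub>tuples\<^esub> v) = ordered_prod B (\<lambda>i. \<psi> i (u i) \<otimes>\<^bsub>B\<^esub> \<psi> i (v i)) n"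
        unfolding w_def by (rule ordered_prod_cong) (use uv alg_homD(3)[OF \<psi>] in \<open>auto simp: PiE_iff\<close>)
      also have "\<dots> = w u \<otimes>\<^bsub>B\<^esub> w v"
        unfolding w_def by (rule B.ordered_prod_mult) (use uv \<psi>c comm in \<open>auto simp: PiE_iff\<close>)
      finally show "w (u \<otimes>\<^bsub>tuples\<^esub> v) = w u \<otimes>\<^bsub>B\<^esub> w v" .
    qed (use wc in auto)
    have "w (\<lambda>i\<in>{..<n}. \<one>\<^bsub>A i\<^esub>) = ordered_prod B (\<lambda>i. \<one>\<^bsub>B\<^esub>) n"
      unfolding w_def by (rule ordered_prod_cong) (use alg_homD(4)[OF \<psi>] in auto)
    also have "\<dots> = \<one>\<^bsub>B\<^esub>" by (induction n) auto
    finally show "w (\<lambda>i\<in>{..<n}. \<one>\<^bsub>A i\<^esub>) = \<one>\<^bsub>B\<^esub>" .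
  qed
  note D = alg_homD[OF hom]
  have m: "u \<in> (\<Pi>\<^sub>E j\<in>{..<n}. carrier (A j)) \<Longrightarrow> linear_extension B w (monom_elem u) = w u" for u
    using wc by simp
  have ker: "linear_extension B w r = \<zero>\<^bsub>B\<^esub>" if "r \<in> tensor_relations {..<n} A" for r
    using that
  proof (cases rule: relation_cases)
    case (add u i a b)
    interpret Ai: kalgebra "A i" by (rule factor[OF add(2)])
    have cl: "u(i := a) \<in> (\<Pi>\<^sub>E j\<in>{..<n}. carrier (A j))" "u(i := b) \<in> (\<Pi>\<^sub>E j\<in>{..<n}. carrier (A j))"
      "u(i := a \<oplus>\<^bsub>A i\<^esub> b) \<in> (\<Pi>\<^sub>E j\<in>{..<n}. carrier (A j))"
      by (intro update_tuple add Ai.add.m_closed)+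
    have s: "w (u(i := a \<oplus>\<^bsub>A i\<^esub> b)) = w (u(i := a)) \<oplus>\<^bsub>B\<^esub> w (u(i := b))"
      unfolding upd using add alg_homD(1,2)[OF \<psi>[of i]] \<psi>c[OF add(1)]
      by (simp add: B.ordered_prod_upd_add)
    have "linear_extension B w r = w (u(i := a \<oplus>\<^bsub>A i\<^esub> b)) \<oplus>\<^bsub>B\<^esub> ((- 1) \<odot>\<^bsub>B\<^esub> w (u(i := a)) \<oplus>\<^bsub>B\<^esub> (- 1) \<odot>\<^bsub>B\<^esub> w (u(i := b)))"
      unfolding add(5) using cl by (simp add: D m)
    also have "\<dots> = \<zero>\<^bsub>B\<^esub>"
      unfolding s using wc[OF cl(1)] wc[OF cl(2)] by (simp add: B.smult_minus_one B.minus_add[symmetric] B.r_neg)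
    finally show ?thesis .
  next
    case (smult u i a c)
    interpret Ai: kalgebra "A i" by (rule factor[OF smult(2)])
    have cl: "u(i := a) \<in> (\<Pi>\<^sub>E j\<in>{..<n}. carrier (A j))"
      "u(i := c \<odot>\<^bsub>A i\<^esub> a) \<in> (\<Pi>\<^sub>E j\<in>{..<n}. carrier (A j))"
      by (intro update_tuple smult Ai.smult_closed)+
    have s: "w (u(i := c \<odot>\<^bsub>A i\<^esub> a)) = c \<odot>\<^bsub>B\<^esub> w (u(i := a))"
      unfolding upd using smult alg_homD(1,5)[OF \<psi>[of i]] \<psi>c[OF smult(1)]
      by (simp add: B.ordered_prod_upd_smult)
    have "linear_extension B w r = w (u(i := c \<odot>\<^bsub>A i\<^esub> a)) \<oplus>\<^bsub>B\<^esub> (- c) \<odot>\<^bsub>B\<^esub> w (u(i := a))"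
      unfolding smult(4) using cl by (simp add: D m)
    also have "\<dots> = \<zero>\<^bsub>B\<^esub>"
      unfolding s using wc[OF cl(1)] by (simp add: B.smult_l_distr[symmetric])
    finally show ?thesis .
  qed
  obtain \<Psi> where \<Psi>: "\<Psi> \<in> alg_hom TA B" "\<And>a. a \<in> carrier FA \<Longrightarrow> \<Psi> (J +>\<^bsub>FA\<^esub> a) = linear_extension B w a"
    using genideal_quotient_induced[OF free.kalgebra_axioms relations_closed B hom ker] unfolding TA_eq by blast
  show ?thesis
    by (rule that[OF \<Psi>(1)]) (simp add: pure_eq \<Psi>(2) m, simp add: w_def)
qed

text \<open>The tensors of elements of spanning sets span: fix all entries of a tuple but one and use linearity
in that entry.\<close>

lemma spans_pure:
  assumes S: "\<And>i. i < n \<Longrightarrow> spans (A i) (S i)"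
  shows "spans TA (pure ` (\<Pi>\<^sub>E i\<in>{..<n}. S i))"
proof -
  interpret T: kalgebra TA by (rule kalgebra_TA)
  have Sc: "i < n \<Longrightarrow> S i \<subseteq> carrier (A i)" for i using S by (auto simp: spans_def)
  have 1: "spans TA (pure ` (\<Pi>\<^sub>E i\<in>{..<n}. carrier (A i)))"
    using spans_image[OF free.kalgebra_axioms kalgebra_TA coset_hom carrier_TA free.spans_monoms]
    by (simp add: image_image pure_eq)
  show ?thesis
  proof (rule spans_trans[OF 1])
    show "pure ` (\<Pi>\<^sub>E i\<in>{..<n}. S i) \<subseteq> carrier TA"
      using Sc by (auto intro!: pure_closed simp: PiE_iff)
    fix s Z assume s: "s \<in> pure ` (\<Pi>\<^sub>E i\<in>{..<n}. carrier (A i))"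
      and Z: "is_subspace TA Z" "pure ` (\<Pi>\<^sub>E i\<in>{..<n}. S i) \<subseteq> Z"
    \<comment> \<open>the first \<open>k\<close> entries are arbitrary, the others lie in the spanning sets\<close>
    have "\<forall>u \<in> (\<Pi>\<^sub>E i\<in>{..<n}. if i < k then carrier (A i) else S i). pure u \<in> Z" if "k \<le> n" for k
      using that
    proof (induction k)
      case (Suc k)
      show ?case
      proof
        fix u assume u: "u \<in> (\<Pi>\<^sub>E i\<in>{..<n}. if i < Suc k then carrier (A i) else S i)"
        have k: "k < n" using Suc by simp
        interpret Ak: kalgebra "A k" by (rule factor[OF k])
        have uc: "u \<in> (\<Pi>\<^sub>E i\<in>{..<n}. carrier (A i))" using u Sc
          by (force simp: PiE_iff split: if_splits)
        let ?Y = "{a \<in> carrier (A k). pure (u(k := a)) \<in> Z}"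
        have "is_subspace (A k) ?Y"
          unfolding is_subspace_def
        proof (intro conjI ballI allI)
          have "pure (u(k := 0 \<odot>\<^bsub>A k\<^esub> \<zero>\<^bsub>A k\<^esub>)) = 0 \<odot>\<^bsub>TA\<^esub> pure (u(k := \<zero>\<^bsub>A k\<^esub>))"
            by (rule pure_smult) (use uc k in auto)
          also have "\<dots> = \<zero>\<^bsub>TA\<^esub>" by (rule T.smult_zero_l, rule pure_closed, rule update_tuple) (use uc k in auto)
          finally show "\<zero>\<^bsub>A k\<^esub> \<in> ?Y" using Z by (simp add: is_subspace_def)
        qed (use Z uc k in \<open>auto simp: pure_add pure_smult is_subspace_def\<close>)
        moreover have "S k \<subseteq> ?Y"
        proof
          fix a assume a: "a \<in> S k"
          have "u(k := a) \<in> (\<Pi>\<^sub>E i\<in>{..<n}. if i < k then carrier (A i) else S i)"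
            using u a k by (auto simp: PiE_iff extensional_def less_Suc_eq split: if_splits)
          then show "a \<in> ?Y" using Suc a Sc[OF k] by auto
        qed
        ultimately have "u k \<in> ?Y"
          by (rule spansD[OF S[OF k]]) (use uc k in auto)
        then show "pure u \<in> Z" by simp
      qed
    qed (use Z in auto)
    from this[of n] have "\<forall>u \<in> (\<Pi>\<^sub>E i\<in>{..<n}. carrier (A i)). pure u \<in> Z"
      by (simp add: PiE_iff)
    then show "s \<in> Z" using s by auto
  qed
qed

end

section \<open>Polynomials in several variables\<close>

abbreviation "lookup \<equiv> Poly_Mapping.lookup"
abbreviation "keys \<equiv> Poly_Mapping.keys"
abbreviation "single \<equiv> Poly_Mapping.single"

type_synonym expo = "nat \<Rightarrow>\<^sub>0 nat"
type_synonym 'k mpoly = "expo \<Rightarrow>\<^sub>0 'k"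

text \<open>The workhorse for additive identities. The step is stated for every \<open>b\<close> and \<open>c\<close>, even if \<open>b\<close> lies in the
support of \<open>p\<close>, so that it follows from additivity alone.\<close>

lemma pm_add_induct [case_names zero add]:
  assumes "P 0" and "\<And>b c p. P p \<Longrightarrow> P (single b c + p)"
  shows "P (p :: 'x \<Rightarrow>\<^sub>0 'c::comm_monoid_add)"
proof (induction p rule: Poly_Mapping.update_induct)
  case (update f a b)
  have "Poly_Mapping.update a b f = single a b + f"
    using update(1) by (intro poly_mapping_eqI) (auto simp: lookup_update lookup_add lookup_single when_def in_keys_iff)
  with update assms(2) show ?case by simp
qed (rule assms(1))

lemma pm_sum_single: "(p :: 'x \<Rightarrow>\<^sub>0 'c::comm_monoid_add) = (\<Sum>b\<in>keys p. single b (lookup p b))"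
proof (rule poly_mapping_eqI)
  fix x
  have "lookup (\<Sum>b\<in>keys p. single b (lookup p b)) x = (\<Sum>b\<in>keys p. if b = x then lookup p b else 0)"
    by (simp add: lookup_sum lookup_single when_def)
  also have "\<dots> = lookup p x" by (simp add: in_keys_iff)
  finally show "lookup p x = lookup (\<Sum>b\<in>keys p. single b (lookup p b)) x" by simp
qed

lemma pm_sum_superset:
  assumes "finite S" "keys p \<subseteq> S" "\<And>b. f b 0 = 0"
  shows "(\<Sum>b\<in>keys p. f b (lookup p b)) = (\<Sum>b\<in>S. f b (lookup p b))"
  by (rule sum.mono_neutral_left) (use assms in \<open>auto simp: in_keys_iff\<close>)

lemma pm_sum_add:
  fixes f :: "'x \<Rightarrow> 'c::comm_monoid_add \<Rightarrow> 'd::comm_monoid_add"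
  assumes "\<And>b. f b 0 = 0" "\<And>b c d. f b (c + d) = f b c + f b d"
  shows "(\<Sum>b\<in>keys (p + p'). f b (lookup (p + p') b)) = (\<Sum>b\<in>keys p. f b (lookup p b)) + (\<Sum>b\<in>keys p'. f b (lookup p' b))"
proof -
  let ?S = "keys p \<union> keys p'"
  have 1: "finite ?S" "keys p \<subseteq> ?S" "keys p' \<subseteq> ?S" "keys (p + p') \<subseteq> ?S" using keys_add[of p p'] by auto
  show ?thesis
    by (subst (1 2 3) pm_sum_superset[where S = ?S and f = f]) (use 1 assms in \<open>auto simp: lookup_add sum.distrib\<close>)
qed

definition cst :: "'k \<Rightarrow> 'k::comm_ring_1 mpoly" where "cst c = single 0 c"
definition var :: "nat \<Rightarrow> 'k::comm_ring_1 mpoly" where "var i = single (single i 1) 1"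

lemma cst_add: "cst (a + b) = cst a + cst b" by (simp add: cst_def single_add)
lemma cst_mult: "cst (a * b) = cst a * cst b" by (simp add: cst_def mult_single)
lemma cst_0 [simp]: "cst 0 = 0" and cst_1 [simp]: "cst 1 = 1" by (simp_all add: cst_def)
lemma cst_minus: "cst (- a) = - cst a" by (simp add: cst_def single_uminus)
lemma cst_eq_iff [simp]: "cst a = cst b \<longleftrightarrow> a = b"
  using injD[OF inj_single[of 0], of a b] by (auto simp: cst_def)
lemma cst_eq_0 [simp]: "cst a = 0 \<longleftrightarrow> a = 0" using cst_eq_iff[of a 0] by (simp del: cst_eq_iff)
lemma lookup_cst_mult [simp]: "lookup (cst c * p) b = c * lookup p b"
  by (simp add: cst_def mult_map_scale_conv_mult[symmetric] Poly_Mapping.map.rep_eq when_def)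

lemma var_inj [simp]: "(var i :: 'k::comm_ring_1 mpoly) = var j \<longleftrightarrow> i = j"
proof
  assume "(var i :: 'k mpoly) = var j"
  then have "keys (var i :: 'k mpoly) = keys (var j :: 'k mpoly)" by simp
  then have "single i (1::nat) = single j 1" by (simp add: var_def)
  then have "keys (single i (1::nat)) = keys (single j (1::nat))" by simp
  then show "i = j" by simp
qed simp

definition mon :: "(nat \<Rightarrow> 'c::comm_ring_1) \<Rightarrow> expo \<Rightarrow> 'c" where
  "mon s b = (\<Prod>i\<in>keys b. s i ^ lookup b i)"

lemma mon_superset: "finite S \<Longrightarrow> keys b \<subseteq> S \<Longrightarrow> mon s b = (\<Prod>i\<in>S. s i ^ lookup b i)"
  unfolding mon_def by (rule prod.mono_neutral_left) (auto simp: in_keys_iff)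

lemma mon_add: "mon s (a + b) = mon s a * mon s b"
proof -
  let ?S = "keys a \<union> keys b"
  have "finite ?S" "keys (a + b) \<subseteq> ?S" using keys_add[of a b] by auto
  then show ?thesis
    by (subst (1 2 3) mon_superset[where S = ?S]) (auto simp: lookup_add power_add prod.distrib)
qed

lemma mon_0 [simp]: "mon s 0 = 1" and mon_single: "mon s (single i k) = s i ^ k"
  by (auto simp: mon_def)

lemma mon_cong: "(\<And>i. i \<in> keys b \<Longrightarrow> s i = t i) \<Longrightarrow> mon s b = mon t b"
  unfolding mon_def by (rule prod.cong) auto

lemma mon_mult_base: "mon (\<lambda>i. s i * t i) b = mon s b * mon t b"
  by (simp add: mon_def power_mult_distrib prod.distrib)

lemma mon_one [simp]: "mon (\<lambda>i. 1) b = 1" by (simp add: mon_def)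

text \<open>Substitution of elements of a commutative ring for the variables.\<close>

definition insertion :: "('k::comm_ring_1 \<Rightarrow> 'c) \<Rightarrow> (nat \<Rightarrow> 'c::comm_ring_1) \<Rightarrow> 'k mpoly \<Rightarrow> 'c" where
  "insertion \<phi> s p = (\<Sum>b\<in>keys p. \<phi> (lookup p b) * mon s b)"

text \<open>Homomorphisms between types of class \<open>comm_ring_1\<close>; substitutions, dilations, permutations of the
variables and the inclusion into the fraction field are all of this kind.\<close>

definition is_hom :: "('a::comm_ring_1 \<Rightarrow> 'b::comm_ring_1) \<Rightarrow> bool" where
  "is_hom f \<longleftrightarrow> f 1 = 1 \<and> (\<forall>a b. f (a + b) = f a + f b) \<and> (\<forall>a b. f (a * b) = f a * f b)"

lemma is_homD:
  assumes "is_hom f"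
  shows "f 1 = 1" "f (a + b) = f a + f b" "f (a * b) = f a * f b" "f 0 = 0" "f (- a) = - f a" "f (a - b) = f a - f b"
    "f (a ^ k) = f a ^ k"
proof -
  show 1: "f 1 = 1" and a: "f (a + b) = f a + f b" and m: "f (a * b) = f a * f b" for a b using assms by (auto simp: is_hom_def)
  show z: "f 0 = 0" using a[of 0 0] by simp
  show n: "f (- a) = - f a" for a using a[of a "- a"] z by (simp add: eq_neg_iff_add_eq_0 add.commute)
  show "f (a - b) = f a - f b" using a[of a "- b"] n by simp
  show "f (a ^ k) = f a ^ k" by (induction k) (auto simp: 1 m)
qed

lemma is_hom_sum: "is_hom f \<Longrightarrow> f (sum g S) = (\<Sum>x\<in>S. f (g x))"
  by (induction S rule: infinite_finite_induct) (auto simp: is_homD)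

lemma is_hom_prod: "is_hom f \<Longrightarrow> f (prod g S) = (\<Prod>x\<in>S. f (g x))"
  by (induction S rule: infinite_finite_induct) (auto simp: is_homD)

lemma is_hom_mon: "is_hom f \<Longrightarrow> f (mon s b) = mon (\<lambda>i. f (s i)) b"
  by (simp add: mon_def is_hom_prod is_homD)

lemma is_hom_comp: "is_hom f \<Longrightarrow> is_hom g \<Longrightarrow> is_hom (\<lambda>x. f (g x))"
  by (auto simp: is_hom_def)

lemma is_hom_cst: "is_hom cst" and is_hom_id: "is_hom (\<lambda>x. x)"
  by (auto simp: is_hom_def cst_add cst_mult)

lemma insertion_single: "is_hom \<phi> \<Longrightarrow> insertion \<phi> s (single b c) = \<phi> c * mon s b"
  by (cases "c = 0") (auto simp: insertion_def is_homD(4))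

lemma insertion_add: "is_hom \<phi> \<Longrightarrow> insertion \<phi> s (p + p') = insertion \<phi> s p + insertion \<phi> s p'"
  unfolding insertion_def by (rule pm_sum_add) (auto simp: is_homD algebra_simps)

lemma insertion_hom: assumes "is_hom \<phi>" shows "is_hom (insertion \<phi> s)"
proof -
  note add = insertion_add[OF assms] and sg = insertion_single[OF assms] and h = is_homD[OF assms]
  have 0: "insertion \<phi> s 0 = 0" by (simp add: insertion_def)
  have 1: "insertion \<phi> s (single b c * p) = insertion \<phi> s (single b c) * insertion \<phi> s p" for b c p
    by (induction p rule: pm_add_induct) (simp_all add: 0 add sg mult_single distrib_left h mon_add algebra_simps)
  have "insertion \<phi> s (p * p') = insertion \<phi> s p * insertion \<phi> s p'" for p p'
    by (induction p rule: pm_add_induct) (simp_all add: 0 add 1 distrib_right)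
  moreover have "insertion \<phi> s 1 = 1" using sg[of s 0 1] by (simp add: h)
  ultimately show ?thesis by (auto simp: is_hom_def add)
qed

lemma insertion_cst: "is_hom \<phi> \<Longrightarrow> insertion \<phi> s (cst c) = \<phi> c"
  and insertion_var: "is_hom \<phi> \<Longrightarrow> insertion \<phi> s (var i) = s i"
  by (simp_all add: cst_def var_def insertion_single mon_single is_homD)

lemma single_eq_mon: "single b c = cst c * mon var b"
proof (induction b rule: pm_add_induct)
  case (add i k b)
  have p: "var i ^ k = (single (single i k) 1 :: 'a mpoly)"
    by (induction k) (auto simp: var_def mult_single single_add[symmetric])
  have "single (single i k + b) c = single (single i k) 1 * single b c" by (simp add: mult_single)
  with add show ?case by (simp add: mon_add mon_single p algebra_simps)
qed (simp add: cst_def)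

text \<open>The polynomials in the first \<open>n\<close> variables.\<close>

definition Pn :: "nat \<Rightarrow> 'k::comm_ring_1 mpoly set" where
  "Pn n = {p. \<forall>b\<in>keys p. keys b \<subseteq> {..<n}}"

lemma Pn_single: "keys b \<subseteq> {..<n} \<Longrightarrow> single b c \<in> Pn n"
  by (auto simp: Pn_def)

lemma Pn_add [intro]: "p \<in> Pn n \<Longrightarrow> p' \<in> Pn n \<Longrightarrow> p + p' \<in> Pn n"
  using keys_add[of p p'] unfolding Pn_def by blast

lemma Pn_mult [intro]: "p \<in> Pn n \<Longrightarrow> p' \<in> Pn n \<Longrightarrow> p * p' \<in> Pn n"
  unfolding Pn_def
proof safe
  fix b i assume p: "\<forall>b\<in>keys p. keys b \<subseteq> {..<n}" "\<forall>b\<in>keys p'. keys b \<subseteq> {..<n}"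
    and b: "b \<in> keys (p * p')" and i: "i \<in> keys b"
  then obtain b1 b2 where "b = b1 + b2" "b1 \<in> keys p" "b2 \<in> keys p'" using keys_mult[of p p'] by blast
  with i p keys_add[of b1 b2] show "i < n" by blast
qed

lemma Pn_cst [simp]: "cst c \<in> Pn n" and Pn_var: "i < n \<Longrightarrow> var i \<in> Pn n"
  and Pn_0 [simp]: "0 \<in> Pn n" and Pn_1 [simp]: "1 \<in> Pn n"
  by (auto simp: Pn_def cst_def var_def split: if_splits)

lemma Pn_uminus [intro]: "p \<in> Pn n \<Longrightarrow> - p \<in> Pn n"
  using Pn_mult[OF Pn_cst[of "-1" n], of p] by (simp add: cst_minus)

lemma Pn_diff [intro]: "p \<in> Pn n \<Longrightarrow> p' \<in> Pn n \<Longrightarrow> p - p' \<in> Pn n"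
  using Pn_add[of p n "- p'"] by auto

lemma Pn_sum: "(\<And>x. x \<in> S \<Longrightarrow> f x \<in> Pn n) \<Longrightarrow> sum f S \<in> Pn n"
  by (induction S rule: infinite_finite_induct) auto

lemma Pn_prod: "(\<And>x. x \<in> S \<Longrightarrow> f x \<in> Pn n) \<Longrightarrow> prod f S \<in> Pn n"
  by (induction S rule: infinite_finite_induct) auto

lemma Pn_power: "p \<in> Pn n \<Longrightarrow> p ^ k \<in> Pn n"
  by (induction k) auto

inductive_set alg_gen :: "'k::comm_ring_1 mpoly set \<Rightarrow> 'k mpoly set" for S where
  alg_cst: "cst c \<in> alg_gen S"
| alg_gen: "s \<in> S \<Longrightarrow> s \<in> alg_gen S"
| alg_add: "a \<in> alg_gen S \<Longrightarrow> b \<in> alg_gen S \<Longrightarrow> a + b \<in> alg_gen S"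
| alg_mult: "a \<in> alg_gen S \<Longrightarrow> b \<in> alg_gen S \<Longrightarrow> a * b \<in> alg_gen S"

lemma alg_gen_0: "0 \<in> alg_gen S" and alg_gen_1: "1 \<in> alg_gen S"
  using alg_cst[of 0 S] alg_cst[of 1 S] by simp_all

lemma alg_gen_uminus: "a \<in> alg_gen S \<Longrightarrow> - a \<in> alg_gen S"
  using alg_mult[OF alg_cst[of "-1" S], of a] by (simp add: cst_minus)

lemma alg_gen_power: "a \<in> alg_gen S \<Longrightarrow> a ^ k \<in> alg_gen S"
  by (induction k) (auto intro: alg_gen_1 alg_mult)

lemma alg_gen_prod: "(\<And>x. x \<in> I \<Longrightarrow> f x \<in> alg_gen S) \<Longrightarrow> prod f I \<in> alg_gen S"
  by (induction I rule: infinite_finite_induct) (auto intro: alg_gen_1 alg_mult)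

lemma alg_gen_sum: "(\<And>x. x \<in> I \<Longrightarrow> f x \<in> alg_gen S) \<Longrightarrow> sum f I \<in> alg_gen S"
  by (induction I rule: infinite_finite_induct) (auto intro: alg_gen_0 alg_add)

lemma alg_gen_trans: "a \<in> alg_gen S \<Longrightarrow> S \<subseteq> alg_gen T \<Longrightarrow> a \<in> alg_gen T"
  by (induction a rule: alg_gen.induct) (auto intro: alg_cst alg_add alg_mult)

lemma Pn_eq_alg_gen: "Pn n = alg_gen (var ` {..<n})"
proof
  show "alg_gen (var ` {..<n}) \<subseteq> (Pn n :: 'a mpoly set)"
  proof
    fix x :: "'a mpoly" assume "x \<in> alg_gen (var ` {..<n})"
    then show "x \<in> Pn n" by induction (auto intro: Pn_var)
  qed
  show "Pn n \<subseteq> alg_gen (var ` {..<n} :: 'a mpoly set)"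
  proof
    fix p :: "'a mpoly" assume p: "p \<in> Pn n"
    have "single b c \<in> alg_gen (var ` {..<n})" if "keys b \<subseteq> {..<n}" for b and c :: 'a
      unfolding single_eq_mon mon_def using that
      by (intro alg_mult alg_cst alg_gen_prod alg_gen_power alg_gen) auto
    then have "(\<Sum>b\<in>keys p. single b (lookup p b)) \<in> alg_gen (var ` {..<n})"
      by (intro alg_gen_sum) (use p in \<open>auto simp: Pn_def\<close>)
    then show "p \<in> alg_gen (var ` {..<n})" using pm_sum_single[of p] by simp
  qed
qed

lemma hom_eq_on_alg_gen:
  assumes "is_hom f" "is_hom g" "\<And>c. f (cst c) = g (cst c)" "\<And>s. s \<in> S \<Longrightarrow> f s = g s" "a \<in> alg_gen S"
  shows "f a = g a"
  using assms(5) by induction (use assms in \<open>auto simp: is_homD\<close>)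

lemma hom_ext:
  assumes "is_hom f" "is_hom g" "\<And>c. f (cst c) = g (cst c)" "\<And>i. i < n \<Longrightarrow> f (var i) = g (var i)" "a \<in> Pn n"
  shows "f a = g a"
  using hom_eq_on_alg_gen[OF assms(1-3), of "var ` {..<n}" a] assms(4,5) by (auto simp: Pn_eq_alg_gen)

lemma Pn_UN: "\<exists>n. p \<in> Pn n"
proof (induction p rule: pm_add_induct)
  case (add b c p)
  then obtain n where n: "p \<in> Pn n" by blast
  obtain m where m: "keys b \<subseteq> {..<m}" using finite_nat_iff_bounded[of "keys b"] by auto
  have "p \<in> Pn (max m n)" "single b c \<in> Pn (max m n)" using n m by (auto simp: Pn_def subset_iff less_max_iff_disj)
  then show ?case by blast
qed auto

lemma hom_ext_UNIV:
  assumes "is_hom f" "is_hom g" "\<And>c. f (cst c) = g (cst c)" "\<And>i. f (var i) = g (var i)"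
  shows "f a = g a"
  using Pn_UN[of a] hom_ext[OF assms(1-3)] assms(4) by blast

section \<open>Substitutions, dilations and permutations of the variables\<close>

definition subst_vars :: "(nat \<Rightarrow> 'k mpoly) \<Rightarrow> 'k::comm_ring_1 mpoly \<Rightarrow> 'k mpoly" where
  "subst_vars = insertion cst"

lemma subst_hom: "is_hom (subst_vars s)" unfolding subst_vars_def by (rule insertion_hom[OF is_hom_cst])
lemma subst_cst [simp]: "subst_vars s (cst c) = cst c" and subst_var [simp]: "subst_vars s (var i) = s i"
  unfolding subst_vars_def by (simp_all add: insertion_cst insertion_var is_hom_cst)
lemmas subst_simps = is_homD[OF subst_hom]

lemma subst_single: "subst_vars s (single b c) = cst c * mon s b"
  unfolding subst_vars_def by (simp add: insertion_single is_hom_cst)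

lemma subst_subst: "subst_vars s (subst_vars t p) = subst_vars (\<lambda>i. subst_vars s (t i)) p"
  by (rule hom_ext_UNIV[where a = p]) (auto intro: is_hom_comp subst_hom)

lemma subst_var_id [simp]: "subst_vars var p = p"
  by (rule hom_ext_UNIV[where a = p]) (auto intro: subst_hom is_hom_id)

lemma subst_Pn: "p \<in> Pn n \<Longrightarrow> (\<And>i. i < n \<Longrightarrow> s i \<in> Pn m) \<Longrightarrow> subst_vars s p \<in> Pn m"
  unfolding Pn_eq_alg_gen[of n]
  by (induction p rule: alg_gen.induct) (auto simp: subst_simps)

text \<open>The dilation \<open>y\<^sub>i \<mapsto> s\<^sub>i y\<^sub>i\<close> and the permutation \<open>y\<^sub>i \<mapsto> y\<^bsub>\<pi>(i)\<^esub>\<close> of the variables.\<close>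

definition dil :: "(nat \<Rightarrow> 'k) \<Rightarrow> 'k::comm_ring_1 mpoly \<Rightarrow> 'k mpoly" where
  "dil s = subst_vars (\<lambda>i. cst (s i) * var i)"

definition perm :: "(nat \<Rightarrow> nat) \<Rightarrow> 'k::comm_ring_1 mpoly \<Rightarrow> 'k mpoly" where
  "perm \<pi> = subst_vars (\<lambda>i. var (\<pi> i))"

lemma dil_hom: "is_hom (dil s)" and perm_hom: "is_hom (perm \<pi>)"
  by (auto simp: dil_def perm_def intro: subst_hom)
lemmas dil_simps = is_homD[OF dil_hom] and perm_simps = is_homD[OF perm_hom]

lemma dil_cst [simp]: "dil s (cst c) = cst c" and dil_var [simp]: "dil s (var i) = cst (s i) * var i"
  and perm_cst [simp]: "perm \<pi> (cst c) = cst c" and perm_var [simp]: "perm \<pi> (var i) = var (\<pi> i)"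
  by (auto simp: dil_def perm_def)

lemma dil_dil: "dil s (dil t p) = dil (\<lambda>i. s i * t i) p"
  unfolding dil_def subst_subst by (simp add: subst_simps dil_def[symmetric] cst_mult algebra_simps)

lemma dil_one [simp]: "dil (\<lambda>i. 1) p = p" by (simp add: dil_def)

lemma dil_inverse: "(\<And>i. s i * t i = 1) \<Longrightarrow> dil s (dil t p) = p" by (simp add: dil_dil)

lemma perm_perm: "perm \<pi> (perm \<rho> p) = perm (\<pi> \<circ> \<rho>) p"
  unfolding perm_def subst_subst by (simp add: o_def)

lemma perm_id [simp]: "perm id p = p" "perm (\<lambda>i. i) p = p"
  by (simp_all add: perm_def)

lemma perm_dil: "perm \<pi> (dil s p) = dil (\<lambda>i. s (inv_into UNIV \<pi> i)) (perm \<pi> p)" if "bij \<pi>"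
  by (rule hom_ext_UNIV[where a = p])
    (use that in \<open>auto intro: is_hom_comp dil_hom perm_hom simp: perm_simps dil_simps bij_inv_eq_iff[OF that, symmetric] inv_f_f[OF bij_is_inj]\<close>)

lemma dil_Pn: "p \<in> Pn n \<Longrightarrow> dil s p \<in> Pn n"
  unfolding dil_def by (rule subst_Pn) (auto intro: Pn_var)

lemma perm_Pn: "p \<in> Pn n \<Longrightarrow> (\<And>i. i < n \<Longrightarrow> \<pi> i < n) \<Longrightarrow> perm \<pi> p \<in> Pn n"
  unfolding perm_def by (rule subst_Pn) (auto intro: Pn_var)

lemma dil_single: "dil s (single b c) = single b (c * mon s b)"
proof -
  have "mon (\<lambda>i. cst (s i) * var i) b = cst (mon s b) * mon var b"
    by (simp add: mon_mult_base is_hom_mon[OF is_hom_cst])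
  then show ?thesis by (simp add: dil_def subst_single single_eq_mon[of b "c * mon s b"] cst_mult mult.assoc)
qed

text \<open>The action of a bijection of the indices on exponents.\<close>

definition pexp :: "(nat \<Rightarrow> nat) \<Rightarrow> (nat \<Rightarrow>\<^sub>0 'c::zero) \<Rightarrow> (nat \<Rightarrow>\<^sub>0 'c)" where
  "pexp \<pi> = Poly_Mapping.map_key (inv_into UNIV \<pi>)"

lemma lookup_pexp: "bij \<pi> \<Longrightarrow> lookup (pexp \<pi> b) i = lookup b (inv_into UNIV \<pi> i)"
  unfolding pexp_def by (subst map_key.rep_eq) (auto simp: bij_imp_bij_inv bij_is_inj)

lemma pexp_add: "bij \<pi> \<Longrightarrow> pexp \<pi> (a + b) = pexp \<pi> a + (pexp \<pi> b :: nat \<Rightarrow>\<^sub>0 'c::comm_monoid_add)"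
  by (rule poly_mapping_eqI) (simp add: lookup_pexp lookup_add)

lemma pexp_0 [simp]: "bij \<pi> \<Longrightarrow> pexp \<pi> 0 = 0"
  by (rule poly_mapping_eqI) (simp add: lookup_pexp)

lemma pexp_single: "bij \<pi> \<Longrightarrow> pexp \<pi> (single i k) = single (\<pi> i) k"
  by (rule poly_mapping_eqI) (auto simp: lookup_pexp lookup_single when_def bij_inv_eq_iff)

lemma pexp_pexp: "bij \<pi> \<Longrightarrow> bij \<rho> \<Longrightarrow> pexp \<pi> (pexp \<rho> b) = pexp (\<pi> \<circ> \<rho>) b"
  by (rule poly_mapping_eqI) (simp add: lookup_pexp bij_comp o_inv_distrib)

lemma pexp_id [simp]: "pexp id b = b" "pexp (\<lambda>i. i) b = b"
  by (auto intro!: poly_mapping_eqI simp: lookup_pexp id_def[symmetric])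

lemma keys_pexp: assumes "bij \<pi>" shows "keys (pexp \<pi> b) = \<pi> ` keys b"
proof (rule Set.set_eqI)
  fix i
  have "\<pi> (inv_into UNIV \<pi> i) = i" using assms by (simp add: bij_is_surj surj_f_inv_f)
  then have "inv_into UNIV \<pi> i \<in> keys b \<Longrightarrow> i \<in> \<pi> ` keys b" by (rule image_eqI[OF sym])
  moreover have "i \<in> \<pi> ` keys b \<Longrightarrow> inv_into UNIV \<pi> i \<in> keys b"
    using inv_f_f[OF bij_is_inj[OF assms]] by auto
  ultimately show "i \<in> keys (pexp \<pi> b) \<longleftrightarrow> i \<in> \<pi> ` keys b"
    by (auto simp: in_keys_iff lookup_pexp[OF assms])
qed

lemma mon_pexp: assumes "bij \<pi>" shows "mon s (pexp \<pi> b) = mon (\<lambda>i. s (\<pi> i)) b"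
  unfolding mon_def keys_pexp[OF assms]
  by (subst prod.reindex) (use assms in \<open>auto simp: lookup_pexp bij_is_inj inj_on_subset[OF bij_is_inj] inv_f_f intro!: prod.cong\<close>)

lemma perm_single: "bij \<pi> \<Longrightarrow> perm \<pi> (single b c) = single (pexp \<pi> b) c"
  by (simp add: perm_def subst_single single_eq_mon[of "pexp \<pi> b"] mon_pexp)

section \<open>Symmetric polynomials\<close>

text \<open>In this part the symmetric polynomials in \<open>y\<^sub>0, \<dots>, y\<^bsub>n-1\<^esub>\<close> are shown to form a polynomial ring over
which the ring of all polynomials is free, with Artin's monomials \<open>y\<^sup>c\<close>, \<open>c\<^sub>i \<le> i\<close>, as a basis. The
elementary symmetric polynomials appear, up to sign, as the coefficients of \<open>\<Prod>\<^sub>l (t - y\<^sub>l)\<close>.\<close>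

abbreviation coeff :: "'a::zero poly \<Rightarrow> nat \<Rightarrow> 'a" where "coeff \<equiv> Polynomial.coeff"
abbreviation degree :: "'a::zero poly \<Rightarrow> nat" where "degree \<equiv> Polynomial.degree"
abbreviation monom :: "'a::zero \<Rightarrow> nat \<Rightarrow> 'a poly" where "monom \<equiv> Polynomial.monom"
abbreviation lead_coeff :: "'a::zero poly \<Rightarrow> 'a" where "lead_coeff p \<equiv> coeff p (degree p)"

inductive_set mod_gen :: "'r::comm_ring_1 set \<Rightarrow> 'r set \<Rightarrow> 'r set" for A B where
  mod_0: "0 \<in> mod_gen A B"
| mod_step: "x \<in> mod_gen A B \<Longrightarrow> a \<in> A \<Longrightarrow> b \<in> B \<Longrightarrow> a * b + x \<in> mod_gen A B"

lemma mod_gen_add: "x \<in> mod_gen A B \<Longrightarrow> y \<in> mod_gen A B \<Longrightarrow> x + y \<in> mod_gen A B"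
  by (induction x rule: mod_gen.induct) (auto simp: add.assoc intro: mod_step)

lemma mod_gen_scale:
  assumes "\<And>a a'. a \<in> A \<Longrightarrow> a' \<in> A \<Longrightarrow> a * a' \<in> A" "a \<in> A" "x \<in> mod_gen A B"
  shows "a * x \<in> mod_gen A B"
  using assms(3)
proof (induction rule: mod_gen.induct)
  case (mod_step x a' b)
  have "a * (a' * b + x) = (a * a') * b + a * x" by (simp add: algebra_simps)
  with mod_step assms show ?case by (auto intro: mod_gen.mod_step)
qed (auto intro: mod_0)

lemma mod_gen_in: "a \<in> A \<Longrightarrow> b \<in> B \<Longrightarrow> a * b \<in> mod_gen A B"
  using mod_step[OF mod_0] by fastforce

lemma mod_gen_sum: "(\<And>i. i \<in> I \<Longrightarrow> f i \<in> mod_gen A B) \<Longrightarrow> sum f I \<in> mod_gen A B"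
  by (induction I rule: infinite_finite_induct) (auto intro: mod_0 mod_gen_add)

definition root_poly :: "nat \<Rightarrow> 'k::comm_ring_1 mpoly poly" where
  "root_poly j = (\<Prod>l<j. [:- var l, 1:])"

lemma root_poly_Suc: "root_poly (Suc j) = [:- var j, 1:] * root_poly j"
  by (simp add: root_poly_def mult.commute)

lemma root_poly_monic: "lead_coeff (root_poly j :: 'k::field mpoly poly) = 1"
  by (induction j) (simp_all add: root_poly_Suc lead_coeff_mult del: mult_pCons_left, simp add: root_poly_def)

lemma root_poly_degree: "degree (root_poly j :: 'k::field mpoly poly) = j"
proof (induction j)
  case (Suc j)
  have "root_poly j \<noteq> (0 :: 'k mpoly poly)" using root_poly_monic[of j, where 'k = 'k] by auto
  then show ?case using Suc by (simp add: root_poly_Suc degree_mult_eq del: mult_pCons_left)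
qed (simp add: root_poly_def)

lemma Pn_mono: "m \<le> n \<Longrightarrow> p \<in> Pn m \<Longrightarrow> p \<in> Pn n"
  unfolding Pn_def by (auto simp: subset_iff intro: less_le_trans)

lemma coeff_root_poly_Pn: "coeff (root_poly j :: 'k::comm_ring_1 mpoly poly) i \<in> Pn j"
proof (induction j arbitrary: i)
  case (Suc j)
  have "coeff (root_poly (Suc j) :: 'k mpoly poly) i = (case i of 0 \<Rightarrow> 0 | Suc i' \<Rightarrow> coeff (root_poly j) i') - var j * coeff (root_poly j) i"
    by (simp add: root_poly_Suc coeff_pCons split: nat.splits)
  also have "\<dots> \<in> Pn (Suc j)"
    using Suc by (intro Pn_diff Pn_mult Pn_var) (auto split: nat.splits intro: Pn_mono[of j])
  finally show ?case .
qed (simp add: root_poly_def coeff_1)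

lemma coeff_root_poly_Suc: "coeff (root_poly j) i = coeff (root_poly (Suc j)) (Suc i) + var j * coeff (root_poly j) (Suc i)"
  by (simp add: root_poly_Suc)

text \<open>The ring generated by the elementary symmetric polynomials in the first \<open>j\<close> variables and by the
remaining variables. It is the ring of all polynomials for \<open>j = 0\<close>, and that of the symmetric ones for
\<open>j = n\<close>.\<close>

definition tower :: "nat \<Rightarrow> nat \<Rightarrow> 'k::comm_ring_1 mpoly set" where
  "tower n j = alg_gen (range (coeff (root_poly j)) \<union> var ` {j..<n})"

text \<open>In this step of the tower \<open>y\<^sub>j\<close> becomes a root of a monic polynomial of degree \<open>j + 1\<close> over the smaller
ring, so the powers \<open>1, \<dots>, y\<^sub>j\<^sup>j\<close> span a subring. It contains the elementary symmetric polynomials of the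
first \<open>j\<close> variables because dividing \<open>\<Prod>\<^bsub>l \<le> j\<^esub> (t - y\<^sub>l)\<close> by \<open>t - y\<^sub>j\<close> expresses them recursively.\<close>

lemma tower_step:
  assumes "j < n"
  shows "tower n j \<subseteq> mod_gen (tower n (Suc j)) ((\<lambda>i. var j ^ i :: 'k::field mpoly) ` {..j})"
proof -
  define A where "A = (tower n (Suc j) :: 'k mpoly set)"
  define B where "B = ((\<lambda>i. var j ^ i :: 'k mpoly) ` {..j})"
  define Z where "Z = mod_gen A B"
  have Amult: "\<And>a a'. a \<in> A \<Longrightarrow> a' \<in> A \<Longrightarrow> a * a' \<in> A" by (auto simp: A_def tower_def intro: alg_mult)
  have Acoeff: "coeff (root_poly (Suc j)) i \<in> A" for i by (auto simp: A_def tower_def intro: alg_gen)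
  have A1: "1 \<in> A" by (simp add: A_def tower_def alg_gen_1)
  have sc: "a \<in> A \<Longrightarrow> x \<in> Z \<Longrightarrow> a * x \<in> Z" for a x unfolding Z_def using mod_gen_scale Amult by metis
  have add: "x \<in> Z \<Longrightarrow> y \<in> Z \<Longrightarrow> x + y \<in> Z" for x y unfolding Z_def by (rule mod_gen_add)
  have pw: "i \<le> j \<Longrightarrow> var j ^ i \<in> Z" for i
    using mod_gen_in[OF A1, of "var j ^ i" B] by (simp add: Z_def B_def)
  have AZ: "a \<in> A \<Longrightarrow> a \<in> Z" for a using sc[of a 1] pw[of 0] by simp
  \<comment> \<open>the monic equation for \<open>y\<^sub>j\<close> rewrites \<open>y\<^sub>j\<^sup>j\<^sup>+\<^sup>1\<close> through lower powers\<close>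
  have "0 = poly (root_poly (Suc j)) (var j :: 'k mpoly)" by (simp add: root_poly_Suc)
  also have "\<dots> = (\<Sum>i\<le>Suc j. coeff (root_poly (Suc j)) i * var j ^ i)"
    by (simp add: poly_altdef root_poly_degree)
  also have "\<dots> = (\<Sum>i\<le>j. coeff (root_poly (Suc j)) i * var j ^ i) + var j ^ Suc j"
    using root_poly_monic[of "Suc j", where 'k = 'k] by (simp add: root_poly_degree)
  finally have "var j ^ Suc j = - 1 * (\<Sum>i\<le>j. coeff (root_poly (Suc j)) i * var j ^ i :: 'k mpoly)"
    by (simp add: eq_neg_iff_add_eq_0 add.commute)
  moreover have "(\<Sum>i\<le>j. coeff (root_poly (Suc j)) i * var j ^ i :: 'k mpoly) \<in> Z"
    unfolding Z_def by (intro mod_gen_sum) (use sc[OF Acoeff pw] in \<open>auto simp: Z_def\<close>)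
  moreover have "- 1 \<in> A" using A1 by (auto simp: A_def tower_def intro: alg_gen_uminus)
  ultimately have top: "var j ^ Suc j \<in> Z" using sc by metis
  have varZ: "var j * x \<in> Z" if "x \<in> Z" for x
    using that unfolding Z_def
  proof (induction rule: mod_gen.induct)
    case (mod_step x a b)
    then obtain i where i: "b = var j ^ i" "i \<le> j" by (auto simp: B_def)
    have "var j ^ Suc i \<in> Z" using top pw[of "Suc i"] i by (cases "i = j") auto
    then have "a * var j ^ Suc i + var j * x \<in> Z" using add sc mod_step by (simp add: Z_def)
    then show ?case by (simp add: i algebra_simps Z_def)
  qed (simp add: mod_0)
  have powZ: "var j ^ i * x \<in> Z" if "x \<in> Z" for x i
    by (induction i) (use that varZ in \<open>auto simp: mult.assoc\<close>)
  have mult: "x * y \<in> Z" if "x \<in> Z" "y \<in> Z" for x y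
    using that(1) unfolding Z_def
  proof (induction rule: mod_gen.induct)
    case (mod_step x a b)
    then obtain i where i: "b = var j ^ i" "i \<le> j" by (auto simp: B_def)
    have "a * (var j ^ i * y) + x * y \<in> Z" using add sc mod_step powZ that by (simp add: Z_def)
    then show ?case by (simp add: i algebra_simps Z_def)
  qed (simp add: mod_0)
  have coeffZ: "coeff (root_poly j) i \<in> Z" for i
  proof (induction "Suc j - i" arbitrary: i)
    case 0
    then have "i > degree (root_poly j :: 'k mpoly poly)" by (simp add: root_poly_degree)
    then show ?case by (simp add: coeff_eq_0 Z_def mod_0)
  next
    case (Suc d)
    then have "coeff (root_poly j) (Suc i) \<in> Z" by simp
    then show ?case using add[OF AZ[OF Acoeff] varZ] by (subst coeff_root_poly_Suc) blast
  qed
  have "x \<in> Z" if "x \<in> tower n j" for x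
    using that unfolding tower_def
  proof (induction rule: alg_gen.induct)
    case (alg_cst c)
    show ?case by (rule AZ) (simp add: A_def tower_def alg_gen.alg_cst)
  next
    case (alg_gen s)
    then consider i where "s = coeff (root_poly j) i" | i where "s = var i" "j < i" "i < n" | "s = var j"
      by (auto simp: le_less)
    then show ?case
    proof cases
      case 2
      then show ?thesis by (intro AZ) (auto simp: A_def tower_def intro: alg_gen.alg_gen)
    next
      case 3
      show ?thesis unfolding 3 using varZ[OF pw[of 0]] by simp
    qed (simp add: coeffZ)
  qed (auto intro: add mult)
  then show ?thesis by (auto simp: Z_def A_def B_def)
qed

text \<open>The exponents of Artin's monomials.\<close>

definition stairs :: "nat \<Rightarrow> (nat \<Rightarrow> nat) set" where
  "stairs k = (\<Pi>\<^sub>E i\<in>{..<k}. {..i})"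

definition stair_mon :: "nat \<Rightarrow> (nat \<Rightarrow> nat) \<Rightarrow> 'k::comm_ring_1 mpoly" where
  "stair_mon k c = (\<Prod>i<k. var i ^ c i)"

lemma finite_stairs [simp]: "finite (stairs k)" by (auto simp: stairs_def intro!: finite_PiE)

lemma stairs_0: "stairs 0 = {\<lambda>i. undefined}" by (simp add: stairs_def)

lemma stairs_Suc: "stairs (Suc k) = (\<lambda>(c, i). c(k := i)) ` (stairs k \<times> {..k})"
  and stairs_inj: "inj_on (\<lambda>(c, i). c(k := i)) (stairs k \<times> {..k})"
proof -
  show "stairs (Suc k) = (\<lambda>(c, i). c(k := i)) ` (stairs k \<times> {..k})"
    unfolding stairs_def lessThan_Suc PiE_insert_eq by (force simp: image_iff)
  show "inj_on (\<lambda>(c, i). c(k := i)) (stairs k \<times> {..k})"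
  proof (rule inj_onI, clarify)
    fix c i c' i' assume *: "c \<in> stairs k" "c' \<in> stairs k" "c(k := i) = c'(k := i')"
    have "i = i'" using fun_cong[OF *(3), of k] by simp
    moreover have "c x = c' x" for x
      using *(1,2) fun_cong[OF *(3), of x] by (cases "x = k") (auto simp: stairs_def PiE_iff extensional_def split: if_splits)
    ultimately show "c = c' \<and> i = i'" by auto
  qed
qed

lemma sum_stairs_Suc: "(\<Sum>c\<in>stairs (Suc k). f c) = (\<Sum>c\<in>stairs k. \<Sum>i\<le>k. f (c(k := i)))"
  unfolding stairs_Suc by (subst sum.reindex[OF stairs_inj]) (simp add: sum.cartesian_product split_def)

lemma stair_mon_Suc: "stair_mon (Suc k) (c(k := i)) = stair_mon k c * var k ^ i"
  by (simp add: stair_mon_def)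

lemma mod_gen_trans:
  assumes "x \<in> mod_gen A B" "A \<subseteq> mod_gen A' C"
  shows "x \<in> mod_gen A' {b * c | b c. b \<in> B \<and> c \<in> C}"
  using assms(1)
proof (induction rule: mod_gen.induct)
  case (mod_step x a b)
  have "a' * b \<in> mod_gen A' {b * c | b c. b \<in> B \<and> c \<in> C}" if "a' \<in> mod_gen A' C" for a'
    using that
  proof (induction rule: mod_gen.induct)
    case (mod_step y a c)
    have "(a * c + y) * b = a * (b * c) + y * b" by (simp add: algebra_simps)
    with mod_step \<open>b \<in> B\<close> show ?case by (auto intro!: mod_gen.mod_step)
  qed (simp add: mod_0)
  with mod_step assms(2) show ?case by (auto intro: mod_gen_add)
qed (rule mod_0)

lemma stairs_span:
  assumes "k \<le> n"
  shows "Pn n \<subseteq> mod_gen (tower n k) (stair_mon k ` stairs k :: 'k::field mpoly set)"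
  using assms
proof (induction k)
  case 0
  have "(p :: 'k mpoly) \<in> mod_gen (tower n 0) {1}" if "p \<in> Pn n" for p
  proof -
    have "Pn n \<subseteq> (tower n 0 :: 'k mpoly set)"
      unfolding Pn_eq_alg_gen tower_def
      by (intro subsetI, erule alg_gen_trans) (auto intro: alg_gen)
    then show ?thesis using mod_gen_in[of p _ 1] that by auto
  qed
  then show ?case by (auto simp: stairs_0 stair_mon_def)
next
  case (Suc k)
  have eq: "{b * c |b c. b \<in> stair_mon k ` stairs k \<and> c \<in> (\<lambda>i. var k ^ i) ` {..k}} = (stair_mon (Suc k) ` stairs (Suc k) :: 'k mpoly set)"
    unfolding stairs_Suc by (force simp: image_iff stair_mon_Suc)
  show ?case
    using Suc mod_gen_trans[OF _ tower_step[where 'k = 'k, of k n], of _ "stair_mon k ` stairs k", unfolded eq] by auto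
qed

lemma mod_gen_finite:
  assumes "x \<in> mod_gen A (f ` I)" "finite I" "0 \<in> A" "\<And>a b. a \<in> A \<Longrightarrow> b \<in> A \<Longrightarrow> a + b \<in> A"
  obtains g where "\<And>i. i \<in> I \<Longrightarrow> g i \<in> A" "x = (\<Sum>i\<in>I. g i * f i)"
proof -
  from assms(1) have "\<exists>g. (\<forall>i\<in>I. g i \<in> A) \<and> x = (\<Sum>i\<in>I. g i * f i)"
  proof (induction rule: mod_gen.induct)
    case mod_0
    show ?case by (rule exI[of _ "\<lambda>_. 0"]) (use assms in auto)
  next
    case (mod_step x a b)
    then obtain g i where g: "\<forall>i\<in>I. g i \<in> A" "x = (\<Sum>i\<in>I. g i * f i)" and i: "i \<in> I" "b = f i" by blast
    have "a * b + x = (\<Sum>j\<in>I. (g(i := a + g i)) j * f j)"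
      using assms(2) i g(2) by (simp add: sum.remove[of I i] algebra_simps)
    with g assms(4) mod_step(2) i show ?case by (intro exI[of _ "g(i := a + g i)"]) auto
  qed
  with that show ?thesis by blast
qed

definition symm :: "nat \<Rightarrow> nat \<Rightarrow> 'k::comm_ring_1 mpoly set" where
  "symm n k = {p \<in> Pn n. \<forall>\<pi>. \<pi> permutes {..<k} \<longrightarrow> perm \<pi> p = p}"

lemma symm_mono: "symm n (Suc k) \<subseteq> symm n k"
proof -
  have "\<pi> permutes {..<k} \<Longrightarrow> \<pi> permutes {..<Suc k}" for \<pi> by (rule permutes_subset) auto
  then show ?thesis by (auto simp: symm_def)
qed

text \<open>Peel off the last variable. The sums \<open>d c = \<Sum>\<^sub>i g(c, i) y\<^sub>k\<^sup>i\<close> are symmetric in the first \<open>k\<close> variables,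
hence zero by induction. Applying the transposition of \<open>k\<close> and \<open>l\<close> shows that the polynomial
\<open>\<Sum>\<^sub>i g(c, i) t\<^sup>i\<close> of degree at most \<open>k\<close> vanishes at all of \<open>y\<^sub>0, \<dots>, y\<^sub>k\<close>, so it is zero.\<close>

lemma stairs_independent:
  assumes "k \<le> n" "\<And>c. c \<in> stairs k \<Longrightarrow> g c \<in> symm n k" "(\<Sum>c\<in>stairs k. g c * stair_mon k c) = 0"
  shows "\<forall>c\<in>stairs k. g c = (0 :: 'k::field mpoly)"
  using assms
proof (induction k arbitrary: g)
  case 0
  then show ?case by (simp add: stairs_0 stair_mon_def)
next
  case (Suc k)
  have upd: "c(k := i) \<in> stairs (Suc k)" if "c \<in> stairs k" "i \<le> k" for c i
    using that by (force simp: stairs_Suc)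
  define d where "d c = (\<Sum>i\<le>k. g (c(k := i)) * var k ^ i)" for c
  have dsymm: "d c \<in> symm n k" if c: "c \<in> stairs k" for c
  proof -
    have "perm \<pi> (d c) = d c" if \<pi>: "\<pi> permutes {..<k}" for \<pi>
    proof -
      have "\<pi> k = k" using \<pi> by (simp add: permutes_not_in)
      moreover have "perm \<pi> (g (c(k := i))) = g (c(k := i))" if "i \<le> k" for i
        using subsetD[OF symm_mono Suc.prems(2)[OF upd[OF c that]]] \<pi> unfolding symm_def by blast
      ultimately show ?thesis
        unfolding d_def is_hom_sum[OF perm_hom] by (intro sum.cong) (auto simp: perm_simps)
    qed
    moreover have "d c \<in> Pn n"
      unfolding d_def using Suc.prems(1,2) upd[OF c] by (intro Pn_sum Pn_mult Pn_power Pn_var) (auto simp: symm_def)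
    ultimately show ?thesis by (auto simp: symm_def)
  qed
  have "(\<Sum>c\<in>stairs k. d c * stair_mon k c) = (\<Sum>c\<in>stairs (Suc k). g c * stair_mon (Suc k) c)"
    unfolding sum_stairs_Suc stair_mon_Suc by (simp add: d_def sum_distrib_right sum_distrib_left algebra_simps)
  with Suc.IH[of d] dsymm Suc.prems have d0: "\<forall>c\<in>stairs k. d c = 0" by simp
  have "g (c(k := i)) = 0" if c: "c \<in> stairs k" and i: "i \<le> k" for c i
  proof -
    define p where "p = (\<Sum>i\<le>k. monom (g (c(k := i))) i)"
    have root: "poly p (var l) = 0" if l: "l \<le> k" for l
    proof -
      let ?\<tau> = "transpose k l"
      have \<tau>: "?\<tau> permutes {..<Suc k}" using l by (intro permutes_swap_id) auto
      have inv: "perm ?\<tau> (g (c(k := i))) = g (c(k := i))" if "i \<le> k" for i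
        using Suc.prems(2)[OF upd[OF c that]] \<tau> unfolding symm_def by blast
      have "0 = perm ?\<tau> (d c)" using d0 c by (simp add: perm_simps)
      also have "\<dots> = (\<Sum>i\<le>k. g (c(k := i)) * var l ^ i)"
        unfolding d_def is_hom_sum[OF perm_hom] by (intro sum.cong) (auto simp: perm_simps inv)
      finally show ?thesis by (simp add: p_def poly_sum poly_monom)
    qed
    have "degree p \<le> k" unfolding p_def by (rule degree_sum_le) (auto intro: order_trans[OF degree_monom_le])
    have "p = 0"
    proof (rule ccontr)
      assume "p \<noteq> 0"
      have "card ((var :: nat \<Rightarrow> 'k mpoly) ` {..k}) \<le> card {x. poly p x = 0}"
        by (intro card_mono poly_roots_finite \<open>p \<noteq> 0\<close>) (use root in auto)
      also have "\<dots> \<le> degree p" by (rule card_poly_roots_bound) fact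
      finally show False using \<open>degree p \<le> k\<close> by (subst (asm) card_image) (auto simp: inj_on_def)
    qed
    moreover have "coeff p i = g (c(k := i))" using i by (simp add: p_def coeff_sum)
    ultimately show ?thesis by simp
  qed
  then show ?case by (auto simp: stairs_Suc)
qed

lemma perm_coeff_root_poly:
  assumes "\<pi> permutes {..<n}"
  shows "perm \<pi> (coeff (root_poly n) i) = coeff (root_poly n :: 'k::field mpoly poly) i"
proof -
  have hom: "map_poly (perm \<pi>) (p * p') = map_poly (perm \<pi>) p * map_poly (perm \<pi>) p'" for p p' :: "'k mpoly poly"
    by (rule poly_eqI) (simp add: coeff_map_poly coeff_mult is_hom_sum[OF perm_hom] perm_simps)
  have prod: "map_poly (perm \<pi>) (\<Prod>l\<in>S. f l) = (\<Prod>l\<in>S. map_poly (perm \<pi>) (f l))" for f :: "nat \<Rightarrow> 'k mpoly poly" and S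
    by (induction S rule: infinite_finite_induct) (auto simp: hom perm_simps)
  have "map_poly (perm \<pi>) (root_poly n :: 'k mpoly poly) = (\<Prod>l<n. [:- var (\<pi> l), 1:])"
    unfolding root_poly_def prod by (intro prod.cong) (auto simp: map_poly_pCons perm_simps)
  also have "\<dots> = root_poly n"
    unfolding root_poly_def using prod.permute[OF assms, of "\<lambda>l. [:- var l :: 'k mpoly, 1:]"] by (simp add: o_def)
  finally show ?thesis by (metis coeff_map_poly perm_simps(4))
qed

lemma tower_n: "tower n n = alg_gen (coeff (root_poly n) ` {..<n} :: 'k::field mpoly set)"
proof -
  have "coeff (root_poly n) i \<in> alg_gen (coeff (root_poly n) ` {..<n} :: 'k mpoly set)" for i
  proof (cases "i < n")
    case False
    then consider "i = n" | "i > n" by linarith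
    then show ?thesis using root_poly_monic[of n, where 'k = 'k]
      by cases (auto simp: root_poly_degree coeff_eq_0 alg_gen_0 alg_gen_1)
  qed (auto intro: alg_gen)
  then have "range (coeff (root_poly n)) \<union> var ` {n..<n} \<subseteq> alg_gen (coeff (root_poly n) ` {..<n} :: 'k mpoly set)" by auto
  moreover have "coeff (root_poly n) ` {..<n} \<subseteq> (tower n n :: 'k mpoly set)" by (auto simp: tower_def intro: alg_gen)
  ultimately show ?thesis unfolding tower_def by (blast intro: alg_gen_trans)
qed

lemma symm_closed:
  "p \<in> symm n k \<Longrightarrow> p' \<in> symm n k \<Longrightarrow> p + p' \<in> symm n k"
  "p \<in> symm n k \<Longrightarrow> p' \<in> symm n k \<Longrightarrow> p - p' \<in> symm n k"
  "cst c \<in> symm n k" "p \<in> symm n k \<Longrightarrow> p' \<in> symm n k \<Longrightarrow> p * p' \<in> symm n k"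
  by (auto simp: symm_def perm_simps)

lemma tower_n_symm: "tower n n \<subseteq> (symm n n :: 'k::field mpoly set)"
proof
  fix x :: "'k mpoly" assume "x \<in> tower n n"
  then show "x \<in> symm n n" unfolding tower_n
    by (induction rule: alg_gen.induct)
      (auto intro: symm_closed, auto simp: symm_def perm_coeff_root_poly coeff_root_poly_Pn)
qed

lemma stairs_basis:
  assumes "p \<in> (Pn n :: 'k::field mpoly set)"
  obtains g where "\<And>c. c \<in> stairs n \<Longrightarrow> g c \<in> tower n n" "p = (\<Sum>c\<in>stairs n. g c * stair_mon n c)"
proof (rule mod_gen_finite)
  show "p \<in> mod_gen (tower n n) (stair_mon n ` stairs n)" using stairs_span[of n n] assms by auto
qed (auto simp: tower_def intro: alg_gen_0 alg_add that)

text \<open>A symmetric \<open>p\<close> has two expansions in Artin's monomials with symmetric coefficients: the one over the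
elementary symmetric polynomials and the trivial one, \<open>p\<close> times the monomial \<open>1\<close>. By independence they
agree, so \<open>p\<close> is the coefficient of \<open>1\<close> in the former.\<close>

lemma symm_eq_tower: "symm n n = (tower n n :: 'k::field mpoly set)"
proof
  show "symm n n \<subseteq> (tower n n :: 'k mpoly set)"
  proof
    fix p :: "'k mpoly" assume p: "p \<in> symm n n"
    then obtain g where g: "\<And>c. c \<in> stairs n \<Longrightarrow> g c \<in> tower n n" "p = (\<Sum>c\<in>stairs n. g c * stair_mon n c)"
      using stairs_basis[of p n] by (auto simp: symm_def)
    define z where "z = (\<lambda>i\<in>{..<n}. 0 :: nat)"
    have z: "z \<in> stairs n" by (auto simp: z_def stairs_def)
    have zm: "stair_mon n z = (1 :: 'k mpoly)" by (simp add: stair_mon_def z_def)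
    have "(\<Sum>c\<in>stairs n. (if c = z then p else 0) * stair_mon n c) = (\<Sum>c\<in>stairs n. if c = z then p else 0)"
      by (intro sum.cong) (auto simp: zm)
    then have "(\<Sum>c\<in>stairs n. (g c - (if c = z then p else 0)) * stair_mon n c) = 0"
      using z g(2) by (simp add: left_diff_distrib sum_subtractf)
    moreover have "g c - (if c = z then p else 0) \<in> symm n n" if "c \<in> stairs n" for c
      using g(1)[OF that] tower_n_symm p symm_closed(3)[of 0 n n] by (intro symm_closed) auto
    ultimately have "\<forall>c\<in>stairs n. g c - (if c = z then p else 0) = 0" by (intro stairs_independent[of n n]) auto
    then have pz: "p = g z" using z by auto
    show "p \<in> tower n n" unfolding pz by (rule g(1)[OF z])
  qed
qed (rule tower_n_symm)

section \<open>Algebraic independence of the elementary symmetric polynomials\<close>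

lemma digits_unique:
  fixes f g :: "nat \<Rightarrow> nat"
  assumes "\<And>i. f i < N" "\<And>i. g i < N" "(\<Sum>i<n. f i * N ^ i) = (\<Sum>i<n. g i * N ^ i)" "i < n"
  shows "f i = g i"
  using assms
proof (induction n arbitrary: f g i)
  case (Suc n)
  have N: "N > 0" using Suc.prems(1)[of 0] by simp
  have split: "(\<Sum>i<Suc n. f i * N ^ i) = f 0 + N * (\<Sum>i<n. f (Suc i) * N ^ i)" for f
    by (subst sum.lessThan_Suc_shift) (simp add: sum_distrib_left algebra_simps)
  have "(f 0 + N * (\<Sum>i<n. f (Suc i) * N ^ i)) mod N = (g 0 + N * (\<Sum>i<n. g (Suc i) * N ^ i)) mod N"
    using Suc.prems(3) unfolding split by simp
  then have 0: "f 0 = g 0" using Suc.prems(1,2) by simp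
  then have "(\<Sum>i<n. f (Suc i) * N ^ i) = (\<Sum>i<n. g (Suc i) * N ^ i)"
    using Suc.prems(3) N unfolding split by simp
  with Suc.IH[of "\<lambda>i. f (Suc i)" "\<lambda>i. g (Suc i)"] Suc.prems 0 show ?case by (cases i) auto
qed simp

text \<open>
  Kronecker's substitution \<open>y\<^sub>i \<mapsto> z\<^bsup>N^i\<^esup>\<close>, with \<open>N\<close> larger than all exponents, reduces this to one
  variable: distinct exponents give distinct powers of \<open>z\<close> because expansions to the base \<open>N\<close> are unique.
\<close>

lemma insertion_vanishes:
  fixes p :: "'k::{field_char_0} mpoly"
  assumes p: "p \<in> Pn n" and van: "\<And>s. insertion (\<lambda>x. x) s p = 0"
  shows "p = 0"
proof -
  define N where "N = Suc (Max (insert 0 (\<Union>b\<in>keys p. lookup b ` keys b)))"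
  define w where "w b = (\<Sum>i<n. lookup b i * N ^ i)" for b
  have bound: "lookup b i < N" if "b \<in> keys p" for b i
  proof (cases "i \<in> keys b")
    case True
    then show ?thesis unfolding N_def less_Suc_eq_le using that by (intro Max_ge) auto
  qed (simp add: N_def in_keys_iff)
  have inj: "inj_on w (keys p)"
  proof (rule inj_onI)
    fix a b assume ab: "a \<in> keys p" "b \<in> keys p" "w a = w b"
    have "lookup a i = lookup b i" for i
    proof (cases "i < n")
      case True
      then show ?thesis using digits_unique[of "lookup a" N "lookup b" n i] ab bound by (simp add: w_def)
    next
      case False
      then have "i \<notin> keys a" "i \<notin> keys b" using p ab by (auto simp: Pn_def)
      then show ?thesis by (simp add: in_keys_iff)
    qed
    then show "a = b" by (rule poly_mapping_eqI)
  qed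
  define f where "f = (\<Sum>b\<in>keys p. monom (lookup p b) (w b))"
  have "poly f z = 0" for z
  proof -
    have "mon (\<lambda>i. z ^ (N ^ i)) b = z ^ w b" if "b \<in> keys p" for b
    proof -
      have "mon (\<lambda>i. z ^ (N ^ i)) b = (\<Prod>i<n. (z ^ (N ^ i)) ^ lookup b i)"
        using that p by (intro mon_superset) (auto simp: Pn_def)
      also have "\<dots> = z ^ w b" by (simp add: w_def power_sum power_mult[symmetric] mult.commute)
      finally show ?thesis .
    qed
    then have "poly f z = insertion (\<lambda>x. x) (\<lambda>i. z ^ (N ^ i)) p"
      unfolding f_def insertion_def poly_sum poly_monom by (intro sum.cong) auto
    then show ?thesis using van by simp
  qed
  then have f0: "f = 0" using poly_all_0_iff_0 by blast
  have "lookup p b = 0" if "b \<in> keys p" for b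
  proof -
    have "0 = coeff f (w b)" by (simp add: f0)
    also have "\<dots> = (\<Sum>a\<in>keys p. if a = b then lookup p a else 0)"
      unfolding f_def coeff_sum coeff_monom by (intro sum.cong) (use inj that in \<open>auto simp: inj_on_def\<close>)
    also have "\<dots> = lookup p b" using that by simp
    finally show ?thesis by simp
  qed
  then show ?thesis by (intro poly_mapping_eqI) (auto simp: in_keys_iff)
qed

text \<open>
  Over an algebraically closed field every tuple is the tuple of coefficients of a monic polynomial
  that splits into linear factors. Evaluation at its roots therefore turns a relation between the
  elementary symmetric polynomials into the vanishing of the relation at an arbitrary point.
\<close>

lemma elementary_independent:
  fixes p :: "'k::{alg_closed_field, field_char_0} mpoly"
  assumes p: "p \<in> Pn n" and z: "subst_vars (coeff (root_poly n)) p = 0"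
  shows "p = 0"
proof (rule insertion_vanishes[OF p])
  fix s :: "nat \<Rightarrow> 'k"
  define f where "f = monom 1 n + (\<Sum>i<n. monom (s i) i)"
  have c: "coeff f i = (if i = n then 1 else if i < n then s i else 0)" for i
    by (auto simp: f_def coeff_sum)
  have deg: "degree f = n"
    by (rule antisym[OF degree_le le_degree]) (auto simp: c)
  have "f \<noteq> 0" using c[of n] by auto
  then obtain A where A: "size A = degree f" "f = Polynomial.smult (lead_coeff f) (\<Prod>x\<in>#A. [:- x, 1:])"
    using alg_closed_imp_factorization[of f] by blast
  obtain xs where xs: "A = mset xs" using ex_mset[of A] by auto
  have len: "length xs = n" using A deg xs by simp
  let ?r = "(!) xs"
  let ?e = "insertion (\<lambda>x. x) ?r"
  have e: "is_hom ?e" by (rule insertion_hom[OF is_hom_id])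
  have hom: "map_poly ?e (p * p') = map_poly ?e p * map_poly ?e p'" for p p'
    by (rule poly_eqI) (simp add: coeff_map_poly coeff_mult is_hom_sum[OF e] is_homD[OF e])
  have prod: "map_poly ?e (\<Prod>l\<in>S. f l) = (\<Prod>l\<in>S. map_poly ?e (f l))" for f :: "nat \<Rightarrow> 'k mpoly poly" and S
    by (induction S rule: infinite_finite_induct) (auto simp: hom is_homD[OF e])
  have "f = (\<Prod>x\<leftarrow>xs. [:- x, 1:])" using A(2) deg c[of n] xs by (simp add: prod_mset_prod_list[symmetric])
  also have "\<dots> = (\<Prod>l<n. [:- ?r l, 1:])"
    by (simp add: prod.list_conv_set_nth len atLeast0LessThan)
  also have "\<dots> = map_poly ?e (root_poly n)"
    unfolding root_poly_def prod
    by (intro prod.cong) (auto simp: map_poly_pCons is_homD[OF e] insertion_var is_hom_id)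
  finally have "?e (coeff (root_poly n) i) = coeff f i" for i by (simp add: coeff_map_poly is_homD[OF e])
  then have ei: "?e (coeff (root_poly n) i) = s i" if "i < n" for i using that by (simp add: c)
  have "0 = ?e (subst_vars (coeff (root_poly n)) p)" by (simp add: z is_homD[OF e])
  also have "\<dots> = insertion (\<lambda>x. x) s p"
    by (rule hom_ext[where f = "\<lambda>p. ?e (subst_vars (coeff (root_poly n)) p)", OF is_hom_comp[OF e subst_hom] insertion_hom[OF is_hom_id] _ _ p])
      (simp_all add: insertion_cst insertion_var is_hom_id ei)
  finally show "insertion (\<lambda>x. x) s p = 0" by simp
qed

section \<open>Crossed products with the monoid of exponents\<close>

text \<open>Sums over supports, as a substitute for the linear extension of a map from basis elements when the
coefficients are moved by a map that is additive but not linear.\<close>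

definition pm_lift :: "('x \<Rightarrow> 'c::zero \<Rightarrow> 'd::comm_monoid_add) \<Rightarrow> ('x \<Rightarrow>\<^sub>0 'c) \<Rightarrow> 'd" where
  "pm_lift h p = (\<Sum>b\<in>keys p. h b (lookup p b))"

lemma pm_lift_0 [simp]: "pm_lift h 0 = 0" by (simp add: pm_lift_def)

lemma pm_lift_single: "(\<And>b. h b 0 = 0) \<Longrightarrow> pm_lift h (single b c) = h b c"
  by (cases "c = 0") (auto simp: pm_lift_def)

lemma pm_lift_add:
  fixes h :: "'x \<Rightarrow> 'c::comm_monoid_add \<Rightarrow> 'd::comm_monoid_add"
  assumes "\<And>b. h b 0 = 0" "\<And>b c d. h b (c + d) = h b c + h b d"
  shows "pm_lift h (p + p') = pm_lift h p + pm_lift h p'"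
  unfolding pm_lift_def by (rule pm_sum_add[where f = h]) (use assms in auto)

text \<open>A monoid of exponents acts on a commutative ring by \<open>s\<close>; then \<open>tmul\<close> is the product of the crossed
product, with \<open>single a c\<close> standing for \<open>c x\<^sup>a\<close> and the rule \<open>x\<^sup>a d = s\<^sub>a(d) x\<^sup>a\<close>. The coefficients are
polynomials in the model of quantum affine space and rational functions in the skew monoid ring.\<close>

locale crossed =
  fixes s :: "expo \<Rightarrow> 'c::comm_ring_1 \<Rightarrow> 'c"
  assumes act_hom: "is_hom (s a)" and act_0 [simp]: "s 0 x = x" and act_add: "s (a + b) x = s a (s b x)"
begin

lemmas act_simps = is_homD[OF act_hom]

definition tmul :: "(expo \<Rightarrow>\<^sub>0 'c) \<Rightarrow> (expo \<Rightarrow>\<^sub>0 'c) \<Rightarrow> (expo \<Rightarrow>\<^sub>0 'c)" where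
  "tmul f g = pm_lift (\<lambda>a c. pm_lift (\<lambda>b d. single (a + b) (c * s a d)) g) f"

lemma inner_add: "pm_lift (\<lambda>b d. single (a + b) (c * s a d)) (g + g') =
   pm_lift (\<lambda>b d. single (a + b) (c * s a d)) g + pm_lift (\<lambda>b d. single (a + b) (c * s a d)) g'"
  by (rule pm_lift_add) (auto simp: act_simps distrib_left single_add)

lemma outer:
  "pm_lift (\<lambda>b d. single (a + b) (0 * s a d)) g = 0"
  "pm_lift (\<lambda>b d. single (a + b) ((c + c') * s a d)) g =
   pm_lift (\<lambda>b d. single (a + b) (c * s a d)) g + pm_lift (\<lambda>b d. single (a + b) (c' * s a d)) g"
  by (simp_all add: pm_lift_def distrib_right single_add sum.distrib)

lemma tmul_0 [simp]: "tmul 0 g = 0" "tmul f 0 = 0" by (simp_all add: tmul_def pm_lift_def)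

lemma tmul_add_l: "tmul (f + f') g = tmul f g + tmul f' g"
  unfolding tmul_def by (rule pm_lift_add) (simp_all add: outer del: mult_zero_left)

lemma tmul_add_r: "tmul f (g + g') = tmul f g + tmul f g'"
  unfolding tmul_def inner_add by (simp add: pm_lift_def sum.distrib)

lemma tmul_single: "tmul (single a c) (single b d) = single (a + b) (c * s a d)"
  unfolding tmul_def
  by (subst pm_lift_single, simp add: outer del: mult_zero_left, subst pm_lift_single) (auto simp: act_simps)

lemma tmul_assoc: "tmul (tmul f g) h = tmul f (tmul g h)"
proof (induction f rule: pm_add_induct)
  case (add a c f)
  have "tmul (tmul (single a c) g) h = tmul (single a c) (tmul g h)"
  proof (induction g rule: pm_add_induct)
    case (add b d g)
    have "tmul (tmul (single a c) (single b d)) h = tmul (single a c) (tmul (single b d) h)"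
      by (induction h rule: pm_add_induct)
        (simp_all add: tmul_add_r tmul_single add.assoc mult.assoc act_add act_simps)
    with add show ?case by (simp add: tmul_add_l tmul_add_r)
  qed simp
  with add show ?case by (simp add: tmul_add_l)
qed simp

lemma tmul_one [simp]: "tmul 1 f = f" "tmul f 1 = f"
proof -
  have "tmul (single 0 1) (single b c) = single b c" "tmul (single b c) (single 0 1) = single b c" for b c
    by (simp_all add: tmul_single act_simps del: single_one)
  then show "tmul 1 f = f" "tmul f 1 = f"
    by (induction f rule: pm_add_induct) (simp_all add: tmul_add_l tmul_add_r)
qed

lemma lookup_tmul_scalar: "lookup (tmul (single 0 c) f) a = c * lookup f a"
proof (induction f rule: pm_add_induct)
  case (add b d p) then show ?case
    by (simp add: tmul_add_r tmul_single lookup_add distrib_left) (simp add: lookup_single when_def)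
qed simp

lemma lookup_tmul_scalar_r: "lookup (tmul f (single 0 c)) a = lookup f a * s a c"
proof (induction f rule: pm_add_induct)
  case (add b d p) then show ?case
    by (simp add: tmul_add_l tmul_single lookup_add distrib_right) (auto simp: lookup_single when_def)
qed simp

text \<open>Restricting the exponents to a submonoid and the coefficients to a stable subring gives a subring.\<close>

lemma tmul_in:
  assumes M: "\<And>a b. a \<in> M \<Longrightarrow> b \<in> M \<Longrightarrow> a + b \<in> M"
    and V: "0 \<in> V" "\<And>c d. c \<in> V \<Longrightarrow> d \<in> V \<Longrightarrow> c + d \<in> V" "\<And>c d. c \<in> V \<Longrightarrow> d \<in> V \<Longrightarrow> c * d \<in> V"
      "\<And>a c. a \<in> M \<Longrightarrow> c \<in> V \<Longrightarrow> s a c \<in> V"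
    and f: "keys f \<subseteq> M" "\<And>a. lookup f a \<in> V" and g: "keys g \<subseteq> M" "\<And>a. lookup g a \<in> V"
  shows "keys (tmul f g) \<subseteq> M" "lookup (tmul f g) a \<in> V"
proof -
  have eq: "tmul f g = (\<Sum>a\<in>keys f. \<Sum>b\<in>keys g. single (a + b) (lookup f a * s a (lookup g b)))"
    by (simp add: tmul_def pm_lift_def)
  have "keys (tmul f g) \<subseteq> (\<Union>a\<in>keys f. \<Union>b\<in>keys g. keys (single (a + b) (lookup f a * s a (lookup g b))))"
    unfolding eq by (rule order_trans[OF keys_sum UN_mono[OF subset_refl keys_sum]])
  also have "\<dots> \<subseteq> M" using f g by (auto intro!: M split: if_splits)
  finally show "keys (tmul f g) \<subseteq> M" .
  have sumV: "(\<And>i. i \<in> I \<Longrightarrow> F i \<in> V) \<Longrightarrow> sum F I \<in> V" for F and I :: "expo set"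
    by (induction I rule: infinite_finite_induct) (auto intro: V)
  show "lookup (tmul f g) a \<in> V"
    unfolding eq lookup_sum lookup_single when_def
    by (intro sumV) (use f g in \<open>auto intro!: V\<close>)
qed

end

lemma keys_in_add: "keys f \<subseteq> M \<Longrightarrow> keys g \<subseteq> M \<Longrightarrow> keys (f + g) \<subseteq> M"
  using keys_add[of f g] by blast

section \<open>The standard model of quantum affine space\<close>

text \<open>The relation \<open>y x = q x y\<close> reads \<open>x y = q\<^sup>-\<^sup>1 y x\<close>, so \<open>x\<^sup>a\<close> acts on polynomials in the \<open>y\<^sub>i\<close> by the
dilations \<open>y\<^sub>i \<mapsto> q\<^bsup>-a_i\<^esup> y\<^sub>i\<close>. Quantum affine space is therefore the crossed product of the polynomials
in the \<open>y\<^sub>i\<close> with the monoid of exponents of the \<open>x\<^sub>i\<close>.\<close>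

definition qdil :: "'k::field \<Rightarrow> expo \<Rightarrow> 'k mpoly \<Rightarrow> 'k mpoly" where
  "qdil q a = dil (\<lambda>i. inverse q ^ lookup a i)"

lemma qdil_crossed: "crossed (qdil q)"
  by unfold_locales (auto simp: qdil_def dil_hom dil_dil lookup_add power_add)

interpretation D: crossed "qdil q" for q by (rule qdil_crossed)

type_synonym 'k qspace = "expo \<Rightarrow>\<^sub>0 'k mpoly"

definition model :: "'k::field \<Rightarrow> ('k, 'k qspace) module" where
  "model q = \<lparr>carrier = UNIV, monoid.mult = D.tmul q, one = 1, ring.zero = 0, ring.add = (+),
     module.smult = (\<lambda>c f. D.tmul q (single 0 (cst c)) f)\<rparr>"

lemma qdil_cst [simp]: "qdil q a (cst c) = cst c" and qdil_var: "qdil q a (var i) = cst (inverse q ^ lookup a i) * var i"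
  by (simp_all add: qdil_def)

lemmas qdil_simps = D.act_simps

lemma kalgebra_model: "kalgebra (model q)"
proof -
  have "abelian_group (model q)"
    by (rule abelian_groupI) (auto simp: model_def algebra_simps intro: exI[of _ "- _"] ab_left_minus)
  moreover have "Group.monoid (model q)"
    by (rule monoidI) (auto simp: model_def D.tmul_assoc)
  ultimately have "ring (model q)"
    by (rule ringI) (auto simp: model_def D.tmul_add_l D.tmul_add_r)
  then interpret ring "model q" .
  have c: "D.tmul q f (single 0 (cst c)) = D.tmul q (single 0 (cst c)) f" for f c
    by (rule poly_mapping_eqI) (simp add: D.lookup_tmul_scalar D.lookup_tmul_scalar_r mult.commute)
  have cc: "single 0 (cst (c * d)) = D.tmul q (single 0 (cst c)) (single 0 (cst d))" for c d
    by (simp add: D.tmul_single cst_mult)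
  show ?thesis
  proof unfold_locales
    fix f g :: "'a qspace" and c d :: 'a
    show "f \<otimes>\<^bsub>model q\<^esub> (c \<odot>\<^bsub>model q\<^esub> g) = c \<odot>\<^bsub>model q\<^esub> (f \<otimes>\<^bsub>model q\<^esub> g)"
      unfolding model_def by (simp, metis D.tmul_assoc c)
  qed (simp_all add: model_def D.tmul_assoc D.tmul_add_l D.tmul_add_r single_add cst_add cc)
qed

interpretation M: kalgebra "model q" for q by (rule kalgebra_model)

lemma model_simps [simp]: "carrier (model q) = UNIV" "monoid.mult (model q) = D.tmul q" "one (model q) = 1"
  "ring.zero (model q) = 0" "ring.add (model q) = (+)" "c \<odot>\<^bsub>model q\<^esub> f = D.tmul q (single 0 (cst c)) f"
  by (simp_all add: model_def)

text \<open>The types allow variables with arbitrary index; \<open>Nn n\<close>, \<open>Pn n\<close> and \<open>Dn n\<close> are the exponents, the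
polynomials and the elements of the model in which only the first \<open>n\<close> occur.\<close>

definition Nn :: "nat \<Rightarrow> expo set" where "Nn n = {a. keys a \<subseteq> {..<n}}"

lemma Nn_add: "a \<in> Nn n \<Longrightarrow> b \<in> Nn n \<Longrightarrow> a + b \<in> Nn n"
  using keys_add[of a b] by (auto simp: Nn_def)

lemma Nn_0 [simp]: "0 \<in> Nn n" by (simp add: Nn_def)

definition Dn :: "nat \<Rightarrow> 'k::field qspace set" where
  "Dn n = {f. keys f \<subseteq> Nn n \<and> (\<forall>a. lookup f a \<in> Pn n)}"

lemma qdil_Pn: "p \<in> Pn n \<Longrightarrow> qdil q a p \<in> Pn n" by (simp add: qdil_def dil_Pn)

lemma Dn_add: "f \<in> Dn n \<Longrightarrow> g \<in> Dn n \<Longrightarrow> f + g \<in> Dn n"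
  unfolding Dn_def using keys_in_add[of f "Nn n" g] by (auto simp: lookup_add)

lemma Dn_tmul: "f \<in> Dn n \<Longrightarrow> g \<in> Dn n \<Longrightarrow> D.tmul q f g \<in> Dn n"
  using D.tmul_in[of "Nn n" "Pn n" q f g] by (auto simp: Dn_def Nn_add qdil_Pn)

lemma Dn_single: "a \<in> Nn n \<Longrightarrow> p \<in> Pn n \<Longrightarrow> single a p \<in> Dn n"
  by (auto simp: Dn_def lookup_single when_def)

lemma Dn_0 [simp]: "0 \<in> Dn n" by (simp add: Dn_def)

lemma Dn_induct [consumes 1, case_names zero add]:
  assumes "f \<in> Dn n" "P 0" "\<And>a b c g. a \<in> Nn n \<Longrightarrow> b \<in> Nn n \<Longrightarrow> g \<in> Dn n \<Longrightarrow> P g \<Longrightarrow> P (single a (single b c) + g)"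
  shows "P f"
proof -
  have inner: "P (single a p + g)" if a: "a \<in> Nn n" and g: "g \<in> Dn n" "P g" and p: "p \<in> Pn n" for a p g
  proof -
    have "finite B \<Longrightarrow> B \<subseteq> keys p \<Longrightarrow> P (single a (\<Sum>b\<in>B. single b (lookup p b)) + g) \<and> single a (\<Sum>b\<in>B. single b (lookup p b)) + g \<in> Dn n" for B
    proof (induction B rule: finite_induct)
      case (insert b B)
      have b: "b \<in> Nn n" using p insert by (auto simp: Pn_def Nn_def)
      have "single b (lookup p b) \<in> Pn n" using b by (auto simp: Nn_def intro: Pn_single)
      then have "single a (single b (lookup p b)) \<in> Dn n" using a by (intro Dn_single)
      then have "single a (single b (lookup p b)) + (single a (\<Sum>b\<in>B. single b (lookup p b)) + g) \<in> Dn n"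
        by (rule Dn_add) (use insert in simp)
      then show ?case using insert assms(3)[OF a b] by (simp add: single_add add.assoc)
    qed (use g in simp)
    from this[of "keys p"] show ?thesis by (simp add: pm_sum_single[symmetric])
  qed
  have "finite A \<Longrightarrow> A \<subseteq> keys f \<Longrightarrow> P (\<Sum>a\<in>A. single a (lookup f a)) \<and> (\<Sum>a\<in>A. single a (lookup f a)) \<in> Dn n" for A
  proof (induction A rule: finite_induct)
    case (insert a A)
    have "a \<in> Nn n" "lookup f a \<in> Pn n" using assms(1) insert by (auto simp: Dn_def)
    then show ?case using insert inner by (simp add: Dn_add Dn_single)
  qed (use assms in simp)
  from this[of "keys f"] show ?thesis by (simp add: pm_sum_single[symmetric])
qed

definition xgen :: "nat \<Rightarrow> 'k::field qspace" where "xgen i = single (single i 1) 1"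
definition ygen :: "nat \<Rightarrow> 'k::field qspace" where "ygen i = single 0 (var i)"

lemma gen_relation: "q \<noteq> 0 \<Longrightarrow> D.tmul q (ygen i) (xgen i) = D.tmul q (single 0 (cst q)) (D.tmul q (xgen i) (ygen i))"
  by (simp add: xgen_def ygen_def D.tmul_single qdil_var qdil_simps mult.assoc[symmetric] cst_mult[symmetric])

lemma gen_pow: "xgen i [^]\<^bsub>model q\<^esub> k = single (single i k) 1"
  "ygen i [^]\<^bsub>model q\<^esub> k = single 0 (single (single i k) 1)"
  "ygen i [^]\<^bsub>model q\<^esub> b \<otimes>\<^bsub>model q\<^esub> xgen i [^]\<^bsub>model q\<^esub> a = single (single i a) (single (single i b) 1)"
proof -
  show x: "xgen i [^]\<^bsub>model q\<^esub> k = single (single i k) 1" for k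
    by (induction k) (simp_all add: xgen_def D.tmul_single qdil_simps single_add[symmetric])
  show y: "ygen i [^]\<^bsub>model q\<^esub> k = single 0 (single (single i k) 1)" for k
    by (induction k) (simp_all add: ygen_def D.tmul_single qdil_simps var_def mult_single single_add[symmetric])
  show "ygen i [^]\<^bsub>model q\<^esub> b \<otimes>\<^bsub>model q\<^esub> xgen i [^]\<^bsub>model q\<^esub> a = single (single i a) (single (single i b) 1)"
    unfolding x y by (simp add: D.tmul_single qdil_simps)
qed

definition to_expo :: "nat \<Rightarrow> (nat \<Rightarrow> nat) \<Rightarrow> expo" where
  "to_expo n f = (\<Sum>i<n. single i (f i))"

lemma lookup_to_expo: "lookup (to_expo n f) i = (if i < n then f i else 0)"
  by (simp add: to_expo_def lookup_sum lookup_single when_def)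

lemma to_expo_Nn: "to_expo n f \<in> Nn n"
  by (auto simp: Nn_def in_keys_iff lookup_to_expo split: if_splits)

lemma to_expo_lookup: "a \<in> Nn n \<Longrightarrow> to_expo n (lookup a) = a"
  by (rule poly_mapping_eqI) (auto simp: lookup_to_expo Nn_def in_keys_iff)

lemma ordered_monomials:
  "ordered_prod (model q) (\<lambda>i. single (single i (a i)) (single (single i (b i)) 1)) n =
    single (to_expo n a) (single (to_expo n b) 1)"
proof (induction n)
  case (Suc n)
  have "mon (\<lambda>i. inverse q ^ lookup (to_expo n a) i) (single n (b n)) = 1"
    by (simp add: mon_single lookup_to_expo)
  then have e: "qdil q (to_expo n a) (single (single n (b n)) 1) = single (single n (b n)) 1"
    by (simp add: qdil_def dil_single)
  show ?case by (simp add: Suc D.tmul_single e mult_single) (simp add: to_expo_def)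
qed (simp add: to_expo_def)

locale quantum =
  fixes n :: nat and q :: "'k::field"
  assumes q_nonzero: "q \<noteq> 0"
begin

abbreviation Q where "Q \<equiv> quantum_space n q"

sublocale T: tensor_product n "\<lambda>_. quantum_plane q"
  by (rule tensor_product.intro) (rule quantum_plane_kalgebra)

lemma Q_eq: "Q = T.TA" by (simp add: quantum_space_def)

sublocale Q: kalgebra Q unfolding Q_eq by (rule T.kalgebra_TA)

text \<open>The element \<open>y\<^sup>b x\<^sup>a\<close>, as the tensor of the monomials \<open>y\<^sub>i\<^bsup>b_i\<^esup> x\<^sub>i\<^bsup>a_i\<^esup>\<close>.\<close>

definition qmon :: "expo \<Rightarrow> expo \<Rightarrow> 'k quantum_space_elem" where
  "qmon a b = T.pure (\<lambda>i\<in>{..<n}. plane_monom q (lookup b i) (lookup a i))"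

lemma plane_monom_closed [simp]: "plane_monom q b a \<in> carrier (quantum_plane q)"
proof -
  interpret P: kalgebra "quantum_plane q" by (rule quantum_plane_kalgebra)
  show ?thesis by (simp add: plane_monom_def)
qed

lemma qmon_closed [simp]: "qmon a b \<in> carrier Q"
  unfolding qmon_def Q_eq by (rule T.pure_closed) auto

lemma spans_qmon: "spans Q ((\<lambda>(a, b). qmon a b) ` (Nn n \<times> Nn n))"
proof -
  have 1: "spans Q (T.pure ` (\<Pi>\<^sub>E i\<in>{..<n}. range (\<lambda>(b, a). plane_monom q b a)))"
    unfolding Q_eq by (rule T.spans_pure) (rule spans_quantum_plane[OF q_nonzero])
  have 2: "T.pure ` (\<Pi>\<^sub>E i\<in>{..<n}. range (\<lambda>(b, a). plane_monom q b a)) \<subseteq> (\<lambda>(a, b). qmon a b) ` (Nn n \<times> Nn n)"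
  proof
    fix z assume "z \<in> T.pure ` (\<Pi>\<^sub>E i\<in>{..<n}. range (\<lambda>(b, a). plane_monom q b a))"
    then obtain u where u: "z = T.pure u" "u \<in> (\<Pi>\<^sub>E i\<in>{..<n}. range (\<lambda>(b, a). plane_monom q b a))" by auto
    then have "\<forall>i. \<exists>ba. i < n \<longrightarrow> u i = plane_monom q (fst ba) (snd ba)" by (fastforce simp: PiE_iff)
    then obtain f where f: "\<And>i. i < n \<Longrightarrow> u i = plane_monom q (fst (f i)) (snd (f i))" by metis
    have "u = (\<lambda>i\<in>{..<n}. plane_monom q (lookup (to_expo n (\<lambda>i. fst (f i))) i) (lookup (to_expo n (\<lambda>i. snd (f i))) i))"
      by (rule ext) (use u(2) f in \<open>auto simp: lookup_to_expo PiE_iff extensional_def\<close>)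
    then have "z = qmon (to_expo n (\<lambda>i. snd (f i))) (to_expo n (\<lambda>i. fst (f i)))"
      by (simp add: qmon_def u(1))
    then show "z \<in> (\<lambda>(a, b). qmon a b) ` (Nn n \<times> Nn n)" using to_expo_Nn by blast
  qed
  show ?thesis
  proof (rule spans_trans[OF 1])
    show "(\<lambda>(a, b). qmon a b) ` (Nn n \<times> Nn n) \<subseteq> carrier Q" by auto
  qed (use subsetD[OF 2] in \<open>meson subsetD\<close>)
qed

text \<open>Each factor maps to the model because the relation of the quantum plane holds there. Images of
different factors commute; by linearity this has to be checked on the spanning monomials only.\<close>

lemma model_hom_exists:
  "\<exists>\<Psi> \<in> alg_hom Q (model q). \<forall>a\<in>Nn n. \<forall>b\<in>Nn n. \<Psi> (qmon a b) = single a (single b 1)"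
proof -
  interpret P: kalgebra "quantum_plane q" by (rule quantum_plane_kalgebra)
  have "\<exists>\<psi>. \<psi> \<in> alg_hom (quantum_plane q) (model q) \<and> \<psi> (plane_var q GenX) = xgen i \<and> \<psi> (plane_var q GenY) = ygen i" for i
  proof -
    have rel: "ygen i \<otimes>\<^bsub>model q\<^esub> xgen i = q \<odot>\<^bsub>model q\<^esub> (xgen i \<otimes>\<^bsub>model q\<^esub> ygen i)"
      by (simp only: model_simps gen_relation[OF q_nonzero])
    show ?thesis by (rule quantum_plane_hom[OF kalgebra_model _ _ rel]) (simp, simp, intro exI conjI, assumption+)
  qed
  then obtain \<psi> where \<psi>: "\<And>i. \<psi> i \<in> alg_hom (quantum_plane q) (model q)"
    "\<And>i. \<psi> i (plane_var q GenX) = xgen i" "\<And>i. \<psi> i (plane_var q GenY) = ygen i" by metis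
  have pw: "\<psi> i (z [^]\<^bsub>quantum_plane q\<^esub> (k::nat)) = \<psi> i z [^]\<^bsub>model q\<^esub> k" if "z \<in> carrier (quantum_plane q)" for i z k
    by (induction k) (use that alg_homD(3,4)[OF \<psi>(1)[of i]] in auto)
  have mono: "\<psi> i (plane_monom q b a) = single (single i a) (single (single i b) 1)" for i a b
    unfolding plane_monom_def
    by (subst alg_homD(3)[OF \<psi>(1)]) (auto simp: pw \<psi> gen_pow(3)[simplified model_simps] simp del: model_simps, simp add: gen_pow(3)[simplified])
  have commute1: "D.tmul q (single (single i a) (single (single i b) 1)) (single (single j a') (single (single j b') 1)) =
     D.tmul q (single (single j a') (single (single j b') 1)) (single (single i a) (single (single i b) 1))" if "i \<noteq> j" for i j a a' b b'
    using that by (simp add: D.tmul_single qdil_def dil_single mon_single lookup_single when_def mult_single add.commute)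
  have sub: "is_subspace (quantum_plane q) {z \<in> carrier (quantum_plane q). D.tmul q (\<psi> i z) w = D.tmul q w (\<psi> i z)}" for i w
    unfolding is_subspace_def
    using alg_homD[OF \<psi>(1)[of i]] alg_hom_zero[OF \<psi>(1)[of i] quantum_plane_kalgebra kalgebra_model]
      M.smult_mult_l[of "\<psi> i _" q w] M.smult_mult_r[of w q "\<psi> i _"]
    by (auto simp: D.tmul_add_l D.tmul_add_r)
  have c1: "D.tmul q (\<psi> i z) (\<psi> j (plane_monom q b' a')) = D.tmul q (\<psi> j (plane_monom q b' a')) (\<psi> i z)"
    if "i \<noteq> j" "z \<in> carrier (quantum_plane q)" for i j z a' b'
  proof -
    have "range (\<lambda>(b, a). plane_monom q b a) \<subseteq> {z \<in> carrier (quantum_plane q).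
        D.tmul q (\<psi> i z) (\<psi> j (plane_monom q b' a')) = D.tmul q (\<psi> j (plane_monom q b' a')) (\<psi> i z)}"
      using commute1[OF that(1)] by (auto simp: mono)
    from spansD[OF spans_quantum_plane[OF q_nonzero] sub this that(2)] show ?thesis by simp
  qed
  have c2: "D.tmul q (\<psi> i z) (\<psi> j w) = D.tmul q (\<psi> j w) (\<psi> i z)"
    if "i \<noteq> j" "z \<in> carrier (quantum_plane q)" "w \<in> carrier (quantum_plane q)" for i j z w
  proof -
    have "range (\<lambda>(b, a). plane_monom q b a) \<subseteq> {w \<in> carrier (quantum_plane q).
        D.tmul q (\<psi> j w) (\<psi> i z) = D.tmul q (\<psi> i z) (\<psi> j w)}"
      using c1[OF that(1,2)] by auto
    from spansD[OF spans_quantum_plane[OF q_nonzero] sub this that(3)] show ?thesis by simp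
  qed
  have comm: "\<psi> i a \<otimes>\<^bsub>model q\<^esub> \<psi> j b = \<psi> j b \<otimes>\<^bsub>model q\<^esub> \<psi> i a"
    if "i < n" "j < n" "i \<noteq> j" "a \<in> carrier (quantum_plane q)" "b \<in> carrier (quantum_plane q)" for i j a b
    using c2[OF that(3-5)] by simp
  obtain \<Psi> where \<Psi>: "\<Psi> \<in> alg_hom Q (model q)"
    "\<And>u. u \<in> (\<Pi>\<^sub>E j\<in>{..<n}. carrier (quantum_plane q)) \<Longrightarrow> \<Psi> (T.pure u) = ordered_prod (model q) (\<lambda>i. \<psi> i (u i)) n"
    by (rule T.universal[OF kalgebra_model \<psi>(1) comm]) (assumption+, simp add: Q_eq)
  have "\<Psi> (qmon a b) = single a (single b 1)" if "a \<in> Nn n" "b \<in> Nn n" for a b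
  proof -
    have "\<Psi> (qmon a b) = ordered_prod (model q) (\<lambda>i. single (single i (lookup a i)) (single (single i (lookup b i)) 1)) n"
      unfolding qmon_def by (subst \<Psi>(2)) (auto simp: mono intro!: ordered_prod_cong)
    also have "\<dots> = single a (single b 1)" using that by (simp add: ordered_monomials to_expo_lookup)
    finally show ?thesis .
  qed
  with \<Psi>(1) show ?thesis by blast
qed

definition \<Psi> :: "'k quantum_space_elem \<Rightarrow> 'k qspace" where
  "\<Psi> = (SOME \<Psi>. \<Psi> \<in> alg_hom Q (model q) \<and> (\<forall>a\<in>Nn n. \<forall>b\<in>Nn n. \<Psi> (qmon a b) = single a (single b 1)))"

lemma \<Psi>_hom: "\<Psi> \<in> alg_hom Q (model q)"
  and \<Psi>_qmon: "a \<in> Nn n \<Longrightarrow> b \<in> Nn n \<Longrightarrow> \<Psi> (qmon a b) = single a (single b 1)"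
proof -
  have "\<exists>\<Psi>. \<Psi> \<in> alg_hom Q (model q) \<and> (\<forall>a\<in>Nn n. \<forall>b\<in>Nn n. \<Psi> (qmon a b) = single a (single b 1))"
    using model_hom_exists by blast
  from someI_ex[OF this] show "\<Psi> \<in> alg_hom Q (model q)" "a \<in> Nn n \<Longrightarrow> b \<in> Nn n \<Longrightarrow> \<Psi> (qmon a b) = single a (single b 1)"
    unfolding \<Psi>_def by auto
qed

lemmas \<Psi>_simps = alg_homD[OF \<Psi>_hom, simplified]

lemma \<Psi>_zero: "\<Psi> \<zero>\<^bsub>Q\<^esub> = 0"
  using alg_hom_zero[OF \<Psi>_hom Q.kalgebra_axioms kalgebra_model] by simp

lemma \<Psi>_in_Dn: "z \<in> carrier Q \<Longrightarrow> \<Psi> z \<in> Dn n"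
proof -
  have "is_subspace Q {z \<in> carrier Q. \<Psi> z \<in> Dn n}"
    unfolding is_subspace_def
    by (auto simp: \<Psi>_simps \<Psi>_zero Dn_add intro!: Dn_tmul Dn_single)
  moreover have "(\<lambda>(a, b). qmon a b) ` (Nn n \<times> Nn n) \<subseteq> {z \<in> carrier Q. \<Psi> z \<in> Dn n}"
    by (auto simp: \<Psi>_qmon intro!: Dn_single Pn_single) (auto simp: Nn_def)
  moreover assume "z \<in> carrier Q"
  ultimately show ?thesis using spansD[OF spans_qmon] by blast
qed

lemma \<Psi>_surj: "f \<in> Dn n \<Longrightarrow> f \<in> \<Psi> ` carrier Q"
proof (induction f rule: Dn_induct)
  case zero
  show ?case using \<Psi>_zero by (metis Q.zero_closed image_eqI)
next
  case (add a b c g)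
  then obtain z where z: "z \<in> carrier Q" "g = \<Psi> z" by auto
  have "\<Psi> (c \<odot>\<^bsub>Q\<^esub> qmon a b \<oplus>\<^bsub>Q\<^esub> z) = single a (single b c) + g"
    using z add by (simp add: \<Psi>_simps \<Psi>_qmon D.tmul_single cst_def mult_single)
  then show ?case using z by (metis Q.add.m_closed Q.smult_closed image_eqI qmon_closed)
qed

text \<open>The monomials span the algebra and go to a basis of the model, so the linear map \<open>\<Theta>\<close> back that sends
this basis to the monomials is a left inverse. This is the basis theorem for quantum affine space.\<close>

lemma \<Psi>_inj: "inj_on \<Psi> (carrier Q)"
proof -
  define co where "co f = (\<lambda>(a, b). lookup (lookup f a) b)" for f :: "'k qspace"
  define \<Theta> where "\<Theta> f = linear_extension Q (\<lambda>(a, b). qmon a b) (co f)" for f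
  have fin: "finite {x. co f x \<noteq> 0}" for f
  proof (rule finite_subset)
    show "{x. co f x \<noteq> 0} \<subseteq> (SIGMA a:keys f. keys (lookup f a))"
      by (auto simp: co_def in_keys_iff)
  qed auto
  have add: "\<Theta> (f + g) = \<Theta> f \<oplus>\<^bsub>Q\<^esub> \<Theta> g" for f g
  proof -
    have "co (f + g) = (\<lambda>x. co f x + co g x)" by (auto simp: co_def lookup_add)
    then show ?thesis unfolding \<Theta>_def using Q.linear_extension_add[OF fin fin] by auto
  qed
  have sm: "\<Theta> (D.tmul q (single 0 (cst c)) f) = c \<odot>\<^bsub>Q\<^esub> \<Theta> f" for c f
  proof -
    have "co (D.tmul q (single 0 (cst c)) f) = (\<lambda>x. c * co f x)" by (auto simp: co_def D.lookup_tmul_scalar)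
    then show ?thesis unfolding \<Theta>_def using Q.linear_extension_smult[OF fin] by auto
  qed
  have ze: "\<Theta> 0 = \<zero>\<^bsub>Q\<^esub>"
    using Q.linear_extension_zero by (simp add: \<Theta>_def co_def split_def)
  have mo: "\<Theta> (single a (single b 1)) = qmon a b" for a b
  proof -
    have "co (single a (single b 1)) = monom_elem (a, b)" by (auto simp: co_def monom_elem_def lookup_single when_def)
    then show ?thesis unfolding \<Theta>_def by simp
  qed
  have "is_subspace Q {z \<in> carrier Q. \<Theta> (\<Psi> z) = z}"
    unfolding is_subspace_def by (auto simp: \<Psi>_simps \<Psi>_zero add sm ze)
  moreover have "(\<lambda>(a, b). qmon a b) ` (Nn n \<times> Nn n) \<subseteq> {z \<in> carrier Q. \<Theta> (\<Psi> z) = z}"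
    by (auto simp: \<Psi>_qmon mo)
  ultimately have "\<Theta> (\<Psi> z) = z" if "z \<in> carrier Q" for z using spansD[OF spans_qmon _ _ that] by blast
  then show ?thesis by (metis inj_onI)
qed

lemma \<Psi>_bij: "bij_betw \<Psi> (carrier Q) (Dn n)"
  using \<Psi>_inj \<Psi>_in_Dn \<Psi>_surj by (auto simp: bij_betw_def)

lemma quantum_var_eq:
  assumes "i < n"
  shows "quantum_var n q GenX i = qmon (single i 1) 0" "quantum_var n q GenY i = qmon 0 (single i 1)"
proof -
  interpret P: kalgebra "quantum_plane q" by (rule quantum_plane_kalgebra)
  show "quantum_var n q GenX i = qmon (single i 1) 0" "quantum_var n q GenY i = qmon 0 (single i 1)"
    unfolding quantum_var_def qmon_def
    by (auto intro!: arg_cong[where f = T.pure] simp: fun_eq_iff lookup_single when_def plane_monom_def)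
qed

lemma \<Psi>_quantum_var:
  assumes "i < n"
  shows "\<Psi> (quantum_var n q GenX i) = xgen i" "\<Psi> (quantum_var n q GenY i) = ygen i"
    "quantum_var n q z i \<in> carrier Q"
proof -
  have "single i 1 \<in> Nn n" using assms by (auto simp: Nn_def)
  then show "\<Psi> (quantum_var n q GenX i) = xgen i" "\<Psi> (quantum_var n q GenY i) = ygen i"
    using assms by (simp_all add: quantum_var_eq \<Psi>_qmon xgen_def ygen_def var_def)
  show "quantum_var n q z i \<in> carrier Q" using assms by (cases z) (simp_all add: quantum_var_eq)
qed

text \<open>
  The variables generate the algebra: a monomial is recognised as a product of variables after
  applying the injective map \<open>\<Psi>\<close>. This gives the uniqueness of the automorphisms that define the
  group action.
\<close>

lemma alg_hom_eqI:
  assumes "\<phi> \<in> alg_hom Q Q" "\<phi>' \<in> alg_hom Q Q"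
    and "\<And>i z. i < n \<Longrightarrow> \<phi> (quantum_var n q z i) = \<phi>' (quantum_var n q z i)" and "a \<in> carrier Q"
  shows "\<phi> a = \<phi>' a"
proof -
  let ?E = "{z \<in> carrier Q. \<phi> z = \<phi>' z}"
  let ?X = "quantum_var n q GenX" and ?Y = "quantum_var n q GenY"
  have mult: "x \<in> ?E \<Longrightarrow> y \<in> ?E \<Longrightarrow> x \<otimes>\<^bsub>Q\<^esub> y \<in> ?E" for x y
    using alg_homD(3)[OF assms(1)] alg_homD(3)[OF assms(2)] by simp
  have one: "\<one>\<^bsub>Q\<^esub> \<in> ?E" using alg_homD(4)[OF assms(1)] alg_homD(4)[OF assms(2)] by simp
  have pow: "x \<in> ?E \<Longrightarrow> x [^]\<^bsub>Q\<^esub> (k::nat) \<in> ?E" for x k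
    by (induction k) (use one mult in auto)
  have op: "(\<And>i. i < j \<Longrightarrow> f i \<in> ?E) \<Longrightarrow> ordered_prod Q f j \<in> ?E" for f j
    by (induction j) (use one mult in auto)
  have "qmon a b \<in> ?E" if ab: "a \<in> Nn n" "b \<in> Nn n" for a b
  proof -
    let ?f = "\<lambda>i. ?Y i [^]\<^bsub>Q\<^esub> lookup b i \<otimes>\<^bsub>Q\<^esub> ?X i [^]\<^bsub>Q\<^esub> lookup a i"
    have vars: "i < n \<Longrightarrow> quantum_var n q z i \<in> ?E" for i z using assms(3) \<Psi>_quantum_var(3) by simp
    have fE: "i < n \<Longrightarrow> ?f i \<in> ?E" for i by (intro mult pow vars)
    then have inE: "ordered_prod Q ?f n \<in> ?E" by (rule op)
    have pw: "\<Psi> (x [^]\<^bsub>Q\<^esub> (k::nat)) = \<Psi> x [^]\<^bsub>model q\<^esub> k" if "x \<in> carrier Q" for x k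
      by (induction k) (use that in \<open>simp_all add: \<Psi>_simps\<close>)
    have "\<Psi> (ordered_prod Q ?f j) = ordered_prod (model q) (\<lambda>i. \<Psi> (?f i)) j" if "j \<le> n" for j
      using that
    proof (induction j)
      case (Suc j)
      then have "ordered_prod Q ?f j \<in> carrier Q" "?f j \<in> carrier Q" using fE op[of j ?f] by auto
      then show ?case using Suc by (simp add: \<Psi>_simps)
    qed (simp add: \<Psi>_simps)
    then have "\<Psi> (ordered_prod Q ?f n) = ordered_prod (model q) (\<lambda>i. \<Psi> (?f i)) n" by simp
    also have "\<dots> = ordered_prod (model q) (\<lambda>i. single (single i (lookup a i)) (single (single i (lookup b i)) 1)) n"
      by (rule ordered_prod_cong) (simp add: \<Psi>_simps pw \<Psi>_quantum_var gen_pow(3)[simplified])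
    also have "\<dots> = \<Psi> (qmon a b)" using ab by (simp add: ordered_monomials to_expo_lookup \<Psi>_qmon)
    finally have "ordered_prod Q ?f n = qmon a b" using inE by (intro inj_onD[OF \<Psi>_inj]) auto
    with inE show ?thesis by simp
  qed
  moreover have "is_subspace Q ?E"
    unfolding is_subspace_def using alg_homD[OF assms(1)] alg_homD[OF assms(2)]
      alg_hom_zero[OF assms(1) Q.kalgebra_axioms Q.kalgebra_axioms] alg_hom_zero[OF assms(2) Q.kalgebra_axioms Q.kalgebra_axioms] by auto
  ultimately have "a \<in> ?E" by (intro spansD[OF spans_qmon _ _ assms(4)]) auto
  then show ?thesis by simp
qed

end

section \<open>The group action\<close>

text \<open>The automorphism \<open>x\<^sub>i \<mapsto> g\<^sub>i x\<^bsub>\<pi>(i)\<^esub>\<close>, \<open>y\<^sub>i \<mapsto> y\<^bsub>\<pi>(i)\<^esub>\<close> on the model: \<open>g\<close> scales the monomial \<open>x\<^sup>a\<close> by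
\<open>g\<^sup>a\<close>, and \<open>\<pi>\<close> moves the exponents and the variables of the coefficients.\<close>

definition act :: "(nat \<Rightarrow> 'k::field) \<Rightarrow> (nat \<Rightarrow> nat) \<Rightarrow> 'k qspace \<Rightarrow> 'k qspace" where
  "act g \<pi> = pm_lift (\<lambda>a p. single (pexp \<pi> a) (cst (mon g a) * perm \<pi> p))"

lemma act_0 [simp]: "act g \<pi> 0 = 0" by (simp add: act_def)

lemma act_single: "act g \<pi> (single a p) = single (pexp \<pi> a) (cst (mon g a) * perm \<pi> p)"
  unfolding act_def by (rule pm_lift_single) (simp add: perm_simps)

lemma act_add: "act g \<pi> (f + f') = act g \<pi> f + act g \<pi> f'"
  unfolding act_def by (rule pm_lift_add) (simp_all add: perm_simps distrib_left single_add)

lemma pexp_inv: "bij \<pi> \<Longrightarrow> pexp (inv_into UNIV \<pi>) (pexp \<pi> a) = a" "bij \<pi> \<Longrightarrow> pexp \<pi> (pexp (inv_into UNIV \<pi>) a) = a"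
  by (auto intro!: poly_mapping_eqI simp: lookup_pexp bij_imp_bij_inv inv_inv_eq bij_is_inj bij_is_surj surj_f_inv_f)

lemma pexp_eq_iff: "bij \<pi> \<Longrightarrow> pexp \<pi> a = pexp \<pi> b \<longleftrightarrow> a = b"
  by (metis pexp_inv(1))

lemma lookup_act:
  assumes "bij \<pi>"
  shows "lookup (act g \<pi> f) (pexp \<pi> a) = cst (mon g a) * perm \<pi> (lookup f a)"
proof (induction f rule: pm_add_induct)
  case (add b c p)
  then show ?case using assms
    by (auto simp: act_add act_single lookup_add perm_simps distrib_left lookup_single when_def pexp_eq_iff)
qed (simp add: perm_simps)

lemma perm_qdil: "bij \<pi> \<Longrightarrow> perm \<pi> (qdil q a p) = qdil q (pexp \<pi> a) (perm \<pi> p)"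
  by (simp add: qdil_def perm_dil lookup_pexp)

lemma act_tmul:
  assumes "bij \<pi>"
  shows "act g \<pi> (D.tmul q f f') = D.tmul q (act g \<pi> f) (act g \<pi> f')"
proof (induction f rule: pm_add_induct)
  case (add a c f)
  have "act g \<pi> (D.tmul q (single a c) f') = D.tmul q (act g \<pi> (single a c)) (act g \<pi> f')"
    by (induction f' rule: pm_add_induct)
      (simp_all add: D.tmul_add_r act_add D.tmul_single act_single pexp_add assms perm_simps perm_qdil
        mon_add cst_mult qdil_simps algebra_simps)
  with add show ?case by (simp add: D.tmul_add_l act_add)
qed simp

lemma act_scalar: "bij \<pi> \<Longrightarrow> act g \<pi> (single 0 (cst c)) = single 0 (cst c)"
  by (simp add: act_single)

lemma permutes_lt: "\<pi> permutes {..<n} \<Longrightarrow> i < n \<Longrightarrow> \<pi> i < n"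
  using permutes_in_image[of \<pi> "{..<n}" i] by simp

lemma pexp_Nn: "\<pi> permutes {..<n} \<Longrightarrow> a \<in> Nn n \<Longrightarrow> pexp \<pi> a \<in> Nn n"
  by (auto simp: Nn_def keys_pexp[OF permutes_bij] permutes_lt)

lemma act_Dn: assumes "\<pi> permutes {..<n}" "f \<in> Dn n" shows "act g \<pi> f \<in> Dn n"
  using assms(2)
proof (induction f rule: Dn_induct)
  case (add a b c f)
  note add = add assms(1)
  have "single b c \<in> Pn n" using add(2) by (intro Pn_single) (auto simp: Nn_def)
  then show ?case unfolding act_add act_single using add
    by (intro Dn_add Dn_single pexp_Nn Pn_mult perm_Pn) (auto intro: permutes_lt)
qed simp

lemma act_inverse:
  fixes f :: "'k::field qspace"
  assumes "\<pi> permutes {..<n}" "\<And>i. i < n \<Longrightarrow> g i \<noteq> 0" "f \<in> Dn n"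
  shows "act (\<lambda>i. inverse (g (inv_into UNIV \<pi> i))) (inv_into UNIV \<pi>) (act g \<pi> f) = f"
  using assms(3)
proof (induction f rule: Dn_induct)
  case (add a b c f)
  have b: "bij \<pi>" by (rule permutes_bij[OF assms(1)])
  have "mon (\<lambda>i. inverse (g (inv_into UNIV \<pi> i))) (pexp \<pi> a) * mon g a = mon (\<lambda>i. inverse (g i) * g i) a"
    by (simp add: mon_pexp[OF b] mon_mult_base inv_f_f[OF bij_is_inj[OF b]])
  also have "\<dots> = mon (\<lambda>i. 1) a" by (rule mon_cong) (use assms(2) add(1) in \<open>auto simp: Nn_def\<close>)
  finally have e: "cst (mon (\<lambda>i. inverse (g (inv_into UNIV \<pi> i))) (pexp \<pi> a)) * (cst (mon g a) * p) = p" for p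
    by (simp add: mult.assoc[symmetric] cst_mult[symmetric])
  have "perm (inv_into UNIV \<pi>) (perm \<pi> p) = p" for p :: "'k mpoly"
    by (simp add: perm_perm bij_is_inj[OF b])
  then show ?case using add by (simp add: act_add act_single perm_simps pexp_inv b e)
qed simp

lemma act_bij:
  assumes \<pi>: "\<pi> permutes {..<n}" and g: "\<And>i. i < n \<Longrightarrow> g i \<noteq> 0"
  shows "bij_betw (act g \<pi>) (Dn n) (Dn n)"
proof (rule bij_betw_byWitness[where f' = "act (\<lambda>i. inverse (g (inv_into UNIV \<pi> i))) (inv_into UNIV \<pi>)"])
  note \<pi>' = permutes_inv[OF \<pi>]
  show "\<forall>f\<in>Dn n. act (\<lambda>i. inverse (g (inv_into UNIV \<pi> i))) (inv_into UNIV \<pi>) (act g \<pi> f) = f"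
    using act_inverse[OF \<pi>, of g] g by blast
  have "inverse (g (inv_into UNIV \<pi> i)) \<noteq> 0" if "i < n" for i using g permutes_lt[OF \<pi>' that] by simp
  then have "act (\<lambda>i. inverse (inverse (g (inv_into UNIV \<pi> (inv_into UNIV (inv_into UNIV \<pi>) i))))) (inv_into UNIV (inv_into UNIV \<pi>))
      (act (\<lambda>i. inverse (g (inv_into UNIV \<pi> i))) (inv_into UNIV \<pi>) f) = f" if "f \<in> Dn n" for f
    using act_inverse[OF \<pi>', of "\<lambda>i. inverse (g (inv_into UNIV \<pi> i))"] that by blast
  then show "\<forall>f\<in>Dn n. act g \<pi> (act (\<lambda>i. inverse (g (inv_into UNIV \<pi> i))) (inv_into UNIV \<pi>) f) = f"
    using permutes_bij[OF \<pi>] by (simp add: inv_inv_eq inv_f_f[OF bij_is_inj])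
  show "act g \<pi> ` Dn n \<subseteq> Dn n" "act (\<lambda>i. inverse (g (inv_into UNIV \<pi> i))) (inv_into UNIV \<pi>) ` Dn n \<subseteq> Dn n"
    using act_Dn[OF \<pi>] act_Dn[OF \<pi>'] by auto
qed

context quantum begin

text \<open>Transport of \<open>act g \<pi>\<close> along \<open>\<Psi>\<close> is an automorphism with the prescribed values, and there is only one
such automorphism, so the definite description in \<open>group_action\<close> picks it.\<close>

lemma group_action_model:
  assumes \<pi>: "\<pi> permutes {..<n}" and g: "\<And>i. i < n \<Longrightarrow> g i \<noteq> 0" and z: "z \<in> carrier Q"
  shows "group_action n q (g, \<pi>) z \<in> carrier Q" "\<Psi> (group_action n q (g, \<pi>) z) = act g \<pi> (\<Psi> z)"
proof -
  note bij = permutes_bij[OF \<pi>]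
  define inv\<Psi> where "inv\<Psi> = the_inv_into (carrier Q) \<Psi>"
  have i: "f \<in> Dn n \<Longrightarrow> inv\<Psi> f \<in> carrier Q" "f \<in> Dn n \<Longrightarrow> \<Psi> (inv\<Psi> f) = f" for f
    using \<Psi>_bij the_inv_into_into[OF \<Psi>_inj] f_the_inv_into_f[OF \<Psi>_inj] by (auto simp: inv\<Psi>_def bij_betw_def)
  have bij_inv: "bij_betw inv\<Psi> (Dn n) (carrier Q)" unfolding inv\<Psi>_def by (rule bij_betw_the_inv_into[OF \<Psi>_bij])
  define \<phi> where "\<phi> = (\<lambda>z\<in>carrier Q. inv\<Psi> (act g \<pi> (\<Psi> z)))"
  have \<phi>: "\<phi> z \<in> carrier Q" "\<Psi> (\<phi> z) = act g \<pi> (\<Psi> z)" if "z \<in> carrier Q" for z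
    using i[OF act_Dn[OF \<pi> \<Psi>_in_Dn[OF that]]] that by (auto simp: \<phi>_def)
  have eqI: "x = y" if "x \<in> carrier Q" "y \<in> carrier Q" "\<Psi> x = \<Psi> y" for x y
    using inj_onD[OF \<Psi>_inj that(3,1,2)] .
  have hom: "\<phi> \<in> ring_hom Q Q"
    by (rule ring_hom_memI; (rule eqI)?) (simp_all add: \<phi> \<Psi>_simps act_add act_tmul[OF bij] act_scalar[OF bij, of g 1, simplified])
  have sm: "\<phi> (c \<odot>\<^bsub>Q\<^esub> a) = c \<odot>\<^bsub>Q\<^esub> \<phi> a" if "a \<in> carrier Q" for c a
    by (rule eqI) (simp_all add: that \<phi> \<Psi>_simps act_tmul[OF bij] act_scalar[OF bij])
  have "bij_betw (\<lambda>z. inv\<Psi> (act g \<pi> (\<Psi> z))) (carrier Q) (carrier Q)"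
    using bij_betw_trans[OF bij_betw_trans[OF \<Psi>_bij act_bij[OF \<pi> g]] bij_inv] by (simp add: o_def)
  then have "\<phi> \<in> Bij (carrier Q)"
    unfolding Bij_def \<phi>_def by (auto cong: bij_betw_cong)
  with hom sm have aut: "\<phi> \<in> algebra_automorphisms Q" by (auto simp: algebra_automorphisms_def)
  have Nnsingle: "i < n \<Longrightarrow> single i 1 \<in> Nn n" for i by (auto simp: Nn_def)
  have vals: "\<phi> (quantum_var n q GenX i) = g i \<odot>\<^bsub>Q\<^esub> quantum_var n q GenX (\<pi> i)"
    "\<phi> (quantum_var n q GenY i) = quantum_var n q GenY (\<pi> i)" if "i < n" for i
    by (rule eqI; simp add: that \<phi> \<Psi>_quantum_var permutes_lt[OF \<pi>] \<Psi>_simps xgen_def ygen_def act_single pexp_single[OF bij] bij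
      D.tmul_single mon_single perm_simps)+
  have "group_action n q (g, \<pi>) = \<phi>"
    unfolding group_action_def prod.case
  proof (rule the_equality)
    show "\<phi> \<in> algebra_automorphisms Q \<and> (\<forall>i<n. \<phi> (quantum_var n q GenX i) = g i \<odot>\<^bsub>Q\<^esub> quantum_var n q GenX (\<pi> i) \<and>
      \<phi> (quantum_var n q GenY i) = quantum_var n q GenY (\<pi> i))"
      using aut vals by blast
    fix \<phi>' assume \<phi>': "\<phi>' \<in> algebra_automorphisms Q \<and> (\<forall>i<n. \<phi>' (quantum_var n q GenX i) = g i \<odot>\<^bsub>Q\<^esub> quantum_var n q GenX (\<pi> i) \<and>
      \<phi>' (quantum_var n q GenY i) = quantum_var n q GenY (\<pi> i))"
    have h: "\<phi>' \<in> alg_hom Q Q" "\<phi> \<in> alg_hom Q Q" "\<phi>' \<in> extensional (carrier Q)" "\<phi> \<in> extensional (carrier Q)"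
      using \<phi>' aut by (auto simp: algebra_automorphisms_def alg_hom_def Bij_def)
    have "\<phi>' a = \<phi> a" if "a \<in> carrier Q" for a
    proof (rule alg_hom_eqI[OF h(1,2) _ that])
      fix i z assume "i < n" then show "\<phi>' (quantum_var n q z i) = \<phi> (quantum_var n q z i)"
        using \<phi>' vals by (cases z) auto
    qed
    with h(3,4) show "\<phi>' = \<phi>" by (rule extensionalityI)
  qed
  then show "group_action n q (g, \<pi>) z \<in> carrier Q" "\<Psi> (group_action n q (g, \<pi>) z) = act g \<pi> (\<Psi> z)"
    using \<phi> z by auto
qed

end

section \<open>Invariants\<close>

lemma carrier_carrier_update: "carrier (R\<lparr>carrier := S\<rparr>) = S" by simp

text \<open>Both families of groups have the form \<open>T \<times> W\<close> as sets: \<open>W\<close> permutes the indices and is trivial for the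
product of cyclic groups, and \<open>T\<close> scales the \<open>x\<^sub>i\<close>.\<close>

locale index_group =
  fixes n :: nat and W :: "(nat \<Rightarrow> nat) set"
  assumes W_cases: "W = {id} \<or> W = {\<pi>. \<pi> permutes {..<n}}"
begin

lemma W_permutes: "\<pi> \<in> W \<Longrightarrow> \<pi> permutes {..<n}" using W_cases by (auto simp: permutes_id)
lemma W_bij: "\<pi> \<in> W \<Longrightarrow> bij \<pi>" using W_permutes permutes_bij by blast
lemma W_id: "id \<in> W" using W_cases by (auto simp: permutes_id)
lemma W_comp: "\<pi> \<in> W \<Longrightarrow> \<rho> \<in> W \<Longrightarrow> \<pi> \<circ> \<rho> \<in> W" using W_cases by (auto simp: permutes_compose)
lemma W_inv: "\<pi> \<in> W \<Longrightarrow> inv_into UNIV \<pi> \<in> W" using W_cases by (auto simp: permutes_inv)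
lemma W_finite: "finite W" using W_cases finite_permutations[of "{..<n}"] by auto
lemma W_lt: "\<pi> \<in> W \<Longrightarrow> i < n \<Longrightarrow> \<pi> i < n" using W_permutes permutes_lt by blast

lemma W_comp_bij: "\<pi> \<in> W \<Longrightarrow> bij_betw (\<lambda>\<rho>. \<pi> \<circ> \<rho>) W W"
proof (rule bij_betw_byWitness[where f' = "\<lambda>\<rho>. inv_into UNIV \<pi> \<circ> \<rho>"])
  assume \<pi>: "\<pi> \<in> W"
  show "\<forall>\<rho>\<in>W. inv_into UNIV \<pi> \<circ> (\<pi> \<circ> \<rho>) = \<rho>" "\<forall>\<rho>\<in>W. \<pi> \<circ> (inv_into UNIV \<pi> \<circ> \<rho>) = \<rho>"
    using W_bij[OF \<pi>] by (auto simp: fun_eq_iff inv_f_f[OF bij_is_inj] surj_f_inv_f[OF bij_is_surj])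
qed (auto intro: W_comp W_inv)

definition \<Gamma> :: "'k::field mpoly set" where
  "\<Gamma> = {p \<in> Pn n. \<forall>\<pi>\<in>W. perm \<pi> p = p}"

lemma \<Gamma>_Pn: "p \<in> \<Gamma> \<Longrightarrow> p \<in> Pn n" by (simp add: \<Gamma>_def)

lemma \<Gamma>_closed:
  "p \<in> \<Gamma> \<Longrightarrow> p' \<in> \<Gamma> \<Longrightarrow> p + p' \<in> \<Gamma>" "p \<in> \<Gamma> \<Longrightarrow> p' \<in> \<Gamma> \<Longrightarrow> p * p' \<in> \<Gamma>"
  "cst c \<in> \<Gamma>" "0 \<in> \<Gamma>" "1 \<in> \<Gamma>" "p \<in> \<Gamma> \<Longrightarrow> - p \<in> \<Gamma>"
  by (auto simp: \<Gamma>_def perm_simps)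

lemma \<Gamma>_sum: "(\<And>i. i \<in> I \<Longrightarrow> f i \<in> \<Gamma>) \<Longrightarrow> sum f I \<in> \<Gamma>"
  by (induction I rule: infinite_finite_induct) (auto intro: \<Gamma>_closed)

text \<open>
  For trivial \<open>W\<close> this is obvious, with the variables as generators and \<open>1\<close> as basis; for the full
  symmetric group it is the theory of symmetric polynomials.
\<close>

lemma \<Gamma>_structure:
  "\<exists>t :: nat \<Rightarrow> 'k::{alg_closed_field, field_char_0} mpoly.
    \<Gamma> = alg_gen (t ` {..<n}) \<and> (\<forall>p\<in>Pn n. subst_vars t p = 0 \<longrightarrow> p = 0)"
  "\<exists>(C :: (nat \<Rightarrow> nat) set) (e :: (nat \<Rightarrow> nat) \<Rightarrow> 'k mpoly). finite C \<and> e ` C \<subseteq> Pn n \<and>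
    (\<forall>p\<in>Pn n. \<exists>g. (\<forall>c\<in>C. g c \<in> \<Gamma>) \<and> p = (\<Sum>c\<in>C. g c * e c)) \<and>
    (\<forall>g. (\<forall>c\<in>C. g c \<in> \<Gamma>) \<and> (\<Sum>c\<in>C. g c * e c) = 0 \<longrightarrow> (\<forall>c\<in>C. g c = 0))"
proof -
  have 1: "(\<exists>t :: nat \<Rightarrow> 'k mpoly. \<Gamma> = alg_gen (t ` {..<n}) \<and> (\<forall>p\<in>Pn n. subst_vars t p = 0 \<longrightarrow> p = 0)) \<and>
    (\<exists>(C :: (nat \<Rightarrow> nat) set) (e :: (nat \<Rightarrow> nat) \<Rightarrow> 'k mpoly). finite C \<and> e ` C \<subseteq> Pn n \<and>
    (\<forall>p\<in>Pn n. \<exists>g. (\<forall>c\<in>C. g c \<in> \<Gamma>) \<and> p = (\<Sum>c\<in>C. g c * e c)) \<and>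
    (\<forall>g. (\<forall>c\<in>C. g c \<in> \<Gamma>) \<and> (\<Sum>c\<in>C. g c * e c) = 0 \<longrightarrow> (\<forall>c\<in>C. g c = 0)))"
    using W_cases
  proof
    assume W: "W = {id}"
    have G: "\<Gamma> = (Pn n :: 'k mpoly set)" unfolding \<Gamma>_def by (auto simp: W)
    show ?thesis
    proof (intro conjI)
      show "\<exists>t :: nat \<Rightarrow> 'k mpoly. \<Gamma> = alg_gen (t ` {..<n}) \<and> (\<forall>p\<in>Pn n. subst_vars t p = 0 \<longrightarrow> p = 0)"
        by (rule exI[of _ var]) (simp add: G Pn_eq_alg_gen)
      show "\<exists>(C :: (nat \<Rightarrow> nat) set) (e :: (nat \<Rightarrow> nat) \<Rightarrow> 'k mpoly). finite C \<and> e ` C \<subseteq> Pn n \<and>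
        (\<forall>p\<in>Pn n. \<exists>g. (\<forall>c\<in>C. g c \<in> \<Gamma>) \<and> p = (\<Sum>c\<in>C. g c * e c)) \<and>
        (\<forall>g. (\<forall>c\<in>C. g c \<in> \<Gamma>) \<and> (\<Sum>c\<in>C. g c * e c) = 0 \<longrightarrow> (\<forall>c\<in>C. g c = 0))"
        by (rule exI[of _ "{\<lambda>_. 0}"], rule exI[of _ "\<lambda>_. 1"]) (auto simp: G)
    qed
  next
    assume W: "W = {\<pi>. \<pi> permutes {..<n}}"
    have G: "\<Gamma> = (tower n n :: 'k mpoly set)" unfolding \<Gamma>_def by (auto simp: W symm_eq_tower[symmetric] symm_def)
    show ?thesis
    proof (intro conjI)
      show "\<exists>t :: nat \<Rightarrow> 'k mpoly. \<Gamma> = alg_gen (t ` {..<n}) \<and> (\<forall>p\<in>Pn n. subst_vars t p = 0 \<longrightarrow> p = 0)"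
        by (rule exI[of _ "coeff (root_poly n)"]) (auto simp: G tower_n elementary_independent)
      have sp: "\<exists>g. (\<forall>c\<in>stairs n. g c \<in> tower n n) \<and> p = (\<Sum>c\<in>stairs n. g c * stair_mon n c)" if "p \<in> Pn n" for p :: "'k mpoly"
        using stairs_basis[OF that] by metis
      have ind: "\<forall>c\<in>stairs n. g c = 0" if "\<forall>c\<in>stairs n. g c \<in> tower n n" "(\<Sum>c\<in>stairs n. g c * stair_mon n c) = 0" for g :: "_ \<Rightarrow> 'k mpoly"
        by (rule stairs_independent[OF le_refl]) (use that tower_n_symm in blast)+
      have st: "stair_mon n ` stairs n \<subseteq> (Pn n :: 'k mpoly set)"
        unfolding stair_mon_def by (auto intro!: Pn_prod Pn_power Pn_var)
      show "\<exists>(C :: (nat \<Rightarrow> nat) set) (e :: (nat \<Rightarrow> nat) \<Rightarrow> 'k mpoly). finite C \<and> e ` C \<subseteq> Pn n \<and>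
        (\<forall>p\<in>Pn n. \<exists>g. (\<forall>c\<in>C. g c \<in> \<Gamma>) \<and> p = (\<Sum>c\<in>C. g c * e c)) \<and>
        (\<forall>g. (\<forall>c\<in>C. g c \<in> \<Gamma>) \<and> (\<Sum>c\<in>C. g c * e c) = 0 \<longrightarrow> (\<forall>c\<in>C. g c = 0))"
        unfolding G by (rule exI[of _ "stairs n"], rule exI[of _ "stair_mon n"]) (use sp ind st in auto)
    qed
  qed
  show "\<exists>t :: nat \<Rightarrow> 'k mpoly. \<Gamma> = alg_gen (t ` {..<n}) \<and> (\<forall>p\<in>Pn n. subst_vars t p = 0 \<longrightarrow> p = 0)"
    by (rule conjunct1[OF 1])
  show "\<exists>(C :: (nat \<Rightarrow> nat) set) (e :: (nat \<Rightarrow> nat) \<Rightarrow> 'k mpoly). finite C \<and> e ` C \<subseteq> Pn n \<and>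
    (\<forall>p\<in>Pn n. \<exists>g. (\<forall>c\<in>C. g c \<in> \<Gamma>) \<and> p = (\<Sum>c\<in>C. g c * e c)) \<and>
    (\<forall>g. (\<forall>c\<in>C. g c \<in> \<Gamma>) \<and> (\<Sum>c\<in>C. g c * e c) = 0 \<longrightarrow> (\<forall>c\<in>C. g c = 0))"
    by (rule conjunct2[OF 1])
qed

text \<open>The product of the conjugates of \<open>b\<close> is invariant. This yields denominators in \<open>\<Gamma>\<close>.\<close>

lemma norm_multiple:
  assumes b: "b \<in> Pn n" "(b :: 'k::field mpoly) \<noteq> 0"
  obtains b' where "b' \<in> Pn n" "b * b' \<in> \<Gamma>" "b * b' \<noteq> 0"
proof -
  define b' where "b' = (\<Prod>\<pi>\<in>W - {id}. perm \<pi> b)"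
  have bb: "b * b' = (\<Prod>\<pi>\<in>W. perm \<pi> b)"
    unfolding b'_def by (subst prod.remove[OF W_finite W_id]) simp
  have pP: "\<pi> \<in> W \<Longrightarrow> perm \<pi> b \<in> Pn n" for \<pi> by (rule perm_Pn[OF b(1)]) (rule W_lt)
  have "b' \<in> Pn n" unfolding b'_def by (rule Pn_prod) (simp add: pP)
  moreover have "b * b' \<in> \<Gamma>"
    unfolding \<Gamma>_def
  proof (intro CollectI conjI ballI)
    show "b * b' \<in> Pn n" using b calculation by auto
    fix \<pi> assume \<pi>: "\<pi> \<in> W"
    have "perm \<pi> (b * b') = (\<Prod>\<rho>\<in>W. perm (\<pi> \<circ> \<rho>) b)"
      unfolding bb is_hom_prod[OF perm_hom] perm_perm ..
    also have "\<dots> = b * b'" unfolding bb using prod.reindex_bij_betw[OF W_comp_bij[OF \<pi>], of "\<lambda>\<rho>. perm \<rho> b"] .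
    finally show "perm \<pi> (b * b') = b * b'" .
  qed
  moreover have "perm \<pi> b \<noteq> 0" if "\<pi> \<in> W" for \<pi>
  proof
    assume "perm \<pi> b = 0"
    then have "perm (inv_into UNIV \<pi>) (perm \<pi> b) = 0" by (simp add: perm_simps)
    then show False using b(2) W_bij[OF that] by (simp add: perm_perm bij_is_inj)
  qed
  then have "b * b' \<noteq> 0" unfolding bb using W_finite by simp
  ultimately show ?thesis using that by blast
qed

end

text \<open>The scaling part \<open>T\<close> consists of tuples of \<open>m\<close>-th roots of unity; stability under \<open>W\<close> makes the
exponents fixed by \<open>T\<close> stable under permutations.\<close>

locale invariants = quantum n q + index_group n W
  for n and q :: "'k::{alg_closed_field, field_char_0}" and W +
  fixes m :: nat and T :: "(nat \<Rightarrow> 'k) set"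
  assumes m_pos: "m \<ge> 1" and q_generic: "\<And>j. j \<ge> 1 \<Longrightarrow> q ^ j \<noteq> 1"
    and T_sub: "T \<subseteq> cyclic_power m n" and T_one: "(\<lambda>i\<in>{..<n}. 1) \<in> T"
    and T_perm: "\<And>g \<pi>. g \<in> T \<Longrightarrow> \<pi> \<in> W \<Longrightarrow> (\<lambda>i\<in>{..<n}. g (\<pi> i)) \<in> T"
begin

lemma T_root: "g \<in> T \<Longrightarrow> i < n \<Longrightarrow> g i ^ m = 1"
  using T_sub by (auto simp: cyclic_power_def PiE_iff)

lemma T_nonzero: "g \<in> T \<Longrightarrow> i < n \<Longrightarrow> g i \<noteq> 0"
  using T_root[of g i] m_pos by (auto simp: power_0_left split: if_splits)

text \<open>The exponents \<open>a\<close> for which \<open>x\<^sup>a\<close> is fixed by \<open>T\<close>. They form a submonoid that is stable under \<open>W\<close> and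
contains all multiples of \<open>m\<close>.\<close>

definition MM :: "expo set" where "MM = {a \<in> Nn n. \<forall>g\<in>T. mon g a = 1}"

lemma MM_Nn: "a \<in> MM \<Longrightarrow> a \<in> Nn n" by (simp add: MM_def)
lemma MM_0 [simp]: "0 \<in> MM" by (simp add: MM_def)
lemma MM_add: "a \<in> MM \<Longrightarrow> b \<in> MM \<Longrightarrow> a + b \<in> MM" by (simp add: MM_def Nn_add mon_add)

lemma MM_pexp: assumes "\<pi> \<in> W" "a \<in> MM" shows "pexp \<pi> a \<in> MM"
proof -
  have "mon g (pexp \<pi> a) = 1" if g: "g \<in> T" for g
  proof -
    have "mon g (pexp \<pi> a) = mon (\<lambda>i\<in>{..<n}. g (\<pi> i)) a"
      unfolding mon_pexp[OF W_bij[OF assms(1)]] using assms(2) by (intro mon_cong) (auto simp: MM_def Nn_def)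
    then show ?thesis using T_perm[OF g assms(1)] assms(2) by (simp add: MM_def)
  qed
  then show ?thesis using assms pexp_Nn[OF W_permutes] by (simp add: MM_def)
qed

lemma MM_pexp_iff: "\<pi> \<in> W \<Longrightarrow> pexp \<pi> a \<in> MM \<longleftrightarrow> a \<in> MM"
  using MM_pexp[of \<pi> a] MM_pexp[OF W_inv, of \<pi> "pexp \<pi> a"] by (auto simp: pexp_inv W_bij)

text \<open>\<open>DM\<close> consists of the invariants of \<open>T\<close>, and \<open>UU\<close> of the invariants of \<open>T \<times> W\<close>.\<close>

definition DM :: "'k qspace set" where "DM = {f. keys f \<subseteq> MM \<and> (\<forall>a. lookup f a \<in> Pn n)}"

definition UU :: "'k qspace set" where
  "UU = {f \<in> DM. \<forall>\<pi>\<in>W. \<forall>a. lookup f (pexp \<pi> a) = perm \<pi> (lookup f a)}"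

lemma DM_Dn: "f \<in> DM \<Longrightarrow> f \<in> Dn n" using MM_Nn by (auto simp: DM_def Dn_def)

lemma UU_DM: "f \<in> UU \<Longrightarrow> f \<in> DM" by (simp add: UU_def)

text \<open>Comparing coefficients at \<open>x\<^sup>a\<close>, invariance under \<open>(g, id)\<close> means \<open>g\<^sup>a = 1\<close> whenever \<open>x\<^sup>a\<close> occurs, and
invariance under \<open>(1, \<pi>)\<close> is the equivariance in the definition of \<open>UU\<close>.\<close>

lemma invariant_iff_UU:
  assumes "f \<in> Dn n"
  shows "(\<forall>h\<in>T \<times> W. act (fst h) (snd h) f = f) \<longleftrightarrow> f \<in> UU"
proof
  assume h: "\<forall>h\<in>T \<times> W. act (fst h) (snd h) f = f"
  have "keys f \<subseteq> MM"
  proof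
    fix a assume a: "a \<in> keys f"
    have "mon g a = 1" if "g \<in> T" for g
    proof -
      have "act g id f = f" using h that W_id by auto
      then have "cst (mon g a) * lookup f a = lookup f a"
        using lookup_act[of id g f a] by simp
      then have "(cst (mon g a) - 1) * lookup f a = 0" by (simp add: left_diff_distrib)
      then have "cst (mon g a) = (cst 1 :: 'k mpoly)" using a by (simp add: in_keys_iff)
      then show ?thesis by (simp only: cst_eq_iff)
    qed
    then show "a \<in> MM" using a assms by (auto simp: MM_def Dn_def)
  qed
  moreover have "lookup f (pexp \<pi> a) = perm \<pi> (lookup f a)" if \<pi>: "\<pi> \<in> W" for \<pi> a
  proof -
    have "act (\<lambda>i\<in>{..<n}. 1) \<pi> f = f" using h T_one \<pi> by auto
    then have e: "lookup f (pexp \<pi> a) = cst (mon (\<lambda>i\<in>{..<n}. 1) a) * perm \<pi> (lookup f a)"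
      using lookup_act[OF W_bij[OF \<pi>], of "\<lambda>i\<in>{..<n}. 1" f a] by simp
    show ?thesis
    proof (cases "a \<in> keys f")
      case True
      then have "mon (\<lambda>i\<in>{..<n}. 1 :: 'k) a = mon (\<lambda>i. 1) a"
        using assms by (intro mon_cong) (auto simp: Dn_def Nn_def)
      then show ?thesis using e by simp
    next
      case False
      then show ?thesis using e by (simp add: in_keys_iff perm_simps)
    qed
  qed
  ultimately show "f \<in> UU" using assms by (auto simp: UU_def DM_def Dn_def)
next
  assume f: "f \<in> UU"
  show "\<forall>h\<in>T \<times> W. act (fst h) (snd h) f = f"
  proof (clarify, simp)
    fix g \<pi> assume g: "g \<in> T" and \<pi>: "\<pi> \<in> W"
    show "act g \<pi> f = f"
    proof (rule poly_mapping_eqI)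
      fix a' :: expo
      define a where "a = pexp (inv_into UNIV \<pi>) a'"
      have a': "a' = pexp \<pi> a" using W_bij[OF \<pi>] by (simp add: a_def pexp_inv)
      have "cst (mon g a) * perm \<pi> (lookup f a) = perm \<pi> (lookup f a)"
      proof (cases "a \<in> keys f")
        case True
        then have "a \<in> MM" using f by (auto simp: UU_def DM_def)
        then show ?thesis using g by (simp add: MM_def)
      qed (simp add: in_keys_iff perm_simps)
      then show "lookup (act g \<pi> f) a' = lookup f a'"
        unfolding a' lookup_act[OF W_bij[OF \<pi>]] using f \<pi> by (simp add: UU_def)
    qed
  qed
qed

abbreviation AG where "AG \<equiv> invariant_algebra n q (T \<times> W)"

lemma carrier_AG: "carrier AG = {z \<in> carrier Q. \<Psi> z \<in> UU}"
proof -
  have *: "group_action n q h z = z \<longleftrightarrow> act (fst h) (snd h) (\<Psi> z) = \<Psi> z" if h: "h \<in> T \<times> W" and z: "z \<in> carrier Q" for h z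
  proof -
    obtain g \<pi> where gp: "h = (g, \<pi>)" "g \<in> T" "\<pi> \<in> W" using h by auto
    note ga = group_action_model[OF W_permutes[OF gp(3)] _ z, of g, OF T_nonzero[OF gp(2)]]
    show ?thesis using ga inj_onD[OF \<Psi>_inj, of "group_action n q h z" z] z by (auto simp: gp(1))
  qed
  have inv: "(\<forall>h\<in>T \<times> W. group_action n q h z = z) \<longleftrightarrow> \<Psi> z \<in> UU" if z: "z \<in> carrier Q" for z
  proof -
    have "(\<forall>h\<in>T \<times> W. group_action n q h z = z) \<longleftrightarrow> (\<forall>h\<in>T \<times> W. act (fst h) (snd h) (\<Psi> z) = \<Psi> z)"
      by (intro ball_cong refl *[OF _ z])
    also have "\<dots> \<longleftrightarrow> \<Psi> z \<in> UU" by (rule invariant_iff_UU[OF \<Psi>_in_Dn[OF z]])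
    finally show ?thesis .
  qed
  have "carrier AG = {a \<in> carrier Q. \<forall>h\<in>T \<times> W. group_action n q h a = a}"
    unfolding invariant_algebra_def carrier_carrier_update ..
  also have "\<dots> = {z \<in> carrier Q. \<Psi> z \<in> UU}"
    by (intro Collect_cong conj_cong refl inv)
  finally show ?thesis .
qed

lemma AG_ops [simp]: "monoid.mult AG = monoid.mult Q" "one AG = one Q" "ring.zero AG = ring.zero Q"
  "ring.add AG = ring.add Q" "module.smult AG = module.smult Q"
  by (simp_all add: invariant_algebra_def)

lemma \<Psi>_AG_bij: "bij_betw \<Psi> (carrier AG) UU"
proof -
  have "UU \<subseteq> \<Psi> ` carrier Q" using DM_Dn UU_DM \<Psi>_surj by blast
  then show ?thesis unfolding bij_betw_def carrier_AG
    using inj_on_subset[OF \<Psi>_inj, of "{z \<in> carrier Q. \<Psi> z \<in> UU}"] by auto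
qed

lemma DM_add: "f \<in> DM \<Longrightarrow> g \<in> DM \<Longrightarrow> f + g \<in> DM"
  unfolding DM_def using keys_in_add[of f MM g] by (auto simp: lookup_add)

lemma DM_tmul: "f \<in> DM \<Longrightarrow> g \<in> DM \<Longrightarrow> D.tmul q f g \<in> DM"
  using D.tmul_in[of MM "Pn n" q f g] by (auto simp: DM_def MM_add qdil_Pn)

lemma DM_single: "a \<in> MM \<Longrightarrow> p \<in> Pn n \<Longrightarrow> single a p \<in> DM"
  by (auto simp: DM_def lookup_single when_def)

lemma UU_iff_act: "f \<in> UU \<longleftrightarrow> f \<in> DM \<and> (\<forall>\<pi>\<in>W. act (\<lambda>i. 1) \<pi> f = f)"
proof -
  have "(\<forall>a. lookup f (pexp \<pi> a) = perm \<pi> (lookup f a)) \<longleftrightarrow> act (\<lambda>i. 1) \<pi> f = f" if \<pi>: "\<pi> \<in> W" for \<pi>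
  proof
    assume *: "\<forall>a. lookup f (pexp \<pi> a) = perm \<pi> (lookup f a)"
    show "act (\<lambda>i. 1) \<pi> f = f"
    proof (rule poly_mapping_eqI)
      fix a
      show "lookup (act (\<lambda>i. 1) \<pi> f) a = lookup f a"
        using lookup_act[OF W_bij[OF \<pi>], of "\<lambda>i. 1" f "pexp (inv_into UNIV \<pi>) a"]
          *[rule_format, of "pexp (inv_into UNIV \<pi>) a"]
        by (simp add: pexp_inv W_bij[OF \<pi>])
    qed
  next
    assume *: "act (\<lambda>i. 1) \<pi> f = f"
    show "\<forall>a. lookup f (pexp \<pi> a) = perm \<pi> (lookup f a)"
      using lookup_act[OF W_bij[OF \<pi>], of "\<lambda>i. 1" f] by (simp add: *)
  qed
  then show ?thesis by (auto simp: UU_def)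
qed

lemma UU_closed:
  "f \<in> UU \<Longrightarrow> g \<in> UU \<Longrightarrow> f + g \<in> UU" "f \<in> UU \<Longrightarrow> g \<in> UU \<Longrightarrow> D.tmul q f g \<in> UU"
  "p \<in> \<Gamma> \<Longrightarrow> single 0 p \<in> UU" "0 \<in> UU" "1 \<in> UU"
proof -
  show "f \<in> UU \<Longrightarrow> g \<in> UU \<Longrightarrow> f + g \<in> UU" "f \<in> UU \<Longrightarrow> g \<in> UU \<Longrightarrow> D.tmul q f g \<in> UU"
    by (auto simp: UU_iff_act DM_add DM_tmul act_add act_tmul W_bij)
  show *: "p \<in> \<Gamma> \<Longrightarrow> single 0 p \<in> UU" for p
    by (auto simp: UU_iff_act \<Gamma>_def act_single W_bij intro!: DM_single)
  show "0 \<in> UU" "1 \<in> UU" using *[OF \<Gamma>_closed(4)] *[OF \<Gamma>_closed(5)] by simp_all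
qed

end

section \<open>Fields of rational functions\<close>

definition toF :: "'r::idom \<Rightarrow> 'r fract" where "toF p = Fract p 1"

lemma toF_hom: "is_hom toF" by (simp add: is_hom_def toF_def One_fract_def)
lemmas toF_simps = is_homD[OF toF_hom]
lemma toF_eq_iff [simp]: "toF a = toF b \<longleftrightarrow> a = b" by (simp add: toF_def eq_fract)
lemma toF_eq_0 [simp]: "toF a = 0 \<longleftrightarrow> a = 0" using toF_eq_iff[of a 0] by (simp del: toF_eq_iff add: toF_simps)
lemma fract_eq: "Fract a b = toF a / toF b" by (simp add: toF_def)

lemma field_hom_div:
  fixes f :: "'a::field \<Rightarrow> 'b::field"
  assumes "is_hom f" shows "f (x / y) = f x / f y" "f (inverse y) = inverse (f y)" "f x = 0 \<longleftrightarrow> x = 0"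
proof -
  have 1: "f y * f (inverse y) = 1" if "y \<noteq> 0" for y using is_homD(1,3)[OF assms] that by (metis right_inverse)
  then show "f x = 0 \<longleftrightarrow> x = 0" using is_homD(4)[OF assms] by (metis mult_zero_left zero_neq_one)
  show i: "f (inverse y) = inverse (f y)"
  proof (cases "y = 0")
    case False then show ?thesis using 1[OF False] by (metis inverse_unique)
  qed (simp add: is_homD[OF assms])
  then show "f (x / y) = f x / f y" by (simp add: divide_inverse is_homD[OF assms])
qed

text \<open>The extension of an injective endomorphism of a domain to its fraction field.\<close>

definition frac_map :: "('r::idom \<Rightarrow> 'r) \<Rightarrow> 'r fract \<Rightarrow> 'r fract" where
  "frac_map h x = (let ab = SOME ab. snd ab \<noteq> 0 \<and> x = Fract (fst ab) (snd ab) in toF (h (fst ab)) / toF (h (snd ab)))"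

locale inj_hom =
  fixes h :: "'r::idom \<Rightarrow> 'r"
  assumes hom: "is_hom h" and inj: "h p = 0 \<Longrightarrow> p = 0"
begin

lemma frac_map_Fract: assumes "b \<noteq> 0" shows "frac_map h (Fract a b) = toF (h a) / toF (h b)"
proof -
  let ?P = "\<lambda>ab. snd ab \<noteq> 0 \<and> Fract a b = Fract (fst ab) (snd ab)"
  have "?P (a, b)" using assms by simp
  then have P: "?P (SOME ab. ?P ab)" by (rule someI)
  define ab where "ab = (SOME ab. ?P ab)"
  have nz: "snd ab \<noteq> 0" and "a * snd ab = fst ab * b" using P assms by (auto simp: ab_def eq_fract)
  then have "h a * h (snd ab) = h (fst ab) * h b" by (metis hom is_homD(3))
  moreover have "h b \<noteq> 0" "h (snd ab) \<noteq> 0" using inj nz assms by auto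
  ultimately have "toF (h (fst ab)) / toF (h (snd ab)) = toF (h a) / toF (h b)"
    by (simp add: frac_eq_eq toF_simps[symmetric])
  then show ?thesis by (simp add: frac_map_def Let_def ab_def[symmetric])
qed

lemma frac_map_toF [simp]: "frac_map h (toF a) = toF (h a)"
  using frac_map_Fract[of 1 a] by (simp add: toF_def[symmetric] is_homD[OF hom] toF_simps)

lemma frac_map_hom: "is_hom (frac_map h)"
  unfolding is_hom_def
proof (intro conjI allI)
  show "frac_map h 1 = 1" using frac_map_toF[of 1] by (simp add: is_homD[OF hom] toF_simps)
  fix x y :: "'r fract"
  obtain a b where x: "x = Fract a b" "b \<noteq> 0" by (cases x)
  obtain c d where y: "y = Fract c d" "d \<noteq> 0" by (cases y)
  have nz: "h b \<noteq> 0" "h d \<noteq> 0" using x y inj by auto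
  have m: "x * y = Fract (a * c) (b * d)" by (simp add: x y)
  show "frac_map h (x * y) = frac_map h x * frac_map h y"
    unfolding m using x y by (simp add: frac_map_Fract is_homD[OF hom] toF_simps)
  have s: "x + y = Fract (a * d + c * b) (b * d)" by (simp add: x y)
  show "frac_map h (x + y) = frac_map h x + frac_map h y"
    unfolding s using x y nz by (simp add: frac_map_Fract is_homD[OF hom] toF_simps add_frac_eq)
qed

end

lemma fract_hom_ext:
  fixes f g :: "'r::idom fract \<Rightarrow> 'c::field"
  assumes "is_hom f" "is_hom g" "\<And>a. f (toF a) = g (toF a)"
  shows "f x = g x"
proof (cases x)
  case (Fract a b) then show ?thesis by (simp add: fract_eq field_hom_div[OF assms(1)] field_hom_div[OF assms(2)] assms(3))
qed

text \<open>The rational functions in the first \<open>n\<close> variables, a subfield of the type of all rational functions.\<close>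

definition Ln :: "nat \<Rightarrow> 'k::field mpoly fract set" where
  "Ln n = {toF a / toF b | a b. a \<in> Pn n \<and> b \<in> Pn n \<and> b \<noteq> 0}"

lemma LnI: "a \<in> Pn n \<Longrightarrow> b \<in> Pn n \<Longrightarrow> b \<noteq> 0 \<Longrightarrow> toF a / toF b \<in> Ln n" by (auto simp: Ln_def)
lemma LnE: "x \<in> Ln n \<Longrightarrow> (\<And>a b. a \<in> Pn n \<Longrightarrow> b \<in> Pn n \<Longrightarrow> b \<noteq> 0 \<Longrightarrow> x = toF a / toF b \<Longrightarrow> P) \<Longrightarrow> P"
  by (auto simp: Ln_def)
lemma Ln_toF [simp]: "a \<in> Pn n \<Longrightarrow> toF a \<in> Ln n" using LnI[of a n 1] by (simp add: toF_simps)
lemma Ln_0 [simp]: "0 \<in> Ln n" and Ln_1 [simp]: "1 \<in> Ln n"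
  using Ln_toF[OF Pn_0, of n] Ln_toF[OF Pn_1, of n] by (simp_all add: toF_simps)

lemma Ln_mult: assumes "x \<in> Ln n" "y \<in> Ln n" shows "x * y \<in> Ln n"
proof -
  obtain a b c d where *: "x = toF a / toF b" "y = toF c / toF d" "a \<in> Pn n" "b \<in> Pn n" "c \<in> Pn n" "d \<in> Pn n" "b \<noteq> 0" "d \<noteq> 0"
    using assms by (auto elim!: LnE)
  have "x * y = toF (a * c) / toF (b * d)" by (simp add: * toF_simps)
  also have "\<dots> \<in> Ln n" using * by (intro LnI) auto
  finally show ?thesis .
qed

lemma Ln_add: assumes "x \<in> Ln n" "y \<in> Ln n" shows "x + y \<in> Ln n"
proof -
  obtain a b c d where *: "x = toF a / toF b" "y = toF c / toF d" "a \<in> Pn n" "b \<in> Pn n" "c \<in> Pn n" "d \<in> Pn n" "b \<noteq> 0" "d \<noteq> 0"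
    using assms by (auto elim!: LnE)
  have "x + y = toF (a * d + c * b) / toF (b * d)" using * by (simp add: toF_simps add_frac_eq)
  also have "\<dots> \<in> Ln n" using * by (intro LnI) auto
  finally show ?thesis .
qed

lemma Ln_inverse: assumes "x \<in> Ln n" shows "inverse x \<in> Ln n"
proof -
  obtain a b where *: "x = toF a / toF b" "a \<in> Pn n" "b \<in> Pn n" "b \<noteq> 0" using assms by (auto elim!: LnE)
  show ?thesis
  proof (cases "a = 0")
    case False
    have "inverse x = toF b / toF a" by (simp add: *)
    also have "\<dots> \<in> Ln n" using * False by (intro LnI)
    finally show ?thesis .
  qed (use * in \<open>simp add: toF_simps\<close>)
qed

lemma Ln_uminus: "x \<in> Ln n \<Longrightarrow> - x \<in> Ln n"
  using Ln_mult[OF Ln_toF[OF Pn_uminus[OF Pn_1]], of x n] by (simp add: toF_simps)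

definition Lring :: "nat \<Rightarrow> 'k::field mpoly fract ring" where
  "Lring n = \<lparr>carrier = Ln n, monoid.mult = (*), one = 1, ring.zero = 0, ring.add = (+)\<rparr>"

lemma Lring_simps [simp]: "carrier (Lring n) = Ln n" "monoid.mult (Lring n) = (*)" "one (Lring n) = 1"
  "ring.zero (Lring n) = 0" "ring.add (Lring n) = (+)"
  by (simp_all add: Lring_def)

lemma field_Lring: "field (Lring n)"
proof -
  have "abelian_group (Lring n)"
    by (rule abelian_groupI) (auto simp: algebra_simps intro: Ln_add bexI[OF _ Ln_uminus])
  moreover have "comm_monoid (Lring n)"
    by (rule comm_monoidI) (auto simp: algebra_simps intro: Ln_mult)
  ultimately have "cring (Lring n)" by (rule cringI) (auto simp: algebra_simps)
  then show ?thesis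
    by (rule cring.cring_fieldI2) (use Ln_inverse right_inverse in \<open>auto intro!: bexI\<close>)
qed

interpretation L: cring "Lring n" for n by (rule fieldE(1)[OF field_Lring])

lemma inv_Lring: "x \<in> Ln n \<Longrightarrow> x \<noteq> 0 \<Longrightarrow> inv\<^bsub>Lring n\<^esub> x = inverse x"
  by (rule L.comm_inv_char) (auto intro: Ln_inverse)

lemma a_inv_Lring: "x \<in> Ln n \<Longrightarrow> \<ominus>\<^bsub>Lring n\<^esub> x = - x"
  using L.minus_equality[of n "- x" x] Ln_uminus by auto

lemma finsum_Lring: "(\<And>i. i \<in> I \<Longrightarrow> f i \<in> Ln n) \<Longrightarrow> finsum (Lring n) f I = sum f I"
proof (induction I rule: infinite_finite_induct)
  case (insert x I)
  then show ?case by (subst L.finsum_insert) (auto simp: Pi_iff)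
qed (simp_all add: L.finsum_infinite)

section \<open>The Galois extension\<close>

lemma perm_inj_hom: "bij \<pi> \<Longrightarrow> inj_hom (perm \<pi>)"
proof
  fix p :: "'a mpoly" assume b: "bij \<pi>" and "perm \<pi> p = 0"
  then have "perm (inv_into UNIV \<pi>) (perm \<pi> p) = 0" by (simp add: perm_simps)
  then show "p = 0" by (simp add: perm_perm bij_is_inj[OF b])
qed (rule perm_hom)

lemma qdil_inj_hom: "q \<noteq> 0 \<Longrightarrow> inj_hom (qdil q a)"
proof
  fix p :: "'a mpoly" assume b: "q \<noteq> 0" and "qdil q a p = 0"
  then have "dil (\<lambda>i. q ^ lookup a i) (qdil q a p) = 0" by (simp add: dil_simps)
  moreover have "dil (\<lambda>i. q ^ lookup a i) (qdil q a p) = p"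
    unfolding qdil_def by (rule dil_inverse) (simp add: b power_mult_distrib[symmetric])
  ultimately show "p = 0" by simp
qed (rule D.act_hom)

definition Fperm :: "(nat \<Rightarrow> nat) \<Rightarrow> 'k::field mpoly fract \<Rightarrow> 'k mpoly fract" where "Fperm \<pi> = frac_map (perm \<pi>)"
definition Fsig :: "'k::field \<Rightarrow> expo \<Rightarrow> 'k mpoly fract \<Rightarrow> 'k mpoly fract" where "Fsig q a = frac_map (qdil q a)"

lemma Fperm_hom: "bij \<pi> \<Longrightarrow> is_hom (Fperm \<pi>)" unfolding Fperm_def by (rule inj_hom.frac_map_hom[OF perm_inj_hom])
lemma Fperm_toF: "bij \<pi> \<Longrightarrow> Fperm \<pi> (toF p) = toF (perm \<pi> p)" unfolding Fperm_def by (rule inj_hom.frac_map_toF[OF perm_inj_hom])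
lemma Fsig_hom: "q \<noteq> 0 \<Longrightarrow> is_hom (Fsig q a)" unfolding Fsig_def by (rule inj_hom.frac_map_hom[OF qdil_inj_hom])
lemma Fsig_toF: "q \<noteq> 0 \<Longrightarrow> Fsig q a (toF p) = toF (qdil q a p)" unfolding Fsig_def by (rule inj_hom.frac_map_toF[OF qdil_inj_hom])

lemma Fperm_Fperm: assumes "bij \<pi>" "bij \<rho>" shows "Fperm \<pi> (Fperm \<rho> x) = Fperm (\<pi> \<circ> \<rho>) x"
  by (rule fract_hom_ext[OF is_hom_comp[OF Fperm_hom[OF assms(1)] Fperm_hom[OF assms(2)]] Fperm_hom[OF bij_comp[OF assms(2,1)]]])
    (simp only: Fperm_toF assms bij_comp perm_perm)

lemma Fperm_id: "Fperm id x = x"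
  by (rule fract_hom_ext[OF Fperm_hom[OF bij_id] is_hom_id]) (simp only: Fperm_toF bij_id perm_id)

lemma Fperm_inv: assumes "bij \<pi>"
  shows "Fperm \<pi> (Fperm (inv_into UNIV \<pi>) x) = x" "Fperm (inv_into UNIV \<pi>) (Fperm \<pi> x) = x"
proof -
  have 1: "\<pi> \<circ> inv_into UNIV \<pi> = id" "inv_into UNIV \<pi> \<circ> \<pi> = id"
    using bij_is_surj[OF assms] bij_is_inj[OF assms] by (simp_all add: surj_iff[symmetric])
  show "Fperm \<pi> (Fperm (inv_into UNIV \<pi>) x) = x" "Fperm (inv_into UNIV \<pi>) (Fperm \<pi> x) = x"
    by (simp_all only: Fperm_Fperm assms bij_imp_bij_inv 1 Fperm_id)
qed

lemma Fsig_add: "q \<noteq> 0 \<Longrightarrow> Fsig q (a + b) x = Fsig q a (Fsig q b x)"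
  by (rule fract_hom_ext[where x = x]) (simp_all add: is_hom_comp Fsig_hom Fsig_toF D.act_add)

lemma Fsig_0: "q \<noteq> 0 \<Longrightarrow> Fsig q 0 x = x"
  by (rule fract_hom_ext[where x = x]) (simp_all add: is_hom_id Fsig_hom Fsig_toF)

lemma Fperm_Fsig: "q \<noteq> 0 \<Longrightarrow> bij \<pi> \<Longrightarrow> Fperm \<pi> (Fsig q a x) = Fsig q (pexp \<pi> a) (Fperm \<pi> x)"
  by (rule fract_hom_ext[where x = x]) (simp_all add: is_hom_comp Fsig_hom Fperm_hom Fsig_toF Fperm_toF perm_qdil)

lemma hom_Ln:
  assumes "is_hom f" "\<And>a. a \<in> Pn n \<Longrightarrow> f (toF a) \<in> toF ` Pn n" "x \<in> Ln n"
  shows "f x \<in> Ln n"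
proof -
  obtain a b where *: "x = toF a / toF b" "a \<in> Pn n" "b \<in> Pn n" "b \<noteq> 0" using assms(3) by (auto elim!: LnE)
  have "f x = f (toF a) * inverse (f (toF b))" by (simp only: *(1) field_hom_div(1)[OF assms(1)]) (simp only: divide_inverse)
  also have "\<dots> \<in> Ln n" using assms(2)[OF *(2)] assms(2)[OF *(3)] by (intro Ln_mult Ln_inverse) auto
  finally show ?thesis .
qed

lemma Fsig_Ln: "q \<noteq> 0 \<Longrightarrow> x \<in> Ln n \<Longrightarrow> Fsig q a x \<in> Ln n"
  by (rule hom_Ln[OF Fsig_hom]) (auto simp: Fsig_toF qdil_Pn)

lemma Fperm_Ln: assumes "\<pi> permutes {..<n}" "x \<in> Ln n" shows "Fperm \<pi> x \<in> Ln n"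
proof (rule hom_Ln[OF Fperm_hom[OF permutes_bij[OF assms(1)]] _ assms(2)])
  fix a :: "'a mpoly" assume "a \<in> Pn n"
  then have "perm \<pi> a \<in> Pn n" by (rule perm_Pn) (rule permutes_lt[OF assms(1)])
  then show "Fperm \<pi> (toF a) \<in> toF ` Pn n" by (simp add: Fperm_toF[OF permutes_bij[OF assms(1)]])
qed

lemma Fsig_inverse:
  assumes q: "q \<noteq> 0"
  shows "frac_map (dil (\<lambda>i. q ^ lookup a i)) (Fsig q a x) = x" "Fsig q a (frac_map (dil (\<lambda>i. q ^ lookup a i)) x) = x"
    "x \<in> Ln n \<Longrightarrow> frac_map (dil (\<lambda>i. q ^ lookup a i)) x \<in> Ln n"
    "is_hom (frac_map (dil (\<lambda>i. q ^ lookup a i)))" "frac_map (dil (\<lambda>i. q ^ lookup a i)) (toF p) = toF (dil (\<lambda>i. q ^ lookup a i) p)"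
proof -
  have e: "dil (\<lambda>i. q ^ lookup a i) = qdil (inverse q) a" by (simp add: qdil_def)
  have "inverse q \<noteq> 0" using q by simp
  note h = inj_hom.frac_map_hom[OF qdil_inj_hom[OF this]] inj_hom.frac_map_toF[OF qdil_inj_hom[OF this]]
  have i: "qdil (inverse q) a (qdil q a p) = p" "qdil q a (qdil (inverse q) a p) = p" for p
    using q by (simp_all add: qdil_def dil_dil power_mult_distrib[symmetric])
  show hm: "is_hom (frac_map (dil (\<lambda>i. q ^ lookup a i)))" "frac_map (dil (\<lambda>i. q ^ lookup a i)) (toF p) = toF (dil (\<lambda>i. q ^ lookup a i) p)" for p
    unfolding e using h by auto
  show "frac_map (dil (\<lambda>i. q ^ lookup a i)) (Fsig q a x) = x"
    by (rule fract_hom_ext[where x = x]) (simp_all add: is_hom_comp is_hom_id hm Fsig_hom q Fsig_toF, simp add: e i)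
  show "Fsig q a (frac_map (dil (\<lambda>i. q ^ lookup a i)) x) = x"
    by (rule fract_hom_ext[where x = x]) (simp_all add: is_hom_comp is_hom_id hm Fsig_hom q Fsig_toF, simp add: e i)
  show "x \<in> Ln n \<Longrightarrow> frac_map (dil (\<lambda>i. q ^ lookup a i)) x \<in> Ln n"
    by (rule hom_Ln[OF hm(1)]) (auto simp: hm dil_Pn)
qed

context invariants begin

abbreviation L :: "'k mpoly fract ring" where "L \<equiv> Lring n"
abbreviation K :: "'k mpoly fract set" where "K \<equiv> fraction_subfield L (toF ` \<Gamma>)"

lemma \<Gamma>_Ln: "x \<in> toF ` \<Gamma> \<Longrightarrow> x \<in> Ln n" by (auto simp: \<Gamma>_Pn)

lemma K_eq: "K = {toF a / toF b | a b. a \<in> \<Gamma> \<and> b \<in> \<Gamma> \<and> b \<noteq> 0}"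
proof -
  have e: "toF a \<otimes>\<^bsub>L\<^esub> inv\<^bsub>L\<^esub> toF b = toF a / toF b" if "b \<in> \<Gamma>" "b \<noteq> 0" for a b
    using that by (simp add: divide_inverse inv_Lring \<Gamma>_Pn)
  show ?thesis
  proof (intro equalityI subsetI)
    fix x assume "x \<in> K"
    then obtain a b where ab: "a \<in> \<Gamma>" "b \<in> \<Gamma>" "toF b \<noteq> 0" "x = toF a \<otimes>\<^bsub>L\<^esub> inv\<^bsub>L\<^esub> toF b"
      unfolding fraction_subfield_def by auto
    then have "b \<noteq> 0" by simp
    then show "x \<in> {toF a / toF b | a b. a \<in> \<Gamma> \<and> b \<in> \<Gamma> \<and> b \<noteq> 0}" using ab e by blast
  next
    fix x :: "'k mpoly fract" assume "x \<in> {toF a / toF b | a b. a \<in> \<Gamma> \<and> b \<in> \<Gamma> \<and> b \<noteq> 0}"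
    then obtain a b where ab: "a \<in> \<Gamma>" "b \<in> \<Gamma>" "b \<noteq> 0" "x = toF a / toF b" by blast
    have "x = toF a \<otimes>\<^bsub>L\<^esub> inv\<^bsub>L\<^esub> toF b" by (rule trans[OF ab(4) e[OF ab(2,3), symmetric]])
    moreover have "toF b \<in> toF ` \<Gamma> - {\<zero>\<^bsub>L\<^esub>}" using ab by simp
    ultimately show "x \<in> K" unfolding fraction_subfield_def using ab(1) by blast
  qed
qed

lemma K_I: "a \<in> \<Gamma> \<Longrightarrow> b \<in> \<Gamma> \<Longrightarrow> b \<noteq> 0 \<Longrightarrow> toF a / toF b \<in> K" unfolding K_eq by auto
lemma K_toF: "a \<in> \<Gamma> \<Longrightarrow> toF a \<in> K" using K_I[of a 1] by (simp add: toF_simps \<Gamma>_closed)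

text \<open>A denominator divides the product of its conjugates, which is invariant; so invariant denominators
suffice.\<close>

lemma common_denominator:
  assumes "finite S" "S \<subseteq> Ln n"
  obtains c where "c \<in> \<Gamma>" "c \<noteq> (0 :: 'k mpoly)" "\<And>x. x \<in> S \<Longrightarrow> toF c * x \<in> toF ` Pn n"
proof -
  have "\<exists>c\<in>\<Gamma>. c \<noteq> (0 :: 'k mpoly) \<and> (\<forall>x\<in>S. toF c * x \<in> toF ` Pn n)"
    using assms
  proof (induction S rule: finite_induct)
    case empty
    show ?case by (rule bexI[of _ 1]) (auto simp: \<Gamma>_closed)
  next
    case (insert x S)
    then obtain c where c: "c \<in> \<Gamma>" "c \<noteq> 0" "\<forall>x\<in>S. toF c * x \<in> toF ` Pn n" by auto
    obtain a b where x: "x = toF a / toF b" "a \<in> Pn n" "b \<in> Pn n" "b \<noteq> 0" using insert by (auto elim!: LnE)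
    obtain b' where b': "b' \<in> Pn n" "b * b' \<in> \<Gamma>" "b * b' \<noteq> 0" by (rule norm_multiple[OF x(3,4)])
    have "toF (c * (b * b')) * x = toF (c * b' * a)" using x by (simp add: toF_simps)
    then have 1: "toF (c * (b * b')) * x \<in> toF ` Pn n" using c b' x \<Gamma>_Pn by (auto intro!: imageI)
    have 2: "toF (c * (b * b')) * z \<in> toF ` Pn n" if z: "z \<in> S" for z
    proof -
      obtain p where p: "p \<in> Pn n" "toF c * z = toF p" using c(3) z by auto
      have "toF (c * (b * b')) * z = toF (b * b') * (toF c * z)" by (simp add: toF_simps)
      also have "\<dots> = toF (b * b' * p)" by (simp add: p toF_simps)
      finally show ?thesis using b' p \<Gamma>_Pn by (auto intro!: imageI)
    qed
    show ?case by (rule bexI[of _ "c * (b * b')"]) (use 1 2 c b' in \<open>auto intro: \<Gamma>_closed\<close>)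
  qed
  with that show ?thesis by blast
qed

text \<open>The fraction field of the invariants is the field of invariant fractions: with a denominator in \<open>\<Gamma>\<close>,
the numerator of an invariant fraction is invariant.\<close>

lemma K_iff: "x \<in> K \<longleftrightarrow> x \<in> Ln n \<and> (\<forall>\<pi>\<in>W. Fperm \<pi> x = x)"
proof
  assume "x \<in> K"
  then obtain a b where x: "x = toF a / toF b" "a \<in> \<Gamma>" "b \<in> \<Gamma>" "b \<noteq> 0" unfolding K_eq by auto
  then show "x \<in> Ln n \<and> (\<forall>\<pi>\<in>W. Fperm \<pi> x = x)"
    using W_bij by (auto simp: field_hom_div[OF Fperm_hom] Fperm_toF \<Gamma>_def intro!: LnI)
next
  assume x: "x \<in> Ln n \<and> (\<forall>\<pi>\<in>W. Fperm \<pi> x = x)"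
  obtain c where c: "c \<in> \<Gamma>" "c \<noteq> 0" "toF c * x \<in> toF ` Pn n"
    using common_denominator[of "{x}"] x by auto
  then obtain p where p: "p \<in> Pn n" "toF c * x = toF p" by auto
  have "p \<in> \<Gamma>"
    unfolding \<Gamma>_def
  proof (intro CollectI conjI ballI p(1))
    fix \<pi> assume \<pi>: "\<pi> \<in> W"
    have "toF (perm \<pi> p) = Fperm \<pi> (toF c * x)" by (simp add: p Fperm_toF W_bij \<pi>)
    also have "\<dots> = toF c * x"
      using c(1) \<pi> x by (simp add: is_homD[OF Fperm_hom[OF W_bij[OF \<pi>]]] Fperm_toF W_bij \<Gamma>_def)
    finally show "perm \<pi> p = p" using p by simp
  qed
  moreover have "x = toF p / toF c" using p c by (simp add: field_simps)
  ultimately show "x \<in> K" using K_I c by auto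
qed

lemma K_Ln: "x \<in> K \<Longrightarrow> x \<in> Ln n" by (simp add: K_iff)

lemma subring_L:
  assumes "S \<subseteq> Ln n" "1 \<in> S" "\<And>x. x \<in> S \<Longrightarrow> - x \<in> S" "\<And>x y. x \<in> S \<Longrightarrow> y \<in> S \<Longrightarrow> x * y \<in> S" "\<And>x y. x \<in> S \<Longrightarrow> y \<in> S \<Longrightarrow> x + y \<in> S"
  shows "subring S L"
  by (rule L.subringI) (use assms in \<open>auto simp: a_inv_Lring subset_iff\<close>)

lemma subfield_K: "subfield K L"
proof (rule field.subfieldI'[OF field_Lring])
  have h: "\<And>\<pi>. \<pi> \<in> W \<Longrightarrow> is_hom (Fperm \<pi>)" using W_bij Fperm_hom by blast
  show "subring K L"
    by (rule subring_L) (auto simp: K_iff is_homD[OF h] Ln_mult Ln_add Ln_uminus)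
  show "inv\<^bsub>L\<^esub> k \<in> K" if "k \<in> K - {\<zero>\<^bsub>L\<^esub>}" for k
    using that by (auto simp: K_iff inv_Lring field_hom_div[OF h] Ln_inverse)
qed

lemma toF_\<Gamma>_subring: "subring (toF ` \<Gamma>) L"
proof (rule subring_L)
  show "toF ` \<Gamma> \<subseteq> Ln n" by (auto simp: \<Gamma>_Pn)
  show "1 \<in> toF ` \<Gamma>" using \<Gamma>_closed(5) toF_simps(1) by (metis image_eqI)
qed (auto simp: toF_simps[symmetric] intro!: imageI \<Gamma>_closed)

definition scalars :: "'k mpoly fract set" where "scalars = range (\<lambda>c. toF (cst c))"

lemma subfield_scalars: "subfield scalars L"
proof (rule field.subfieldI'[OF field_Lring])
  show "subring scalars L"
  proof (rule subring_L)
    show "1 \<in> scalars" unfolding scalars_def by (rule image_eqI[of _ _ 1]) (simp_all add: toF_simps)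
  qed (auto simp: scalars_def toF_simps[symmetric] cst_minus[symmetric] cst_mult[symmetric] cst_add[symmetric])
  show "inv\<^bsub>L\<^esub> k \<in> scalars" if k: "k \<in> scalars - {\<zero>\<^bsub>L\<^esub>}" for k
  proof -
    obtain c where c: "k = toF (cst c)" "c \<noteq> 0" using k by (auto simp: scalars_def toF_simps)
    have "toF (cst c) * toF (cst (inverse c)) = 1" using c by (simp add: toF_simps[symmetric] cst_mult[symmetric])
    then have "inverse k = toF (cst (inverse c))" using c by (simp add: inverse_unique)
    then show ?thesis using c by (simp add: inv_Lring scalars_def)
  qed
qed

lemma Bij_L:
  assumes "\<And>x. x \<in> Ln n \<Longrightarrow> f x \<in> Ln n" "\<And>x. x \<in> Ln n \<Longrightarrow> g x \<in> Ln n"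
    "\<And>x. x \<in> Ln n \<Longrightarrow> f (g x) = x" "\<And>x. x \<in> Ln n \<Longrightarrow> g (f x) = x"
  shows "restrict f (Ln n) \<in> Bij (Ln n)"
proof -
  have "bij_betw f (Ln n) (Ln n)" by (rule bij_betw_byWitness[where f' = g]) (use assms in auto)
  then show ?thesis by (auto simp: Bij_def cong: bij_betw_cong)
qed

lemma field_automorphism_L:
  assumes "is_hom f" "\<And>x. x \<in> Ln n \<Longrightarrow> f x \<in> Ln n" "\<And>x. x \<in> Ln n \<Longrightarrow> g x \<in> Ln n"
    "\<And>x. x \<in> Ln n \<Longrightarrow> f (g x) = x" "\<And>x. x \<in> Ln n \<Longrightarrow> g (f x) = x" "S \<subseteq> Ln n" "\<And>x. x \<in> S \<Longrightarrow> f x = x"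
  shows "restrict f (Ln n) \<in> field_automorphisms L S"
proof -
  have "restrict f (Ln n) \<in> ring_hom L L"
    by (rule ring_hom_memI) (use assms(2) in \<open>auto simp: is_homD[OF assms(1)] Ln_mult Ln_add\<close>)
  then show ?thesis using Bij_L[of f g] assms unfolding field_automorphisms_def by auto
qed

lemma Fperm_galois: "\<pi> \<in> W \<Longrightarrow> restrict (Fperm \<pi>) (Ln n) \<in> galois_group L (toF ` \<Gamma>)"
  by (rule field_automorphism_L[where g = "Fperm (inv_into UNIV \<pi>)"])
    (auto simp: Fperm_hom W_bij Fperm_Ln W_permutes W_inv Fperm_inv K_iff)

text \<open>An automorphism over \<open>K\<close> fixes the coefficients of \<open>\<Prod>\<^sub>l (t - y\<^sub>l)\<close>, so it permutes the roots \<open>y\<^sub>l\<close>, and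
it is determined by this permutation. For trivial \<open>W\<close> the fields \<open>K\<close> and \<open>L\<close> are equal.\<close>

lemma galois_group_cases:
  assumes h: "h \<in> galois_group L (toF ` \<Gamma>)"
  obtains \<pi> where "\<pi> \<in> W" "h = restrict (Fperm \<pi>) (Ln n)"
proof -
  have hh: "h \<in> ring_hom L L" "bij_betw h (Ln n) (Ln n)" "h \<in> extensional (Ln n)" "\<And>x. x \<in> K \<Longrightarrow> h x = x"
    using h by (auto simp: field_automorphisms_def Bij_def)
  have hc: "h x \<in> Ln n" if "x \<in> Ln n" for x using hh(2) that by (auto simp: bij_betw_def)
  have ha: "h (x + y) = h x + h y" and hm: "h (x * y) = h x * h y" if "x \<in> Ln n" "y \<in> Ln n" for x y
    using ring_hom_add[OF hh(1), of x y] ring_hom_mult[OF hh(1), of x y] that by auto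
  have h1: "h 1 = 1" using ring_hom_one[OF hh(1)] by simp
  from ha[OF Ln_0 Ln_0] have "h 0 + 0 = h 0 + h 0" by (simp only: add_0_right)
  then have h0: "h 0 = 0" by (simp only: add_left_cancel)
  have inj: "h x = h y \<Longrightarrow> x \<in> Ln n \<Longrightarrow> y \<in> Ln n \<Longrightarrow> x = y" for x y using hh(2) by (auto simp: bij_betw_def inj_on_def)
  have hcst: "h (toF (cst c)) = toF (cst c)" for c by (rule hh(4), rule K_toF, rule \<Gamma>_closed)
  show ?thesis
    using W_cases
  proof
    assume W: "W = {id}"
    have "h x = Fperm id x" if "x \<in> Ln n" for x
    proof -
      have "\<forall>\<pi>\<in>W. Fperm \<pi> x = x" using W by (simp add: Fperm_id)
      then have "x \<in> K" using that K_iff by blast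
      then show ?thesis by (simp add: hh(4) Fperm_id)
    qed
    then have "h = restrict (Fperm id) (Ln n)" using hh(3) by (intro extensionalityI[OF hh(3) restrict_extensional]) simp
    with that[OF W_id] show ?thesis by blast
  next
    assume W: "W = {\<pi>. \<pi> permutes {..<n}}"
    have G: "\<Gamma> = (tower n n :: 'k mpoly set)" unfolding \<Gamma>_def by (auto simp: W symm_eq_tower[symmetric] symm_def)
    have hp: "h (x ^ k) = h x ^ k \<and> x ^ k \<in> Ln n" if "x \<in> Ln n" for x k
      by (induction k) (use that in \<open>auto simp: h1 hm intro: Ln_mult\<close>)
    have hs: "h (sum f I) = (\<Sum>i\<in>I. h (f i)) \<and> sum f I \<in> Ln n" if "\<And>i. i \<in> I \<Longrightarrow> f i \<in> Ln n" for f and I :: "nat set"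
      using that by (induction I rule: infinite_finite_induct) (auto simp: h0 ha intro: Ln_add)
    have "\<exists>l<n. h (toF (var i)) = toF (var l)" if i: "i < n" for i
    proof -
      define v where "v = h (toF (var i :: 'k mpoly))"
      have vi: "toF (var i) \<in> Ln n" using i by (simp add: Pn_var)
      have ck: "toF (coeff (root_poly n) k) \<in> K" for k
        by (rule K_toF) (auto simp: G tower_def intro: alg_gen)
      have rt: "poly (root_poly n) (var i :: 'k mpoly) = 0"
        unfolding root_poly_def poly_prod using i by (intro prod_zero) (auto intro: bexI[of _ i])
      have mp: "map_poly toF (root_poly n :: 'k mpoly poly) = (\<Prod>l<n. [:- toF (var l), 1:])"
      proof -
        have hom: "map_poly toF (p * p') = map_poly toF p * map_poly toF p'" for p p' :: "'k mpoly poly"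
          by (rule poly_eqI) (simp add: coeff_map_poly coeff_mult is_hom_sum[OF toF_hom] toF_simps)
        have "map_poly toF (\<Prod>l\<in>S. f l) = (\<Prod>l\<in>S. map_poly toF (f l))" for f :: "nat \<Rightarrow> 'k mpoly poly" and S
          by (induction S rule: infinite_finite_induct) (auto simp: hom toF_simps)
        then show ?thesis unfolding root_poly_def by (simp add: map_poly_pCons toF_simps)
      qed
      have ev: "poly (map_poly toF p) x = (\<Sum>k\<le>degree p. toF (coeff p k) * x ^ k)" for p :: "'k mpoly poly" and x
        by (simp add: poly_altdef degree_map_poly coeff_map_poly toF_simps)
      have tm: "toF (coeff (root_poly n :: 'k mpoly poly) k) * toF (var i) ^ k \<in> Ln n" for k
        using hp[OF vi, of k] K_Ln[OF ck[of k]] by (auto intro: Ln_mult)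
      have "(\<Prod>l<n. v - toF (var l)) = poly (map_poly toF (root_poly n :: 'k mpoly poly)) v"
        unfolding mp by (simp add: poly_prod)
      also have "\<dots> = (\<Sum>k\<le>n. toF (coeff (root_poly n) k) * v ^ k)"
        unfolding ev by (simp add: root_poly_degree)
      also have "\<dots> = (\<Sum>k\<le>n. h (toF (coeff (root_poly n) k) * toF (var i) ^ k))"
        using hp[OF vi] K_Ln[OF ck] by (intro sum.cong) (auto simp: hm hh(4)[OF ck] v_def)
      also have "\<dots> = h (\<Sum>k\<le>n. toF (coeff (root_poly n) k) * toF (var i) ^ k)"
        using hs[of "{..n}" "\<lambda>k. toF (coeff (root_poly n) k) * toF (var i) ^ k"] tm by simp
      also have "(\<Sum>k\<le>n. toF (coeff (root_poly n) k) * toF (var i) ^ k) = toF (poly (root_poly n) (var i :: 'k mpoly))"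
        by (simp add: poly_altdef root_poly_degree is_hom_sum[OF toF_hom] toF_simps)
      finally have "(\<Prod>l<n. v - toF (var l)) = 0" by (simp add: rt toF_simps h0)
      then show ?thesis by (auto simp: v_def)
    qed
    then obtain r where r: "\<And>i. i < n \<Longrightarrow> r i < n \<and> h (toF (var i)) = toF (var (r i))" by metis
    define \<pi> where "\<pi> i = (if i < n then r i else i)" for i
    have "inj_on \<pi> {..<n}"
    proof (rule inj_onI)
      fix i j assume ij: "i \<in> {..<n}" "j \<in> {..<n}" "\<pi> i = \<pi> j"
      then have "h (toF (var i)) = h (toF (var j))" using r[of i] r[of j] by (auto simp: \<pi>_def)
      then have "toF (var i) = (toF (var j) :: 'k mpoly fract)" by (rule inj) (use ij in \<open>auto simp: Pn_var\<close>)
      then show "i = j" by simp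
    qed
    moreover have "\<pi> ` {..<n} \<subseteq> {..<n}" using r by (auto simp: \<pi>_def)
    ultimately have "bij_betw \<pi> {..<n} {..<n}" by (simp add: bij_betw_def endo_inj_surj)
    then have \<pi>: "\<pi> permutes {..<n}" by (rule bij_imp_permutes) (simp add: \<pi>_def)
    then have \<pi>W: "\<pi> \<in> W" by (simp add: W)
    have \<pi>r: "i < n \<Longrightarrow> \<pi> i = r i" for i by (simp add: \<pi>_def)
    note hom = Fperm_hom[OF permutes_bij[OF \<pi>]] and eF = Fperm_toF[OF permutes_bij[OF \<pi>]]
    have e: "h (toF p) = Fperm \<pi> (toF p) \<and> toF p \<in> Ln n" if "p \<in> Pn n" for p
      using that unfolding Pn_eq_alg_gen
    proof (induction rule: alg_gen.induct)
      case (alg_cst c) show ?case by (simp add: hcst eF)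
    next
      case (alg_gen s) then show ?case using r by (auto simp: eF \<pi>r Pn_var)
    next
      case (alg_add a b) then show ?case by (simp add: toF_simps ha is_homD[OF hom] Ln_add)
    next
      case (alg_mult a b) then show ?case by (simp add: toF_simps hm is_homD[OF hom] Ln_mult)
    qed
    have "h x = Fperm \<pi> x" if x: "x \<in> Ln n" for x
    proof -
      obtain a b where ab: "x = toF a / toF b" "a \<in> Pn n" "b \<in> Pn n" "b \<noteq> 0" using x by (auto elim!: LnE)
      have "h x * h (toF b) = h (toF a)" using hm[OF x, of "toF b"] e ab by simp
      moreover have "Fperm \<pi> x * Fperm \<pi> (toF b) = Fperm \<pi> (toF a)" using ab by (simp add: is_homD(3)[OF hom, symmetric])
      moreover have "Fperm \<pi> (toF b) \<noteq> 0" using ab by (simp add: field_hom_div(3)[OF hom])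
      ultimately show ?thesis using e ab by (metis mult_right_cancel)
    qed
    then have "h = restrict (Fperm \<pi>) (Ln n)" by (intro extensionalityI[OF hh(3) restrict_extensional]) simp
    with that[OF \<pi>W] show ?thesis by blast
  qed
qed

text \<open>A basis of the polynomials over \<open>\<Gamma>\<close> spans \<open>L\<close> over \<open>K\<close> by clearing denominators.\<close>

lemma finite_galois_LK: "finite_galois L K"
  unfolding finite_galois_def
proof (intro conjI field_Lring subfield_K)
  show "{a \<in> carrier L. \<forall>\<sigma>\<in>field_automorphisms L K. \<sigma> a = a} = K"
  proof (intro equalityI subsetI)
    fix a assume a: "a \<in> {a \<in> carrier L. \<forall>\<sigma>\<in>field_automorphisms L K. \<sigma> a = a}"
    then have "restrict (Fperm \<pi>) (Ln n) a = a" if "\<pi> \<in> W" for \<pi> using Fperm_galois[OF that] by blast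
    then show "a \<in> K" using a by (simp add: K_iff)
  next
    fix a assume "a \<in> K"
    then show "a \<in> {a \<in> carrier L. \<forall>\<sigma>\<in>field_automorphisms L K. \<sigma> a = a}"
      using K_Ln by (simp add: field_automorphisms_def)
  qed
  obtain C :: "(nat \<Rightarrow> nat) set" and e :: "(nat \<Rightarrow> nat) \<Rightarrow> 'k mpoly" where
    C: "finite C" "e ` C \<subseteq> Pn n" "\<forall>p\<in>Pn n. \<exists>g. (\<forall>c\<in>C. g c \<in> \<Gamma>) \<and> p = (\<Sum>c\<in>C. g c * e c)"
    using \<Gamma>_structure(2) by blast
  obtain cs where cs: "set cs = C" "distinct cs" using finite_distinct_list[OF C(1)] by blast
  let ?Us = "map (\<lambda>c. toF (e c)) cs"
  have Us: "set ?Us \<subseteq> carrier L" using C cs by auto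
  have line: "k * u + z \<in> ring.Span L K (u # us)" if "k \<in> K" "z \<in> ring.Span L K us" for k u z us
    using that by (auto simp: L.line_extension_def set_add_def set_mult_def r_coset_def)
  have Sp: "(\<Sum>c\<in>set ds. k c * toF (e c)) \<in> ring.Span L K (map (\<lambda>c. toF (e c)) ds)" if "distinct ds" "\<And>c. c \<in> set ds \<Longrightarrow> k c \<in> K" for k ds
    using that by (induction ds) (use line in \<open>auto simp del: L.Span.simps, simp add: L.Span.simps\<close>)
  have "carrier L = ring.Span L K ?Us"
  proof
    show "ring.Span L K ?Us \<subseteq> carrier L" by (rule L.Span_in_carrier[OF _ Us]) (use K_Ln in auto)
    show "carrier L \<subseteq> ring.Span L K ?Us"
    proof
      fix x assume "x \<in> carrier L"
      then obtain c where c: "c \<in> \<Gamma>" "c \<noteq> 0" "toF c * x \<in> toF ` Pn n" using common_denominator[of "{x}"] by auto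
      then obtain p where p: "p \<in> Pn n" "toF c * x = toF p" by auto
      obtain g where g: "\<forall>c\<in>C. g c \<in> \<Gamma>" "p = (\<Sum>c\<in>C. g c * e c)" using C(3) p by blast
      have "x = toF p / toF c" using p c by (simp add: field_simps)
      also have "\<dots> = (\<Sum>d\<in>set cs. toF (g d) / toF c * toF (e d))"
        by (simp add: cs g(2) is_hom_sum[OF toF_hom] toF_simps sum_divide_distrib)
      also have "\<dots> \<in> ring.Span L K ?Us" by (rule Sp) (use cs g c K_I in auto)
      finally show "x \<in> ring.Span L K ?Us" .
    qed
  qed
  then show "ring.finite_dimension L K (carrier L)"
    using L.Span_finite_dimension[OF subfield_K Us] by simp
qed

text \<open>The monoid of the skew monoid ring consists of the dilations by which the monomials \<open>x\<^sup>a\<close> fixed by \<open>T\<close>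
act on rational functions in the \<open>y\<^sub>i\<close>.\<close>

definition \<sigma> :: "expo \<Rightarrow> 'k mpoly fract \<Rightarrow> 'k mpoly fract" where "\<sigma> a = restrict (Fsig q a) (Ln n)"

definition MS :: "('k mpoly fract \<Rightarrow> 'k mpoly fract) set" where "MS = \<sigma> ` MM"

abbreviation BG where "BG \<equiv> BijGroup (Ln n :: 'k mpoly fract set)"

lemma \<sigma>_apply: "x \<in> Ln n \<Longrightarrow> \<sigma> a x = Fsig q a x" by (simp add: \<sigma>_def)

lemma \<sigma>_Bij: "\<sigma> a \<in> Bij (Ln n)"
  unfolding \<sigma>_def
  by (rule Bij_L[where g = "frac_map (dil (\<lambda>i. q ^ lookup a i))"]) (auto simp: Fsig_inverse q_nonzero Fsig_Ln)

lemma \<sigma>_mult: "\<sigma> a \<otimes>\<^bsub>BG\<^esub> \<sigma> b = \<sigma> (a + b)"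
proof -
  have "\<sigma> a \<otimes>\<^bsub>BG\<^esub> \<sigma> b = compose (Ln n) (\<sigma> a) (\<sigma> b)" using \<sigma>_Bij by (simp add: BijGroup_def)
  also have "\<dots> = \<sigma> (a + b)" by (rule ext) (simp add: compose_def \<sigma>_def Fsig_add q_nonzero Fsig_Ln)
  finally show ?thesis .
qed

lemma \<sigma>_one: "\<one>\<^bsub>BG\<^esub> = \<sigma> 0"
  by (rule ext) (simp add: BijGroup_def \<sigma>_def Fsig_0 q_nonzero)

text \<open>The dilations are separated by a single element of \<open>K\<close>, the sum of the variables: its image under \<open>\<sigma> a\<close>
has the coefficients \<open>q\<^bsup>-a_i\<^esup>\<close>, and these determine \<open>a\<close> because \<open>q\<close> is not a root of unity.\<close>

lemma \<sigma>_inj_K: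
  assumes "a \<in> Nn n" "b \<in> Nn n" "\<And>x. x \<in> K \<Longrightarrow> \<sigma> a x = \<sigma> b x"
  shows "a = b"
proof (rule poly_mapping_eqI)
  fix i
  show "lookup a i = lookup b i"
  proof (cases "i < n")
    case False
    then have "i \<notin> keys a" "i \<notin> keys b" using assms(1,2) by (auto simp: Nn_def)
    then show ?thesis by (simp add: in_keys_iff)
  next
    case True
    define s where "s = (\<Sum>i<n. var i :: 'k mpoly)"
    have sG: "s \<in> \<Gamma>"
      unfolding \<Gamma>_def
    proof (intro CollectI conjI ballI)
      show "s \<in> Pn n" unfolding s_def by (rule Pn_sum) (auto intro: Pn_var)
      fix \<pi> assume "\<pi> \<in> W"
      then show "perm \<pi> s = s"
        unfolding s_def is_hom_sum[OF perm_hom] using sum.permute[OF W_permutes, of \<pi> "var :: nat \<Rightarrow> 'k mpoly"] by (simp add: o_def)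
    qed
    then have "\<sigma> a (toF s) = \<sigma> b (toF s)" by (intro assms(3) K_toF)
    then have "qdil q a s = qdil q b s"
      by (simp add: \<sigma>_apply Fsig_toF q_nonzero \<Gamma>_Pn[OF sG])
    then have "lookup (qdil q a s) (single i 1) = lookup (qdil q b s) (single i 1)" by simp
    moreover have "lookup (qdil q c s) (single i 1) = inverse q ^ lookup c i" for c
    proof -
      have *: "(single j (Suc 0) = single i (Suc 0)) \<longleftrightarrow> j = i" for j :: nat
        using keys_single[of j "Suc 0"] keys_single[of i "Suc 0"] by (metis singleton_inject zero_less_Suc less_irrefl)
      have "lookup (qdil q c s) (single i 1) = (\<Sum>j<n. inverse q ^ lookup c j * (if j = i then 1 else 0))"
        unfolding s_def is_hom_sum[OF D.act_hom] lookup_sum qdil_var lookup_cst_mult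
        by (intro sum.cong) (auto simp: var_def lookup_single when_def *)
      also have "\<dots> = (\<Sum>j<n. if j = i then inverse q ^ lookup c j else 0)" by (intro sum.cong) auto
      finally show ?thesis using True by simp
    qed
    ultimately have e: "inverse q ^ lookup a i = inverse q ^ lookup b i" by simp
    have gen: "k = l" if "inverse q ^ k = inverse q ^ l" "k \<le> l" for k l
    proof (rule ccontr)
      assume "k \<noteq> l"
      with that have kl: "l - k \<ge> 1" by simp
      have "inverse q ^ l = inverse q ^ k * inverse q ^ (l - k)" using that(2) by (simp add: power_add[symmetric])
      then have "inverse q ^ (l - k) = 1" using that(1) q_nonzero by simp
      then have "q ^ (l - k) = 1" by (simp add: power_inverse)
      with q_generic[OF kl] show False by simp
    qed
    show ?thesis using gen[OF e] gen[OF e[symmetric]] by (cases "lookup a i \<le> lookup b i") auto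
  qed
qed

lemma \<sigma>_inj: "a \<in> Nn n \<Longrightarrow> b \<in> Nn n \<Longrightarrow> \<sigma> a = \<sigma> b \<Longrightarrow> a = b"
  by (rule \<sigma>_inj_K) auto

lemma conjugate_\<sigma>:
  assumes "\<pi> \<in> W"
  shows "conjugate L (restrict (Fperm \<pi>) (Ln n)) (\<sigma> a) = \<sigma> (pexp \<pi> a)"
    "inv\<^bsub>BG\<^esub> (restrict (Fperm \<pi>) (Ln n)) = restrict (Fperm (inv_into UNIV \<pi>)) (Ln n)"
proof -
  interpret B: group BG by (rule group_BijGroup)
  let ?h = "restrict (Fperm \<pi>) (Ln n :: 'k mpoly fract set)"
  let ?h' = "restrict (Fperm (inv_into UNIV \<pi>)) (Ln n :: 'k mpoly fract set)"
  have FL: "\<And>\<rho> x. \<rho> \<in> W \<Longrightarrow> x \<in> Ln n \<Longrightarrow> Fperm \<rho> x \<in> Ln n" using Fperm_Ln W_permutes by blast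
  have B: "?h \<in> Bij (Ln n)" "?h' \<in> Bij (Ln n)"
    using Fperm_galois[OF assms] Fperm_galois[OF W_inv[OF assms]] by (auto simp: field_automorphisms_def)
  have bij: "bij \<pi>" by (rule W_bij[OF assms])
  have inv1: "Fperm \<pi> (Fperm (inv_into UNIV \<pi>) x) = x" "Fperm (inv_into UNIV \<pi>) (Fperm \<pi> x) = x" for x
    by (simp_all only: Fperm_inv[OF bij])
  have mult: "f \<otimes>\<^bsub>BG\<^esub> g = compose (Ln n) f g" if "f \<in> Bij (Ln n)" "g \<in> Bij (Ln n)" for f g
    using that by (simp add: BijGroup_def)
  have "?h' \<otimes>\<^bsub>BG\<^esub> ?h = \<one>\<^bsub>BG\<^esub>"
    unfolding mult[OF B(2,1)] by (rule ext) (simp add: compose_def BijGroup_def FL assms inv1)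
  then show i: "inv\<^bsub>BG\<^esub> ?h = ?h'" using B by (intro B.inv_equality) (auto simp: BijGroup_def)
  have c: "compose (Ln n) ?h (\<sigma> a) \<in> Bij (Ln n)" by (rule compose_Bij[OF B(1) \<sigma>_Bij])
  show "conjugate L ?h (\<sigma> a) = \<sigma> (pexp \<pi> a)"
    unfolding conjugate_def Lring_simps i mult[OF B(1) \<sigma>_Bij] mult[OF c B(2)]
    by (rule ext) (simp add: compose_def \<sigma>_def FL assms W_inv Fsig_Ln q_nonzero Fperm_Fsig bij inv1)
qed

lemma galois_setting_L: "galois_setting L scalars (toF ` \<Gamma>) MS"
  unfolding galois_setting_def
proof (intro conjI field_Lring subfield_scalars finite_galois_LK)
  show "subdomain (toF ` \<Gamma>) L" by (rule domain.subdomainI'[OF field.axioms(1)[OF field_Lring] toF_\<Gamma>_subring])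
  show "scalars \<subseteq> toF ` \<Gamma>" by (auto simp: scalars_def \<Gamma>_closed)
  show "MS \<subseteq> field_automorphisms L scalars"
  proof
    fix x assume "x \<in> MS"
    then obtain a where a: "x = \<sigma> a" by (auto simp: MS_def)
    show "x \<in> field_automorphisms L scalars"
      unfolding a \<sigma>_def
      by (rule field_automorphism_L[where g = "frac_map (dil (\<lambda>i. q ^ lookup a i))"])
        (auto simp: Fsig_inverse q_nonzero Fsig_Ln Fsig_hom scalars_def Fsig_toF)
  qed
  show "submonoid MS (BijGroup (carrier L))"
  proof
    show "MS \<subseteq> carrier (BijGroup (carrier L))" using \<sigma>_Bij by (auto simp: MS_def BijGroup_def)
    show "\<one>\<^bsub>BijGroup (carrier L)\<^esub> \<in> MS" using \<sigma>_one by (auto simp: MS_def)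
  qed (auto simp: MS_def \<sigma>_mult intro: MM_add)
  show "\<forall>m\<in>MS. \<forall>m'\<in>MS. (\<forall>a\<in>K. m a = m' a) \<longrightarrow> m = m'"
    using \<sigma>_inj_K MM_Nn unfolding MS_def by blast
  show "\<forall>h\<in>galois_group L (toF ` \<Gamma>). \<forall>m\<in>MS. conjugate L h m \<in> MS"
    unfolding MS_def using MM_pexp by (auto elim!: galois_group_cases simp: conjugate_\<sigma>(1))
qed

end

section \<open>Noetherian modules over polynomial rings\<close>

text \<open>Finitely supported functions with values in a commutative ring form the free module on their index
set. The next notions are those of submodules, of generated submodules and of Noetherian ones over a
subring \<open>R\<close> that is given as a set.\<close>

definition pscale :: "'r::comm_ring_1 \<Rightarrow> ('i \<Rightarrow>\<^sub>0 'r) \<Rightarrow> ('i \<Rightarrow>\<^sub>0 'r)" where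
  "pscale c v = Poly_Mapping.map ((*) c) v"

lemma lookup_pscale [simp]: "lookup (pscale c v) i = c * lookup v i"
  by (simp add: pscale_def Poly_Mapping.map.rep_eq when_def)

lemma pscale_simps:
  "pscale c (v + w) = pscale c v + pscale c w" "pscale (c + d) v = pscale c v + pscale d v"
  "pscale (c * d) v = pscale c (pscale d v)" "pscale 1 v = v" "pscale c 0 = 0" "pscale 0 v = 0"
  "pscale (- c) v = - pscale c v" "pscale c (- v) = - pscale c v" "pscale c (v - w) = pscale c v - pscale c w"
  by (auto intro!: poly_mapping_eqI simp: lookup_add lookup_uminus lookup_minus algebra_simps)

lemma pscale_sum: "pscale c (sum f I) = (\<Sum>i\<in>I. pscale c (f i))"
  by (induction I rule: infinite_finite_induct) (auto simp: pscale_simps)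

lemma keys_pscale: "keys (pscale c v) \<subseteq> keys v" by (auto simp: in_keys_iff)

lemma pscale_single: "pscale c (single i p) = single i (c * p)"
  by (rule poly_mapping_eqI) (simp add: lookup_single when_def)

definition msub :: "'r::comm_ring_1 set \<Rightarrow> ('i \<Rightarrow>\<^sub>0 'r) set \<Rightarrow> bool" where
  "msub R N \<longleftrightarrow> 0 \<in> N \<and> (\<forall>v\<in>N. \<forall>w\<in>N. v + w \<in> N) \<and> (\<forall>c\<in>R. \<forall>v\<in>N. pscale c v \<in> N)"

lemma msubD: "msub R N \<Longrightarrow> 0 \<in> N" "msub R N \<Longrightarrow> v \<in> N \<Longrightarrow> w \<in> N \<Longrightarrow> v + w \<in> N" "msub R N \<Longrightarrow> c \<in> R \<Longrightarrow> v \<in> N \<Longrightarrow> pscale c v \<in> N"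
  by (auto simp: msub_def)

inductive_set mhull :: "'r::comm_ring_1 set \<Rightarrow> ('i \<Rightarrow>\<^sub>0 'r) set \<Rightarrow> ('i \<Rightarrow>\<^sub>0 'r) set" for R G where
  mhull_0: "0 \<in> mhull R G"
| mhull_step: "v \<in> mhull R G \<Longrightarrow> c \<in> R \<Longrightarrow> g \<in> G \<Longrightarrow> pscale c g + v \<in> mhull R G"

lemma mhull_add: "v \<in> mhull R G \<Longrightarrow> w \<in> mhull R G \<Longrightarrow> v + w \<in> mhull R G"
  by (induction v rule: mhull.induct) (auto simp: add.assoc intro: mhull_step)

lemma mhull_scale:
  assumes "\<And>a b. a \<in> R \<Longrightarrow> b \<in> R \<Longrightarrow> a * b \<in> R" "c \<in> R" "v \<in> mhull R G"
  shows "pscale c v \<in> mhull R G"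
  using assms(3)
proof induction
  case (mhull_step v d g)
  have "pscale c (pscale d g + v) = pscale (c * d) g + pscale c v" by (simp add: pscale_simps)
  with mhull_step assms show ?case by (auto intro: mhull.intros)
qed (simp add: pscale_simps mhull_0)

lemma mhull_msub: "(\<And>a b. a \<in> R \<Longrightarrow> b \<in> R \<Longrightarrow> a * b \<in> R) \<Longrightarrow> msub R (mhull R G)"
  by (auto simp: msub_def intro: mhull_0 mhull_add mhull_scale)

lemma mhull_least: "msub R N \<Longrightarrow> G \<subseteq> N \<Longrightarrow> mhull R G \<subseteq> N"
proof
  fix v assume *: "msub R N" "G \<subseteq> N" and "v \<in> mhull R G"
  from this(3) show "v \<in> N" by induction (use * in \<open>auto simp: msub_def\<close>)
qed

lemma mhull_incl: "1 \<in> R \<Longrightarrow> g \<in> G \<Longrightarrow> g \<in> mhull R G"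
  using mhull_step[OF mhull_0, of 1 R g G] by (simp add: pscale_simps)

lemma mhull_sum: "(\<And>i. i \<in> I \<Longrightarrow> f i \<in> mhull R G) \<Longrightarrow> sum f I \<in> mhull R G"
  by (induction I rule: infinite_finite_induct) (auto intro: mhull_0 mhull_add)

definition noeth :: "'r::comm_ring_1 set \<Rightarrow> ('i \<Rightarrow>\<^sub>0 'r) set \<Rightarrow> bool" where
  "noeth R Y \<longleftrightarrow> (\<forall>N. msub R N \<and> N \<subseteq> Y \<longrightarrow> (\<exists>G. finite G \<and> G \<subseteq> N \<and> N \<subseteq> mhull R G))"

interpretation VS: vector_space "\<lambda>(c::'k::field) (v :: 'i \<Rightarrow>\<^sub>0 'k mpoly). pscale (cst c) v"
  by unfold_locales (simp_all add: pscale_simps cst_add cst_mult)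

lemma msub_subspace: "msub (range cst) N \<longleftrightarrow> VS.subspace N"
  by (auto simp: msub_def VS.subspace_def)

lemma noeth_base:
  fixes B :: "('i \<Rightarrow>\<^sub>0 'k::field mpoly) set"
  assumes "finite B"
  shows "noeth (range cst) (mhull (range cst) B)"
  unfolding noeth_def
proof (intro allI impI, elim conjE)
  fix N assume N: "msub (range cst) N" "N \<subseteq> mhull (range cst) B"
  have closed: "a \<in> range cst \<Longrightarrow> b \<in> range cst \<Longrightarrow> a * b \<in> range cst" for a b :: "'k mpoly"
    by (auto simp: cst_mult[symmetric])
  obtain G where G: "G \<subseteq> N" "VS.independent G" "N \<subseteq> VS.span G" by (rule VS.maximal_independent_subset)
  have "mhull (range cst) B \<subseteq> VS.span B"
    by (rule mhull_least) (auto simp: msub_subspace VS.span_superset)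
  then have "finite G" using VS.independent_span_bound[OF assms G(2)] N G by blast
  moreover have "VS.span G \<subseteq> mhull (range cst) G"
  proof (rule VS.span_minimal)
    have "1 \<in> range (cst :: 'k \<Rightarrow> 'k mpoly)" by (metis cst_1 rangeI)
    then show "G \<subseteq> mhull (range cst) G" by (auto intro: mhull_incl)
    show "VS.subspace (mhull (range cst) G)" unfolding msub_subspace[symmetric] by (rule mhull_msub[OF closed])
  qed
  ultimately show "\<exists>G. finite G \<and> G \<subseteq> N \<and> N \<subseteq> mhull (range cst) G" using G by blast
qed

text \<open>
  Hilbert's basis theorem for modules. An element of the module generated by \<open>B\<close> over \<open>R[t]\<close> is a
  polynomial in \<open>t\<close> with coefficients in the \<open>R\<close>-module \<open>Y\<close> generated by \<open>B\<close>, and \<open>rp d v x\<close> says that \<open>v\<close>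
  can be written with degree at most \<open>d\<close> and coefficient \<open>x\<close> at \<open>t\<^sup>d\<close>; representations are not unique.
  The leading coefficients of a submodule, degree by degree, form an increasing chain of submodules of
  \<open>Y\<close>, which is stationary.
\<close>

lemma noeth_step:
  fixes R R' :: "'r::comm_ring_1 set" and B :: "('i \<Rightarrow>\<^sub>0 'r) set" and t :: 'r
  assumes R: "0 \<in> R" "1 \<in> R" "\<And>a b. a \<in> R \<Longrightarrow> b \<in> R \<Longrightarrow> a + b \<in> R" "\<And>a b. a \<in> R \<Longrightarrow> b \<in> R \<Longrightarrow> a * b \<in> R" "\<And>a. a \<in> R \<Longrightarrow> - a \<in> R"
    and R': "R \<subseteq> R'" "t \<in> R'" "\<And>a b. a \<in> R' \<Longrightarrow> b \<in> R' \<Longrightarrow> a * b \<in> R'"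
    and gen: "\<And>c. c \<in> R' \<Longrightarrow> \<exists>d f. (\<forall>j\<le>d. f j \<in> R) \<and> c = (\<Sum>j\<le>(d::nat). t ^ j * f j)"
    and noeth: "noeth R (mhull R B)"
  shows "noeth R' (mhull R' B)"
  unfolding noeth_def
proof (intro allI impI, elim conjE)
  fix N assume N: "msub R' N" "N \<subseteq> mhull R' B"
  define Y where "Y = mhull R B"
  have Y: "msub R Y" unfolding Y_def by (rule mhull_msub[OF R(4)])
  have tk: "t ^ k \<in> R'" for k by (induction k) (use R R' in auto)
  define rp where "rp d v x \<longleftrightarrow> (\<exists>f. (\<forall>j\<le>d. f j \<in> Y) \<and> f d = x \<and> v = (\<Sum>j\<le>d. pscale (t ^ j) (f j)))" for d v x
  have rp0: "rp d 0 0" for d unfolding rp_def by (rule exI[of _ "\<lambda>_. 0"]) (simp add: pscale_simps msubD[OF Y])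
  have rp_add: "rp d (v + w) (x + y)" if r: "rp d v x" "rp d w y" for d v w x y
  proof -
    obtain f g where "\<forall>j\<le>d. f j \<in> Y" "f d = x" "v = (\<Sum>j\<le>d. pscale (t ^ j) (f j))"
      "\<forall>j\<le>d. g j \<in> Y" "g d = y" "w = (\<Sum>j\<le>d. pscale (t ^ j) (g j))" using r unfolding rp_def by auto
    then show ?thesis unfolding rp_def
      by (intro exI[of _ "\<lambda>j. f j + g j"]) (auto simp: pscale_simps sum.distrib msubD[OF Y])
  qed
  have rp_scale: "rp d (pscale c v) (pscale c x)" if r: "rp d v x" "c \<in> R" for d v x c
  proof -
    obtain f where "\<forall>j\<le>d. f j \<in> Y" "f d = x" "v = (\<Sum>j\<le>d. pscale (t ^ j) (f j))" using r unfolding rp_def by blast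
    then show ?thesis using r(2) unfolding rp_def
      by (intro exI[of _ "\<lambda>j. pscale c (f j)"]) (auto simp: pscale_sum pscale_simps(3)[symmetric] mult.commute msubD[OF Y])
  qed
  have rp_shift: "rp (Suc d) (pscale t v) x" if r: "rp d v x" for d v x
  proof -
    obtain f where f: "\<forall>j\<le>d. f j \<in> Y" "f d = x" "v = (\<Sum>j\<le>d. pscale (t ^ j) (f j))" using r unfolding rp_def by blast
    have "pscale t v = (\<Sum>j\<le>Suc d. pscale (t ^ j) (case j of 0 \<Rightarrow> 0 | Suc j \<Rightarrow> f j))"
      by (subst sum.atMost_Suc_shift) (simp add: f(3) pscale_sum pscale_simps)
    with f show ?thesis unfolding rp_def
      by (intro exI[of _ "\<lambda>j. case j of 0 \<Rightarrow> 0 | Suc j \<Rightarrow> f j"]) (auto simp: msubD[OF Y] split: nat.splits)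
  qed
  have rp_shifts: "rp (d + k) (pscale (t ^ k) v) x" if "rp d v x" for d k v x
    by (induction k) (use that rp_shift in \<open>auto simp: pscale_simps\<close>)
  have rp_pad: "\<exists>x. rp (d + k) v x" if r: "rp d v x" for d k v x
  proof -
    obtain f where f: "\<forall>j\<le>d. f j \<in> Y" "f d = x" "v = (\<Sum>j\<le>d. pscale (t ^ j) (f j))" using r unfolding rp_def by blast
    have "v = (\<Sum>j\<le>d + k. pscale (t ^ j) (if j \<le> d then f j else 0))"
      unfolding f(3) by (rule sum.mono_neutral_cong_left) (auto simp: pscale_simps)
    with f show ?thesis unfolding rp_def
      by (intro exI[of _ "if k = 0 then x else 0"] exI[of _ "\<lambda>j. if j \<le> d then f j else 0"]) (auto simp: msubD[OF Y])
  qed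
  have ex: "\<exists>d x. rp d v x" if "v \<in> mhull R' B" for v
    using that
  proof induction
    case mhull_0 then show ?case using rp0 by blast
  next
    case (mhull_step v c g)
    then obtain d x where dx: "rp d v x" by blast
    obtain e f where f: "\<forall>j\<le>e. f j \<in> R" "c = (\<Sum>j\<le>(e::nat). t ^ j * f j)" using gen[OF mhull_step(2)] by blast
    have gX: "g \<in> Y" unfolding Y_def by (rule mhull_incl[OF R(2) mhull_step(3)])
    have ps: "pscale (\<Sum>j\<in>J. h j) g = (\<Sum>j\<in>J. pscale (h j) g)" for h and J :: "nat set"
      by (induction J rule: infinite_finite_induct) (auto simp: pscale_simps)
    have "rp e (pscale c g) (pscale (f e) g)"
      unfolding rp_def by (rule exI[of _ "\<lambda>j. pscale (f j) g"]) (use f(1) gX in \<open>auto simp: f(2) ps pscale_simps msubD[OF Y]\<close>)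
    then obtain y where y: "rp (e + d) (pscale c g) y" using rp_pad by blast
    obtain z where z: "rp (d + e) v z" using rp_pad[OF dx] by blast
    show ?case using rp_add[OF y] z by (metis add.commute)
  qed
  define ND where "ND d = {x. \<exists>v\<in>N. rp d v x}" for d
  have ND_Y: "ND d \<subseteq> Y" for d by (auto simp: ND_def rp_def)
  have ND_msub: "msub R (ND d)" for d
    unfolding msub_def ND_def
  proof (intro conjI ballI)
    show "0 \<in> {x. \<exists>v\<in>N. rp d v x}" using rp0 msubD(1)[OF N(1)] by blast
  next
    fix x y assume "x \<in> {x. \<exists>v\<in>N. rp d v x}" "y \<in> {x. \<exists>v\<in>N. rp d v x}"
    then show "x + y \<in> {x. \<exists>v\<in>N. rp d v x}" using rp_add msubD(2)[OF N(1)] by blast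
  next
    fix c x assume "c \<in> R" "x \<in> {x. \<exists>v\<in>N. rp d v x}"
    then show "pscale c x \<in> {x. \<exists>v\<in>N. rp d v x}" using rp_scale msubD(3)[OF N(1)] R'(1) by blast
  qed
  have ND_Suc: "ND d \<subseteq> ND (Suc d)" for d
    unfolding ND_def using rp_shift msubD(3)[OF N(1) R'(2)] by blast
  then have ND_mono: "d \<le> e \<Longrightarrow> ND d \<subseteq> ND e" for d e by (rule lift_Suc_mono_le)
  have nY: "\<exists>G. finite G \<and> G \<subseteq> N' \<and> N' \<subseteq> mhull R G" if "msub R N'" "N' \<subseteq> Y" for N'
    using noeth that unfolding noeth_def Y_def by simp
  have ms: "msub R (\<Union>d. ND d)"
    unfolding msub_def
  proof (intro conjI ballI)
    fix x y assume "x \<in> (\<Union>d. ND d)" "y \<in> (\<Union>d. ND d)"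
    then obtain d e where "x \<in> ND d" "y \<in> ND e" by blast
    then have "x \<in> ND (max d e)" "y \<in> ND (max d e)" using ND_mono[of d "max d e"] ND_mono[of e "max d e"] by auto
    then show "x + y \<in> (\<Union>d. ND d)" using msubD(2)[OF ND_msub] by blast
  next
    show "0 \<in> (\<Union>d. ND d)" by (rule UN_I[where a = 0]) (simp_all add: msubD(1)[OF ND_msub])
  next
    fix c x assume c: "c \<in> R" and "x \<in> (\<Union>d. ND d)"
    from this(2) show "pscale c x \<in> (\<Union>d. ND d)"
    proof (rule UN_E)
      fix d assume "x \<in> ND d"
      from msubD(3)[OF ND_msub c this] show ?thesis by (intro UN_I[where a = d]) simp_all
    qed
  qed
  obtain GI where GI: "finite GI" "GI \<subseteq> (\<Union>d. ND d)" "(\<Union>d. ND d) \<subseteq> mhull R GI"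
    using nY[OF ms UN_least[OF ND_Y]] by (elim exE conjE)
  have "\<exists>D. GI \<subseteq> ND D"
    using GI(1,2)
  proof (induction GI rule: finite_induct)
    case (insert x F)
    then obtain D d where "F \<subseteq> ND D" "x \<in> ND d" by auto
    then have "insert x F \<subseteq> ND (max d D)" using ND_mono[of d "max d D"] ND_mono[of D "max d D"] by auto
    then show ?case by blast
  qed auto
  then obtain D where D: "GI \<subseteq> ND D" by blast
  have ND_D: "ND d \<subseteq> ND D" for d
    using GI(3) mhull_least[OF ND_msub D] by blast
  have "\<forall>d. \<exists>G. finite G \<and> G \<subseteq> ND d \<and> ND d \<subseteq> mhull R G"
    by (intro allI nY ND_msub ND_Y)
  then obtain GG where GG: "\<And>d. finite (GG d)" "\<And>d. GG d \<subseteq> ND d" "\<And>d. ND d \<subseteq> mhull R (GG d)" by metis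
  have "\<forall>d g. \<exists>v. g \<in> GG d \<longrightarrow> v \<in> N \<and> rp d v g" using GG(2) unfolding ND_def by blast
  then obtain lift where lift: "\<And>d g. g \<in> GG d \<Longrightarrow> lift d g \<in> N \<and> rp d (lift d g) g" by metis
  \<comment> \<open>lifts of generators of the modules of leading coefficients, up to a degree \<open>D\<close> where the chain is stationary\<close>
  define G where "G = (\<Union>d\<in>{..D}. lift d ` GG d)"
  have G: "finite G" "G \<subseteq> N" using GG(1) lift by (auto simp: G_def)
  have GN: "mhull R' G \<subseteq> N" by (rule mhull_least[OF N(1) G(2)])
  have approx: "\<exists>u\<in>mhull R' G. rp d u x" if "e \<le> D" "e \<le> d" "x \<in> mhull R (GG e)" for d e x
    using that(3)
  proof induction
    case mhull_0 then show ?case using rp0 mhull.mhull_0 by blast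
  next
    case (mhull_step x c g)
    then obtain u where u: "u \<in> mhull R' G" "rp d u x" by blast
    have "rp (e + (d - e)) (pscale (t ^ (d - e)) (lift e g)) g" by (rule rp_shifts) (use lift mhull_step in blast)
    then have "rp d (pscale (t ^ (d - e)) (lift e g)) g" using that by simp
    from rp_add[OF rp_scale[OF this mhull_step(2)] u(2)]
    have "rp d (pscale (c * t ^ (d - e)) (lift e g) + u) (pscale c g + x)" by (simp add: pscale_simps)
    moreover have "pscale (c * t ^ (d - e)) (lift e g) + u \<in> mhull R' G"
      by (rule mhull.mhull_step[OF u(1)]) (use mhull_step that R' tk in \<open>auto simp: G_def\<close>)
    ultimately show ?case by blast
  qed
  \<comment> \<open>subtracting an element of the span of \<open>G\<close> with the same leading coefficient lowers the degree\<close>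
  have main: "v \<in> mhull R' G" if "v \<in> N" "rp d v x" for d v x
    using that
  proof (induction d arbitrary: v x)
    case 0
    then have "x \<in> ND 0" by (auto simp: ND_def)
    then obtain u where u: "u \<in> mhull R' G" "rp 0 u x" using approx[of 0 0 x] GG(3)[of 0] by blast
    then have "v = u" using 0 by (auto simp: rp_def)
    with u show ?case by simp
  next
    case (Suc d)
    have "x \<in> ND (min (Suc d) D)" using Suc.prems ND_D by (cases "Suc d \<le> D") (auto simp: ND_def min_def)
    then obtain u where u: "u \<in> mhull R' G" "rp (Suc d) u x"
      using approx[of "min (Suc d) D" "Suc d" x] GG(3) by auto
    obtain f where f: "\<forall>j\<le>Suc d. f j \<in> Y" "f (Suc d) = x" "v = (\<Sum>j\<le>Suc d. pscale (t ^ j) (f j))" using Suc.prems unfolding rp_def by blast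
    obtain g where g: "\<forall>j\<le>Suc d. g j \<in> Y" "g (Suc d) = x" "u = (\<Sum>j\<le>Suc d. pscale (t ^ j) (g j))" using u unfolding rp_def by blast
    have neg: "- y \<in> Y" if "y \<in> Y" for y using msubD(3)[OF Y R(5)[OF R(2)] that] by (simp add: pscale_simps)
    have "v - u = (\<Sum>j\<le>d. pscale (t ^ j) (f j - g j))"
      by (simp add: f(2,3) g(2,3) pscale_simps sum_subtractf)
    moreover have "f j - g j \<in> Y" if "j \<le> d" for j
      using msubD(2)[OF Y, of "f j" "- g j"] f g that neg by simp
    ultimately have "rp d (v - u) (f d - g d)" unfolding rp_def by (intro exI[of _ "\<lambda>j. f j - g j"]) auto
    moreover have "v - u \<in> N"
    proof -
      have "- 1 \<in> R'" using R R' by auto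
      then have "pscale (- 1) u \<in> N" using msubD(3)[OF N(1)] GN u by blast
      then show ?thesis using msubD(2)[OF N(1) Suc.prems(1), of "- u"] by (simp add: pscale_simps)
    qed
    ultimately have "v - u \<in> mhull R' G" by (rule Suc.IH[rotated])
    then show ?case using mhull_add[OF _ u(1), of "v - u"] by simp
  qed
  have "N \<subseteq> mhull R' G" using main ex N(2) by blast
  with G show "\<exists>G. finite G \<and> G \<subseteq> N \<and> N \<subseteq> mhull R' G" by blast
qed

lemma alg_gen_insert_expand:
  assumes "c \<in> alg_gen (insert t S)"
  shows "\<exists>d f. (\<forall>j\<le>d. f j \<in> alg_gen S) \<and> c = (\<Sum>j\<le>(d::nat). t ^ j * f j)"
proof -
  have "\<exists>p :: 'a mpoly poly. (\<forall>j. coeff p j \<in> alg_gen S) \<and> c = poly p t"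
    using assms
  proof induction
    case (alg_cst c)
    show ?case by (rule exI[of _ "[:cst c:]"]) (auto simp: coeff_pCons alg_gen_0 alg_gen.alg_cst split: nat.splits)
  next
    case (alg_gen s)
    show ?case
    proof (cases "s = t")
      case True
      then show ?thesis by (intro exI[of _ "[:0, 1:]"]) (auto simp: coeff_pCons alg_gen_0 alg_gen_1 split: nat.splits)
    next
      case False
      then have "s \<in> S" using alg_gen by simp
      then show ?thesis by (intro exI[of _ "[:s:]"]) (auto simp: coeff_pCons alg_gen_0 alg_gen.alg_gen split: nat.splits)
    qed
  next
    case (alg_add a b)
    then obtain p p' :: "'a mpoly poly" where "\<forall>j. coeff p j \<in> alg_gen S" "a = poly p t" "\<forall>j. coeff p' j \<in> alg_gen S" "b = poly p' t" by blast
    then show ?case by (intro exI[of _ "p + p'"]) (auto intro: alg_gen.alg_add)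
  next
    case (alg_mult a b)
    then obtain p p' :: "'a mpoly poly" where "\<forall>j. coeff p j \<in> alg_gen S" "a = poly p t" "\<forall>j. coeff p' j \<in> alg_gen S" "b = poly p' t" by blast
    then show ?case by (intro exI[of _ "p * p'"]) (auto simp: coeff_mult intro!: alg_gen_sum alg_gen.alg_mult)
  qed
  then obtain p :: "'a mpoly poly" where "\<forall>j. coeff p j \<in> alg_gen S" "c = poly p t" by blast
  then show ?thesis by (intro exI[of _ "degree p"] exI[of _ "coeff p"]) (auto simp: poly_altdef mult.commute)
qed

text \<open>Adjoin the generators one at a time, starting from finite dimensional vector spaces.\<close>

lemma noeth_alg_gen:
  fixes B :: "('i \<Rightarrow>\<^sub>0 'k::field mpoly) set" and t :: "nat \<Rightarrow> 'k mpoly"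
  assumes "finite B"
  shows "noeth (alg_gen (t ` {..<n})) (mhull (alg_gen (t ` {..<n})) B)"
proof (induction n)
  case 0
  have "alg_gen {} = range (cst :: 'k \<Rightarrow> 'k mpoly)"
  proof (intro equalityI subsetI)
    fix x :: "'k mpoly" assume "x \<in> alg_gen {}" then show "x \<in> range cst"
      by induction (auto simp: cst_add[symmetric] cst_mult[symmetric])
  qed (auto intro: alg_cst)
  then show ?case using noeth_base[OF assms] by simp
next
  case (Suc n)
  show ?case
  proof (rule noeth_step[OF _ _ _ _ _ _ _ _ _ Suc])
    show "\<And>c. c \<in> alg_gen (t ` {..<Suc n}) \<Longrightarrow> \<exists>d f. (\<forall>j\<le>d. f j \<in> alg_gen (t ` {..<n})) \<and> c = (\<Sum>j\<le>d. t n ^ j * f j)"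
      using alg_gen_insert_expand[of _ "t n" "t ` {..<n}"] by (simp add: lessThan_Suc)
    show "alg_gen (t ` {..<n}) \<subseteq> alg_gen (t ` {..<Suc n})"
      by (auto elim!: alg_gen_trans intro: alg_gen)
  qed (auto intro: alg_gen_0 alg_gen_1 alg_add alg_mult alg_gen_uminus alg_gen)
qed

section \<open>Spans, free and finitely generated modules\<close>

context ring begin

lemma left_span_least:
  assumes "Z \<subseteq> carrier R" "\<zero> \<in> Z" "\<And>x y. x \<in> Z \<Longrightarrow> y \<in> Z \<Longrightarrow> x \<oplus> y \<in> Z" "\<And>s b. s \<in> S \<Longrightarrow> b \<in> B \<Longrightarrow> s \<otimes> b \<in> Z"
  shows "left_span R S B \<subseteq> Z"
proof
  fix x assume "x \<in> left_span R S B"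
  then obtain F c where F: "finite F" "F \<subseteq> B" "c \<in> F \<rightarrow> S" "x = (\<Oplus>b\<in>F. c b \<otimes> b)" by (auto simp: left_span_def)
  have "(\<Oplus>b\<in>F. c b \<otimes> b) \<in> Z"
    using F(1-3)
  proof (induction F rule: finite_induct)
    case (insert b F)
    then have "c b \<otimes> b \<in> Z" "\<forall>b\<in>F. c b \<otimes> b \<in> Z" using assms(4) by (auto simp: Pi_iff)
    then have "c b \<otimes> b \<in> Z" "c b \<otimes> b \<in> carrier R" "(\<lambda>b. c b \<otimes> b) \<in> F \<rightarrow> carrier R" using assms(1) by auto
    then show ?case using insert assms(3) by (simp add: Pi_iff)
  qed (use assms in auto)
  then show "x \<in> Z" by (simp add: F)
qed

context
  fixes S B
  assumes S: "S \<subseteq> carrier R" "\<zero> \<in> S" "\<one> \<in> S" "\<And>x y. x \<in> S \<Longrightarrow> y \<in> S \<Longrightarrow> x \<oplus> y \<in> S" "\<And>x y. x \<in> S \<Longrightarrow> y \<in> S \<Longrightarrow> x \<otimes> y \<in> S"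
    and B: "B \<subseteq> carrier R"
begin

lemma left_span_zero: "\<zero> \<in> left_span R S B"
  unfolding left_span_def by (auto intro!: exI[of _ "{}"])

lemma left_span_add:
  assumes "x \<in> left_span R S B" "y \<in> left_span R S B"
  shows "x \<oplus> y \<in> left_span R S B"
proof -
  obtain F c where F: "finite F" "F \<subseteq> B" "c \<in> F \<rightarrow> S" "x = (\<Oplus>b\<in>F. c b \<otimes> b)" using assms by (auto simp: left_span_def)
  obtain G d where G: "finite G" "G \<subseteq> B" "d \<in> G \<rightarrow> S" "y = (\<Oplus>b\<in>G. d b \<otimes> b)" using assms by (auto simp: left_span_def)
  define c' where "c' b = (if b \<in> F then c b else \<zero>)" for b
  define d' where "d' b = (if b \<in> G then d b else \<zero>)" for b
  have cd: "c' b \<in> S" "d' b \<in> S" for b using F G S by (auto simp: c'_def d'_def)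
  have cdc: "c' b \<in> carrier R" "d' b \<in> carrier R" for b using cd S by auto
  have FG: "b \<in> F \<union> G \<Longrightarrow> b \<in> carrier R" for b using F G B by auto
  have x: "x = (\<Oplus>b\<in>F \<union> G. c' b \<otimes> b)"
    unfolding F(4) by (rule add.finprod_mono_neutral_cong_left) (use F G FG cdc in \<open>auto simp: c'_def Pi_iff\<close>)
  have y: "y = (\<Oplus>b\<in>F \<union> G. d' b \<otimes> b)"
    unfolding G(4) by (rule add.finprod_mono_neutral_cong_left) (use F G FG cdc in \<open>auto simp: d'_def Pi_iff\<close>)
  have "x \<oplus> y = (\<Oplus>b\<in>F \<union> G. c' b \<otimes> b \<oplus> d' b \<otimes> b)"
    unfolding x y by (rule finsum_addf[symmetric]) (use FG cdc in auto)
  also have "\<dots> = (\<Oplus>b\<in>F \<union> G. (c' b \<oplus> d' b) \<otimes> b)"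
    by (rule finsum_cong') (use FG cdc in \<open>auto simp: l_distr\<close>)
  finally have "x \<oplus> y = (\<Oplus>b\<in>F \<union> G. (c' b \<oplus> d' b) \<otimes> b)" .
  then show ?thesis unfolding left_span_def
    using F G cd S by (intro CollectI exI[of _ "F \<union> G"] exI[of _ "\<lambda>b. c' b \<oplus> d' b"]) auto
qed

lemma left_span_mult:
  assumes "s \<in> S" "x \<in> left_span R S B"
  shows "s \<otimes> x \<in> left_span R S B"
proof -
  obtain F c where F: "finite F" "F \<subseteq> B" "c \<in> F \<rightarrow> S" "x = (\<Oplus>b\<in>F. c b \<otimes> b)" using assms by (auto simp: left_span_def)
  have cc: "b \<in> F \<Longrightarrow> c b \<in> carrier R" "b \<in> F \<Longrightarrow> b \<in> carrier R" for b using F S B by auto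
  have sc: "s \<in> carrier R" using assms S by auto
  have "s \<otimes> x = (\<Oplus>b\<in>F. s \<otimes> (c b \<otimes> b))"
    unfolding F(4) by (rule finsum_rdistr) (use F cc sc in auto)
  also have "\<dots> = (\<Oplus>b\<in>F. (s \<otimes> c b) \<otimes> b)"
    by (rule finsum_cong') (use cc sc in \<open>auto simp: m_assoc\<close>)
  finally show ?thesis unfolding left_span_def
    using F S(5)[OF assms(1)] by (intro CollectI exI[of _ F] exI[of _ "\<lambda>b. s \<otimes> c b"]) (auto simp: Pi_iff)
qed

lemma left_span_incl: "b \<in> B \<Longrightarrow> b \<in> left_span R S B"
  unfolding left_span_def using S B by (intro CollectI exI[of _ "{b}"] exI[of _ "\<lambda>_. \<one>"]) auto

end

lemma ring_opposite: "ring (opposite_ring R)"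
proof -
  have "abelian_group (opposite_ring R)"
    by (rule abelian_groupI) (use add.l_inv_ex in \<open>auto simp: opposite_ring_def a_assoc a_comm a_lcomm\<close>)
  moreover have "Group.monoid (opposite_ring R)"
    by (rule monoidI) (auto simp: opposite_ring_def m_assoc)
  ultimately show ?thesis by (rule ringI) (auto simp: opposite_ring_def l_distr r_distr)
qed

end

lemma finsum_hom:
  assumes "ring R" "ring R'" "\<phi> \<in> ring_hom R R'" "f \<in> I \<rightarrow> carrier R" "finite I"
  shows "\<phi> (finsum R f I) = finsum R' (\<lambda>i. \<phi> (f i)) I"
proof -
  interpret R: ring R by fact
  interpret R': ring R' by fact
  interpret h: ring_hom_ring R R' \<phi> by (rule ring_hom_ringI2) fact+
  show ?thesis using h.hom_finsum[of f I] assms(4) by (simp add: o_def)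
qed

text \<open>Freeness is transported along injective ring homomorphisms. It is used for the isomorphism between the
model of the invariants and the algebra itself, and for its opposite.\<close>

lemma left_free_image:
  assumes R: "ring R" "ring R'" and h: "\<phi> \<in> ring_hom R R'" and inj: "inj_on \<phi> (carrier R)"
    and S: "S \<subseteq> carrier R" and N: "N \<subseteq> carrier R" and free: "left_free R S N"
  shows "left_free R' (\<phi> ` S) (\<phi> ` N)"
proof -
  interpret R: ring R by fact
  interpret R': ring R' by fact
  obtain B where B: "B \<subseteq> N" "left_span R S B = N"
    "\<forall>F c. finite F \<and> F \<subseteq> B \<and> c \<in> F \<rightarrow> S \<and> (\<Oplus>\<^bsub>R\<^esub>b\<in>F. c b \<otimes>\<^bsub>R\<^esub> b) = \<zero>\<^bsub>R\<^esub> \<longrightarrow> (\<forall>b\<in>F. c b = \<zero>\<^bsub>R\<^esub>)"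
    using free unfolding left_free_def by (elim exE conjE)
  have BC: "B \<subseteq> carrier R" using B N by auto
  have h0: "\<phi> \<zero>\<^bsub>R\<^esub> = \<zero>\<^bsub>R'\<^esub>" by (rule ring_hom_zero[OF h R])
  have key: "\<exists>F c. finite F \<and> F \<subseteq> B \<and> c \<in> F \<rightarrow> S \<and> F' = \<phi> ` F \<and> (\<forall>b\<in>F. c' (\<phi> b) = \<phi> (c b)) \<and>
      (\<Oplus>\<^bsub>R'\<^esub>b\<in>F'. c' b \<otimes>\<^bsub>R'\<^esub> b) = \<phi> (\<Oplus>\<^bsub>R\<^esub>b\<in>F. c b \<otimes>\<^bsub>R\<^esub> b)"
    if F': "finite F'" "F' \<subseteq> \<phi> ` B" "c' \<in> F' \<rightarrow> \<phi> ` S" for F' c'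
  proof -
    define F where "F = {b \<in> B. \<phi> b \<in> F'}"
    have injB: "inj_on \<phi> B" using inj BC by (rule inj_on_subset)
    have FF: "F' = \<phi> ` F" using F'(2) by (auto simp: F_def)
    have "finite (\<phi> ` F)" using F'(1) by (simp add: FF)
    then have fin: "finite F" by (rule finite_imageD) (rule inj_on_subset[OF injB], auto simp: F_def)
    have "\<forall>b\<in>F. \<exists>s\<in>S. c' (\<phi> b) = \<phi> s" using F'(3) FF by auto
    then obtain c where c: "\<And>b. b \<in> F \<Longrightarrow> c b \<in> S \<and> c' (\<phi> b) = \<phi> (c b)" by metis
    have carr: "b \<in> F \<Longrightarrow> b \<in> carrier R \<and> c b \<in> carrier R" for b using c S BC by (auto simp: F_def)
    have mc: "b \<in> F \<Longrightarrow> \<phi> (c b) \<otimes>\<^bsub>R'\<^esub> \<phi> b = \<phi> (c b \<otimes>\<^bsub>R\<^esub> b)" for b using ring_hom_mult[OF h] carr by simp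
    have "(\<Oplus>\<^bsub>R'\<^esub>b\<in>F'. c' b \<otimes>\<^bsub>R'\<^esub> b) = (\<Oplus>\<^bsub>R'\<^esub>b\<in>F. c' (\<phi> b) \<otimes>\<^bsub>R'\<^esub> \<phi> b)"
      unfolding FF
      by (rule R'.add.finprod_reindex) (use c carr ring_hom_closed[OF h] inj_on_subset[OF injB] in \<open>auto simp: F_def\<close>)
    also have "\<dots> = (\<Oplus>\<^bsub>R'\<^esub>b\<in>F. \<phi> (c b \<otimes>\<^bsub>R\<^esub> b))"
      by (rule R'.finsum_cong') (use c mc carr ring_hom_closed[OF h] in auto)
    also have "\<dots> = \<phi> (\<Oplus>\<^bsub>R\<^esub>b\<in>F. c b \<otimes>\<^bsub>R\<^esub> b)"
      by (rule finsum_hom[OF R h, symmetric]) (use carr fin in auto)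
    finally have e: "(\<Oplus>\<^bsub>R'\<^esub>b\<in>F'. c' b \<otimes>\<^bsub>R'\<^esub> b) = \<phi> (\<Oplus>\<^bsub>R\<^esub>b\<in>F. c b \<otimes>\<^bsub>R\<^esub> b)" .
    have "F \<subseteq> B" "c \<in> F \<rightarrow> S" "\<forall>b\<in>F. c' (\<phi> b) = \<phi> (c b)" using c by (auto simp: F_def)
    with fin FF e show ?thesis by (intro exI[of _ F] exI[of _ c] conjI)
  qed
  show ?thesis
    unfolding left_free_def
  proof (intro exI[of _ "\<phi> ` B"] conjI allI impI)
    show "\<phi> ` B \<subseteq> \<phi> ` N" using B by auto
    show "left_span R' (\<phi> ` S) (\<phi> ` B) = \<phi> ` N"
    proof (intro equalityI subsetI)
      fix x assume "x \<in> left_span R' (\<phi> ` S) (\<phi> ` B)"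
      then obtain F' c' where F': "finite F'" "F' \<subseteq> \<phi> ` B" "c' \<in> F' \<rightarrow> \<phi> ` S" "x = (\<Oplus>\<^bsub>R'\<^esub>b\<in>F'. c' b \<otimes>\<^bsub>R'\<^esub> b)"
        unfolding left_span_def by blast
      then show "x \<in> \<phi> ` N" using key[OF F'(1-3)] B(2) unfolding left_span_def by blast
    next
      fix x assume "x \<in> \<phi> ` N"
      then obtain F c where F: "finite F" "F \<subseteq> B" "c \<in> F \<rightarrow> S" "x = \<phi> (\<Oplus>\<^bsub>R\<^esub>b\<in>F. c b \<otimes>\<^bsub>R\<^esub> b)"
        unfolding B(2)[symmetric] left_span_def by blast
      have injF: "inj_on \<phi> F" by (rule inj_on_subset[OF inj]) (use F BC in auto)
      have carr: "b \<in> F \<Longrightarrow> b \<in> carrier R \<and> c b \<in> carrier R" for b using F S BC by auto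
      define c' where "c' y = \<phi> (c (the_inv_into F \<phi> y))" for y
      have c': "b \<in> F \<Longrightarrow> c' (\<phi> b) = \<phi> (c b)" for b by (simp add: c'_def the_inv_into_f_f[OF injF])
      have "x = (\<Oplus>\<^bsub>R'\<^esub>b\<in>F. \<phi> (c b \<otimes>\<^bsub>R\<^esub> b))"
        unfolding F(4) by (rule finsum_hom[OF R h]) (use carr F in auto)
      also have "\<dots> = (\<Oplus>\<^bsub>R'\<^esub>b\<in>F. c' (\<phi> b) \<otimes>\<^bsub>R'\<^esub> \<phi> b)"
        by (rule R'.finsum_cong') (use carr c' ring_hom_mult[OF h] ring_hom_closed[OF h] in auto)
      also have "\<dots> = (\<Oplus>\<^bsub>R'\<^esub>b\<in>\<phi> ` F. c' b \<otimes>\<^bsub>R'\<^esub> b)"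
        by (rule R'.add.finprod_reindex[symmetric]) (use carr c' ring_hom_closed[OF h] injF in auto)
      finally show "x \<in> left_span R' (\<phi> ` S) (\<phi> ` B)"
        unfolding left_span_def using F c' by (intro CollectI exI[of _ "\<phi> ` F"] exI[of _ c']) auto
    qed
    fix F' c' assume F': "finite F' \<and> F' \<subseteq> \<phi> ` B \<and> c' \<in> F' \<rightarrow> \<phi> ` S \<and> (\<Oplus>\<^bsub>R'\<^esub>b\<in>F'. c' b \<otimes>\<^bsub>R'\<^esub> b) = \<zero>\<^bsub>R'\<^esub>"
    then obtain F c where F: "finite F" "F \<subseteq> B" "c \<in> F \<rightarrow> S" "F' = \<phi> ` F" "\<forall>b\<in>F. c' (\<phi> b) = \<phi> (c b)"
      "\<zero>\<^bsub>R'\<^esub> = \<phi> (\<Oplus>\<^bsub>R\<^esub>b\<in>F. c b \<otimes>\<^bsub>R\<^esub> b)" using key[of F' c'] by auto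
    have "(\<Oplus>\<^bsub>R\<^esub>b\<in>F. c b \<otimes>\<^bsub>R\<^esub> b) \<in> carrier R"
      using F(2,3) S BC by (intro R.finsum_closed funcsetI R.m_closed) (auto simp: Pi_iff)
    then have "(\<Oplus>\<^bsub>R\<^esub>b\<in>F. c b \<otimes>\<^bsub>R\<^esub> b) = \<zero>\<^bsub>R\<^esub>" using inj_onD[OF inj] F(6) h0 by auto
    then have "\<forall>b\<in>F. c b = \<zero>\<^bsub>R\<^esub>" using B(3) F by blast
    then show "\<forall>b\<in>F'. c' b = \<zero>\<^bsub>R'\<^esub>" using F h0 by auto
  qed
qed

section \<open>The skew monoid ring\<close>

text \<open>The inclusion of the model into the crossed product with rational coefficients.\<close>

definition toFm :: "('x \<Rightarrow>\<^sub>0 'r::idom) \<Rightarrow> ('x \<Rightarrow>\<^sub>0 'r fract)" where "toFm v = Poly_Mapping.map toF v"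

lemma lookup_toFm [simp]: "lookup (toFm v) a = toF (lookup v a)"
  by (simp add: toFm_def Poly_Mapping.map.rep_eq when_def toF_simps)

lemma toFm_inj [simp]: "toFm v = toFm w \<longleftrightarrow> v = w"
proof
  assume "toFm v = toFm w"
  then have "lookup (toFm v) a = lookup (toFm w) a" for a by simp
  then show "v = w" by (intro poly_mapping_eqI) simp
qed simp

lemma toFm_simps: "toFm (v + w) = toFm v + toFm w" "toFm 0 = 0" "toFm (pscale c v) = pscale (toF c) (toFm v)"
   "toFm (single a c) = single a (toF c)" "toFm 1 = 1"
  by (auto intro!: poly_mapping_eqI simp: lookup_add toF_simps lookup_single when_def lookup_one)

lemma keys_toFm [simp]: "keys (toFm v) = keys v" by (auto simp: in_keys_iff)

sublocale invariants \<subseteq> E: crossed "Fsig q"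
  by unfold_locales (auto simp: Fsig_hom Fsig_0 Fsig_add q_nonzero)

context invariants begin

lemma toFm_tmul: "toFm (D.tmul q f g) = E.tmul (toFm f) (toFm g)"
proof (induction f rule: pm_add_induct)
  case (add a c f)
  have "toFm (D.tmul q (single a c) g) = E.tmul (toFm (single a c)) (toFm g)"
    by (induction g rule: pm_add_induct)
      (simp_all add: toFm_simps D.tmul_add_r E.tmul_add_r D.tmul_single E.tmul_single toF_simps Fsig_toF q_nonzero)
  with add show ?case by (simp add: toFm_simps D.tmul_add_l E.tmul_add_l)
qed (simp add: toFm_simps)

text \<open>The skew monoid ring is the crossed product of \<open>L\<close> with the monoid \<open>MM\<close> of exponents.\<close>

definition EM :: "(expo \<Rightarrow>\<^sub>0 'k mpoly fract) set" where "EM = {f. keys f \<subseteq> MM \<and> (\<forall>a. lookup f a \<in> Ln n)}"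

definition Er :: "(expo \<Rightarrow>\<^sub>0 'k mpoly fract) ring" where
  "Er = \<lparr>carrier = EM, monoid.mult = E.tmul, one = 1, ring.zero = 0, ring.add = (+)\<rparr>"

lemma EM_add: "f \<in> EM \<Longrightarrow> g \<in> EM \<Longrightarrow> f + g \<in> EM"
  unfolding EM_def using keys_in_add[of f MM g] by (auto simp: lookup_add Ln_add)
lemma EM_uminus: "f \<in> EM \<Longrightarrow> - f \<in> EM"
  unfolding EM_def by (auto simp: lookup_uminus Ln_uminus)
lemma EM_tmul: "f \<in> EM \<Longrightarrow> g \<in> EM \<Longrightarrow> E.tmul f g \<in> EM"
  using E.tmul_in[of MM "Ln n" f g] by (auto simp: EM_def MM_add Ln_add Ln_mult Fsig_Ln q_nonzero)
lemma EM_single: "a \<in> MM \<Longrightarrow> l \<in> Ln n \<Longrightarrow> single a l \<in> EM"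
  by (auto simp: EM_def lookup_single when_def)
lemma EM_0 [simp]: "0 \<in> EM" and EM_1 [simp]: "1 \<in> EM"
  using EM_single[OF MM_0 Ln_0] EM_single[OF MM_0 Ln_1] by simp_all
lemma EM_pscale: "l \<in> Ln n \<Longrightarrow> f \<in> EM \<Longrightarrow> pscale l f \<in> EM"
  using keys_pscale[of l f] by (auto simp: EM_def Ln_mult)
lemma EM_lookup: "f \<in> EM \<Longrightarrow> lookup f a \<in> Ln n" and EM_outside: "f \<in> EM \<Longrightarrow> a \<notin> MM \<Longrightarrow> lookup f a = 0"
  by (auto simp: EM_def in_keys_iff)

lemma ring_Er: "ring Er"
proof -
  have "abelian_group Er"
    by (rule abelian_groupI) (auto simp: Er_def algebra_simps EM_add intro: bexI[OF _ EM_uminus])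
  moreover have "Group.monoid Er"
    by (rule monoidI) (auto simp: Er_def E.tmul_assoc EM_tmul)
  ultimately show ?thesis by (rule ringI) (auto simp: Er_def E.tmul_add_l E.tmul_add_r)
qed

abbreviation SK :: "(('k mpoly fract \<Rightarrow> 'k mpoly fract) \<Rightarrow> 'k mpoly fract) ring" where "SK \<equiv> skew_monoid_ring L MS"

text \<open>The isomorphism onto the skew monoid ring of the definitions, whose elements are functions on the set
of automorphisms \<open>\<sigma> a\<close> instead of functions of \<open>a\<close>. It exists because the \<open>\<sigma> a\<close> are distinct.\<close>

definition \<xi> :: "(expo \<Rightarrow>\<^sub>0 'k mpoly fract) \<Rightarrow> ('k mpoly fract \<Rightarrow> 'k mpoly fract) \<Rightarrow> 'k mpoly fract" where
  "\<xi> f = (\<lambda>m\<in>MS. lookup f (the_inv_into MM \<sigma> m))"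

lemma \<sigma>_inj_MM: "inj_on \<sigma> MM"
  using \<sigma>_inj MM_Nn by (auto simp: inj_on_def)

lemma \<sigma>_MS [simp]: "a \<in> MM \<Longrightarrow> \<sigma> a \<in> MS" by (simp add: MS_def)

lemma \<xi>_\<sigma> [simp]: "a \<in> MM \<Longrightarrow> \<xi> f (\<sigma> a) = lookup f a"
  by (simp add: \<xi>_def the_inv_into_f_f[OF \<sigma>_inj_MM])

lemma \<xi>_ext: "\<xi> f \<in> extensional MS" by (simp add: \<xi>_def)

lemma MS_eqI: "x \<in> extensional MS \<Longrightarrow> y \<in> extensional MS \<Longrightarrow> (\<And>a. a \<in> MM \<Longrightarrow> x (\<sigma> a) = y (\<sigma> a)) \<Longrightarrow> x = y"
  by (rule extensionalityI[of _ MS]) (auto simp: MS_def)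

lemma SK_simps: "carrier SK = {f \<in> MS \<rightarrow>\<^sub>E Ln n. finite {m \<in> MS. f m \<noteq> 0}}"
  "\<one>\<^bsub>SK\<^esub> = (\<lambda>m\<in>MS. if m = \<one>\<^bsub>BG\<^esub> then 1 else 0)" "\<zero>\<^bsub>SK\<^esub> = (\<lambda>m\<in>MS. 0)" "x \<oplus>\<^bsub>SK\<^esub> y = (\<lambda>m\<in>MS. x m + y m)"
  by (simp_all add: skew_monoid_ring_def cong del: if_weak_cong)

lemma \<xi>_carrier: "f \<in> EM \<Longrightarrow> \<xi> f \<in> carrier SK"
proof -
  assume f: "f \<in> EM"
  have "{m \<in> MS. \<xi> f m \<noteq> 0} \<subseteq> \<sigma> ` keys f" by (auto simp: MS_def in_keys_iff)
  then have "finite {m \<in> MS. \<xi> f m \<noteq> 0}" by (rule finite_subset) simp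
  moreover have "\<xi> f m \<in> Ln n" if "m \<in> MS" for m using that f by (simp add: \<xi>_def EM_lookup)
  ultimately show ?thesis by (simp add: SK_simps PiE_iff \<xi>_ext)
qed

lemma \<xi>_inj: "inj_on \<xi> EM"
proof (rule inj_onI)
  fix f g assume *: "f \<in> EM" "g \<in> EM" "\<xi> f = \<xi> g"
  show "f = g"
  proof (rule poly_mapping_eqI)
    fix a
    show "lookup f a = lookup g a"
    proof (cases "a \<in> MM")
      case True then show ?thesis using fun_cong[OF *(3), of "\<sigma> a"] by simp
    qed (use * EM_outside in auto)
  qed
qed

lemma \<xi>_surj: assumes "x \<in> carrier SK" shows "\<exists>f\<in>EM. x = \<xi> f"
proof -
  have x: "x \<in> MS \<rightarrow>\<^sub>E Ln n" "finite {m \<in> MS. x m \<noteq> 0}" using assms by (auto simp: SK_simps)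
  define S where "S = {a \<in> MM. x (\<sigma> a) \<noteq> 0}"
  have "finite (\<sigma> ` S)" by (rule finite_subset[OF _ x(2)]) (auto simp: S_def)
  then have S: "finite S" by (rule finite_imageD) (rule inj_on_subset[OF \<sigma>_inj_MM], auto simp: S_def)
  define f where "f = (\<Sum>a\<in>S. single a (x (\<sigma> a)))"
  have f: "lookup f a = (if a \<in> MM then x (\<sigma> a) else 0)" for a
  proof -
    have "lookup f a = (\<Sum>b\<in>S. if b = a then x (\<sigma> b) else 0)" by (simp add: f_def lookup_sum lookup_single when_def)
    also have "\<dots> = (if a \<in> S then x (\<sigma> a) else 0)" using S by simp
    finally show ?thesis by (auto simp: S_def)
  qed
  have "f \<in> EM" using x(1) by (auto simp: EM_def in_keys_iff f PiE_iff split: if_splits)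
  moreover have "x = \<xi> f" by (rule MS_eqI) (use x(1) in \<open>auto simp: \<xi>_ext f PiE_iff\<close>)
  ultimately show ?thesis by blast
qed

lemma \<xi>_bij: "bij_betw \<xi> EM (carrier SK)"
  using \<xi>_inj \<xi>_carrier \<xi>_surj by (auto simp: bij_betw_def)

lemma \<xi>_mult: assumes f: "f \<in> EM" and g: "g \<in> EM" shows "\<xi> (E.tmul f g) = \<xi> f \<otimes>\<^bsub>SK\<^esub> \<xi> g"
proof (rule MS_eqI)
  show "\<xi> f \<otimes>\<^bsub>SK\<^esub> \<xi> g \<in> extensional MS" by (simp add: skew_monoid_ring_def)
  fix c assume c: "c \<in> MM"
  define P where "P = {(a, b) \<in> keys f \<times> keys g. a + b = c}"
  have keys: "a \<in> keys f \<Longrightarrow> a \<in> MM" "a \<in> keys g \<Longrightarrow> a \<in> MM" for a using f g by (auto simp: EM_def)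
  have PMM: "(a, b) \<in> P \<Longrightarrow> a \<in> MM \<and> b \<in> MM" for a b using keys by (auto simp: P_def)
  have fin: "finite P" by (rule finite_subset[of _ "keys f \<times> keys g"]) (auto simp: P_def)
  have set: "{(m, m') \<in> MS \<times> MS. \<xi> f m \<noteq> \<zero>\<^bsub>L\<^esub> \<and> \<xi> g m' \<noteq> \<zero>\<^bsub>L\<^esub> \<and> m \<otimes>\<^bsub>BijGroup (carrier L)\<^esub> m' = \<sigma> c} = (\<lambda>(a, b). (\<sigma> a, \<sigma> b)) ` P"
  proof (intro equalityI subsetI)
    fix x assume "x \<in> {(m, m') \<in> MS \<times> MS. \<xi> f m \<noteq> \<zero>\<^bsub>L\<^esub> \<and> \<xi> g m' \<noteq> \<zero>\<^bsub>L\<^esub> \<and> m \<otimes>\<^bsub>BijGroup (carrier L)\<^esub> m' = \<sigma> c}"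
    then obtain a b where ab: "x = (\<sigma> a, \<sigma> b)" "a \<in> MM" "b \<in> MM" "lookup f a \<noteq> 0" "lookup g b \<noteq> 0" "\<sigma> (a + b) = \<sigma> c"
      by (auto simp: MS_def \<sigma>_mult)
    then have "a + b = c" using c by (intro \<sigma>_inj) (auto intro: MM_Nn Nn_add)
    then show "x \<in> (\<lambda>(a, b). (\<sigma> a, \<sigma> b)) ` P" using ab by (auto simp: P_def in_keys_iff)
  next
    fix x assume "x \<in> (\<lambda>(a, b). (\<sigma> a, \<sigma> b)) ` P"
    then obtain a b where "x = (\<sigma> a, \<sigma> b)" "(a, b) \<in> P" by auto
    then show "x \<in> {(m, m') \<in> MS \<times> MS. \<xi> f m \<noteq> \<zero>\<^bsub>L\<^esub> \<and> \<xi> g m' \<noteq> \<zero>\<^bsub>L\<^esub> \<and> m \<otimes>\<^bsub>BijGroup (carrier L)\<^esub> m' = \<sigma> c}"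
      using PMM by (auto simp: P_def \<sigma>_mult in_keys_iff)
  qed
  have inj: "inj_on (\<lambda>(a, b). (\<sigma> a, \<sigma> b)) P"
    using PMM inj_onD[OF \<sigma>_inj_MM] by (fastforce simp: inj_on_def)
  have "(\<xi> f \<otimes>\<^bsub>SK\<^esub> \<xi> g) (\<sigma> c) = finsum L (\<lambda>(m, m'). \<xi> f m * m (\<xi> g m')) ((\<lambda>(a, b). (\<sigma> a, \<sigma> b)) ` P)"
    unfolding skew_monoid_ring_def monoid.simps using c set by simp
  also have "\<dots> = (\<Sum>x\<in>(\<lambda>(a, b). (\<sigma> a, \<sigma> b)) ` P. case x of (m, m') \<Rightarrow> \<xi> f m * m (\<xi> g m'))"
    by (rule finsum_Lring) (use PMM f g in \<open>auto simp: \<sigma>_apply EM_lookup intro!: Ln_mult Fsig_Ln q_nonzero\<close>)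
  also have "\<dots> = (\<Sum>(a, b)\<in>P. lookup f a * Fsig q a (lookup g b))"
    by (subst sum.reindex[OF inj]) (use PMM g in \<open>auto simp: \<sigma>_apply EM_lookup intro!: sum.cong\<close>)
  also have "\<dots> = (\<Sum>(a, b)\<in>keys f \<times> keys g. if a + b = c then lookup f a * Fsig q a (lookup g b) else 0)"
    by (rule sum.mono_neutral_cong_left) (auto simp: P_def split: if_splits)
  also have "\<dots> = lookup (E.tmul f g) c"
    by (simp add: E.tmul_def pm_lift_def lookup_sum lookup_single when_def sum.cartesian_product[symmetric])
  finally show "\<xi> (E.tmul f g) (\<sigma> c) = (\<xi> f \<otimes>\<^bsub>SK\<^esub> \<xi> g) (\<sigma> c)" using c by simp
qed (rule \<xi>_ext)

lemma \<xi>_add: "\<xi> (f + g) = \<xi> f \<oplus>\<^bsub>SK\<^esub> \<xi> g"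
  by (rule MS_eqI) (auto simp: \<xi>_ext SK_simps lookup_add)

lemma \<xi>_0: "\<xi> 0 = \<zero>\<^bsub>SK\<^esub>"
  by (rule MS_eqI) (auto simp: \<xi>_ext SK_simps)

lemma skew_embed_eq: "skew_embed L MS l = \<xi> (single 0 l)"
proof (rule MS_eqI)
  fix a assume a: "a \<in> MM"
  have "\<sigma> a = \<one>\<^bsub>BG\<^esub> \<longleftrightarrow> a = 0" unfolding \<sigma>_one using inj_onD[OF \<sigma>_inj_MM _ a MM_0] by auto
  then show "skew_embed L MS l (\<sigma> a) = \<xi> (single 0 l) (\<sigma> a)"
    using a by (auto simp: skew_embed_def lookup_single when_def)
qed (auto simp: skew_embed_def \<xi>_ext)

lemma \<xi>_1: "\<xi> 1 = \<one>\<^bsub>SK\<^esub>"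
proof -
  have "\<one>\<^bsub>SK\<^esub> = skew_embed L MS 1" by (simp add: SK_simps skew_embed_def cong del: if_weak_cong)
  then show ?thesis by (simp add: skew_embed_eq)
qed

lemma \<xi>_iso: "\<xi> \<in> ring_iso Er SK"
  unfolding ring_iso_def using \<xi>_bij by (auto simp: Er_def \<xi>_mult \<xi>_add \<xi>_1 \<xi>_carrier intro!: ring_hom_memI)

lemma ring_SK: "ring SK"
proof -
  have "ring (SK\<lparr>ring.zero := \<xi> \<zero>\<^bsub>Er\<^esub>\<rparr>)" by (rule ring.ring_iso_imp_img_ring[OF ring_Er \<xi>_iso])
  then show ?thesis by (simp add: Er_def \<xi>_0)
qed

text \<open>\<open>EI\<close> is the ring of invariants of the Galois group in these coordinates, and \<open>UE\<close> the image of the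
invariants of the model.\<close>

definition EI :: "(expo \<Rightarrow>\<^sub>0 'k mpoly fract) set" where
  "EI = {f \<in> EM. \<forall>\<pi>\<in>W. \<forall>a. lookup f (pexp \<pi> a) = Fperm \<pi> (lookup f a)}"

definition UE :: "(expo \<Rightarrow>\<^sub>0 'k mpoly fract) set" where "UE = toFm ` UU"

lemma UE_EI: "UE \<subseteq> EI"
  by (auto simp: UE_def EI_def EM_def UU_def DM_def Fperm_toF W_bij)

lemma toFm_EM: "v \<in> UU \<Longrightarrow> toFm v \<in> EM"
  using UE_EI by (auto simp: UE_def EI_def)

lemma UU_pscale: "c \<in> \<Gamma> \<Longrightarrow> v \<in> UU \<Longrightarrow> pscale c v \<in> UU"
  using keys_pscale[of c v] by (auto simp: UU_def DM_def perm_simps \<Gamma>_def)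

text \<open>The invariants of quantum affine space are exactly the elements of the invariant skew monoid ring
with polynomial coefficients.\<close>

lemma EI_integral: "f \<in> EI \<Longrightarrow> (\<And>a. lookup f a \<in> toF ` Pn n) \<Longrightarrow> f \<in> UE"
proof -
  assume f: "f \<in> EI" and i: "\<And>a. lookup f a \<in> toF ` Pn n"
  then have "\<forall>a. \<exists>p\<in>Pn n. lookup f a = toF p" by blast
  then obtain h where h: "\<And>a. h a \<in> Pn n" "\<And>a. lookup f a = toF (h a)" by metis
  define v where "v = (\<Sum>a\<in>keys f. single a (h a))"
  have v: "lookup v a = h a" for a
  proof -
    have "lookup v a = (\<Sum>b\<in>keys f. if b = a then h b else 0)" by (simp add: v_def lookup_sum lookup_single when_def)
    also have "\<dots> = (if a \<in> keys f then h a else 0)" by simp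
    also have "\<dots> = h a" using h(2)[of a] by (auto simp: in_keys_iff)
    finally show ?thesis .
  qed
  have tv: "toFm v = f" by (rule poly_mapping_eqI) (simp add: v h)
  then have k: "keys v = keys f" by (metis keys_toFm)
  have "lookup v (pexp \<pi> a) = perm \<pi> (lookup v a)" if \<pi>: "\<pi> \<in> W" for \<pi> a
  proof -
    have "toF (lookup v (pexp \<pi> a)) = toF (perm \<pi> (lookup v a))"
      using f \<pi> by (simp add: tv[symmetric] EI_def Fperm_toF W_bij)
    then show ?thesis by simp
  qed
  then have "v \<in> UU" using f h by (auto simp: UU_def DM_def k v EI_def EM_def)
  then show ?thesis using tv by (auto simp: UE_def)
qed

text \<open>The Galois group consists of the permutations \<open>\<pi>\<close> in \<open>W\<close>, and conjugation by \<open>\<pi>\<close> turns \<open>\<sigma> a\<close> into the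
dilation with permuted exponents.\<close>

lemma skew_invariants_eq: "skew_invariants L (toF ` \<Gamma>) MS = \<xi> ` EI"
proof -
  have "(\<forall>h\<in>galois_group L (toF ` \<Gamma>). skew_act L MS h (\<xi> f) = \<xi> f) \<longleftrightarrow> f \<in> EI" if f: "f \<in> EM" for f
  proof -
    have act: "skew_act L MS (restrict (Fperm \<pi>) (Ln n)) (\<xi> f) (\<sigma> (pexp \<pi> a)) = Fperm \<pi> (lookup f a)"
      if \<pi>: "\<pi> \<in> W" and a: "a \<in> MM" for \<pi> a
    proof -
      have "conjugate L (inv\<^bsub>BG\<^esub> restrict (Fperm \<pi>) (Ln n)) (\<sigma> (pexp \<pi> a)) = \<sigma> a"
        by (simp add: conjugate_\<sigma>(2)[OF \<pi>] conjugate_\<sigma>(1)[OF W_inv[OF \<pi>]] pexp_inv W_bij[OF \<pi>])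
      then show ?thesis using f a MM_pexp[OF \<pi> a] by (simp add: skew_act_def EM_lookup)
    qed
    have one: "skew_act L MS (restrict (Fperm \<pi>) (Ln n)) (\<xi> f) = \<xi> f \<longleftrightarrow> (\<forall>a. lookup f (pexp \<pi> a) = Fperm \<pi> (lookup f a))"
      if \<pi>: "\<pi> \<in> W" for \<pi>
    proof
      assume eq: "skew_act L MS (restrict (Fperm \<pi>) (Ln n)) (\<xi> f) = \<xi> f"
      show "\<forall>a. lookup f (pexp \<pi> a) = Fperm \<pi> (lookup f a)"
      proof
        fix a show "lookup f (pexp \<pi> a) = Fperm \<pi> (lookup f a)"
        proof (cases "a \<in> MM")
          case True
          then show ?thesis using act[OF \<pi> True] MM_pexp[OF \<pi> True] by (simp add: eq)
        next
          case False
          then have "pexp \<pi> a \<notin> MM" using MM_pexp_iff[OF \<pi>] by simp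
          then show ?thesis using False f by (simp add: EM_outside is_homD[OF Fperm_hom[OF W_bij[OF \<pi>]]])
        qed
      qed
    next
      assume *: "\<forall>a. lookup f (pexp \<pi> a) = Fperm \<pi> (lookup f a)"
      show "skew_act L MS (restrict (Fperm \<pi>) (Ln n)) (\<xi> f) = \<xi> f"
      proof (rule MS_eqI)
        fix b assume b: "b \<in> MM"
        define a where "a = pexp (inv_into UNIV \<pi>) b"
        have ab: "b = pexp \<pi> a" "a \<in> MM" using b MM_pexp[OF W_inv[OF \<pi>]] by (simp_all add: a_def pexp_inv W_bij[OF \<pi>])
        show "skew_act L MS (restrict (Fperm \<pi>) (Ln n)) (\<xi> f) (\<sigma> b) = \<xi> f (\<sigma> b)"
          using act[OF \<pi> ab(2)] * MM_pexp[OF \<pi> ab(2)] by (simp add: ab(1))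
      qed (auto simp: skew_act_def \<xi>_ext)
    qed
    show ?thesis
    proof
      assume "\<forall>h\<in>galois_group L (toF ` \<Gamma>). skew_act L MS h (\<xi> f) = \<xi> f"
      then show "f \<in> EI" using one Fperm_galois f unfolding EI_def by blast
    next
      assume "f \<in> EI"
      then show "\<forall>h\<in>galois_group L (toF ` \<Gamma>). skew_act L MS h (\<xi> f) = \<xi> f"
        using one unfolding EI_def by (auto elim!: galois_group_cases)
    qed
  qed
  then show ?thesis
    unfolding skew_invariants_def using \<xi>_carrier \<xi>_surj unfolding EI_def by blast
qed

definition USK :: "(('k mpoly fract \<Rightarrow> 'k mpoly fract) \<Rightarrow> 'k mpoly fract) set" where "USK = \<xi> ` UE"

abbreviation emb :: "'k mpoly fract \<Rightarrow> ('k mpoly fract \<Rightarrow> 'k mpoly fract) \<Rightarrow> 'k mpoly fract" where "emb \<equiv> skew_embed L MS"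

end

text \<open>
  One-sided statements about the skew monoid ring are proved once, for a ring \<open>R\<close> with a system of
  coordinates \<open>\<epsilon>\<close> in which multiplication by \<open>L\<close> from the left is coefficientwise. The ring is the skew
  monoid ring or its opposite; in the latter case the coordinates are changed so that coefficients
  stand on the right of the monomials.
\<close>

locale coordinates = invariants +
  fixes R :: "(('a mpoly fract \<Rightarrow> 'a mpoly fract) \<Rightarrow> 'a mpoly fract) ring"
    and \<epsilon> :: "(expo \<Rightarrow>\<^sub>0 'a mpoly fract) \<Rightarrow> ('a mpoly fract \<Rightarrow> 'a mpoly fract) \<Rightarrow> 'a mpoly fract"
  assumes ring_R: "ring R" and bij: "bij_betw \<epsilon> EM (carrier R)"
    and add: "f \<in> EM \<Longrightarrow> g \<in> EM \<Longrightarrow> \<epsilon> (f + g) = \<epsilon> f \<oplus>\<^bsub>R\<^esub> \<epsilon> g"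
    and scale: "l \<in> Ln n \<Longrightarrow> f \<in> EM \<Longrightarrow> emb l \<otimes>\<^bsub>R\<^esub> \<epsilon> f = \<epsilon> (pscale l f)"
    and one: "\<epsilon> 1 = \<one>\<^bsub>R\<^esub>" and emb_eq: "l \<in> Ln n \<Longrightarrow> emb l = \<epsilon> (single 0 l)"
    and invs: "\<epsilon> ` EI = \<xi> ` EI" and ints: "\<epsilon> ` UE = \<xi> ` UE"
begin

sublocale R: ring R by (rule ring_R)

lemma \<epsilon>_closed: "f \<in> EM \<Longrightarrow> \<epsilon> f \<in> carrier R" using bij by (auto simp: bij_betw_def)
lemma \<epsilon>_zero: "\<epsilon> 0 = \<zero>\<^bsub>R\<^esub>"
  using add[of 0 0] \<epsilon>_closed[of 0] by (simp add: R.add.l_cancel_one')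

lemma emb_closed: "l \<in> Ln n \<Longrightarrow> emb l \<in> carrier R" by (simp add: emb_eq \<epsilon>_closed EM_single)
lemma emb_add: "l \<in> Ln n \<Longrightarrow> l' \<in> Ln n \<Longrightarrow> emb (l + l') = emb l \<oplus>\<^bsub>R\<^esub> emb l'"
  by (simp add: emb_eq Ln_add single_add add EM_single)
lemma emb_mult: "l \<in> Ln n \<Longrightarrow> l' \<in> Ln n \<Longrightarrow> emb (l * l') = emb l \<otimes>\<^bsub>R\<^esub> emb l'"
  by (simp add: emb_eq[of l'] emb_eq[of "l * l'"] scale Ln_mult EM_single pscale_single)
lemma emb_0: "emb 0 = \<zero>\<^bsub>R\<^esub>" and emb_1: "emb 1 = \<one>\<^bsub>R\<^esub>"
  by (simp_all add: emb_eq \<epsilon>_zero one)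

lemma EI_EM: "f \<in> EI \<Longrightarrow> f \<in> EM" by (simp add: EI_def)

lemma EI_closed: "f \<in> EI \<Longrightarrow> g \<in> EI \<Longrightarrow> f + g \<in> EI" "0 \<in> EI" "l \<in> K \<Longrightarrow> f \<in> EI \<Longrightarrow> pscale l f \<in> EI"
  unfolding EI_def by (auto simp: EM_add lookup_add is_homD[OF Fperm_hom[OF W_bij]] EM_pscale K_Ln, simp add: K_iff)

lemma USK_eq: "USK = (\<lambda>v. \<epsilon> (toFm v)) ` UU"
proof -
  have "USK = \<epsilon> ` UE" by (simp only: USK_def ints)
  then show ?thesis by (simp only: UE_def image_image)
qed

lemma embK: "emb ` K \<subseteq> carrier R" "\<zero>\<^bsub>R\<^esub> \<in> emb ` K" "\<one>\<^bsub>R\<^esub> \<in> emb ` K"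
  "x \<in> emb ` K \<Longrightarrow> y \<in> emb ` K \<Longrightarrow> x \<oplus>\<^bsub>R\<^esub> y \<in> emb ` K" "x \<in> emb ` K \<Longrightarrow> y \<in> emb ` K \<Longrightarrow> x \<otimes>\<^bsub>R\<^esub> y \<in> emb ` K"
proof -
  show "emb ` K \<subseteq> carrier R" using emb_closed K_Ln by auto
  show "\<zero>\<^bsub>R\<^esub> \<in> emb ` K" using emb_0 K_toF[OF \<Gamma>_closed(4)] by (metis imageI toF_simps(4))
  show "\<one>\<^bsub>R\<^esub> \<in> emb ` K" using emb_1 K_toF[OF \<Gamma>_closed(5)] by (metis imageI toF_simps(1))
  note s = subringE(6,7)[OF subfieldE(1)[OF subfield_K]]
  show "x \<in> emb ` K \<Longrightarrow> y \<in> emb ` K \<Longrightarrow> x \<oplus>\<^bsub>R\<^esub> y \<in> emb ` K" "x \<in> emb ` K \<Longrightarrow> y \<in> emb ` K \<Longrightarrow> x \<otimes>\<^bsub>R\<^esub> y \<in> emb ` K"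
    using s by (auto simp: emb_add[symmetric] emb_mult[symmetric] K_Ln intro!: imageI)
qed

lemma emb\<Gamma>: "emb ` toF ` \<Gamma> \<subseteq> carrier R" "\<zero>\<^bsub>R\<^esub> \<in> emb ` toF ` \<Gamma>" "\<one>\<^bsub>R\<^esub> \<in> emb ` toF ` \<Gamma>"
  "x \<in> emb ` toF ` \<Gamma> \<Longrightarrow> y \<in> emb ` toF ` \<Gamma> \<Longrightarrow> x \<oplus>\<^bsub>R\<^esub> y \<in> emb ` toF ` \<Gamma>" "x \<in> emb ` toF ` \<Gamma> \<Longrightarrow> y \<in> emb ` toF ` \<Gamma> \<Longrightarrow> x \<otimes>\<^bsub>R\<^esub> y \<in> emb ` toF ` \<Gamma>"
proof -
  have L: "x \<in> toF ` \<Gamma> \<Longrightarrow> x \<in> Ln n" for x using \<Gamma>_Ln by blast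
  show "emb ` toF ` \<Gamma> \<subseteq> carrier R" using emb_closed L by auto
  show "\<zero>\<^bsub>R\<^esub> \<in> emb ` toF ` \<Gamma>" using emb_0 \<Gamma>_closed(4) by (metis imageI toF_simps(4))
  show "\<one>\<^bsub>R\<^esub> \<in> emb ` toF ` \<Gamma>" using emb_1 \<Gamma>_closed(5) by (metis imageI toF_simps(1))
  note s = subringE(6,7)[OF toF_\<Gamma>_subring]
  show "x \<in> emb ` toF ` \<Gamma> \<Longrightarrow> y \<in> emb ` toF ` \<Gamma> \<Longrightarrow> x \<oplus>\<^bsub>R\<^esub> y \<in> emb ` toF ` \<Gamma>" "x \<in> emb ` toF ` \<Gamma> \<Longrightarrow> y \<in> emb ` toF ` \<Gamma> \<Longrightarrow> x \<otimes>\<^bsub>R\<^esub> y \<in> emb ` toF ` \<Gamma>"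
  proof -
    assume "x \<in> emb ` toF ` \<Gamma>" "y \<in> emb ` toF ` \<Gamma>"
    then obtain a b where ab: "x = emb a" "y = emb b" "a \<in> toF ` \<Gamma>" "b \<in> toF ` \<Gamma>" by blast
    show "x \<oplus>\<^bsub>R\<^esub> y \<in> emb ` toF ` \<Gamma>" "x \<otimes>\<^bsub>R\<^esub> y \<in> emb ` toF ` \<Gamma>"
      unfolding ab(1,2) using s[OF ab(3,4)] L[OF ab(3)] L[OF ab(4)] by (simp_all only: emb_add[symmetric] emb_mult[symmetric] Lring_simps imageI)
  qed
qed

lemma USK_carrier: "USK \<subseteq> carrier R"
  by (auto simp: USK_eq \<epsilon>_closed toFm_EM)

text \<open>
  A common denominator \<open>c\<close> in \<open>\<Gamma>\<close> of the coefficients of an invariant turns it into an integral one.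
\<close>

lemma span_fractions: "left_span R (emb ` K) USK = skew_invariants L (toF ` \<Gamma>) MS"
proof -
  have "left_span R (emb ` K) USK \<subseteq> \<epsilon> ` EI"
  proof (rule R.left_span_least)
    show "\<epsilon> ` EI \<subseteq> carrier R" using \<epsilon>_closed EI_EM by auto
    show "\<zero>\<^bsub>R\<^esub> \<in> \<epsilon> ` EI" using \<epsilon>_zero EI_closed(2) by (metis imageI)
    show "x \<oplus>\<^bsub>R\<^esub> y \<in> \<epsilon> ` EI" if xy: "x \<in> \<epsilon> ` EI" "y \<in> \<epsilon> ` EI" for x y
      using xy by (auto simp: add[symmetric] EI_EM intro!: imageI EI_closed)
    show "s \<otimes>\<^bsub>R\<^esub> b \<in> \<epsilon> ` EI" if sb: "s \<in> emb ` K" "b \<in> USK" for s b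
    proof -
      obtain l v where lv: "s = emb l" "l \<in> K" "b = \<epsilon> (toFm v)" "v \<in> UU" using sb by (auto simp: USK_eq)
      have "toFm v \<in> EI" using UE_EI lv(4) by (auto simp: UE_def)
      then show ?thesis unfolding lv(1,3) using lv(2) by (simp add: scale K_Ln EI_EM EI_closed)
    qed
  qed
  moreover have "\<epsilon> f \<in> left_span R (emb ` K) USK" if f: "f \<in> EI" for f
  proof -
    have fE: "f \<in> EM" by (rule EI_EM[OF f])
    obtain c where c: "c \<in> \<Gamma>" "c \<noteq> 0" "\<And>x. x \<in> lookup f ` keys f \<Longrightarrow> toF c * x \<in> toF ` Pn n"
      using common_denominator[of "lookup f ` keys f"] EM_lookup[OF fE] by auto
    have "pscale (toF c) f \<in> UE"
    proof (rule EI_integral)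
      show "pscale (toF c) f \<in> EI" by (rule EI_closed(3)[OF K_toF[OF c(1)] f])
      fix a show "lookup (pscale (toF c) f) a \<in> toF ` Pn n"
      proof (cases "a \<in> keys f")
        case False
        then show ?thesis by (auto simp: in_keys_iff toF_simps intro!: image_eqI[of _ _ 0])
      qed (use c(3) in auto)
    qed
    then have u: "\<epsilon> (pscale (toF c) f) \<in> USK" by (simp add: USK_def ints[symmetric])
    have cL: "toF c \<in> Ln n" "1 / toF c \<in> Ln n" using c LnI[of 1 n c] \<Gamma>_Pn[OF c(1)] by (auto simp: toF_simps)
    have "\<epsilon> f = \<epsilon> (pscale (1 / toF c) (pscale (toF c) f))" using c(2) by (simp add: pscale_simps(3)[symmetric] pscale_simps(4))
    also have "\<dots> = emb (1 / toF c) \<otimes>\<^bsub>R\<^esub> \<epsilon> (pscale (toF c) f)" by (simp add: scale cL EM_pscale fE)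
    also have "\<dots> \<in> left_span R (emb ` K) USK"
    proof (rule R.left_span_mult[OF embK USK_carrier])
      have "toF 1 / toF c \<in> K" using c by (intro K_I \<Gamma>_closed)
      then show "emb (1 / toF c) \<in> emb ` K" by (simp add: toF_simps)
      show "\<epsilon> (pscale (toF c) f) \<in> left_span R (emb ` K) USK" by (rule R.left_span_incl[OF embK USK_carrier u])
    qed
    finally show ?thesis .
  qed
  ultimately show ?thesis unfolding skew_invariants_eq invs[symmetric] by blast
qed

text \<open>A finite dimensional subspace involves only finitely many exponents: this passes from a subspace to
its extension by one vector.\<close>

lemma dimension_support:
  assumes "R.dimension d (emb ` K) V"
  shows "\<exists>A. finite A \<and> A \<subseteq> MM \<and> V \<subseteq> \<epsilon> ` {f \<in> EM. keys f \<subseteq> A} \<and> \<zero>\<^bsub>R\<^esub> \<in> V \<and>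
    (\<forall>x\<in>V. \<forall>y\<in>V. x \<oplus>\<^bsub>R\<^esub> y \<in> V) \<and> (\<forall>l\<in>K. \<forall>x\<in>V. emb l \<otimes>\<^bsub>R\<^esub> x \<in> V)"
  using assms
proof (induction d "emb ` K" V rule: R.dimension.induct)
  case zero_dim
  show ?case
    by (rule exI[of _ "{}"]) (auto simp: emb_closed K_Ln \<epsilon>_zero[symmetric] scale pscale_simps add[symmetric])
next
  case (Suc_dim v E d)
  then obtain A where A: "finite A" "A \<subseteq> MM" "E \<subseteq> \<epsilon> ` {f \<in> EM. keys f \<subseteq> A}" "\<zero>\<^bsub>R\<^esub> \<in> E"
    "\<forall>x\<in>E. \<forall>y\<in>E. x \<oplus>\<^bsub>R\<^esub> y \<in> E" "\<forall>l\<in>K. \<forall>x\<in>E. emb l \<otimes>\<^bsub>R\<^esub> x \<in> E" by blast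
  obtain g where g: "g \<in> EM" "v = \<epsilon> g" using Suc_dim(1) bij by (auto simp: bij_betw_def)
  have le: "R.line_extension (emb ` K) v E = {emb l \<otimes>\<^bsub>R\<^esub> v \<oplus>\<^bsub>R\<^esub> e | l e. l \<in> K \<and> e \<in> E}"
    by (auto simp: R.line_extension_def set_add_def set_mult_def r_coset_def)
  have Ec: "e \<in> E \<Longrightarrow> e \<in> carrier R" for e using A(3) \<epsilon>_closed by auto
  have vc: "v \<in> carrier R" by fact
  have lc: "l \<in> K \<Longrightarrow> emb l \<in> carrier R" for l by (simp add: emb_closed K_Ln)
  note s = subringE(6,7)[OF subfieldE(1)[OF subfield_K], simplified]
  show ?case
  proof (intro exI[of _ "A \<union> keys g"] conjI ballI)
    show "finite (A \<union> keys g)" "A \<union> keys g \<subseteq> MM" using A g by (auto simp: EM_def)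
    show "R.line_extension (emb ` K) v E \<subseteq> \<epsilon> ` {f \<in> EM. keys f \<subseteq> A \<union> keys g}"
    proof
      fix x assume "x \<in> R.line_extension (emb ` K) v E"
      then obtain l e where x: "x = emb l \<otimes>\<^bsub>R\<^esub> v \<oplus>\<^bsub>R\<^esub> e" "l \<in> K" "e \<in> E" by (auto simp: le)
      obtain f where f: "e = \<epsilon> f" "f \<in> EM" "keys f \<subseteq> A" using A(3) x(3) by auto
      have "x = \<epsilon> (pscale l g + f)" by (simp add: x f g scale K_Ln add EM_pscale)
      moreover have "pscale l g + f \<in> EM" by (simp add: EM_add EM_pscale f g K_Ln x)
      moreover have "keys (pscale l g + f) \<subseteq> A \<union> keys g" using keys_add[of "pscale l g" f] keys_pscale[of l g] f by auto
      ultimately show "x \<in> \<epsilon> ` {f \<in> EM. keys f \<subseteq> A \<union> keys g}" by blast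
    qed
    have K0: "0 \<in> K" using K_toF[OF \<Gamma>_closed(4)] by (simp add: toF_simps)
    have "\<zero>\<^bsub>R\<^esub> = emb 0 \<otimes>\<^bsub>R\<^esub> v \<oplus>\<^bsub>R\<^esub> \<zero>\<^bsub>R\<^esub>" by (simp add: emb_0 vc)
    then show "\<zero>\<^bsub>R\<^esub> \<in> R.line_extension (emb ` K) v E" unfolding le using K0 A(4) by blast
  next
    fix x y assume "x \<in> R.line_extension (emb ` K) v E" "y \<in> R.line_extension (emb ` K) v E"
    then obtain l e l' e' where x: "x = emb l \<otimes>\<^bsub>R\<^esub> v \<oplus>\<^bsub>R\<^esub> e" "l \<in> K" "e \<in> E" "y = emb l' \<otimes>\<^bsub>R\<^esub> v \<oplus>\<^bsub>R\<^esub> e'" "l' \<in> K" "e' \<in> E"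
      unfolding le by blast
    have "x \<oplus>\<^bsub>R\<^esub> y = emb (l + l') \<otimes>\<^bsub>R\<^esub> v \<oplus>\<^bsub>R\<^esub> (e \<oplus>\<^bsub>R\<^esub> e')"
      using x Ec vc lc by (simp add: emb_add K_Ln R.l_distr R.a_ac)
    then show "x \<oplus>\<^bsub>R\<^esub> y \<in> R.line_extension (emb ` K) v E" unfolding le using s(2)[OF x(2,5)] A(5) x by blast
  next
    fix l x assume l: "l \<in> K" and "x \<in> R.line_extension (emb ` K) v E"
    then obtain l' e where x: "x = emb l' \<otimes>\<^bsub>R\<^esub> v \<oplus>\<^bsub>R\<^esub> e" "l' \<in> K" "e \<in> E" unfolding le by blast
    have "emb l \<otimes>\<^bsub>R\<^esub> x = emb (l * l') \<otimes>\<^bsub>R\<^esub> v \<oplus>\<^bsub>R\<^esub> (emb l \<otimes>\<^bsub>R\<^esub> e)"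
      using x l Ec vc lc by (simp add: emb_mult K_Ln R.r_distr R.m_assoc)
    then show "emb l \<otimes>\<^bsub>R\<^esub> x \<in> R.line_extension (emb ` K) v E" unfolding le using s(1)[OF l x(2)] A(6) x l by blast
  qed
qed

text \<open>The integral elements of a finite dimensional subspace have their exponents in a finite set \<open>A\<close> and
their coefficients in the polynomials, which are finitely generated over \<open>\<Gamma>\<close>. So they lie in a finitely
generated module over the Noetherian ring \<open>\<Gamma>\<close>.\<close>

lemma finitely_generated_intersections:
  assumes "V \<subseteq> skew_invariants L (toF ` \<Gamma>) MS" "R.finite_dimension (emb ` K) V"
  shows "left_finitely_generated R (emb ` toF ` \<Gamma>) (V \<inter> USK)"
proof -
  obtain d where "R.dimension d (emb ` K) V" using assms(2) unfolding R.finite_dimension_def by blast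
  from dimension_support[OF this] obtain A where A: "finite A" "A \<subseteq> MM" "V \<subseteq> \<epsilon> ` {f \<in> EM. keys f \<subseteq> A}" "\<zero>\<^bsub>R\<^esub> \<in> V"
    "\<forall>x\<in>V. \<forall>y\<in>V. x \<oplus>\<^bsub>R\<^esub> y \<in> V" "\<forall>l\<in>K. \<forall>x\<in>V. emb l \<otimes>\<^bsub>R\<^esub> x \<in> V" by blast
  define N where "N = {v \<in> UU. \<epsilon> (toFm v) \<in> V}"
  have VN: "V \<inter> USK = (\<lambda>v. \<epsilon> (toFm v)) ` N" by (auto simp: N_def USK_eq)
  have N: "msub \<Gamma> N"
    unfolding msub_def
  proof (intro conjI ballI)
    show "0 \<in> N" using A(4) by (simp add: N_def UU_closed toFm_simps \<epsilon>_zero)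
    show "v + w \<in> N" if "v \<in> N" "w \<in> N" for v w
      using that A(5) by (simp add: N_def UU_closed toFm_simps add toFm_EM)
    show "pscale c v \<in> N" if "c \<in> \<Gamma>" "v \<in> N" for c v
      using that A(6) K_toF[OF that(1)] by (simp add: N_def UU_pscale toFm_simps scale[symmetric] toFm_EM \<Gamma>_Pn)
  qed
  obtain t :: "nat \<Rightarrow> 'a mpoly" where t: "\<Gamma> = alg_gen (t ` {..<n})" using \<Gamma>_structure(1) by blast
  obtain C :: "(nat \<Rightarrow> nat) set" and e :: "(nat \<Rightarrow> nat) \<Rightarrow> 'a mpoly" where
    C: "finite C" "\<forall>p\<in>Pn n. \<exists>g. (\<forall>c\<in>C. g c \<in> \<Gamma>) \<and> p = (\<Sum>c\<in>C. g c * e c)"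
    using \<Gamma>_structure(2) by blast
  define B where "B = (\<lambda>(a, c). single a (e c)) ` (A \<times> C)"
  have B: "finite B" using A(1) C(1) by (simp add: B_def)
  have "N \<subseteq> mhull \<Gamma> B"
  proof
    fix v assume v: "v \<in> N"
    then obtain f where f: "\<epsilon> (toFm v) = \<epsilon> f" "f \<in> EM" "keys f \<subseteq> A" using A(3) by (auto simp: N_def)
    have "toFm v = f" using f toFm_EM v bij by (auto simp: N_def bij_betw_def inj_on_def)
    then have kv: "keys v \<subseteq> A" using f(3) by (metis keys_toFm)
    have "single a (lookup v a) \<in> mhull \<Gamma> B" if a: "a \<in> keys v" for a
    proof -
      have "lookup v a \<in> Pn n" using v by (auto simp: N_def UU_def DM_def)
      then obtain g where g: "\<forall>c\<in>C. g c \<in> \<Gamma>" "lookup v a = (\<Sum>c\<in>C. g c * e c)" using C(2) by blast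
      have "single a (lookup v a) = (\<Sum>c\<in>C. pscale (g c) (single a (e c)))"
        unfolding g(2) by (rule poly_mapping_eqI) (auto simp: lookup_sum lookup_single when_def)
      also have "\<dots> \<in> mhull \<Gamma> B"
      proof (rule mhull_sum)
        fix c assume c: "c \<in> C"
        have "single a (e c) \<in> B" unfolding B_def by (rule image_eqI[of _ _ "(a, c)"]) (use kv a c in auto)
        then show "pscale (g c) (single a (e c)) \<in> mhull \<Gamma> B"
          using mhull_step[OF mhull_0, of "g c" \<Gamma> "single a (e c)" B] g(1) c by simp
      qed
      finally show ?thesis .
    qed
    then have "(\<Sum>a\<in>keys v. single a (lookup v a)) \<in> mhull \<Gamma> B" by (rule mhull_sum)
    then show "v \<in> mhull \<Gamma> B" by (simp only: pm_sum_single[symmetric])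
  qed
  then have NB: "msub \<Gamma> N \<and> N \<subseteq> mhull \<Gamma> B" using N by blast
  have "noeth \<Gamma> (mhull \<Gamma> B)" using noeth_alg_gen[OF B, of t n] by (simp only: t[symmetric])
  note nB = this[unfolded noeth_def]
  obtain G where G: "finite G" "G \<subseteq> N" "N \<subseteq> mhull \<Gamma> G"
    using mp[OF spec[OF nB, of N] NB] by (elim exE conjE)
  define H where "H = (\<lambda>v. \<epsilon> (toFm v)) ` G"
  have HV: "H \<subseteq> V \<inter> USK" unfolding VN H_def using G(2) by blast
  then have Hc: "H \<subseteq> carrier R" using USK_carrier by blast
  have "left_span R (emb ` toF ` \<Gamma>) H \<subseteq> V \<inter> USK"
  proof (rule R.left_span_least)
    show "V \<inter> USK \<subseteq> carrier R" using USK_carrier by blast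
    show "\<zero>\<^bsub>R\<^esub> \<in> V \<inter> USK"
      unfolding VN using msubD(1)[OF N] \<epsilon>_zero toFm_simps(2) by (metis image_eqI)
    show "x \<oplus>\<^bsub>R\<^esub> y \<in> V \<inter> USK" if xy: "x \<in> V \<inter> USK" "y \<in> V \<inter> USK" for x y
    proof -
      obtain v w where vw: "x = \<epsilon> (toFm v)" "y = \<epsilon> (toFm w)" "v \<in> N" "w \<in> N"
        using xy unfolding VN by (elim imageE) simp
      then have "x \<oplus>\<^bsub>R\<^esub> y = \<epsilon> (toFm (v + w))" "v + w \<in> N" using msubD(2)[OF N] by (simp_all add: toFm_simps add toFm_EM N_def)
      then show ?thesis unfolding VN by blast
    qed
    show "s \<otimes>\<^bsub>R\<^esub> b \<in> V \<inter> USK" if sb: "s \<in> emb ` toF ` \<Gamma>" "b \<in> H" for s b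
    proof -
      obtain c v where cv: "s = emb (toF c)" "c \<in> \<Gamma>" "b = \<epsilon> (toFm v)" "v \<in> N" using sb G(2) unfolding H_def by blast
      then have "s \<otimes>\<^bsub>R\<^esub> b = \<epsilon> (toFm (pscale c v))" by (simp add: toFm_simps scale toFm_EM N_def \<Gamma>_Pn)
      then show ?thesis unfolding VN using msubD(3)[OF N cv(2,4)] by blast
    qed
  qed
  moreover have "\<epsilon> (toFm v) \<in> left_span R (emb ` toF ` \<Gamma>) H \<and> v \<in> UU" if "v \<in> mhull \<Gamma> G" for v
    using that
  proof induction
    case mhull_0
    show ?case using R.left_span_zero[OF emb\<Gamma> Hc] by (simp add: toFm_simps \<epsilon>_zero UU_closed)
  next
    case (mhull_step v c g)
    have gU: "g \<in> UU" using G(2) mhull_step by (auto simp: N_def)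
    have "\<epsilon> (toFm (pscale c g + v)) = emb (toF c) \<otimes>\<^bsub>R\<^esub> \<epsilon> (toFm g) \<oplus>\<^bsub>R\<^esub> \<epsilon> (toFm v)"
      using mhull_step gU by (simp add: toFm_simps scale add toFm_EM EM_pscale \<Gamma>_Pn)
    also have "\<dots> \<in> left_span R (emb ` toF ` \<Gamma>) H"
    proof (rule R.left_span_add[OF emb\<Gamma> Hc R.left_span_mult[OF emb\<Gamma> Hc _ R.left_span_incl[OF emb\<Gamma> Hc]]])
      show "emb (toF c) \<in> emb ` toF ` \<Gamma>" using mhull_step(2) by blast
      show "\<epsilon> (toFm g) \<in> H" using mhull_step(3) by (simp add: H_def)
      show "\<epsilon> (toFm v) \<in> left_span R (emb ` toF ` \<Gamma>) H" using mhull_step by blast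
    qed
    finally show ?case using mhull_step gU by (simp add: UU_closed UU_pscale)
  qed
  then have "V \<inter> USK \<subseteq> left_span R (emb ` toF ` \<Gamma>) H" unfolding VN using G(3) by blast
  ultimately show ?thesis
    unfolding left_finitely_generated_def using HV G(1) by (intro exI[of _ H]) (auto simp: H_def)
qed

end

context invariants begin

lemma coordinates_left: "coordinates n q W m T SK \<xi>"
proof (rule coordinates.intro[OF invariants_axioms coordinates_axioms.intro])
  show "ring SK" by (rule ring_SK)
  show "bij_betw \<xi> EM (carrier SK)" by (rule \<xi>_bij)
  show "\<xi> 1 = \<one>\<^bsub>SK\<^esub>" by (rule \<xi>_1)
next
  fix l :: "'k mpoly fract" and f :: "expo \<Rightarrow>\<^sub>0 'k mpoly fract" assume "l \<in> Ln n" "f \<in> EM"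
  then have "emb l \<otimes>\<^bsub>SK\<^esub> \<xi> f = \<xi> (E.tmul (single 0 l) f)"
    by (simp add: skew_embed_eq \<xi>_mult EM_single)
  also have "E.tmul (single 0 l) f = pscale l f" by (rule poly_mapping_eqI) (simp add: E.lookup_tmul_scalar)
  finally show "emb l \<otimes>\<^bsub>SK\<^esub> \<xi> f = \<xi> (pscale l f)" .
qed (simp_all add: \<xi>_add skew_embed_eq)

text \<open>Since \<open>x\<^sup>a l = \<sigma>\<^sub>a(l) x\<^sup>a\<close>, the element with coefficients \<open>l\<^sub>a\<close> on the right of the monomials has the
coefficients \<open>\<sigma>\<^sub>a(l\<^sub>a)\<close> on their left. The change of coordinates preserves invariance and integrality.\<close>

definition twist :: "(expo \<Rightarrow>\<^sub>0 'k mpoly fract) \<Rightarrow> (expo \<Rightarrow>\<^sub>0 'k mpoly fract)" where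
  "twist f = pm_lift (\<lambda>a l. single a (Fsig q a l)) f"

lemma lookup_twist: "lookup (twist f) a = Fsig q a (lookup f a)"
proof -
  have "lookup (twist f) a = (\<Sum>b\<in>keys f. if b = a then Fsig q b (lookup f b) else 0)"
    by (simp add: twist_def pm_lift_def lookup_sum lookup_single when_def)
  also have "\<dots> = Fsig q a (lookup f a)" by (simp add: in_keys_iff is_homD[OF Fsig_hom[OF q_nonzero]])
  finally show ?thesis .
qed

definition untwist :: "(expo \<Rightarrow>\<^sub>0 'k mpoly fract) \<Rightarrow> (expo \<Rightarrow>\<^sub>0 'k mpoly fract)" where
  "untwist f = pm_lift (\<lambda>a l. single a (frac_map (dil (\<lambda>i. q ^ lookup a i)) l)) f"

lemma lookup_untwist: "lookup (untwist f) a = frac_map (dil (\<lambda>i. q ^ lookup a i)) (lookup f a)"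
proof -
  have "lookup (untwist f) a = (\<Sum>b\<in>keys f. if b = a then frac_map (dil (\<lambda>i. q ^ lookup b i)) (lookup f b) else 0)"
    by (simp add: untwist_def pm_lift_def lookup_sum lookup_single when_def)
  also have "\<dots> = frac_map (dil (\<lambda>i. q ^ lookup a i)) (lookup f a)"
    by (simp add: in_keys_iff is_homD[OF Fsig_inverse(4)[OF q_nonzero]])
  finally show ?thesis .
qed

lemma twist_untwist: "twist (untwist f) = f" "untwist (twist f) = f"
  by (auto intro!: poly_mapping_eqI simp: lookup_twist lookup_untwist Fsig_inverse q_nonzero)

lemma keys_twist: "keys (twist f) = keys f" "keys (untwist f) = keys f"
proof -
  have "Fsig q a x = 0 \<longleftrightarrow> x = 0" "frac_map (dil (\<lambda>i. q ^ lookup a i)) x = 0 \<longleftrightarrow> x = 0" for a x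
    using field_hom_div(3)[OF Fsig_hom[OF q_nonzero]] field_hom_div(3)[OF Fsig_inverse(4)[OF q_nonzero]] by auto
  then show "keys (twist f) = keys f" "keys (untwist f) = keys f"
    by (auto simp: in_keys_iff lookup_twist lookup_untwist)
qed

lemma twist_EM: "twist f \<in> EM \<longleftrightarrow> f \<in> EM"
proof -
  have 1: "f \<in> EM \<Longrightarrow> twist f \<in> EM" for f by (auto simp: EM_def keys_twist lookup_twist Fsig_Ln q_nonzero)
  have 2: "f \<in> EM \<Longrightarrow> untwist f \<in> EM" for f by (auto simp: EM_def keys_twist lookup_untwist Fsig_inverse q_nonzero)
  show ?thesis using 1[of f] 2[of "twist f"] by (auto simp: twist_untwist)
qed

lemma twist_EI: "twist f \<in> EI \<longleftrightarrow> f \<in> EI"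
proof -
  have "lookup (twist f) (pexp \<pi> a) = Fperm \<pi> (lookup (twist f) a) \<longleftrightarrow> lookup f (pexp \<pi> a) = Fperm \<pi> (lookup f a)"
    if "\<pi> \<in> W" for \<pi> a
    using Fsig_inverse(1)[OF q_nonzero]
    by (simp add: lookup_twist Fperm_Fsig q_nonzero W_bij[OF that]) metis
  then show ?thesis by (simp add: EI_def twist_EM)
qed

lemma twist_UE: "twist f \<in> UE \<longleftrightarrow> f \<in> UE"
proof -
  have UEc: "f \<in> UE \<longleftrightarrow> f \<in> EI \<and> (\<forall>a. lookup f a \<in> toF ` Pn n)" for f
    using EI_integral UE_EI by (auto simp: UE_def UU_def DM_def)
  have "Fsig q a x \<in> toF ` Pn n \<longleftrightarrow> x \<in> toF ` Pn n" for a x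
  proof
    assume "Fsig q a x \<in> toF ` Pn n"
    then obtain p where "p \<in> Pn n" "Fsig q a x = toF p" by blast
    then have "x = toF (dil (\<lambda>i. q ^ lookup a i) p)" "dil (\<lambda>i. q ^ lookup a i) p \<in> Pn n"
      using Fsig_inverse(1)[OF q_nonzero, of a x] by (simp_all add: Fsig_inverse(5)[OF q_nonzero] dil_Pn)
    then show "x \<in> toF ` Pn n" by blast
  qed (auto simp: Fsig_toF q_nonzero qdil_Pn)
  then show ?thesis by (simp add: UEc twist_EI lookup_twist)
qed

lemma twist_image: "(\<And>f. twist f \<in> Z \<longleftrightarrow> f \<in> Z) \<Longrightarrow> twist ` Z = Z"
  by (auto simp: image_iff) (metis twist_untwist(1))

lemma coordinates_right: "coordinates n q W m T (opposite_ring SK) (\<lambda>f. \<xi> (twist f))"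
proof (rule coordinates.intro[OF invariants_axioms coordinates_axioms.intro])
  have opp: "carrier (opposite_ring SK) = carrier SK" "x \<otimes>\<^bsub>opposite_ring SK\<^esub> y = y \<otimes>\<^bsub>SK\<^esub> x" "one (opposite_ring SK) = one SK"
    "ring.add (opposite_ring SK) = ring.add SK" for x y by (simp_all add: opposite_ring_def)
  have ta: "twist (f + g) = twist f + twist g" for f g
    by (rule poly_mapping_eqI) (simp add: lookup_twist lookup_add is_homD[OF Fsig_hom[OF q_nonzero]])
  have ts: "twist (single 0 l) = single 0 l" for l
    by (rule poly_mapping_eqI) (auto simp: lookup_twist lookup_single when_def Fsig_0 q_nonzero is_homD[OF Fsig_hom[OF q_nonzero]])
  show "ring (opposite_ring SK)" by (rule ring.ring_opposite[OF ring_SK])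
  have "bij_betw twist EM EM"
    by (rule bij_betw_byWitness[where f' = untwist]) (use twist_EM twist_EM[of "untwist _"] twist_untwist in auto)
  then show "bij_betw (\<lambda>f. \<xi> (twist f)) EM (carrier (opposite_ring SK))"
    using bij_betw_trans[OF _ \<xi>_bij] by (simp add: opp o_def)
  show "\<xi> (twist (f + g)) = \<xi> (twist f) \<oplus>\<^bsub>opposite_ring SK\<^esub> \<xi> (twist g)" for f g
    by (simp add: opp ta \<xi>_add)
  show "emb l = \<xi> (twist (single 0 l))" for l by (simp add: ts skew_embed_eq)
  show "\<xi> (twist 1) = \<one>\<^bsub>opposite_ring SK\<^esub>" using ts[of 1] by (simp add: opp \<xi>_1)
  show "(\<lambda>f. \<xi> (twist f)) ` EI = \<xi> ` EI" using twist_image[of EI, OF twist_EI] by (metis image_image)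
  show "(\<lambda>f. \<xi> (twist f)) ` UE = \<xi> ` UE" using twist_image[of UE, OF twist_UE] by (metis image_image)
  fix l :: "'k mpoly fract" and f :: "expo \<Rightarrow>\<^sub>0 'k mpoly fract" assume lf: "l \<in> Ln n" "f \<in> EM"
  then have "emb l \<otimes>\<^bsub>opposite_ring SK\<^esub> \<xi> (twist f) = \<xi> (E.tmul (twist f) (single 0 l))"
    by (simp add: opp skew_embed_eq \<xi>_mult EM_single twist_EM)
  also have "E.tmul (twist f) (single 0 l) = twist (pscale l f)"
    by (rule poly_mapping_eqI) (simp add: E.lookup_tmul_scalar_r lookup_twist is_homD[OF Fsig_hom[OF q_nonzero]])
  finally show "emb l \<otimes>\<^bsub>opposite_ring SK\<^esub> \<xi> (twist f) = \<xi> (twist (pscale l f))" .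
qed

end

section \<open>Freeness over the polynomial subalgebra\<close>

text \<open>The algebra of invariants is graded by the total degree in the \<open>y\<^sub>i\<close>. Degrees
are not negative, which is what the graded version of Nakayama's lemma needs. The maps \<open>hpart d\<close> and \<open>hparts d\<close> are the projections to the part of degree \<open>d\<close>, the latter
acting on coefficients.\<close>

definition tdeg :: "expo \<Rightarrow> nat" where "tdeg b = (\<Sum>i\<in>keys b. lookup b i)"

lemma tdeg_superset: "finite S \<Longrightarrow> keys b \<subseteq> S \<Longrightarrow> tdeg b = (\<Sum>i\<in>S. lookup b i)"
  unfolding tdeg_def by (rule sum.mono_neutral_left) (auto simp: in_keys_iff)

lemma tdeg_add: "tdeg (a + b) = tdeg a + tdeg b"
proof -
  have "tdeg (a + b) = (\<Sum>i\<in>keys a \<union> keys b. lookup (a + b) i)"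
    by (rule tdeg_superset) (use keys_add[of a b] in auto)
  then show ?thesis
    by (simp add: lookup_add sum.distrib tdeg_superset[of "keys a \<union> keys b" a] tdeg_superset[of "keys a \<union> keys b" b])
qed

lemma tdeg_0 [simp]: "tdeg 0 = 0" by (simp add: tdeg_def)
lemma tdeg_eq_0: "tdeg b = 0 \<longleftrightarrow> b = 0"
  by (auto simp: tdeg_def in_keys_iff intro: poly_mapping_eqI)

lemma tdeg_pexp: assumes "bij \<pi>" shows "tdeg (pexp \<pi> b) = tdeg b"
proof -
  have "inj_on \<pi> (keys b)" using bij_is_inj[OF assms] by (auto simp: inj_on_def)
  then show ?thesis unfolding tdeg_def keys_pexp[OF assms]
    by (subst sum.reindex) (simp_all add: lookup_pexp[OF assms] inv_f_f[OF bij_is_inj[OF assms]])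
qed

definition hpart :: "nat \<Rightarrow> 'k::comm_ring_1 mpoly \<Rightarrow> 'k mpoly" where
  "hpart d = pm_lift (\<lambda>b c. if tdeg b = d then single b c else 0)"

lemma hpart_0 [simp]: "hpart d 0 = 0" by (simp add: hpart_def)
lemma hpart_add: "hpart d (p + p') = hpart d p + hpart d p'"
  unfolding hpart_def by (rule pm_lift_add) (simp_all add: single_add)
lemma hpart_single: "hpart d (single b c) = (if tdeg b = d then single b c else 0)"
  unfolding hpart_def by (rule pm_lift_single) simp
lemma lookup_hpart: "lookup (hpart d p) b = (if tdeg b = d then lookup p b else 0)"
  by (induction p rule: pm_add_induct) (auto simp: hpart_add hpart_single lookup_add lookup_single when_def)
lemma hpart_Pn: "p \<in> Pn n \<Longrightarrow> hpart d p \<in> Pn n"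
  by (auto simp: Pn_def in_keys_iff lookup_hpart split: if_splits)
lemma hpart_perm: "bij \<pi> \<Longrightarrow> hpart d (perm \<pi> p) = perm \<pi> (hpart d p)"
  by (induction p rule: pm_add_induct) (auto simp: perm_simps hpart_add hpart_single perm_single tdeg_pexp)

lemma hpart_mult: "hpart d (p * p') = (\<Sum>i\<le>d. hpart i p * hpart (d - i) p')"
proof (induction p rule: pm_add_induct)
  case (add b c p)
  have "hpart d (single b c * p') = (\<Sum>i\<le>d. hpart i (single b c) * hpart (d - i) p')"
  proof (induction p' rule: pm_add_induct)
    case (add b' c' p')
    have "hpart d (single b c * single b' c') = (\<Sum>i\<le>d. if i = tdeg b then single b c * hpart (d - tdeg b) (single b' c') else 0)"
      by (auto simp: mult_single hpart_single tdeg_add)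
    also have "\<dots> = (\<Sum>i\<le>d. hpart i (single b c) * hpart (d - i) (single b' c'))"
      by (rule sum.cong) (auto simp: hpart_single)
    finally show ?case using add by (simp add: distrib_left hpart_add sum.distrib)
  qed simp
  then show ?case using add by (simp add: distrib_right hpart_add sum.distrib)
qed simp

definition hparts :: "nat \<Rightarrow> ('x \<Rightarrow>\<^sub>0 'k::comm_ring_1 mpoly) \<Rightarrow> ('x \<Rightarrow>\<^sub>0 'k mpoly)" where
  "hparts d = pm_lift (\<lambda>a p. single a (hpart d p))"

lemma lookup_hparts [simp]:
  fixes v :: "'x \<Rightarrow>\<^sub>0 'k::comm_ring_1 mpoly"
  shows "lookup (hparts d v) a = hpart d (lookup v a)"
proof -
  have add: "hparts d (v + w) = hparts d v + hparts d w" for v w :: "'x \<Rightarrow>\<^sub>0 'k mpoly"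
    unfolding hparts_def by (rule pm_lift_add) (simp_all add: hpart_add single_add)
  have sing: "hparts d (single a p) = single a (hpart d p)" for a :: 'x and p :: "'k mpoly"
    unfolding hparts_def by (rule pm_lift_single) simp
  have zero: "hparts d 0 = (0 :: 'x \<Rightarrow>\<^sub>0 'k mpoly)" by (simp add: hparts_def)
  show ?thesis
    by (induction v rule: pm_add_induct) (auto simp: add sing zero lookup_add hpart_add lookup_single when_def)
qed

lemma hparts_simps: "hparts d 0 = 0" "hparts d (v + w) = hparts d v + hparts d w"
  "hparts d (pscale (cst c) v) = pscale (cst c) (hparts d v)"
  "hparts d (pscale p v) = (\<Sum>i\<le>d. pscale (hpart i p) (hparts (d - i) v))"
proof -
  have "hpart d (cst c * p) = cst c * hpart d p" for p
    by (rule poly_mapping_eqI) (simp add: lookup_hpart)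
  then show "hparts d (pscale (cst c) v) = pscale (cst c) (hparts d v)"
    by (intro poly_mapping_eqI) simp
qed (auto intro!: poly_mapping_eqI simp: lookup_add hpart_add lookup_sum hpart_mult)

lemma keys_hparts: "keys (hparts d v) \<subseteq> keys v" by (auto simp: in_keys_iff)

text \<open>Only the constant term of \<open>g\<close> contributes to the lowest homogeneous part of \<open>p g\<close>.\<close>

lemma lookup_mult_lowest:
  fixes p g :: "'k::comm_ring_1 mpoly"
  assumes "\<And>b'. b' \<in> keys p \<Longrightarrow> tdeg b \<le> tdeg b'"
  shows "lookup (p * g) b = lookup p b * lookup g 0"
proof -
  define g' where "g' = g - cst (lookup g 0)"
  have g'0: "lookup g' 0 = 0" by (simp add: g'_def lookup_minus cst_def)
  have "b \<notin> keys (p * g')"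
  proof
    assume "b \<in> keys (p * g')"
    then obtain u v where uv: "b = u + v" "u \<in> keys p" "v \<in> keys g'" using keys_mult[of p g'] by blast
    have "tdeg v > 0" using uv(3) g'0 tdeg_eq_0[of v] by (cases "v = 0") (auto simp: in_keys_iff)
    then show False using assms[OF uv(2)] by (simp add: uv(1) tdeg_add)
  qed
  moreover have "p * g = cst (lookup g 0) * p + p * g'" by (simp add: g'_def algebra_simps)
  ultimately have "lookup (p * g) b = lookup (cst (lookup g 0) * p) b" by (simp only: lookup_add in_keys_iff not_not add_0_right)
  then show ?thesis by (simp only: lookup_cst_mult mult.commute[of "lookup p b"])
qed

lemma cst_of_nat: "cst (of_nat k) = of_nat k" by (induction k) (simp_all add: cst_add)

context invariants begin

text \<open>The Reynolds operator: a \<open>\<Gamma>\<close>-linear projection of the invariants of \<open>T\<close> onto those of \<open>T \<times> W\<close>. It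
exists since the characteristic is zero.\<close>

definition reynolds :: "'k qspace \<Rightarrow> 'k qspace" where
  "reynolds f = pscale (cst (1 / of_nat (card W))) (\<Sum>\<pi>\<in>W. act (\<lambda>_. 1) \<pi> f)"

lemma reynolds_0 [simp]: "reynolds 0 = 0" by (simp add: reynolds_def pscale_simps)

lemma reynolds_add: "reynolds (f + g) = reynolds f + reynolds g"
  by (simp add: reynolds_def act_add sum.distrib pscale_simps)

lemma reynolds_sum: "reynolds (\<Sum>i\<in>I. f i) = (\<Sum>i\<in>I. reynolds (f i))"
  by (induction I rule: infinite_finite_induct) (simp_all add: reynolds_add)

lemma act_pscale: "perm \<pi> c = c \<Longrightarrow> act g \<pi> (pscale c f) = pscale c (act g \<pi> f)"
  by (induction f rule: pm_add_induct)
    (simp_all add: pscale_simps act_add pscale_single act_single perm_simps algebra_simps)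

lemma reynolds_pscale: "c \<in> \<Gamma> \<Longrightarrow> reynolds (pscale c f) = pscale c (reynolds f)"
  by (simp add: reynolds_def act_pscale \<Gamma>_def pscale_sum[symmetric] pscale_simps(3)[symmetric] mult.commute)

lemma W_card: "of_nat (card W) \<noteq> (0 :: 'k)" using W_finite W_id by auto

lemma reynolds_id: "f \<in> UU \<Longrightarrow> reynolds f = f"
proof -
  assume "f \<in> UU"
  then have "(\<Sum>\<pi>\<in>W. act (\<lambda>_. 1) \<pi> f) = (\<Sum>\<pi>\<in>W. f)" by (intro sum.cong) (auto simp: UU_iff_act)
  also have "\<dots> = pscale (cst (of_nat (card W))) f"
    by (rule poly_mapping_eqI, unfold lookup_sum lookup_pscale cst_of_nat) simp
  finally show ?thesis using W_card by (simp add: reynolds_def pscale_simps(3)[symmetric] cst_mult[symmetric] pscale_simps(4))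
qed

lemma act_DM: assumes "\<pi> \<in> W" "f \<in> DM" shows "act (\<lambda>_. 1) \<pi> f \<in> DM"
proof -
  have l: "lookup (act (\<lambda>_. 1) \<pi> f) a = perm \<pi> (lookup f (pexp (inv_into UNIV \<pi>) a))" for a
    using lookup_act[OF W_bij[OF assms(1)], of "\<lambda>_. 1" f "pexp (inv_into UNIV \<pi>) a"] by (simp add: pexp_inv W_bij[OF assms(1)])
  have "keys (act (\<lambda>_. 1) \<pi> f) \<subseteq> MM"
  proof
    fix a assume "a \<in> keys (act (\<lambda>_. 1) \<pi> f)"
    then have "pexp (inv_into UNIV \<pi>) a \<in> keys f" by (auto simp: in_keys_iff l perm_simps)
    then have "pexp (inv_into UNIV \<pi>) a \<in> MM" using assms by (auto simp: DM_def)
    then show "a \<in> MM" using MM_pexp_iff[OF W_inv[OF assms(1)]] by simp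
  qed
  moreover have "perm \<pi> (lookup f b) \<in> Pn n" for b
    by (rule perm_Pn) (use assms W_lt in \<open>auto simp: DM_def\<close>)
  ultimately show ?thesis by (simp add: DM_def l)
qed

lemma DM_0 [simp]: "0 \<in> DM" by (simp add: DM_def)

lemma DM_sum: "(\<And>i. i \<in> I \<Longrightarrow> f i \<in> DM) \<Longrightarrow> sum f I \<in> DM"
  by (induction I rule: infinite_finite_induct) (auto intro: DM_add)

lemma DM_pscale: "c \<in> Pn n \<Longrightarrow> f \<in> DM \<Longrightarrow> pscale c f \<in> DM"
  using keys_pscale[of c f] by (auto simp: DM_def)

lemma act_sum: "act g \<pi> (\<Sum>i\<in>I. f i) = (\<Sum>i\<in>I. act g \<pi> (f i))"
  by (induction I rule: infinite_finite_induct) (simp_all add: act_add)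

lemma act_act: assumes "bij \<pi>" "bij \<rho>" shows "act (\<lambda>_. 1) \<pi> (act (\<lambda>_. 1) \<rho> f) = act (\<lambda>_. 1) (\<pi> \<circ> \<rho>) f"
  by (induction f rule: pm_add_induct) (simp_all add: act_add act_single assms pexp_pexp perm_perm comp_def)

lemma reynolds_UU: assumes "f \<in> DM" shows "reynolds f \<in> UU"
proof -
  have "reynolds f \<in> DM" unfolding reynolds_def using assms by (intro DM_pscale DM_sum act_DM) auto
  moreover have "act (\<lambda>_. 1) \<pi> (reynolds f) = reynolds f" if \<pi>: "\<pi> \<in> W" for \<pi>
  proof -
    have "act (\<lambda>_. 1) \<pi> (\<Sum>\<rho>\<in>W. act (\<lambda>_. 1) \<rho> f) = (\<Sum>\<rho>\<in>W. act (\<lambda>_. 1) (\<pi> \<circ> \<rho>) f)"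
      unfolding act_sum by (rule sum.cong) (simp_all add: act_act W_bij \<pi>)
    also have "\<dots> = (\<Sum>\<rho>\<in>W. act (\<lambda>_. 1) \<rho> f)" by (rule sum.reindex_bij_betw[OF W_comp_bij[OF \<pi>]])
    finally show ?thesis unfolding reynolds_def by (subst act_pscale) (simp_all)
  qed
  ultimately show ?thesis by (auto simp: UU_iff_act)
qed

lemma hpart_\<Gamma>: "p \<in> \<Gamma> \<Longrightarrow> hpart d p \<in> \<Gamma>"
  by (auto simp: \<Gamma>_def hpart_Pn hpart_perm[symmetric] W_bij)

lemma hparts_UU: "u \<in> UU \<Longrightarrow> hparts d u \<in> UU"
  using keys_hparts[of d u] by (auto simp: UU_def DM_def hpart_Pn hpart_perm W_bij)

lemma hparts_reynolds: "hparts d (reynolds f) = reynolds (hparts d f)"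
proof -
  have a: "hparts d (act (\<lambda>_. 1) \<pi> f) = act (\<lambda>_. 1) \<pi> (hparts d f)" if \<pi>: "\<pi> \<in> W" for \<pi>
  proof (rule poly_mapping_eqI)
    fix a' :: expo
    define a where "a = pexp (inv_into UNIV \<pi>) a'"
    have a': "a' = pexp \<pi> a" by (simp add: a_def pexp_inv W_bij[OF \<pi>])
    show "lookup (hparts d (act (\<lambda>_. 1) \<pi> f)) a' = lookup (act (\<lambda>_. 1) \<pi> (hparts d f)) a'"
      by (simp add: a' lookup_act W_bij[OF \<pi>] hpart_perm)
  qed
  have s: "hparts d (sum h I) = (\<Sum>i\<in>I. hparts d (h i))" for h :: "_ \<Rightarrow> 'k qspace" and I :: "(nat \<Rightarrow> nat) set"
    by (induction I rule: infinite_finite_induct) (simp_all add: hparts_simps(1,2))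
  show ?thesis by (simp add: reynolds_def hparts_simps(3) s a)
qed

text \<open>The augmentation ideal of \<open>\<Gamma>\<close>.\<close>

definition \<Gamma>p :: "'k mpoly set" where "\<Gamma>p = {p \<in> \<Gamma>. lookup p 0 = 0}"

lemma mhull_subspace:
  fixes R :: "'k mpoly set"
  assumes "\<And>c d. d \<in> R \<Longrightarrow> cst c * d \<in> R"
  shows "VS.subspace (mhull R Z)"
proof (rule VS.subspaceI)
  show "pscale (cst c) v \<in> mhull R Z" if "v \<in> mhull R Z" for c v
    using that
  proof induction
    case (mhull_step v d g)
    have "pscale (cst c) (pscale d g + v) = pscale (cst c * d) g + pscale (cst c) v" by (simp add: pscale_simps)
    with mhull_step show ?case by (auto intro: mhull.mhull_step assms)
  qed (simp add: pscale_simps mhull_0)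
qed (auto intro: mhull_0 mhull_add)

lemma \<Gamma>p_cst: "d \<in> \<Gamma>p \<Longrightarrow> cst c * d \<in> \<Gamma>p" by (simp add: \<Gamma>p_def \<Gamma>_closed)

text \<open>Hence an invariant in \<open>\<Gamma>\<^sub>+ DM\<close> already lies in \<open>\<Gamma>\<^sub>+ UU\<close>. This is how the freeness of the larger module
passes to its direct summand.\<close>

lemma reynolds_positive: "v \<in> mhull \<Gamma>p DM \<Longrightarrow> reynolds v \<in> mhull \<Gamma>p UU"
proof (induction rule: mhull.induct)
  case (mhull_step v c g)
  then show ?case
    by (auto simp: reynolds_add reynolds_pscale \<Gamma>p_def intro!: mhull.mhull_step reynolds_UU)
qed (simp add: mhull_0)

text \<open>Averages of monomials. They span the invariants over the ground field and are homogeneous.\<close>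

definition orbit_sums :: "'k qspace set" where
  "orbit_sums = (\<lambda>(a, b). reynolds (single a (single b 1))) ` (MM \<times> Nn n)"

lemma monomial_DM: "a \<in> MM \<Longrightarrow> b \<in> Nn n \<Longrightarrow> single a (single b c) \<in> DM"
  by (rule DM_single) (auto simp: Nn_def intro: Pn_single)

lemma orbit_sums_UU: "orbit_sums \<subseteq> UU"
  by (auto simp: orbit_sums_def intro!: reynolds_UU monomial_DM)

lemma UU_orbit_sums:
  assumes u: "u \<in> UU"
  shows "u = (\<Sum>a\<in>keys u. \<Sum>b\<in>keys (lookup u a). pscale (cst (lookup (lookup u a) b)) (reynolds (single a (single b 1))))"
proof -
  have "u = reynolds (\<Sum>a\<in>keys u. \<Sum>b\<in>keys (lookup u a). pscale (cst (lookup (lookup u a) b)) (single a (single b 1)))"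
  proof -
    have "single a p = (\<Sum>b\<in>keys p. single a (single b (lookup p b)))" for a :: expo and p :: "'k mpoly"
    proof -
      have "single a (sum f I) = (\<Sum>b\<in>I. single a (f b))" for f :: "expo \<Rightarrow> 'k mpoly" and I
        by (induction I rule: infinite_finite_induct) (simp_all add: single_add)
      from this[of "\<lambda>b. single b (lookup p b)" "keys p"] show ?thesis by (simp only: pm_sum_single[symmetric])
    qed
    note st = this[symmetric]
    have "(\<Sum>a\<in>keys u. \<Sum>b\<in>keys (lookup u a). pscale (cst (lookup (lookup u a) b)) (single a (single b 1))) = u"
      by (simp only: pscale_single cst_def mult_single mult_1_right add_0 st pm_sum_single[symmetric])
    then show ?thesis using reynolds_id[OF u] by simp
  qed
  also have "\<dots> = (\<Sum>a\<in>keys u. \<Sum>b\<in>keys (lookup u a). pscale (cst (lookup (lookup u a) b)) (reynolds (single a (single b 1))))"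
    by (simp add: reynolds_sum reynolds_pscale \<Gamma>_closed)
  finally show ?thesis .
qed

lemma orbit_sum_homogeneous:
  "hparts d (reynolds (single a (single b 1))) = (if tdeg b = d then reynolds (single a (single b 1)) else 0)"
proof -
  have "hparts d (single a (single b (1 :: 'k))) = (if tdeg b = d then single a (single b 1) else 0)"
    by (rule poly_mapping_eqI) (auto simp: lookup_single when_def hpart_single)
  then show ?thesis by (simp add: hparts_reynolds)
qed

text \<open>Representatives \<open>B\<close> of a basis of \<open>UU\<close> modulo \<open>\<Gamma>\<^sub>+ UU\<close>, chosen among the homogeneous orbit sums, are a
basis over \<open>\<Gamma>\<close>. That they generate is the graded Nakayama lemma, by induction on the degree. For their
independence, expand a relation \<open>\<Sum>\<^sub>b c\<^sub>b b = 0\<close> in the basis of the polynomials over \<open>\<Gamma>\<close>, and let \<open>e\<^sub>0\<close> be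
an exponent of least degree in the \<open>c\<^sub>b\<close>. Comparing coefficients at \<open>e\<^sub>0\<close> puts the combination of the \<open>b\<close>
with the scalars \<open>(c\<^sub>b)\<^bsub>e_0\<^esub>\<close> into \<open>\<Gamma>\<^sub>+ DM\<close>, hence into \<open>\<Gamma>\<^sub>+ UU\<close> by averaging, which contradicts the choice
of \<open>B\<close>.\<close>

lemma invariants_free:
  "\<exists>B\<subseteq>UU. UU \<subseteq> mhull \<Gamma> B \<and>
    (\<forall>F c. finite F \<and> F \<subseteq> B \<and> c \<in> F \<rightarrow> \<Gamma> \<and> (\<Sum>b\<in>F. pscale (c b) b) = 0 \<longrightarrow> (\<forall>b\<in>F. c b = 0))"
proof -
  define J where "J = mhull \<Gamma>p UU"
  have J: "VS.subspace J" unfolding J_def by (rule mhull_subspace) (rule \<Gamma>p_cst)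
  \<comment> \<open>a basis of \<open>J\<close>, extended by orbit sums to a basis of all invariants\<close>
  obtain C0 where C0: "C0 \<subseteq> J" "VS.independent C0" "J \<subseteq> VS.span C0" by (rule VS.maximal_independent_subset)
  have spC0: "VS.span C0 \<subseteq> J" by (rule VS.span_minimal[OF C0(1) J])
  have sub: "C0 \<subseteq> C0 \<union> orbit_sums" by simp
  obtain B' where B': "C0 \<subseteq> B'" "B' \<subseteq> C0 \<union> orbit_sums" "VS.independent B'" "C0 \<union> orbit_sums \<subseteq> VS.span B'"
    by (rule VS.maximal_independent_subset_extend[OF sub C0(2)])
  define B where "B = B' - C0"
  have B: "B \<subseteq> orbit_sums" using B' by (auto simp: B_def)
  have indep: "s b = 0" if F: "finite F" "F \<subseteq> B" and s: "(\<Sum>b\<in>F. pscale (cst (s b)) b) \<in> J" and b: "b \<in> F" for F s b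
  proof (rule ccontr)
    assume sb: "s b \<noteq> 0"
    have C0B: "C0 \<subseteq> B' - {b}" "F - {b} \<subseteq> B' - {b}" using B'(1) F b by (auto simp: B_def)
    have 1: "(\<Sum>b\<in>F. pscale (cst (s b)) b) \<in> VS.span (B' - {b})"
      using s C0(3) VS.span_mono[OF C0B(1)] by blast
    have 2: "(\<Sum>b\<in>F - {b}. pscale (cst (s b)) b) \<in> VS.span (B' - {b})"
      using C0B(2) by (intro VS.span_sum VS.span_scale VS.span_base) blast
    have "pscale (cst (s b)) b = (\<Sum>b\<in>F. pscale (cst (s b)) b) - (\<Sum>b\<in>F - {b}. pscale (cst (s b)) b)"
      using F b by (simp add: sum.remove)
    then have "pscale (cst (s b)) b \<in> VS.span (B' - {b})" using VS.span_diff[OF 1 2] by simp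
    then have "pscale (cst (1 / s b)) (pscale (cst (s b)) b) \<in> VS.span (B' - {b})" by (rule VS.span_scale)
    then have "b \<in> VS.span (B' - {b})" using sb by (simp add: pscale_simps(3)[symmetric] cst_mult[symmetric] pscale_simps(4))
    moreover have "b \<in> B'" using F b by (auto simp: B_def)
    ultimately show False using B'(3) unfolding VS.dependent_def by blast
  qed
  define H where "H = mhull \<Gamma> B"
  have Hs: "VS.subspace H" unfolding H_def by (rule mhull_subspace) (simp add: \<Gamma>_closed)
  have spB: "VS.span B \<subseteq> H" by (rule VS.span_minimal[OF _ Hs]) (auto simp: H_def intro: mhull_incl \<Gamma>_closed)
  have gen: "reynolds (single a (single b 1)) \<in> H" if "a \<in> MM" "b \<in> Nn n" for a b
    using that
  proof (induction "tdeg b" arbitrary: a b rule: less_induct)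
    case less
    define d where "d = tdeg b"
    have low: "u \<in> H" if u: "u \<in> UU" and d': "u = hparts d' u" "d' < d" for u d'
    proof -
      have "pscale (cst (lookup (lookup u a) b)) (reynolds (single a (single b 1))) \<in> H"
        if ab: "a \<in> keys u" "b \<in> keys (lookup u a)" for a b
      proof -
        have "lookup (hpart d' (lookup u a)) b \<noteq> 0" using ab d'(1) by (metis in_keys_iff lookup_hparts)
        then have tb: "tdeg b < d" using d'(2) by (simp add: lookup_hpart split: if_splits)
        have "a \<in> MM" "b \<in> Nn n" using u ab by (auto simp: UU_def DM_def Pn_def Nn_def)
        from less.hyps[OF tb[unfolded d_def] this] show ?thesis by (rule VS.subspace_scale[OF Hs])
      qed
      then show ?thesis by (subst UU_orbit_sums[OF u]) (intro VS.subspace_sum[OF Hs]; assumption)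
    qed
    have "reynolds (single a (single b 1)) \<in> orbit_sums" using less.prems by (force simp: orbit_sums_def)
    then have "reynolds (single a (single b 1)) \<in> VS.span (B \<union> C0)"
    proof -
      have "B \<union> C0 = B'" using B'(1) by (auto simp: B_def)
      then show ?thesis using B'(4) \<open>reynolds (single a (single b 1)) \<in> orbit_sums\<close> by blast
    qed
    \<comment> \<open>modulo \<open>J\<close> the orbit sum is a combination \<open>x\<close> of \<open>B\<close>; the part of degree \<open>d\<close> of the error \<open>j\<close> only involves invariants of smaller degree\<close>
    then obtain x j where xj: "reynolds (single a (single b 1)) = x + j" "x \<in> VS.span B" "j \<in> VS.span C0"
      unfolding VS.span_Un by blast
    have "hparts d x \<in> VS.span B"
      using xj(2)
    proof (induction rule: VS.span_induct_alt)
      case (step c y z)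
      obtain a b where ab: "y = reynolds (single a (single b 1))" using step(1) B by (auto simp: orbit_sums_def)
      have "hparts d y = y \<or> hparts d y = 0" unfolding ab orbit_sum_homogeneous by simp
      then have "hparts d y \<in> VS.span B" using step(1) by (metis VS.span_base VS.span_zero)
      then show ?case unfolding hparts_simps(2,3) using step(2) by (intro VS.span_add VS.span_scale)
    qed (simp add: hparts_simps(1) VS.span_zero)
    moreover have "hparts d j \<in> H"
    proof -
      have "j \<in> mhull \<Gamma>p UU" using xj(3) spC0 by (auto simp: J_def)
      then show ?thesis
      proof induction
        case mhull_0
        then show ?case by (simp add: hparts_simps(1) VS.subspace_0[OF Hs])
      next
        case (mhull_step v c g)
        have "pscale (hpart i c) (hparts (d - i) g) \<in> H" if i: "i \<le> d" for i
        proof (cases "i = 0")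
          case True
          have "hpart 0 c = 0" using mhull_step(2)
            by (intro poly_mapping_eqI) (auto simp: lookup_hpart tdeg_eq_0 \<Gamma>p_def)
          then show ?thesis using True by (simp add: pscale_simps VS.subspace_0[OF Hs])
        next
          case False
          have "hparts (d - i) (hparts (d - i) g) = hparts (d - i) g"
            by (intro poly_mapping_eqI) (simp add: lookup_hpart)
          then have "hparts (d - i) g \<in> H" using False i mhull_step(3) by (intro low[of _ "d - i"] hparts_UU) auto
          then show ?thesis unfolding H_def using mhull_step(2)
            by (intro mhull_scale) (auto simp: \<Gamma>p_def intro: hpart_\<Gamma> \<Gamma>_closed)
        qed
        then have "hparts d (pscale c g) \<in> H" unfolding hparts_simps(4) by (intro VS.subspace_sum[OF Hs]) simp
        then show ?case unfolding hparts_simps(2) using mhull_step by (intro VS.subspace_add[OF Hs])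
      qed
    qed
    ultimately have "hparts d (x + j) \<in> H" unfolding hparts_simps(2) using spB by (intro VS.subspace_add[OF Hs]) auto
    then show ?case unfolding xj(1)[symmetric] orbit_sum_homogeneous by (simp add: d_def)
  qed
  have "UU \<subseteq> H"
  proof
    fix u assume u: "u \<in> UU"
    have ab: "a \<in> MM \<and> b \<in> Nn n" if "a \<in> keys u" "b \<in> keys (lookup u a)" for a b
      using that u by (auto simp: UU_def DM_def Pn_def Nn_def)
    show "u \<in> H" by (subst UU_orbit_sums[OF u]) (use ab gen in \<open>intro VS.subspace_sum[OF Hs] VS.subspace_scale[OF Hs]; blast\<close>)
  qed
  moreover have "c b = 0" if F: "finite F" "F \<subseteq> B" and c: "c \<in> F \<rightarrow> \<Gamma>" and rel: "(\<Sum>b\<in>F. pscale (c b) b) = 0" and b: "b \<in> F" for F c b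
  proof (rule ccontr)
    assume cb: "c b \<noteq> 0"
    define P where "P d \<longleftrightarrow> (\<exists>b\<in>F. \<exists>b'\<in>keys (c b). tdeg b' = d)" for d
    define d where "d = (LEAST d. P d)"
    have "keys (c b) \<noteq> {}" using cb by simp
    then have "\<exists>d. P d" using b unfolding P_def by blast
    then have "P d" unfolding d_def by (rule LeastI_ex)
    then obtain b0 e0 where b0: "b0 \<in> F" "e0 \<in> keys (c b0)" "tdeg e0 = d" unfolding P_def by blast
    have low: "tdeg e0 \<le> tdeg b'" if "b1 \<in> F" "b' \<in> keys (c b1)" for b1 b'
      unfolding b0(3) d_def by (rule Least_le) (use that in \<open>auto simp: P_def\<close>)
    obtain C :: "(nat \<Rightarrow> nat) set" and e :: "(nat \<Rightarrow> nat) \<Rightarrow> 'k mpoly" where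
      C: "finite C" "e ` C \<subseteq> Pn n" "\<forall>p\<in>Pn n. \<exists>g. (\<forall>k\<in>C. g k \<in> \<Gamma>) \<and> p = (\<Sum>k\<in>C. g k * e k)"
      "\<forall>g. (\<forall>k\<in>C. g k \<in> \<Gamma>) \<and> (\<Sum>k\<in>C. g k * e k) = 0 \<longrightarrow> (\<forall>k\<in>C. g k = 0)"
      using \<Gamma>_structure(2) by blast
    have FD: "b \<in> F \<Longrightarrow> b \<in> DM" for b using F(2) B orbit_sums_UU UU_DM by blast
    then have "\<forall>b\<in>F. \<forall>a. \<exists>g. (\<forall>k\<in>C. g k \<in> \<Gamma>) \<and> lookup b a = (\<Sum>k\<in>C. g k * e k)"
      using C(3) by (auto simp: DM_def)
    then obtain g where g: "\<And>b a k. b \<in> F \<Longrightarrow> k \<in> C \<Longrightarrow> g b a k \<in> \<Gamma>" "\<And>b a. b \<in> F \<Longrightarrow> lookup b a = (\<Sum>k\<in>C. g b a k * e k)"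
      by metis
    have z: "(\<Sum>b\<in>F. c b * g b a k) = 0" if k: "k \<in> C" for a k
    proof -
      have "(\<Sum>k\<in>C. (\<Sum>b\<in>F. c b * g b a k) * e k) = (\<Sum>b\<in>F. c b * (\<Sum>k\<in>C. g b a k * e k))"
        unfolding sum_distrib_left sum_distrib_right by (subst sum.swap) (simp add: mult.assoc)
      also have "\<dots> = lookup (\<Sum>b\<in>F. pscale (c b) b) a" by (simp add: lookup_sum g(2))
      also have "\<dots> = 0" by (simp add: rel)
      finally show ?thesis using C(4)[rule_format, of "\<lambda>k. \<Sum>b\<in>F. c b * g b a k" k] k c g(1)
        by (auto intro!: \<Gamma>_sum \<Gamma>_closed)
    qed
    define s where "s b = lookup (c b) e0" for b
    have z0: "(\<Sum>b\<in>F. s b * lookup (g b a k) 0) = 0" if k: "k \<in> C" for a k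
    proof -
      have "0 = lookup (\<Sum>b\<in>F. c b * g b a k) e0" by (simp add: z[OF k])
      also have "\<dots> = (\<Sum>b\<in>F. s b * lookup (g b a k) 0)"
        unfolding lookup_sum s_def by (intro sum.cong refl lookup_mult_lowest low)
      finally show ?thesis by simp
    qed
    \<comment> \<open>the combination of the \<open>b\<close> with the lowest coefficients\<close>
    define w where "w = (\<Sum>b\<in>F. pscale (cst (s b)) b)"
    have wU: "w \<in> UU" unfolding w_def using F(2) B orbit_sums_UU
      by (intro VS.subspace_sum VS.subspace_scale) (auto simp: VS.subspace_def UU_closed UU_pscale \<Gamma>_closed)
    have "w \<in> mhull \<Gamma>p DM"
    proof -
      have h: "lookup w a = (\<Sum>k\<in>C. (\<Sum>b\<in>F. cst (s b) * g b a k) * e k)" for a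
      proof -
        have "lookup w a = (\<Sum>b\<in>F. cst (s b) * (\<Sum>k\<in>C. g b a k * e k))" by (simp add: w_def lookup_sum g(2))
        also have "\<dots> = (\<Sum>k\<in>C. (\<Sum>b\<in>F. cst (s b) * g b a k) * e k)"
          unfolding sum_distrib_left sum_distrib_right by (subst sum.swap) (simp add: mult.assoc)
        finally show ?thesis .
      qed
      have hp: "(\<Sum>b\<in>F. cst (s b) * g b a k) \<in> \<Gamma>p" if "k \<in> C" for a k
        using z0[OF that] g(1)[OF _ that] by (auto simp: \<Gamma>p_def lookup_sum intro!: \<Gamma>_sum \<Gamma>_closed)
      have "single a (lookup w a) \<in> mhull \<Gamma>p DM" if a: "a \<in> keys w" for a
      proof -
        have aM: "a \<in> MM" using a wU by (auto simp: UU_def DM_def)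
        have "single a (lookup w a) = (\<Sum>k\<in>C. pscale (\<Sum>b\<in>F. cst (s b) * g b a k) (single a (e k)))"
          unfolding h by (rule poly_mapping_eqI) (simp add: lookup_sum lookup_single when_def)
        also have "\<dots> \<in> mhull \<Gamma>p DM"
        proof (rule mhull_sum)
          fix k assume k: "k \<in> C"
          have "single a (e k) \<in> DM" by (rule DM_single[OF aM]) (use C(2) k in auto)
          then show "pscale (\<Sum>b\<in>F. cst (s b) * g b a k) (single a (e k)) \<in> mhull \<Gamma>p DM"
            using mhull_step[OF mhull_0 hp[OF k], of "single a (e k)" DM a] by (simp only: add_0_right)
        qed
        finally show ?thesis .
      qed
      then have "(\<Sum>a\<in>keys w. single a (lookup w a)) \<in> mhull \<Gamma>p DM" by (rule mhull_sum)
      then show ?thesis by (simp only: pm_sum_single[symmetric])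
    qed
    then have "w \<in> J" using reynolds_positive reynolds_id[OF wU] by (metis J_def)
    then have "s b0 = 0" unfolding w_def by (rule indep[OF F _ b0(1)])
    then show False using b0(2) by (simp add: s_def in_keys_iff)
  qed
  ultimately show ?thesis using B orbit_sums_UU unfolding H_def by (intro exI[of _ B]) blast
qed

lemma finsum_eq_sum:
  assumes "ring R" "ring.add R = (+)" "\<zero>\<^bsub>R\<^esub> = (0 :: 'b::ab_group_add)" "finite F" "f \<in> F \<rightarrow> carrier R"
  shows "finsum R f F = sum f F"
proof -
  interpret R: ring R by fact
  show ?thesis using assms(4,5) by (induction F rule: finite_induct) (simp_all add: assms(2,3) Pi_iff)
qed

text \<open>As for the skew monoid ring, the left and the right module structure differ by a change of coordinates
\<open>\<epsilon>\<close>, which is the identity for the former and \<open>qtwist\<close> for the latter.\<close>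

lemma left_free_coordinates:
  fixes R :: "('k qspace, 'e) ring_scheme"
  assumes R: "ring R" "carrier R = UU" "ring.add R = (+)" "\<zero>\<^bsub>R\<^esub> = 0" "\<one>\<^bsub>R\<^esub> = 1"
    and \<epsilon>: "bij_betw \<epsilon> UU UU" "\<And>u v. \<epsilon> (u + v) = \<epsilon> u + \<epsilon> v" "\<epsilon> 0 = 0"
    and scale: "\<And>c v. c \<in> \<Gamma> \<Longrightarrow> v \<in> UU \<Longrightarrow> single 0 c \<otimes>\<^bsub>R\<^esub> \<epsilon> v = \<epsilon> (pscale c v)"
    and mult: "\<And>c d. c \<in> \<Gamma> \<Longrightarrow> d \<in> \<Gamma> \<Longrightarrow> single 0 c \<otimes>\<^bsub>R\<^esub> single 0 d = single 0 (c * d)"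
  shows "left_free R (single 0 ` \<Gamma>) UU"
proof -
  interpret R: ring R by fact
  obtain B where B: "B \<subseteq> UU" "UU \<subseteq> mhull \<Gamma> B"
    "\<forall>F c. finite F \<and> F \<subseteq> B \<and> c \<in> F \<rightarrow> \<Gamma> \<and> (\<Sum>b\<in>F. pscale (c b) b) = 0 \<longrightarrow> (\<forall>b\<in>F. c b = 0)"
    using invariants_free by (elim exE conjE)
  have \<epsilon>U: "u \<in> UU \<Longrightarrow> \<epsilon> u \<in> UU" for u using \<epsilon>(1) by (auto simp: bij_betw_def)
  have \<epsilon>s: "\<epsilon> (sum f F) = (\<Sum>b\<in>F. \<epsilon> (f b))" for f :: "'k qspace \<Rightarrow> 'k qspace" and F
    by (induction F rule: infinite_finite_induct) (simp_all add: \<epsilon>)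
  have S: "single 0 ` \<Gamma> \<subseteq> carrier R" "\<zero>\<^bsub>R\<^esub> \<in> single 0 ` \<Gamma>" "\<one>\<^bsub>R\<^esub> \<in> single 0 ` \<Gamma>"
    "\<And>x y. x \<in> single 0 ` \<Gamma> \<Longrightarrow> y \<in> single 0 ` \<Gamma> \<Longrightarrow> x \<oplus>\<^bsub>R\<^esub> y \<in> single 0 ` \<Gamma>"
    "\<And>x y. x \<in> single 0 ` \<Gamma> \<Longrightarrow> y \<in> single 0 ` \<Gamma> \<Longrightarrow> x \<otimes>\<^bsub>R\<^esub> y \<in> single 0 ` \<Gamma>"
  proof -
    show "\<zero>\<^bsub>R\<^esub> \<in> single 0 ` \<Gamma>" using \<Gamma>_closed(4) by (intro image_eqI[of _ _ 0]) (simp_all add: R)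
    show "\<one>\<^bsub>R\<^esub> \<in> single 0 ` \<Gamma>" using \<Gamma>_closed(5) by (intro image_eqI[of _ _ 1]) (simp_all add: R)
  qed (auto simp: R UU_closed mult single_add[symmetric] intro!: imageI \<Gamma>_closed)
  have \<epsilon>B: "\<epsilon> ` B \<subseteq> carrier R" using B(1) \<epsilon>U by (auto simp: R)
  show ?thesis
    unfolding left_free_def
  proof (intro exI[of _ "\<epsilon> ` B"] conjI allI impI)
    show "\<epsilon> ` B \<subseteq> UU" using B(1) \<epsilon>U by auto
    show "left_span R (single 0 ` \<Gamma>) (\<epsilon> ` B) = UU"
    proof
      show "left_span R (single 0 ` \<Gamma>) (\<epsilon> ` B) \<subseteq> UU"
        by (rule R.left_span_least) (use B(1) \<epsilon>U in \<open>auto simp: R UU_closed scale intro!: \<epsilon>U UU_pscale\<close>)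
      have "\<epsilon> v \<in> left_span R (single 0 ` \<Gamma>) (\<epsilon> ` B)" if "v \<in> mhull \<Gamma> B" for v
        using that
      proof induction
        case mhull_0
        show ?case using R.left_span_zero[OF S \<epsilon>B] by (simp add: R \<epsilon>)
      next
        case (mhull_step v c g)
        have "\<epsilon> (pscale c g + v) = single 0 c \<otimes>\<^bsub>R\<^esub> \<epsilon> g \<oplus>\<^bsub>R\<^esub> \<epsilon> v"
          using mhull_step B(1) by (simp add: R \<epsilon> scale subset_iff)
        moreover have "\<dots> \<in> left_span R (single 0 ` \<Gamma>) (\<epsilon> ` B)"
        proof (rule R.left_span_add[OF S \<epsilon>B R.left_span_mult[OF S \<epsilon>B _ R.left_span_incl[OF S \<epsilon>B]]])
          show "single 0 c \<in> single 0 ` \<Gamma>" using mhull_step(2) by blast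
          show "\<epsilon> g \<in> \<epsilon> ` B" using mhull_step(3) by blast
          show "\<epsilon> v \<in> left_span R (single 0 ` \<Gamma>) (\<epsilon> ` B)" by (rule mhull_step)
        qed
        ultimately show ?case by simp
      qed
      then have "\<epsilon> ` UU \<subseteq> left_span R (single 0 ` \<Gamma>) (\<epsilon> ` B)" using B(2) by blast
      then show "UU \<subseteq> left_span R (single 0 ` \<Gamma>) (\<epsilon> ` B)" using \<epsilon>(1) by (simp add: bij_betw_def)
    qed
    fix F c assume F: "finite F \<and> F \<subseteq> \<epsilon> ` B \<and> c \<in> F \<rightarrow> single 0 ` \<Gamma> \<and> (\<Oplus>\<^bsub>R\<^esub>b\<in>F. c b \<otimes>\<^bsub>R\<^esub> b) = \<zero>\<^bsub>R\<^esub>"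
    then have "F \<subseteq> \<epsilon> ` B" by simp
    then obtain F0 where F0: "F0 \<subseteq> B" "F = \<epsilon> ` F0" by (rule subset_imageE)
    have injF0: "inj_on \<epsilon> F0" by (rule inj_on_subset[of \<epsilon> UU]) (use \<epsilon>(1) F0 B(1) in \<open>auto simp: bij_betw_def\<close>)
    have finF0: "finite F0" using F F0(2) injF0 by (simp add: finite_image_iff)
    have "\<forall>b\<in>F0. \<exists>p\<in>\<Gamma>. c (\<epsilon> b) = single 0 p" using F F0(2) by (auto simp: Pi_iff)
    then obtain p where p: "\<And>b. b \<in> F0 \<Longrightarrow> p b \<in> \<Gamma> \<and> c (\<epsilon> b) = single 0 (p b)" by metis
    have F0U: "b \<in> F0 \<Longrightarrow> b \<in> UU" for b using F0 B(1) by auto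
    have "(\<Oplus>\<^bsub>R\<^esub>b\<in>F. c b \<otimes>\<^bsub>R\<^esub> b) = (\<Sum>b\<in>F. c b \<otimes>\<^bsub>R\<^esub> b)"
      by (rule finsum_eq_sum[OF R(1,3,4)]) (use F \<epsilon>B S(1) in \<open>auto simp: Pi_iff intro!: R.m_closed\<close>)
    also have "\<dots> = (\<Sum>b\<in>F0. \<epsilon> (pscale (p b) b))"
      unfolding F0(2) sum.reindex[OF injF0] by (rule sum.cong) (simp_all add: p scale F0U)
    also have "\<dots> = \<epsilon> (\<Sum>b\<in>F0. pscale (p b) b)" by (simp add: \<epsilon>s)
    finally have "\<epsilon> (\<Sum>b\<in>F0. pscale (p b) b) = \<epsilon> 0" using F by (simp add: R \<epsilon>)
    moreover have "(\<Sum>b\<in>F0. pscale (p b) b) \<in> UU" using F0U p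
      by (intro VS.subspace_sum[of UU]) (auto simp: VS.subspace_def UU_closed UU_pscale \<Gamma>_closed)
    ultimately have "(\<Sum>b\<in>F0. pscale (p b) b) = 0" using \<epsilon>(1) UU_closed(4) by (auto simp: bij_betw_def inj_on_def)
    moreover have "p \<in> F0 \<rightarrow> \<Gamma>" using p by blast
    ultimately have "\<forall>b\<in>F0. p b = 0" using B(3) finF0 F0(1) by simp
    then show "\<forall>b\<in>F. c b = \<zero>\<^bsub>R\<^esub>" using p by (auto simp: F0(2) R)
  qed
qed

text \<open>The algebra of invariants in the model.\<close>

definition UR :: "('k, 'k qspace) module" where "UR = (model q)\<lparr>carrier := UU\<rparr>"

lemma UR_simps [simp]: "carrier UR = UU" "monoid.mult UR = D.tmul q" "\<one>\<^bsub>UR\<^esub> = 1" "\<zero>\<^bsub>UR\<^esub> = 0" "ring.add UR = (+)"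
  by (simp_all add: UR_def)

lemma UU_uminus: "f \<in> UU \<Longrightarrow> - f \<in> UU"
  using UU_pscale[OF \<Gamma>_closed(3)[of "- 1"], of f] by (simp add: cst_minus pscale_simps)

lemma ring_UR: "ring UR"
proof -
  have "abelian_group UR"
    by (rule abelian_groupI) (auto simp: algebra_simps UU_closed intro: bexI[OF _ UU_uminus])
  moreover have "Group.monoid UR"
    by (rule monoidI) (auto simp: D.tmul_assoc UU_closed)
  ultimately show ?thesis by (rule ringI) (auto simp: D.tmul_add_l D.tmul_add_r)
qed

lemma left_free_UR: "left_free UR (single 0 ` \<Gamma>) UU"
proof (rule left_free_coordinates[of _ "\<lambda>v. v"])
  show "single 0 c \<otimes>\<^bsub>UR\<^esub> v = pscale c v" for c v
    by (rule poly_mapping_eqI) (simp add: D.lookup_tmul_scalar)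
qed (simp_all add: ring_UR D.tmul_single qdil_def bij_betw_id[unfolded id_def])

definition qtwist :: "'k qspace \<Rightarrow> 'k qspace" where
  "qtwist = pm_lift (\<lambda>a p. single a (qdil q a p))"

lemma qtwist_add: "qtwist (f + g) = qtwist f + qtwist g"
  unfolding qtwist_def by (rule pm_lift_add) (simp_all add: qdil_simps single_add)
lemma qtwist_0 [simp]: "qtwist 0 = 0" by (simp add: qtwist_def)
lemma lookup_qtwist [simp]: "lookup (qtwist f) a = qdil q a (lookup f a)"
proof (induction f rule: pm_add_induct)
  case (add b c f)
  have "qtwist (single b c) = single b (qdil q b c)" unfolding qtwist_def by (rule pm_lift_single) (simp add: qdil_simps)
  then show ?case using add by (auto simp: qtwist_add lookup_add lookup_single when_def qdil_simps)
qed (simp add: qdil_simps)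

lemma qdil_inverse: "dil (\<lambda>i. q ^ lookup a i) (qdil q a p) = p" "qdil q a (dil (\<lambda>i. q ^ lookup a i) p) = p"
proof -
  have "q ^ j * inverse q ^ j = 1" for j :: nat using q_nonzero by (simp flip: power_mult_distrib)
  then show "dil (\<lambda>i. q ^ lookup a i) (qdil q a p) = p" "qdil q a (dil (\<lambda>i. q ^ lookup a i) p) = p"
    unfolding qdil_def by (auto intro!: dil_inverse simp: mult.commute)
qed

lemma qtwist_bij: "bij_betw qtwist UU UU"
proof (rule bij_betwI')
  show "qtwist f = qtwist g \<longleftrightarrow> f = g" for f g
  proof
    assume "qtwist f = qtwist g"
    then have "qdil q a (lookup f a) = qdil q a (lookup g a)" for a by (metis lookup_qtwist)
    then have "lookup f a = lookup g a" for a by (metis qdil_inverse(1))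
    then show "f = g" by (rule poly_mapping_eqI)
  qed simp
  have k: "qdil q a p = 0 \<longleftrightarrow> p = 0" for a p using qdil_inverse(1)[of a p] by (auto simp: qdil_simps dil_simps)
  show "qtwist f \<in> UU" if "f \<in> UU" for f
    using that by (auto simp: UU_def DM_def in_keys_iff k qdil_Pn perm_qdil W_bij subset_iff)
  show "\<exists>f\<in>UU. g = qtwist f" if g: "g \<in> UU" for g
  proof -
    define f where "f = (\<Sum>a\<in>keys g. single a (dil (\<lambda>i. q ^ lookup a i) (lookup g a)))"
    have f: "lookup f a = dil (\<lambda>i. q ^ lookup a i) (lookup g a)" for a
    proof -
      have "lookup f a = (\<Sum>b\<in>keys g. if b = a then dil (\<lambda>i. q ^ lookup b i) (lookup g b) else 0)"
        by (simp add: f_def lookup_sum lookup_single when_def)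
      then show ?thesis by (simp add: in_keys_iff dil_simps)
    qed
    have gf: "g = qtwist f" by (rule poly_mapping_eqI) (simp add: f qdil_inverse)
    have "keys f = keys g" by (auto simp: gf in_keys_iff k)
    moreover have "lookup f (pexp \<pi> a) = perm \<pi> (lookup f a)" if \<pi>: "\<pi> \<in> W" for \<pi> a
    proof -
      have "qdil q (pexp \<pi> a) (lookup f (pexp \<pi> a)) = qdil q (pexp \<pi> a) (perm \<pi> (lookup f a))"
        using g \<pi> by (simp add: gf UU_def perm_qdil W_bij)
      then show ?thesis by (metis qdil_inverse(1))
    qed
    ultimately have "f \<in> UU" using g by (auto simp: UU_def DM_def f dil_Pn)
    with gf show ?thesis by blast
  qed
qed

lemma right_free_UR: "left_free (opposite_ring UR) (single 0 ` \<Gamma>) UU"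
proof (rule left_free_coordinates[of _ qtwist])
  show "single 0 c \<otimes>\<^bsub>opposite_ring UR\<^esub> qtwist v = qtwist (pscale c v)" for c v
    by (rule poly_mapping_eqI) (simp add: opposite_ring_def D.lookup_tmul_scalar_r qdil_simps mult.commute)
  show "ring (opposite_ring UR)" by (rule ring.ring_opposite[OF ring_UR])
qed (simp_all add: opposite_ring_def D.tmul_single qtwist_bij qtwist_add qdil_def mult.commute)

end

section \<open>Finite generation of the ring of invariants\<close>

text \<open>The powers \<open>x\<^sub>i\<^sup>m\<close> are fixed by \<open>T\<close>, so every invariant under \<open>W\<close> in the polynomial ring in the \<open>x\<^sub>i\<^sup>m\<close> is an
invariant of the group. Here \<open>mexp m b\<close> is the exponent \<open>m b\<close>.\<close>

definition mexp :: "nat \<Rightarrow> expo \<Rightarrow> expo" where "mexp m b = Poly_Mapping.map ((*) m) b"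

lemma lookup_mexp [simp]: "lookup (mexp m b) i = m * lookup b i"
  by (simp add: mexp_def Poly_Mapping.map.rep_eq when_def)

lemma mexp_add: "mexp m (a + b) = mexp m a + mexp m b"
  by (rule poly_mapping_eqI) (simp add: lookup_add distrib_left)

lemma mexp_0 [simp]: "mexp m 0 = 0" by (rule poly_mapping_eqI) simp

lemma mexp_pexp: "bij \<pi> \<Longrightarrow> mexp m (pexp \<pi> b) = pexp \<pi> (mexp m b)"
  by (rule poly_mapping_eqI) (simp add: lookup_pexp)

lemma keys_mexp: "keys (mexp m b) \<subseteq> keys b" by (auto simp: in_keys_iff)

context invariants begin

lemma mexp_MM: assumes "b \<in> Nn n" shows "mexp m b \<in> MM"
proof -
  have k: "keys (mexp m b) \<subseteq> {..<n}" using keys_mexp[of m b] assms by (auto simp: Nn_def)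
  have "mon g (mexp m b) = 1" if g: "g \<in> T" for g
    using T_root[OF g] by (subst mon_superset[OF _ k]) (simp_all add: power_mult)
  with k show ?thesis by (simp add: MM_def Nn_def)
qed

text \<open>The substitution \<open>y\<^sub>i \<mapsto> x\<^sub>i\<^sup>m\<close>; it is a homomorphism because the \<open>x\<^sub>i\<close> commute with each other.\<close>

definition xpoly :: "'k mpoly \<Rightarrow> 'k qspace" where
  "xpoly = pm_lift (\<lambda>b c. single (mexp m b) (cst c))"

lemma xpoly_0 [simp]: "xpoly 0 = 0" by (simp add: xpoly_def)
lemma xpoly_add: "xpoly (p + p') = xpoly p + xpoly p'"
  unfolding xpoly_def by (rule pm_lift_add) (simp_all add: cst_add single_add)
lemma xpoly_single: "xpoly (single b c) = single (mexp m b) (cst c)"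
  unfolding xpoly_def by (rule pm_lift_single) simp
lemma xpoly_sum: "xpoly (sum f I) = (\<Sum>i\<in>I. xpoly (f i))"
  by (induction I rule: infinite_finite_induct) (simp_all add: xpoly_add)

lemma xpoly_mult: "xpoly (p * p') = D.tmul q (xpoly p) (xpoly p')"
proof (induction p rule: pm_add_induct)
  case (add b c p)
  have "xpoly (single b c * p') = D.tmul q (xpoly (single b c)) (xpoly p')"
    by (induction p' rule: pm_add_induct)
      (simp_all add: distrib_left xpoly_add D.tmul_add_r mult_single xpoly_single D.tmul_single mexp_add cst_mult)
  then show ?case using add by (simp add: distrib_right xpoly_add D.tmul_add_l)
qed simp

lemma act_xpoly: "bij \<pi> \<Longrightarrow> act (\<lambda>_. 1) \<pi> (xpoly p) = xpoly (perm \<pi> p)"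
  by (induction p rule: pm_add_induct)
    (simp_all add: perm_simps xpoly_add act_add xpoly_single act_single perm_single mexp_pexp)

lemma xpoly_DM: assumes "p \<in> Pn n" shows "xpoly p \<in> DM"
proof -
  have "xpoly p = (\<Sum>b\<in>keys p. single (mexp m b) (cst (lookup p b)))" by (simp add: xpoly_def pm_lift_def)
  also have "\<dots> \<in> DM"
  proof (intro DM_sum DM_single mexp_MM)
    show "b \<in> Nn n" if "b \<in> keys p" for b using that assms by (auto simp: Pn_def Nn_def)
  qed simp
  finally show ?thesis .
qed

lemma xpoly_UU: "p \<in> \<Gamma> \<Longrightarrow> xpoly p \<in> UU"
  by (auto simp: UU_iff_act xpoly_DM \<Gamma>_def act_xpoly W_bij)

lemma pscale_tmul: "pscale c v = D.tmul q (single 0 c) v"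
  by (rule poly_mapping_eqI) (simp add: D.lookup_tmul_scalar)

lemma reynolds_tmul: assumes "u \<in> UU" shows "reynolds (D.tmul q f u) = D.tmul q (reynolds f) u"
proof -
  have "(\<Sum>\<pi>\<in>W. act (\<lambda>_. 1) \<pi> (D.tmul q f u)) = (\<Sum>\<pi>\<in>W. D.tmul q (act (\<lambda>_. 1) \<pi> f) u)"
    using assms by (intro sum.cong refl) (simp add: act_tmul W_bij UU_iff_act)
  also have "\<dots> = D.tmul q (\<Sum>\<pi>\<in>W. act (\<lambda>_. 1) \<pi> f) u"
    by (rule sym, induction W rule: infinite_finite_induct) (simp_all add: D.tmul_add_l)
  finally show ?thesis by (simp add: reynolds_def pscale_tmul D.tmul_assoc)
qed

lemma tmul_sum_r: "D.tmul q f (sum g I) = (\<Sum>i\<in>I. D.tmul q f (g i))"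
  by (induction I rule: infinite_finite_induct) (simp_all add: D.tmul_add_r)

text \<open>The invariants of \<open>T\<close> are a finitely generated bimodule over \<open>\<Gamma>\<close>, acting from the left, and the copy of
\<open>\<Gamma>\<close> in the powers \<open>x\<^sub>i\<^sup>m\<close>, acting from the right: split \<open>x\<^sup>a\<close> as \<open>x\<^sup>r\<close> with \<open>r\<^sub>i < m\<close> times a monomial in
the \<open>x\<^sub>i\<^sup>m\<close>, and expand that monomial and the coefficient in the basis of the polynomials over \<open>\<Gamma>\<close>. The
Reynolds operator is linear on both sides, so the invariants are generated, as a ring that contains \<open>\<Gamma>\<close>,
by the averages of the bimodule generators and by finitely many generators of the second copy of \<open>\<Gamma>\<close>.\<close>

lemma UU_generated:
  "\<exists>F\<subseteq>UU. finite F \<and> (\<forall>Z. single 0 ` \<Gamma> \<subseteq> Z \<and> F \<subseteq> Z \<and> (\<forall>u\<in>Z. \<forall>v\<in>Z. u + v \<in> Z) \<and>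
    (\<forall>u\<in>Z. \<forall>v\<in>Z. D.tmul q u v \<in> Z) \<longrightarrow> UU \<subseteq> Z)"
proof -
  obtain t :: "nat \<Rightarrow> 'k mpoly" where t: "\<Gamma> = alg_gen (t ` {..<n})" using \<Gamma>_structure(1) by blast
  obtain C :: "(nat \<Rightarrow> nat) set" and e :: "(nat \<Rightarrow> nat) \<Rightarrow> 'k mpoly" where
    C: "finite C" "e ` C \<subseteq> Pn n" "\<forall>p\<in>Pn n. \<exists>g. (\<forall>c\<in>C. g c \<in> \<Gamma>) \<and> p = (\<Sum>c\<in>C. g c * e c)"
    using \<Gamma>_structure(2) by blast
  define E where "E = {r \<in> MM. \<forall>i. lookup r i < m}"
  have "E \<subseteq> to_expo n ` (\<Pi>\<^sub>E i\<in>{..<n}. {..<m})"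
  proof
    fix r assume r: "r \<in> E"
    have "r = to_expo n (\<lambda>i\<in>{..<n}. lookup r i)"
      using r MM_Nn[of r] by (intro poly_mapping_eqI) (auto simp: E_def lookup_to_expo Nn_def in_keys_iff)
    moreover have "(\<lambda>i\<in>{..<n}. lookup r i) \<in> (\<Pi>\<^sub>E i\<in>{..<n}. {..<m})" using r by (auto simp: E_def)
    ultimately show "r \<in> to_expo n ` (\<Pi>\<^sub>E i\<in>{..<n}. {..<m})" by blast
  qed
  then have E: "finite E" by (rule finite_subset) (intro finite_imageI finite_PiE; simp)
  define h where "h r c c' = D.tmul q (single r (e c)) (xpoly (e c'))" for r c c'
  define F where "F = xpoly ` t ` {..<n} \<union> (\<lambda>(r, c, c'). reynolds (h r c c')) ` (E \<times> C \<times> C)"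
  have t\<Gamma>: "t i \<in> \<Gamma>" if "i < n" for i unfolding t using that by (auto intro: alg_gen)
  have hD: "h r c c' \<in> DM" if "r \<in> E" "c \<in> C" "c' \<in> C" for r c c'
    unfolding h_def using that C(2) by (intro DM_tmul DM_single xpoly_DM) (auto simp: E_def)
  have FU: "F \<subseteq> UU"
    unfolding F_def using t\<Gamma> hD by (auto intro!: xpoly_UU reynolds_UU)
  have "UU \<subseteq> Z" if Z: "single 0 ` \<Gamma> \<subseteq> Z" "F \<subseteq> Z" "\<forall>u\<in>Z. \<forall>v\<in>Z. u + v \<in> Z" "\<forall>u\<in>Z. \<forall>v\<in>Z. D.tmul q u v \<in> Z" for Z
  proof -
    have s\<Gamma>: "single 0 c \<in> Z" if "c \<in> \<Gamma>" for c using that Z(1) by blast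
    have Z0: "0 \<in> Z" using s\<Gamma>[OF \<Gamma>_closed(4)] by simp
    have Zsum: "(\<And>i. i \<in> I \<Longrightarrow> f i \<in> Z) \<Longrightarrow> sum f I \<in> Z" for f :: "'i \<Rightarrow> 'k qspace" and I
      by (induction I rule: infinite_finite_induct) (use Z0 Z(3) in auto)
    have Zscale: "pscale c v \<in> Z" if "c \<in> \<Gamma>" "v \<in> Z" for c v
      unfolding pscale_tmul using Z(4) s\<Gamma> that by blast
    have x\<Gamma>: "xpoly c \<in> Z" if "c \<in> \<Gamma>" for c
      using that unfolding t
    proof induction
      case (alg_cst c)
      have "xpoly (cst c) = single 0 (cst c)" by (simp add: cst_def xpoly_single)
      then show ?case using s\<Gamma>[OF \<Gamma>_closed(3)] by simp
    next
      case (alg_gen s)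
      then show ?case using Z(2) unfolding F_def by blast
    qed (use Z(3,4) in \<open>auto simp: xpoly_add xpoly_mult\<close>)
    have mono: "reynolds (single a (single b 1)) \<in> Z" if a: "a \<in> MM" and b: "b \<in> Nn n" for a b
    proof -
      define a' where "a' = Poly_Mapping.map (\<lambda>k. k div m) a"
      have a': "lookup a' i = lookup a i div m" for i by (simp add: a'_def Poly_Mapping.map.rep_eq when_def)
      define r where "r = Poly_Mapping.map (\<lambda>k. k mod m) a"
      have r: "lookup r i = lookup a i mod m" for i by (simp add: r_def Poly_Mapping.map.rep_eq when_def)
      have ar: "a = r + mexp m a'" by (rule poly_mapping_eqI) (simp add: lookup_add a' r)
      have "i \<notin> keys a \<Longrightarrow> i \<notin> keys a' \<and> i \<notin> keys r" for i by (simp add: in_keys_iff a' r)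
      then have "keys a' \<subseteq> keys a" "keys r \<subseteq> keys a" by (blast, blast)
      then have a'N: "a' \<in> Nn n" and "r \<in> Nn n" using MM_Nn[OF a] unfolding Nn_def by auto
      have "mon g r = 1" if g: "g \<in> T" for g
        using a mexp_MM[OF a'N] g unfolding ar by (auto simp: MM_def mon_add)
      with \<open>r \<in> Nn n\<close> have rE: "r \<in> E" using m_pos by (simp add: E_def MM_def r)
      have bP: "single b 1 \<in> Pn n" and aP: "single a' 1 \<in> Pn n" using b a'N by (auto simp: Nn_def intro!: Pn_single)
      obtain g where g: "\<forall>c\<in>C. g c \<in> \<Gamma>" "single b 1 = (\<Sum>c\<in>C. g c * e c)" using C(3) bP by blast
      obtain g' where g': "\<forall>c\<in>C. g' c \<in> \<Gamma>" "single a' 1 = (\<Sum>c\<in>C. g' c * e c)" using C(3) aP by blast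
      have "single a (single b 1) = (\<Sum>c\<in>C. pscale (g c) (single a (e c)))"
        unfolding g(2) by (rule poly_mapping_eqI) (simp add: lookup_sum lookup_single when_def)
      moreover have "single a (e c) = (\<Sum>c'\<in>C. D.tmul q (h r c c') (xpoly (g' c')))" for c
      proof -
        have "single a (e c) = D.tmul q (single r (e c)) (xpoly (single a' 1))"
          by (simp add: ar xpoly_single D.tmul_single qdil_simps)
        also have "\<dots> = (\<Sum>c'\<in>C. D.tmul q (single r (e c)) (xpoly (e c' * g' c')))"
          unfolding g'(2) xpoly_sum tmul_sum_r by (simp only: mult.commute)
        also have "\<dots> = (\<Sum>c'\<in>C. D.tmul q (h r c c') (xpoly (g' c')))"
          by (simp only: h_def xpoly_mult D.tmul_assoc)
        finally show ?thesis .
      qed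
      ultimately have "reynolds (single a (single b 1)) = (\<Sum>c\<in>C. reynolds (pscale (g c) (\<Sum>c'\<in>C. D.tmul q (h r c c') (xpoly (g' c')))))"
        by (simp only: reynolds_sum)
      also have "\<dots> = (\<Sum>c\<in>C. pscale (g c) (\<Sum>c'\<in>C. D.tmul q (reynolds (h r c c')) (xpoly (g' c'))))"
        using g(1) g'(1) by (intro sum.cong refl) (simp add: reynolds_pscale reynolds_sum reynolds_tmul xpoly_UU)
      also have "\<dots> \<in> Z"
      proof (intro Zsum Zscale)
        fix c c' assume c: "c \<in> C" "c' \<in> C"
        have "reynolds (h r c c') \<in> F" unfolding F_def using rE c by force
        then show "D.tmul q (reynolds (h r c c')) (xpoly (g' c')) \<in> Z" using Z(2,4) x\<Gamma> g'(1) c by blast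
      qed (use g in blast)
      finally show ?thesis .
    qed
    show "UU \<subseteq> Z"
    proof
      fix u assume u: "u \<in> UU"
      have "a \<in> MM \<and> b \<in> Nn n" if "a \<in> keys u" "b \<in> keys (lookup u a)" for a b
        using that u by (auto simp: UU_def DM_def Pn_def Nn_def)
      then show "u \<in> Z" by (subst UU_orbit_sums[OF u]) (intro Zsum Zscale mono \<Gamma>_closed; blast)
    qed
  qed
  moreover have "finite F" using E C(1) by (simp add: F_def)
  ultimately show ?thesis using FU by (intro exI[of _ F]) blast
qed

end

section \<open>The Galois order\<close>

context invariants begin

text \<open>The embedding of the invariants of the model into the skew monoid ring.\<close>

definition \<Theta> :: "'k qspace \<Rightarrow> ('k mpoly fract \<Rightarrow> 'k mpoly fract) \<Rightarrow> 'k mpoly fract" where "\<Theta> v = \<xi> (toFm v)"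

lemma \<Theta>_hom: "\<Theta> \<in> ring_hom UR SK"
  by (rule ring_hom_memI) (simp_all add: \<Theta>_def toFm_EM toFm_tmul \<xi>_mult toFm_simps \<xi>_add \<xi>_1 \<xi>_carrier)

lemma \<Theta>_inj: "inj_on \<Theta> UU"
  unfolding \<Theta>_def by (rule inj_onI) (auto dest!: inj_onD[OF \<xi>_inj] simp: toFm_EM)

lemma \<Theta>_image: "\<Theta> ` UU = USK"
  by (auto simp: \<Theta>_def USK_def UE_def)

lemma \<Theta>_scalar: "\<Theta> (single 0 c) = emb (toF c)"
  by (simp add: \<Theta>_def toFm_simps skew_embed_eq)

lemma ring_hom_ring_\<Theta>: "ring_hom_ring UR SK \<Theta>"
  by (rule ring_hom_ringI2[OF ring_UR ring_SK \<Theta>_hom])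

lemma USK_subring: "subring USK SK"
  using ring_hom_ring.img_is_subring[OF ring_hom_ring_\<Theta> ring.carrier_is_subring[OF ring_UR]]
  by (simp add: \<Theta>_image)

lemma USK_generated:
  "\<exists>F. finite F \<and> F \<subseteq> USK \<and> generate_ring SK (emb ` toF ` \<Gamma> \<union> F) = USK"
proof -
  obtain F where F: "F \<subseteq> UU" "finite F" "\<And>Z. single 0 ` \<Gamma> \<subseteq> Z \<and> F \<subseteq> Z \<and> (\<forall>u\<in>Z. \<forall>v\<in>Z. u + v \<in> Z) \<and>
    (\<forall>u\<in>Z. \<forall>v\<in>Z. D.tmul q u v \<in> Z) \<Longrightarrow> UU \<subseteq> Z"
    using UU_generated by (elim exE conjE) simp
  define H where "H = emb ` toF ` \<Gamma> \<union> \<Theta> ` F"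
  have H: "H \<subseteq> USK"
    using F(1) UU_closed(3) by (auto simp: H_def \<Theta>_scalar[symmetric] \<Theta>_image[symmetric] intro!: imageI)
  have le: "generate_ring SK H \<subseteq> USK"
    by (rule ring.generate_ring_min_subring1[OF ring_SK _ USK_subring H]) (use H subringE(1)[OF USK_subring] in blast)
  define Z where "Z = {v \<in> UU. \<Theta> v \<in> generate_ring SK H}"
  have "UU \<subseteq> Z"
  proof (rule F(3), intro conjI ballI subsetI)
    fix v :: "'k qspace" assume "v \<in> single 0 ` \<Gamma>"
    then obtain c where c: "v = single 0 c" "c \<in> \<Gamma>" by blast
    then have "\<Theta> v \<in> H" by (simp add: H_def \<Theta>_scalar)
    then show "v \<in> Z" using c UU_closed(3) by (simp add: Z_def generate_ring.incl)
  next
    fix v assume "v \<in> F"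
    then have "\<Theta> v \<in> H" "v \<in> UU" using F(1) by (auto simp: H_def)
    then show "v \<in> Z" by (simp add: Z_def generate_ring.incl)
  next
    fix u v assume "u \<in> Z" "v \<in> Z"
    then show "u + v \<in> Z" "D.tmul q u v \<in> Z"
      using ring_hom_add[OF \<Theta>_hom, of u v] ring_hom_mult[OF \<Theta>_hom, of u v]
      by (simp_all add: Z_def UU_closed generate_ring.eng_add generate_ring.eng_mult)
  qed
  then have "USK \<subseteq> generate_ring SK H" unfolding \<Theta>_image[symmetric] Z_def by blast
  with le have "generate_ring SK H = USK" by blast
  then show ?thesis unfolding H_def using F(1,2) by (intro exI[of _ "\<Theta> ` F"]) (auto simp: \<Theta>_image[symmetric])
qed

lemma galois_order_USK: "galois_order L (toF ` \<Gamma>) MS USK"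
proof -
  have scal: "emb ` toF ` \<Gamma> \<subseteq> USK"
    using UU_closed(3) by (auto simp: \<Theta>_scalar[symmetric] \<Theta>_image[symmetric] intro!: imageI)
  have inv: "USK \<subseteq> skew_invariants L (toF ` \<Gamma>) MS"
    unfolding skew_invariants_eq USK_def using UE_EI by blast
  have ring: "galois_ring L (toF ` \<Gamma>) MS USK"
    unfolding galois_ring_def Let_def
    by (intro conjI USK_subring scal inv USK_generated coordinates.span_fractions[OF coordinates_left]
        coordinates.span_fractions[OF coordinates_right])
  show ?thesis
    unfolding galois_order_def Let_def
  proof (intro conjI ring ballI allI impI)
    fix R V assume R: "R \<in> {SK, opposite_ring SK}" and V: "V \<subseteq> skew_invariants L (toF ` \<Gamma>) MS" "ring.finite_dimension R (emb ` K) V"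
    from R have "R = SK \<or> R = opposite_ring SK" by simp
    then show "left_finitely_generated R (emb ` toF ` \<Gamma>) (V \<inter> USK)"
    proof
      assume "R = SK"
      then show ?thesis using coordinates.finitely_generated_intersections[OF coordinates_left V(1)] V(2) by simp
    next
      assume "R = opposite_ring SK"
      then show ?thesis using coordinates.finitely_generated_intersections[OF coordinates_right V(1)] V(2) by simp
    qed
  qed
qed

section \<open>Transport to the algebra of invariants\<close>

definition \<Phi> :: "'k qspace \<Rightarrow> 'k quantum_space_elem" where "\<Phi> = the_inv_into (carrier AG) \<Psi>"

lemma \<Phi>_AG: "v \<in> UU \<Longrightarrow> \<Phi> v \<in> carrier AG"
  and \<Psi>_\<Phi>: "v \<in> UU \<Longrightarrow> \<Psi> (\<Phi> v) = v"
  and \<Phi>_\<Psi>: "z \<in> carrier AG \<Longrightarrow> \<Phi> (\<Psi> z) = z"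
  and \<Psi>_AG: "z \<in> carrier AG \<Longrightarrow> \<Psi> z \<in> UU"
  using \<Psi>_AG_bij the_inv_into_into[of \<Psi> "carrier AG" v "carrier AG"] f_the_inv_into_f[of \<Psi> "carrier AG" v] the_inv_into_f_f[of \<Psi> "carrier AG" z]
  by (auto simp: \<Phi>_def bij_betw_def)

lemma AG_Q: "z \<in> carrier AG \<Longrightarrow> z \<in> carrier Q" by (simp add: carrier_AG)

lemma \<Phi>_eqI: "z \<in> carrier Q \<Longrightarrow> \<Psi> z = v \<Longrightarrow> v \<in> UU \<Longrightarrow> \<Phi> v = z"
  using \<Phi>_\<Psi>[of z] by (auto simp: carrier_AG)

lemma \<Phi>_bij: "bij_betw \<Phi> UU (carrier AG)"
  unfolding \<Phi>_def by (rule bij_betw_the_inv_into[OF \<Psi>_AG_bij])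

lemma \<Phi>_hom: "\<Phi> \<in> ring_hom UR AG"
proof (rule ring_hom_memI)
  show "\<Phi> (u \<otimes>\<^bsub>UR\<^esub> v) = \<Phi> u \<otimes>\<^bsub>AG\<^esub> \<Phi> v" if "u \<in> carrier UR" "v \<in> carrier UR" for u v
    using that by (intro \<Phi>_eqI) (simp_all add: AG_Q \<Phi>_AG \<Psi>_simps \<Psi>_\<Phi> UU_closed)
  show "\<Phi> (u \<oplus>\<^bsub>UR\<^esub> v) = \<Phi> u \<oplus>\<^bsub>AG\<^esub> \<Phi> v" if "u \<in> carrier UR" "v \<in> carrier UR" for u v
    using that by (intro \<Phi>_eqI) (simp_all add: AG_Q \<Phi>_AG \<Psi>_simps \<Psi>_\<Phi> UU_closed)
  show "\<Phi> \<one>\<^bsub>UR\<^esub> = \<one>\<^bsub>AG\<^esub>" by (rule \<Phi>_eqI) (simp_all add: \<Psi>_simps UU_closed)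
qed (simp add: \<Phi>_AG)

lemma \<Phi>_smult: "v \<in> UU \<Longrightarrow> \<Phi> (D.tmul q (single 0 (cst c)) v) = c \<odot>\<^bsub>AG\<^esub> \<Phi> v"
  by (intro \<Phi>_eqI) (simp_all add: AG_Q \<Phi>_AG \<Psi>_simps \<Psi>_\<Phi> UU_closed \<Gamma>_closed)

lemma ring_AG: "ring AG"
proof -
  have "\<Phi> \<in> ring_iso UR AG" using \<Phi>_hom \<Phi>_bij by (simp add: ring_iso_def)
  then have "ring (AG\<lparr>ring.zero := \<Phi> \<zero>\<^bsub>UR\<^esub>\<rparr>)" by (rule ring.ring_iso_imp_img_ring[OF ring_UR])
  moreover have "\<Phi> 0 = \<zero>\<^bsub>AG\<^esub>" by (rule \<Phi>_eqI) (simp_all add: \<Psi>_zero UU_closed)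
  ultimately show ?thesis by (simp del: AG_ops)
qed

lemma \<Psi>_AG_hom: "\<Psi> \<in> ring_hom AG UR"
  by (rule ring_hom_memI) (simp_all add: \<Psi>_AG AG_Q \<Psi>_simps)

text \<open>The polynomial subalgebra of the theorem: the invariants in the \<open>y\<^sub>i\<close> alone.\<close>

definition \<Delta> :: "'k quantum_space_elem set" where "\<Delta> = \<Phi> ` single 0 ` \<Gamma>"

lemma scalar_subring: "subring (single 0 ` \<Gamma>) UR"
proof (rule ring.subringI[OF ring_UR])
  show "\<ominus>\<^bsub>UR\<^esub> h \<in> single 0 ` \<Gamma>" if "h \<in> single 0 ` \<Gamma>" for h
  proof -
    obtain c where c: "h = single 0 c" "c \<in> \<Gamma>" using \<open>h \<in> single 0 ` \<Gamma>\<close> by blast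
    have "\<ominus>\<^bsub>UR\<^esub> h = single 0 (- c)"
      by (rule abelian_group.minus_equality[OF ring.is_abelian_group[OF ring_UR]])
        (use c in \<open>simp_all add: UU_closed \<Gamma>_closed single_add[symmetric]\<close>)
    then show ?thesis by (simp only: imageI[OF \<Gamma>_closed(6)[OF c(2)]])
  qed
  show "\<one>\<^bsub>UR\<^esub> \<in> single 0 ` \<Gamma>" using \<Gamma>_closed(5) by (intro image_eqI[of _ _ 1]) simp_all
qed (auto simp: UU_closed D.tmul_single qdil_def single_add[symmetric] intro!: imageI \<Gamma>_closed)

lemma subalgebra_\<Delta>: "subalgebra \<Delta> AG"
  unfolding subalgebra_def
proof (intro conjI allI ballI)
  show "subring \<Delta> AG"
    unfolding \<Delta>_def by (rule ring_hom_ring.img_is_subring[OF ring_hom_ringI2[OF ring_UR ring_AG \<Phi>_hom] scalar_subring])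
  fix c b assume "b \<in> \<Delta>"
  then obtain p where p: "b = \<Phi> (single 0 p)" "p \<in> \<Gamma>" by (auto simp: \<Delta>_def)
  have "c \<odot>\<^bsub>AG\<^esub> b = \<Phi> (D.tmul q (single 0 (cst c)) (single 0 p))"
    unfolding p(1) by (rule \<Phi>_smult[symmetric]) (simp add: UU_closed p)
  also have "\<dots> = \<Phi> (single 0 (cst c * p))" by (simp add: D.tmul_single qdil_def)
  finally show "c \<odot>\<^bsub>AG\<^esub> b \<in> \<Delta>"
    by (simp only: \<Delta>_def imageI[OF imageI[OF \<Gamma>_closed(2)[OF \<Gamma>_closed(3) p(2)]]])
qed

lemma \<Delta>_elem: "z \<in> \<Delta> \<Longrightarrow> \<exists>p\<in>\<Gamma>. z = \<Phi> (single 0 p) \<and> \<Psi> z = single 0 p \<and> z \<in> carrier Q"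
  by (auto simp: \<Delta>_def \<Psi>_\<Phi> UU_closed AG_Q \<Phi>_AG)

text \<open>The homomorphism \<open>\<eta>\<close> from the abstract polynomial algebra sends its variables to the algebraically
independent generators \<open>t\<^sub>i\<close> of \<open>\<Gamma>\<close>; injectivity is the independence, and the image is a subalgebra that
contains the generators.\<close>

lemma polynomial_subalgebra_\<Delta>: "polynomial_subalgebra \<Delta> AG"
proof -
  define M where "M = product_group {..<n} (\<lambda>_. \<lparr>carrier = (UNIV :: nat set), monoid.mult = (+), one = 0\<rparr>)"
  have mM: "Group.monoid M" unfolding M_def by (rule monoid_product_group, rule monoidI) auto
  have pa: "polynomial_algebra n = monoid_algebra M" by (simp add: polynomial_algebra_def M_def)
  interpret F: monoid_alg M "polynomial_algebra n :: ('k, (nat \<Rightarrow> nat) \<Rightarrow> 'k) module"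
    by (rule monoid_alg.intro[OF mM]) (simp add: pa)
  have cM: "carrier M = (\<Pi>\<^sub>E i\<in>{..<n}. UNIV)" by (simp add: M_def)
  obtain t :: "nat \<Rightarrow> 'k mpoly" where t: "\<Gamma> = alg_gen (t ` {..<n})" "\<forall>p\<in>Pn n. subst_vars t p = 0 \<longrightarrow> p = 0"
    using \<Gamma>_structure(1) by blast
  define u where "u a = (single 0 (mon t (to_expo n a)) :: 'k qspace)" for a
  have te: "to_expo n (x \<otimes>\<^bsub>M\<^esub> y) = to_expo n x + to_expo n y" for x y
    by (rule poly_mapping_eqI) (simp add: M_def lookup_to_expo lookup_add)
  have te1: "to_expo n \<one>\<^bsub>M\<^esub> = 0" by (rule poly_mapping_eqI) (simp add: M_def lookup_to_expo)
  have inj: "inj_on (to_expo n) (carrier M)"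
  proof (rule inj_onI)
    fix x y assume xy: "x \<in> carrier M" "y \<in> carrier M" "to_expo n x = to_expo n y"
    have "x i = y i" if "i < n" for i using arg_cong[OF xy(3), of "\<lambda>b. lookup b i"] that by (simp add: lookup_to_expo)
    then show "x = y" using xy(1,2) unfolding cM by (intro PiE_ext) auto
  qed
  define \<eta> where "\<eta> = linear_extension (model q) u"
  have \<eta>: "\<eta> \<in> alg_hom (polynomial_algebra n) (model q)"
    unfolding \<eta>_def
  proof (rule F.linear_extension_hom[OF kalgebra_model])
    show "u \<in> hom M (model q)" by (rule homI) (simp_all add: u_def te mon_add D.tmul_single qdil_def)
    show "u \<one>\<^bsub>M\<^esub> = \<one>\<^bsub>model q\<^esub>" by (simp add: u_def te1)
  qed
  note \<eta>D = alg_homD[OF \<eta>, simplified]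
  define P where "P f = (\<Sum>a\<in>{a. f a \<noteq> 0}. single (to_expo n a) (f a))" for f :: "(nat \<Rightarrow> nat) \<Rightarrow> 'k"
  have PPn: "P f \<in> Pn n" for f
    unfolding P_def using to_expo_Nn by (intro Pn_sum Pn_single) (auto simp: Nn_def)
  have P: "lookup (P f) (to_expo n a) = f a" if f: "f \<in> carrier (polynomial_algebra n)" and a: "a \<in> carrier M" for f a
  proof -
    have "lookup (P f) (to_expo n a) = (\<Sum>b\<in>{b. f b \<noteq> 0}. if b = a then f b else 0)"
      unfolding P_def lookup_sum using f a inj_onD[OF inj]
      by (intro sum.cong refl) (auto simp: F.carrier_iff lookup_single when_def)
    also have "\<dots> = f a" using f by (simp add: F.carrier_iff)
    finally show ?thesis .
  qed
  have \<eta>P: "\<eta> f = single 0 (subst_vars t (P f))" if f: "f \<in> carrier (polynomial_algebra n)" for f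
  proof -
    have s: "single 0 (sum g I) = (\<Sum>i\<in>I. single 0 (g i))" for g :: "(nat \<Rightarrow> nat) \<Rightarrow> 'k mpoly" and I
      by (induction I rule: infinite_finite_induct) (simp_all add: single_add)
    have "\<eta> f = (\<Sum>a\<in>{a. f a \<noteq> 0}. f a \<odot>\<^bsub>model q\<^esub> u a)"
      unfolding \<eta>_def linear_extension_def
      by (rule finsum_eq_sum[OF M.ring_axioms]) (use f in \<open>simp_all add: F.carrier_iff\<close>)
    also have "\<dots> = (\<Sum>a\<in>{a. f a \<noteq> 0}. single 0 (subst_vars t (single (to_expo n a) (f a))))"
      by (rule sum.cong) (simp_all add: u_def D.tmul_single qdil_def subst_single)
    also have "\<dots> = single 0 (subst_vars t (P f))" by (simp add: s P_def is_hom_sum[OF subst_hom])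
    finally show ?thesis .
  qed
  have \<eta>_inj: "inj_on \<eta> (carrier (polynomial_algebra n))"
  proof (rule inj_onI)
    fix f g :: "(nat \<Rightarrow> nat) \<Rightarrow> 'k" assume fg: "f \<in> carrier (polynomial_algebra n)" "g \<in> carrier (polynomial_algebra n)" "\<eta> f = \<eta> g"
    have "lookup (\<eta> f) 0 = lookup (\<eta> g) 0" by (simp add: fg(3))
    then have "subst_vars t (P f - P g) = 0" using fg(1,2) by (simp add: \<eta>P subst_simps)
    moreover have "P f - P g \<in> Pn n" using PPn by (intro Pn_diff)
    ultimately have "P f = P g" using t(2) by auto
    have "f a = g a" for a
    proof (cases "a \<in> carrier M")
      case True
      then show ?thesis using P[OF fg(1) True] P[OF fg(2) True] \<open>P f = P g\<close> by simp
    next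
      case False
      then show ?thesis using fg(1,2) unfolding F.carrier_iff by (metis (mono_tags) mem_Collect_eq subsetD)
    qed
    then show "f = g" by (rule ext)
  qed
  have \<eta>_image: "\<eta> ` carrier (polynomial_algebra n) = single 0 ` \<Gamma>"
  proof
    have sub: "subst_vars t p \<in> \<Gamma>" if "p \<in> Pn n" for p
      using that unfolding Pn_eq_alg_gen
    proof induction
      case (alg_gen s)
      then show ?case unfolding t(1) by (auto intro: alg_gen.alg_gen)
    qed (auto simp: subst_simps \<Gamma>_closed)
    show "\<eta> ` carrier (polynomial_algebra n) \<subseteq> single 0 ` \<Gamma>" using \<eta>P sub[OF PPn] by auto
    have "single 0 c \<in> \<eta> ` carrier (polynomial_algebra n)" if "c \<in> \<Gamma>" for c
      using that unfolding t(1)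
    proof induction
      case (alg_cst c)
      have "\<eta> (c \<odot>\<^bsub>polynomial_algebra n\<^esub> \<one>\<^bsub>polynomial_algebra n\<^esub>) = single 0 (cst c)" by (simp add: \<eta>D)
      then show ?case by (metis F.one_closed F.smult_closed imageI)
    next
      case (alg_gen s)
      then obtain i where i: "i < n" "s = t i" by auto
      define a where "a = (\<lambda>j\<in>{..<n}. if j = i then 1 else (0::nat))"
      have a: "a \<in> carrier M" by (simp add: a_def cM)
      have "to_expo n a = single i 1"
        using i by (intro poly_mapping_eqI) (auto simp: a_def lookup_to_expo lookup_single when_def)
      then have "\<eta> (monom_elem a) = single 0 s" by (simp add: \<eta>_def u_def mon_single i)
      then show ?case using F.monom_closed[OF a] by (metis imageI)
    next
      case (alg_add a b)
      then obtain f g where fg: "f \<in> carrier (polynomial_algebra n)" "g \<in> carrier (polynomial_algebra n)" "single 0 a = \<eta> f" "single 0 b = \<eta> g" by blast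
      have "single 0 (a + b) = \<eta> (f \<oplus>\<^bsub>polynomial_algebra n\<^esub> g)" using fg by (simp add: \<eta>D single_add)
      then show ?case using fg by simp
    next
      case (alg_mult a b)
      then obtain f g where fg: "f \<in> carrier (polynomial_algebra n)" "g \<in> carrier (polynomial_algebra n)" "single 0 a = \<eta> f" "single 0 b = \<eta> g" by blast
      have "D.tmul q (single 0 a) (single 0 b) = \<eta> (f \<otimes>\<^bsub>polynomial_algebra n\<^esub> g)" using fg by (simp add: \<eta>D)
      then have "single 0 (a * b) = \<eta> (f \<otimes>\<^bsub>polynomial_algebra n\<^esub> g)" by (simp add: D.tmul_single qdil_def)
      then show ?case using fg by simp
    qed
    then show "single 0 ` \<Gamma> \<subseteq> \<eta> ` carrier (polynomial_algebra n)" by blast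
  qed
  have \<eta>U: "\<eta> f \<in> UU" if "f \<in> carrier (polynomial_algebra n)" for f
  proof -
    have "\<eta> f \<in> single 0 ` \<Gamma>" unfolding \<eta>_image[symmetric] by (rule imageI[OF that])
    then show ?thesis by (rule imageE) (simp add: UU_closed)
  qed
  define \<psi> where "\<psi> = (\<lambda>f. \<Phi> (\<eta> f))"
  have "\<psi> \<in> ring_hom (polynomial_algebra n) (AG\<lparr>carrier := \<Delta>\<rparr>)"
  proof (rule ring_hom_memI)
    show "\<psi> f \<in> carrier (AG\<lparr>carrier := \<Delta>\<rparr>)" if "f \<in> carrier (polynomial_algebra n)" for f
      using that by (simp add: \<psi>_def \<Delta>_def \<eta>_image[symmetric])
  qed (use ring_hom_add[OF \<Phi>_hom] ring_hom_mult[OF \<Phi>_hom] ring_hom_one[OF \<Phi>_hom] in \<open>simp_all add: \<psi>_def \<eta>D \<eta>U\<close>)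
  moreover have "bij_betw \<psi> (carrier (polynomial_algebra n)) \<Delta>"
    unfolding bij_betw_def
  proof
    have "inj_on \<Phi> (\<eta> ` carrier (polynomial_algebra n))"
      by (rule inj_on_subset[of \<Phi> UU]) (use \<Phi>_bij \<eta>U in \<open>auto simp: bij_betw_def\<close>)
    then show "inj_on \<psi> (carrier (polynomial_algebra n))"
      unfolding \<psi>_def using comp_inj_on[OF \<eta>_inj] by (simp only: o_def)
    show "\<psi> ` carrier (polynomial_algebra n) = \<Delta>"
      unfolding \<psi>_def \<Delta>_def \<eta>_image[symmetric] image_image ..
  qed
  ultimately have iso: "\<psi> \<in> ring_iso (polynomial_algebra n) (AG\<lparr>carrier := \<Delta>\<rparr>)" by (simp add: ring_iso_def)
  have "\<forall>c. \<forall>f\<in>carrier (polynomial_algebra n). \<psi> (c \<odot>\<^bsub>polynomial_algebra n\<^esub> f) = c \<odot>\<^bsub>AG\<^esub> \<psi> f"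
    using \<Phi>_smult[OF \<eta>U] by (simp add: \<psi>_def \<eta>D)
  then show ?thesis unfolding polynomial_subalgebra_def using subalgebra_\<Delta> iso by blast
qed

text \<open>The structure maps are \<open>\<phi> = \<Theta> \<circ> \<Psi>\<close> and its restriction \<open>\<iota>\<close> to the subalgebra, read off from the
coefficient at the exponent \<open>0\<close> of the \<open>x\<^sub>i\<close>.\<close>

lemma galois_order_over_\<Delta>: "galois_order_over TYPE('k rational_functions) \<Delta> AG"
proof -
  define \<iota> where "\<iota> z = toF (lookup (\<Psi> z) 0)" for z
  define \<phi> where "\<phi> = (\<lambda>z. \<Theta> (\<Psi> z))"
  have sc: "range (\<lambda>c. \<iota> (c \<odot>\<^bsub>AG\<^esub> \<one>\<^bsub>AG\<^esub>)) = scalars"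
    by (simp add: \<iota>_def \<Psi>_simps scalars_def)
  have image: "\<iota> ` \<Delta> = toF ` \<Gamma>"
    unfolding \<Delta>_def image_image by (intro image_cong refl) (simp add: \<iota>_def \<Psi>_\<Phi> UU_closed)
  have \<phi>_image: "\<phi> ` carrier AG = USK"
    using \<Psi>_AG_bij unfolding \<phi>_def \<Theta>_image[symmetric] bij_betw_def image_image[symmetric] by simp
  show ?thesis
    unfolding galois_order_over_def
  proof (intro conjI subalgebra_\<Delta> exI)
    show "\<iota> \<in> ring_hom (AG\<lparr>carrier := \<Delta>\<rparr>) L"
    proof (rule ring_hom_memI)
      show "\<iota> z \<in> carrier L" if "z \<in> carrier (AG\<lparr>carrier := \<Delta>\<rparr>)" for z
        using \<Delta>_elem[of z] that by (auto simp: \<iota>_def \<Gamma>_Pn)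
      show "\<iota> (y \<otimes>\<^bsub>AG\<lparr>carrier := \<Delta>\<rparr>\<^esub> z) = \<iota> y \<otimes>\<^bsub>L\<^esub> \<iota> z"
        if yz: "y \<in> carrier (AG\<lparr>carrier := \<Delta>\<rparr>)" "z \<in> carrier (AG\<lparr>carrier := \<Delta>\<rparr>)" for y z
      proof -
        obtain p where p: "\<Psi> y = single 0 p" "y \<in> carrier Q" using \<Delta>_elem[of y] yz by auto
        obtain r where r: "\<Psi> z = single 0 r" "z \<in> carrier Q" using \<Delta>_elem[of z] yz by auto
        show ?thesis by (simp add: \<iota>_def \<Psi>_simps p r D.tmul_single qdil_def toF_simps)
      qed
      show "\<iota> (y \<oplus>\<^bsub>AG\<lparr>carrier := \<Delta>\<rparr>\<^esub> z) = \<iota> y \<oplus>\<^bsub>L\<^esub> \<iota> z"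
        if yz: "y \<in> carrier (AG\<lparr>carrier := \<Delta>\<rparr>)" "z \<in> carrier (AG\<lparr>carrier := \<Delta>\<rparr>)" for y z
      proof -
        have "y \<in> carrier Q" "z \<in> carrier Q" using \<Delta>_elem[of y] \<Delta>_elem[of z] yz by auto
        then show ?thesis by (simp add: \<iota>_def \<Psi>_simps lookup_add toF_simps)
      qed
    qed (simp add: \<iota>_def \<Psi>_simps toF_simps)
    show "inj_on \<iota> \<Delta>"
    proof (rule inj_onI)
      fix y z assume yz: "y \<in> \<Delta>" "z \<in> \<Delta>" "\<iota> y = \<iota> z"
      obtain p where p: "\<Psi> y = single 0 p" "y = \<Phi> (single 0 p)" using \<Delta>_elem[OF yz(1)] by auto
      obtain r where r: "\<Psi> z = single 0 r" "z = \<Phi> (single 0 r)" using \<Delta>_elem[OF yz(2)] by auto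
      have "p = r" using yz(3) by (simp add: \<iota>_def p(1) r(1))
      then show "y = z" by (simp add: p(2) r(2))
    qed
    show "galois_setting L (range (\<lambda>c. \<iota> (c \<odot>\<^bsub>AG\<^esub> \<one>\<^bsub>AG\<^esub>))) (\<iota> ` \<Delta>) MS"
      unfolding sc image by (rule galois_setting_L)
    show "\<phi> \<in> ring_hom AG SK"
      unfolding \<phi>_def using ring_hom_trans[OF \<Psi>_AG_hom \<Theta>_hom] by (simp only: o_def)
    show "inj_on \<phi> (carrier AG)"
      using comp_inj_on[of \<Psi> "carrier AG" \<Theta>] \<Psi>_AG_bij \<Theta>_inj by (simp add: \<phi>_def o_def bij_betw_def)
    show "\<forall>a\<in>\<Delta>. \<phi> a = emb (\<iota> a)"
    proof
      fix a assume "a \<in> \<Delta>"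
      then obtain p where "\<Psi> a = single 0 p" using \<Delta>_elem by blast
      then show "\<phi> a = emb (\<iota> a)" by (simp add: \<phi>_def \<iota>_def \<Theta>_scalar)
    qed
    show "galois_order L (\<iota> ` \<Delta>) MS (\<phi> ` carrier AG)"
      unfolding image \<phi>_image by (rule galois_order_USK)
  qed
qed

lemma left_free_AG: "left_free AG \<Delta> (carrier AG)" "left_free (opposite_ring AG) \<Delta> (carrier AG)"
proof -
  have im: "\<Phi> ` UU = carrier AG" and inj: "inj_on \<Phi> UU" using \<Phi>_bij by (simp_all add: bij_betw_def)
  have s: "single 0 ` \<Gamma> \<subseteq> UU" using UU_closed(3) by blast
  have "left_free AG (\<Phi> ` single 0 ` \<Gamma>) (\<Phi> ` UU)"
    by (rule left_free_image[OF ring_UR ring_AG \<Phi>_hom _ _ _ left_free_UR]) (simp_all add: inj s)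
  then show "left_free AG \<Delta> (carrier AG)" by (simp only: \<Delta>_def im)
  have "\<Phi> \<in> ring_hom (opposite_ring UR) (opposite_ring AG)"
    using \<Phi>_hom by (auto simp: ring_hom_def opposite_ring_def)
  then have "left_free (opposite_ring AG) (\<Phi> ` single 0 ` \<Gamma>) (\<Phi> ` UU)"
    by (rule left_free_image[OF ring.ring_opposite[OF ring_UR] ring.ring_opposite[OF ring_AG] _ _ _ _ right_free_UR])
      (simp_all add: inj s opposite_ring_def)
  then show "left_free (opposite_ring AG) \<Delta> (carrier AG)" by (simp only: \<Delta>_def im)
qed

end

theorem theorem1:
  fixes q :: "'k::{alg_closed_field, field_char_0}"
    and n m :: nat
    and G :: "((nat \<Rightarrow> 'k) \<times> (nat \<Rightarrow> nat)) set"
  assumes "q \<noteq> 0" and "\<forall>j\<ge>1. q ^ j \<noteq> 1"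
    and "n \<ge> 1" and "m \<ge> 1"
    and "G = cyclic_power_group m n \<or> (\<exists>p>0. p dvd m \<and> G = reflection_group m p n)"
  shows "\<exists>\<Gamma>. polynomial_subalgebra \<Gamma> (invariant_algebra n q G) \<and>
    galois_order_over TYPE('k rational_functions) \<Gamma> (invariant_algebra n q G) \<and>
    left_free (invariant_algebra n q G) \<Gamma> (carrier (invariant_algebra n q G)) \<and>
    left_free (opposite_ring (invariant_algebra n q G)) \<Gamma> (carrier (invariant_algebra n q G))"
proof -
  have "\<exists>T W. G = T \<times> W \<and> invariants n q W m T"
    using assms(5)
  proof
    assume G: "G = cyclic_power_group m n"
    have "invariants n q {id} m (cyclic_power m n)"
      by (intro invariants.intro quantum.intro index_group.intro invariants_axioms.intro)
        (use assms in \<open>auto simp: cyclic_power_def PiE_iff extensional_def\<close>)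
    then show ?thesis using G by (auto simp: cyclic_power_group_def)
  next
    assume "\<exists>p>0. p dvd m \<and> G = reflection_group m p n"
    then obtain p where p: "G = reflection_group m p n" by blast
    define T where "T = {h \<in> cyclic_power m n. (\<Prod>i<n. h i :: 'k) ^ (m div p) = 1}"
    have "(\<lambda>i\<in>{..<n}. g (\<pi> i)) \<in> T" if g: "g \<in> T" and \<pi>: "\<pi> permutes {..<n}" for g \<pi>
    proof -
      have "(\<Prod>i<n. g (\<pi> i)) = (\<Prod>i<n. g i)"
        using prod.reindex_bij_betw[OF permutes_imp_bij[OF \<pi>], of g] .
      then show ?thesis using g permutes_lt[OF \<pi>] by (auto simp: T_def cyclic_power_def PiE_iff)
    qed
    then have "invariants n q {\<pi>. \<pi> permutes {..<n}} m T"
      by (intro invariants.intro quantum.intro index_group.intro invariants_axioms.intro)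
        (use assms in \<open>auto simp: T_def cyclic_power_def\<close>)
    moreover have "G = T \<times> {\<pi>. \<pi> permutes {..<n}}" by (simp add: p reflection_group_def T_def)
    ultimately show ?thesis by blast
  qed
  then obtain T W where TW: "G = T \<times> W" "invariants n q W m T" by blast
  interpret invariants n q W m T by (rule TW(2))
  show ?thesis
    unfolding TW(1) using polynomial_subalgebra_\<Delta> galois_order_over_\<Delta> left_free_AG by blast
qed

end
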